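(* Let $a \in \bigl(-\frac{\pi^2}{2}, 0\bigr)$. Then the family $(\mathcal{E}_T)_{T>0}$ of statistical experiments is LAN at $a$ with scaling $r_{a,T} = \frac{1}{\sqrt{T}}$, $T > 0$, and with $$J_a = \int_0^\infty \left(\int_{-1}^0 x_{0,a}(t+u)\,\mathrm{d}u\right)^2 \mathrm{d}t .$$
   Context: Setting. On a probability space $(\Omega,\mathcal{A},\mathbb{P})$ let $(W(t))_{t\geq 0}$ be a standard Wiener process and $(X_0(t))_{t\in[-1,0]}$ a fixed continuous stochastic process independent of $W$. For $a\in\mathbb{R}$ let $X^{(a)}=(X^{(a)}(t))_{t\in[-1,\infty)}$ be the pathwise unique continuous solution of $$X(t)=X_0(0)+a\int_0^t\int_{-1}^0 X(s+u)\,\mathrm{d}u\,\mathrm{d}s+W(t)\ (t\geq 0),\qquad X(t)=X_0(t)\ (t\in[-1,0]).$$ For $T>0$ let $\mathbb{P}_{a,T}$ be the law of $(X^{(a)}(t))_{t\in[-1,T]}$ on $(C([-1,T]),\mathcal{B}(C([-1,T])))$; for fixed $T$ these measures, $a \in \mathbb{R}$, are mutually absolutely continuous. Put $\mathcal{E}_T:=\bigl(C([-1,T]),\mathcal{B}(C([-1,T])),\{\mathbb{P}_{a,T}:a\in\mathbb{R}\}\bigr)$, $T>0$. Fundamental solution. $(x_{0,a}(t))_{t\in[-1,\infty)}$ is the solution of the deterministic equation $x(t)=1+a\int_0^t\int_{-1}^0 x(s+u)\,\mathrm{d}u\,\mathrm{d}s$ for $t\geq 0$, with $x(t)=0$ for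 $t\in[-1,0)$ (so $x(0)=1$). Definitions (parameter set $\mathbb{R}$). The family $(\mathcal{E}_T)_{T>0}$ is LAQ (locally asymptotically quadratic) at $a$ with scaling $r_{a,T}\in\mathbb{R}$ and limit $(\Delta_a,J_a)$ if there exist real random variables $\Delta_{a,T}$, $J_{a,T}$ ($T>0$) and $\Delta_a$, $J_a$ such that: (1) for every bounded family $h_T\in\mathbb{R}$, $T>0$, $$\log\frac{\mathrm{d}\mathbb{P}_{a+r_{a,T}h_T,T}}{\mathrm{d}\mathbb{P}_{a,T}}\bigl(X^{(a)}|_{[-1,T]}\bigr)=h_T\Delta_{a,T}-\tfrac12 h_T^2J_{a,T}+o_{\mathbb{P}}(1)\quad\text{as }T\to\infty;$$ (2) $(\Delta_{a,T},J_{a,T})\to(\Delta_a,J_a)$ in distribution as $T\to\infty$; (3) $\mathbb{P}(J_a>0)=1$; (4) $\mathbb{E}\exp\{h\Delta_a-\frac12h^2J_a\}=1$ for all $h\in\mathbb{R}$. It is LAMN (locally asymptotically mixed normal) at $a$ if it is LAQ at $a$ and the conditional distribution of $\Delta_a$ given $J_a$ is $\mathcal{N}(0,J_a)$. It is LAN (locally asymptotically normal) at $a$ if it is LAMN at $a$ and $J_a$ is deterministic (so that $\Delta_a\sim\mathcal{N}(0,J_a)$). *)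

theory Defs
  imports "HOL-Probability.Probability"
begin

section \<open>The affine delay equation\<close>

definition wiener_process :: "'w measure \<Rightarrow> (real \<Rightarrow> 'w \<Rightarrow> real) \<Rightarrow> bool" where
  "wiener_process M W \<longleftrightarrow>
     prob_space M \<and>
     (\<forall>t\<ge>0. W t \<in> borel_measurable M) \<and>
     (AE \<omega> in M. W 0 \<omega> = 0) \<and>
     (\<forall>s t. 0 \<le> s \<and> s < t \<longrightarrow>
        distributed M lborel (\<lambda>\<omega>. W t \<omega> - W s \<omega>) (normal_density 0 (sqrt (t - s)))) \<and>
     (\<forall>(n::nat) t. 0 \<le> t 0 \<and> (\<forall>i<n. t i < t (Suc i)) \<longrightarrow>
        prob_space.indep_vars M (\<lambda>_. borel) (\<lambda>i \<omega>. W (t (Suc i)) \<omega> - W (t i) \<omega>) {..<n}) \<and>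
     (AE \<omega> in M. continuous_on {0..} (\<lambda>t. W t \<omega>))"

definition continuous_process_on :: "'w measure \<Rightarrow> real set \<Rightarrow> (real \<Rightarrow> 'w \<Rightarrow> real) \<Rightarrow> bool" where
  "continuous_process_on M I Y \<longleftrightarrow>
     (\<forall>t\<in>I. Y t \<in> borel_measurable M) \<and>
     (AE \<omega> in M. continuous_on I (\<lambda>t. Y t \<omega>))"

definition indep_processes ::
    "'w measure \<Rightarrow> real set \<Rightarrow> (real \<Rightarrow> 'w \<Rightarrow> real) \<Rightarrow> real set \<Rightarrow> (real \<Rightarrow> 'w \<Rightarrow> real) \<Rightarrow> bool" where
  "indep_processes M I Y K Z \<longleftrightarrow>
     prob_space.indep_var M
       (Pi\<^sub>M I (\<lambda>_. borel)) (\<lambda>\<omega>. \<lambda>t\<in>I. Y t \<omega>)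
       (Pi\<^sub>M K (\<lambda>_. borel)) (\<lambda>\<omega>. \<lambda>t\<in>K. Z t \<omega>)"

text \<open>All paths of a solution are continuous, not merely almost all of them, so that it is a
  random element of the path space; the equations hold almost surely.\<close>

definition solves_sdde ::
    "'w measure \<Rightarrow> (real \<Rightarrow> 'w \<Rightarrow> real) \<Rightarrow> (real \<Rightarrow> 'w \<Rightarrow> real) \<Rightarrow> real \<Rightarrow> (real \<Rightarrow> 'w \<Rightarrow> real) \<Rightarrow> bool" where
  "solves_sdde M W X0 a Y \<longleftrightarrow>
     (\<forall>t\<ge>-1. Y t \<in> borel_measurable M) \<and>
     (\<forall>\<omega>\<in>space M. continuous_on {-1..} (\<lambda>t. Y t \<omega>)) \<and>
     (AE \<omega> in M.
        (\<forall>t\<in>{-1..0}. Y t \<omega> = X0 t \<omega>) \<and>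
        (\<forall>t\<ge>0. Y t \<omega> =
           X0 0 \<omega> + a * (LBINT s:{0..t}. (LBINT u:{-1..0}. Y (s + u) \<omega>)) + W t \<omega>))"

definition fundamental_solution :: "real \<Rightarrow> (real \<Rightarrow> real) \<Rightarrow> bool" where
  "fundamental_solution a x \<longleftrightarrow>
     (\<forall>t\<in>{-1..<0}. x t = 0) \<and>
     continuous_on {0..} x \<and>
     (\<forall>t\<ge>0. x t = 1 + a * (LBINT s:{0..t}. (LBINT u:{-1..0}. x (s + u))))"

section \<open>Laws on path space and likelihood ratios\<close>

text \<open>The space \<open>C([-1,T])\<close> with the supremum metric. Its elements are functions on the whole
  real line that are extensional, i.e. \<open>undefined\<close> outside \<open>[-1,T]\<close>.\<close>

definition path_space :: "real \<Rightarrow> (real \<Rightarrow> real) metric" where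
  "path_space T = cfunspace (top_of_set {-1..T}) euclidean_metric"

definition borel_path_space :: "real \<Rightarrow> (real \<Rightarrow> real) measure" where
  "borel_path_space T =
     sigma (mspace (path_space T)) {U. openin (mtopology_of (path_space T)) U}"

definition restricted_path :: "(real \<Rightarrow> 'w \<Rightarrow> real) \<Rightarrow> real \<Rightarrow> 'w \<Rightarrow> (real \<Rightarrow> real)" where
  "restricted_path Y T \<omega> = (\<lambda>t\<in>{-1..T}. Y t \<omega>)"

definition path_law :: "'w measure \<Rightarrow> (real \<Rightarrow> 'w \<Rightarrow> real) \<Rightarrow> real \<Rightarrow> (real \<Rightarrow> real) measure" where
  "path_law M Y T = distr M (borel_path_space T) (restricted_path Y T)"

text \<open>Here and below \<open>X a\<close> is the process with parameter \<open>a\<close>. Note the order of the arguments of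
  \<^const>\<open>RN_deriv\<close>: the dominating measure comes first.\<close>

definition log_likelihood_ratio ::
    "'w measure \<Rightarrow> (real \<Rightarrow> real \<Rightarrow> 'w \<Rightarrow> real) \<Rightarrow> real \<Rightarrow> real \<Rightarrow> real \<Rightarrow> 'w \<Rightarrow> real" where
  "log_likelihood_ratio M X a b T \<omega> =
     ln (enn2real (RN_deriv (path_law M (X a) T) (path_law M (X b) T) (restricted_path (X a) T \<omega>)))"

section \<open>Local asymptotic properties\<close>

definition vanishes_in_probability :: "'w measure \<Rightarrow> (real \<Rightarrow> 'w \<Rightarrow> real) \<Rightarrow> bool" where
  "vanishes_in_probability M R \<longleftrightarrow>
     (\<forall>T>0. R T \<in> borel_measurable M) \<and>
     (\<forall>\<epsilon>>0. ((\<lambda>T. measure M {\<omega>\<in>space M. \<bar>R T \<omega>\<bar> > \<epsilon>}) \<longlongrightarrow> 0) at_top)"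

definition converges_in_distribution ::
    "'w measure \<Rightarrow> (real \<Rightarrow> 'w \<Rightarrow> 'b::topological_space) \<Rightarrow> ('w \<Rightarrow> 'b) \<Rightarrow> bool" where
  "converges_in_distribution M Y Z \<longleftrightarrow>
     (\<forall>f :: 'b \<Rightarrow> real. continuous_on UNIV f \<and> bounded (range f) \<longrightarrow>
        ((\<lambda>T. LINT \<omega>|M. f (Y T \<omega>)) \<longlongrightarrow> (LINT \<omega>|M. f (Z \<omega>))) at_top)"

definition LAQ ::
    "'w measure \<Rightarrow> (real \<Rightarrow> real \<Rightarrow> 'w \<Rightarrow> real) \<Rightarrow> real \<Rightarrow> (real \<Rightarrow> real) \<Rightarrow>
     ('w \<Rightarrow> real) \<Rightarrow> ('w \<Rightarrow> real) \<Rightarrow> bool" where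
  "LAQ M X a r \<Delta> J \<longleftrightarrow>
     \<Delta> \<in> borel_measurable M \<and> J \<in> borel_measurable M \<and>
     (\<exists>\<Delta>\<^sub>T J\<^sub>T.
        (\<forall>T>0. \<Delta>\<^sub>T T \<in> borel_measurable M \<and> J\<^sub>T T \<in> borel_measurable M) \<and>
        (\<forall>h. bounded (h ` {0<..}) \<longrightarrow>
           vanishes_in_probability M (\<lambda>T \<omega>.
             log_likelihood_ratio M X a (a + r T * h T) T \<omega>
               - (h T * \<Delta>\<^sub>T T \<omega> - (h T)\<^sup>2 * J\<^sub>T T \<omega> / 2))) \<and>
        converges_in_distribution M (\<lambda>T \<omega>. (\<Delta>\<^sub>T T \<omega>, J\<^sub>T T \<omega>)) (\<lambda>\<omega>. (\<Delta> \<omega>, J \<omega>))) \<and>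
     (AE \<omega> in M. J \<omega> > 0) \<and>
     (\<forall>h. (LINT \<omega>|M. exp (h * \<Delta> \<omega> - h\<^sup>2 * J \<omega> / 2)) = 1)"

text \<open>\<open>cond_centred_normal M \<Delta> J\<close>: the conditional distribution of \<open>\<Delta>\<close> given \<open>J\<close> is normal with mean
  \<open>0\<close> and variance \<open>J\<close>. It is only used when \<open>J > 0\<close> almost surely, so the degenerate
  normal distribution needs no separate treatment.\<close>

definition cond_centred_normal :: "'w measure \<Rightarrow> ('w \<Rightarrow> real) \<Rightarrow> ('w \<Rightarrow> real) \<Rightarrow> bool" where
  "cond_centred_normal M \<Delta> J \<longleftrightarrow>
     (\<forall>B\<in>sets (borel :: real measure). AE \<omega> in M.
        real_cond_exp M (vimage_algebra (space M) J borel) (\<lambda>\<omega>'. indicator B (\<Delta> \<omega>')) \<omega>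
          = measure (density lborel (normal_density 0 (sqrt (J \<omega>)))) B)"

definition LAMN ::
    "'w measure \<Rightarrow> (real \<Rightarrow> real \<Rightarrow> 'w \<Rightarrow> real) \<Rightarrow> real \<Rightarrow> (real \<Rightarrow> real) \<Rightarrow>
     ('w \<Rightarrow> real) \<Rightarrow> ('w \<Rightarrow> real) \<Rightarrow> bool" where
  "LAMN M X a r \<Delta> J \<longleftrightarrow> LAQ M X a r \<Delta> J \<and> cond_centred_normal M \<Delta> J"

definition LAN ::
    "'w measure \<Rightarrow> (real \<Rightarrow> real \<Rightarrow> 'w \<Rightarrow> real) \<Rightarrow> real \<Rightarrow> (real \<Rightarrow> real) \<Rightarrow>
     ('w \<Rightarrow> real) \<Rightarrow> ('w \<Rightarrow> real) \<Rightarrow> bool" where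
  "LAN M X a r \<Delta> J \<longleftrightarrow> LAMN M X a r \<Delta> J \<and> (\<exists>c. AE \<omega> in M. J \<omega> = c)"

end

theory Submission
  imports Defs "HOL-Complex_Analysis.Complex_Analysis"
begin

text \<open>
  Let \<open>Y t\<close> denote the integral of the observed process \<open>X\<close> over \<open>[t - 1, t]\<close>, so that the equation
  reads \<open>dX = a * Y dt + dW\<close>. Girsanov's theorem gives the log-likelihood ratio of \<open>b\<close> against \<open>a\<close>
  on \<open>[-1, T]\<close> as \<open>(b - a) * \<integral>Y dX - (b\<^sup>2 - a\<^sup>2) / 2 * \<integral>Y\<^sup>2 dt\<close>. For \<open>b = a + h / sqrt T\<close> this
  equals \<open>h * \<Delta> - h\<^sup>2 * I / 2\<close> exactly, where \<open>\<Delta> = (\<integral>Y dX - a * \<integral>Y\<^sup>2 dt) / sqrt T\<close> is the score and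
  \<open>I = \<integral>Y\<^sup>2 dt / T\<close> the observed information. So the remainder in the quadratic expansion is zero
  almost surely, and two facts about \<open>T \<rightarrow> \<infinity>\<close> are left: the information converges in probability to a
  constant \<open>J > 0\<close> (\<open>energy_ergodic\<close>), and the score \<open>\<Delta> = \<integral>Y dW / sqrt T\<close> converges in distribution
  to a normal variable with variance \<open>J\<close> (\<open>score_characteristic_function\<close>).

  Since \<open>Y\<close> is continuously differentiable, the stochastic integral \<open>\<integral>Y dX\<close> is defined path by path
  through integration by parts (\<open>drift_integral\<close>). Every probabilistic identity is first proved for
  the Euler scheme with step \<open>1 / N\<close>, which is driven by finitely many independent normal variables
  and where it is an induction over time steps; the scheme converges uniformly on every path
  (\<open>euler_converges\<close>), and dominated convergence gives the identity for the equation itself. This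
  yields the Girsanov formula (\<open>discrete_girsanov\<close>, \<open>girsanov_functional\<close>), first for Lipschitz
  functionals of the path and then, approximating indicators of open sets, for the laws on path
  space (\<open>path_law_density\<close>).

  For the information, the variation of constants formula (\<open>moving_decomposition\<close>) splits \<open>Y\<close> into a
  transient that depends on the initial segment and the Wiener integral of the kernel \<open>window x0\<close>,
  the integral of the fundamental solution over unit windows. The range of \<open>a\<close> enters through the
  fact that this kernel decays exponentially (\<open>window_exponential_decay\<close>): for \<open>0 < - a < pi\<^sup>2 / 2\<close>
  the characteristic function of the delay equation has no zeros in a half plane \<open>Re z \<ge> - c\<close> with
  \<open>c > 0\<close>, and the Laplace inversion integral can be shifted to the left of the imaginary axis.
  After discretisation, the time average of the squared Wiener integral is a quadratic form in
  Gaussian variables, whose variance is of order \<open>1 / T\<close> by explicit computation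
  (\<open>kernel_energy_variance\<close>).

  For the score, \<open>exp (\<i> * s * M + s\<^sup>2 / 2 * [M])\<close> has mean \<open>1\<close> for the martingale \<open>M = \<integral>Y dW\<close> with
  bracket \<open>[M] = \<integral>Y\<^sup>2 dt\<close>, as soon as the bracket is bounded. With \<open>s = u / sqrt T\<close> and the bracket
  close to \<open>J * T\<close>, this shows that the characteristic function of the score tends to
  \<open>exp (- u\<^sup>2 * J / 2)\<close>. Levy's theorem gives convergence of the score and Slutsky's theorem that of
  the pair; as the limit \<open>J\<close> is a constant, the model is locally asymptotically normal.
\<close>

section \<open>The fundamental solution and its integrals over unit windows\<close>

text \<open>For \<open>t \<le> 0\<close> the integral is over an empty or one-point interval, so \<open>primitive x\<close> is the integral of
  \<open>x\<close> continued by zero to the left of the origin, as the fundamental solution is.\<close>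

definition primitive :: "(real \<Rightarrow> real) \<Rightarrow> real \<Rightarrow> real" where
  "primitive x t = integral {0..t} x"

definition window :: "(real \<Rightarrow> real) \<Rightarrow> real \<Rightarrow> real" where
  "window x t = primitive x t - primitive x (t - 1)"

lemma primitive_nonpos [simp]: "t \<le> 0 \<Longrightarrow> primitive x t = 0"
  unfolding primitive_def by (cases "t = 0") auto

lemma primitive_has_derivative_within:
  assumes "continuous_on {0..} x" "t \<ge> 0"
  shows "(primitive x has_real_derivative x t) (at t within {0..})"
proof -
  have "((\<lambda>s. integral {0..s} x) has_real_derivative x t) (at t within {0..t+1})"
    by (rule integral_has_real_derivative) (use assms in \<open>auto intro: continuous_on_subset\<close>)
  moreover have "at t within {0..t+1} = at t within {0..}"
    by (rule at_within_nhd[of t "{..<t+1}"]) auto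
  ultimately show ?thesis unfolding primitive_def[abs_def] by simp
qed

lemma primitive_has_derivative:
  assumes "continuous_on {0..} x" "t > 0"
  shows "(primitive x has_real_derivative x t) (at t)"
proof -
  have "(primitive x has_real_derivative x t) (at t within {0<..})"
    by (rule has_field_derivative_subset[OF primitive_has_derivative_within]) (use assms in auto)
  then show ?thesis using assms at_within_open[of t "{0<..}"] by simp
qed

text \<open>Continuity on the whole line holds because \<open>primitive x\<close> is constant to the left of the origin; this
  is what lets shifted copies \<open>primitive x (t - 1)\<close> be used without case distinctions.\<close>

lemma primitive_continuous:
  assumes "continuous_on {0..} x"
  shows "continuous_on A (primitive x)"
proof -
  have c: "continuous_on {0..} (primitive x)"
    by (rule DERIV_continuous_on) (rule primitive_has_derivative_within[OF assms], simp)
  have "continuous_on UNIV (primitive x \<circ> (\<lambda>t. max 0 t))"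
    by (intro continuous_on_compose continuous_intros continuous_on_subset[OF c]) auto
  moreover have "primitive x \<circ> (\<lambda>t. max 0 t) = primitive x"
    by (rule ext) (simp add: max_def)
  ultimately show ?thesis using continuous_on_subset by auto
qed

lemma window_continuous:
  assumes "continuous_on {0..} x"
  shows "continuous_on A (window x)"
proof -
  have "continuous_on A (\<lambda>t. primitive x (t - 1))"
    by (rule continuous_on_compose2[OF primitive_continuous[OF assms, of UNIV]]) (auto intro: continuous_intros)
  then show ?thesis unfolding window_def
    by (intro continuous_intros primitive_continuous assms)
qed

lemma window_nonpos [simp]: "t \<le> 0 \<Longrightarrow> window x t = 0"
  by (simp add: window_def)

lemma set_integral_shift:
  fixes f :: "real \<Rightarrow> real"
  shows "(LBINT u:{-1..0}. f (s + u)) = (LBINT r:{s-1..s}. f r)"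
proof -
  have "(LBINT r:{s-1..s}. f r) = \<bar>1\<bar> *\<^sub>R (\<integral>u. (indicator {s-1..s} (s + 1 * u) *\<^sub>R f (s + 1 * u)) \<partial>lborel)"
    unfolding set_lebesgue_integral_def by (rule lborel_integral_real_affine) simp
  also have "\<dots> = (LBINT u:{-1..0}. f (s + u))"
    unfolding set_lebesgue_integral_def by (auto intro!: Bochner_Integration.integral_cong simp: indicator_def)
  finally show ?thesis by simp
qed

lemma set_integral_continuous:
  fixes f :: "real \<Rightarrow> 'a :: euclidean_space"
  assumes "continuous_on {a..b} f"
  shows "set_integrable lborel {a..b} f" "(LBINT r:{a..b}. f r) = integral {a..b} f"
proof -
  show *: "set_integrable lborel {a..b} f"
    unfolding set_integrable_def by (rule borel_integrable_compact) (use assms in auto)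
  show "(LBINT r:{a..b}. f r) = integral {a..b} f"
    by (rule set_borel_integral_eq_integral(2)[OF *])
qed

lemma fundamental_solution_window:
  assumes "fundamental_solution a x" "s \<ge> 0"
  shows "(LBINT u:{-1..0}. x (s + u)) = window x s"
proof -
  have x: "continuous_on {0..} x" "\<And>t. -1 \<le> t \<Longrightarrow> t < 0 \<Longrightarrow> x t = 0"
    using assms(1) unfolding fundamental_solution_def by auto
  have c: "continuous_on {0..s} x" by (rule continuous_on_subset[OF x(1)]) auto
  have "(LBINT u:{-1..0}. x (s + u)) = (LBINT r:{s-1..s}. x r)" by (rule set_integral_shift)
  also have "\<dots> = (LBINT r:{max 0 (s-1)..s}. x r)"
    unfolding set_lebesgue_integral_def
    by (rule Bochner_Integration.integral_cong) (use x(2) assms(2) in \<open>auto simp: indicator_def\<close>)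
  also have "\<dots> = integral {max 0 (s-1)..s} x"
    by (rule set_integral_continuous) (rule continuous_on_subset[OF x(1)], auto)
  also have "\<dots> = primitive x s - primitive x (s - 1)"
  proof (cases "s \<ge> 1")
    case True
    have "integral {0..s-1} x + integral {s-1..s} x = integral {0..s} x"
      by (rule Henstock_Kurzweil_Integration.integral_combine)
        (use True c in \<open>auto intro: integrable_continuous_real\<close>)
    then show ?thesis using True by (simp add: primitive_def)
  qed (simp add: primitive_def)
  finally show ?thesis by (simp add: window_def)
qed

lemma fundamental_solution_eq:
  assumes "fundamental_solution a x" "t \<ge> 0"
  shows "x t = 1 + a * integral {0..t} (window x)"
proof -
  have c: "continuous_on {0..} x" using assms(1) unfolding fundamental_solution_def by auto
  have "x t = 1 + a * (LBINT s:{0..t}. (LBINT u:{-1..0}. x (s + u)))"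
    using assms unfolding fundamental_solution_def by auto
  also have "(LBINT s:{0..t}. (LBINT u:{-1..0}. x (s + u))) = (LBINT s:{0..t}. window x s)"
    using fundamental_solution_window[OF assms(1)]
    by (intro set_lebesgue_integral_cong) auto
  also have "\<dots> = integral {0..t} (window x)"
    by (rule set_integral_continuous) (rule window_continuous[OF c])
  finally show ?thesis .
qed

lemma fundamental_solution_continuous:
  "fundamental_solution a x \<Longrightarrow> continuous_on {0..} x"
  unfolding fundamental_solution_def by auto

lemma fundamental_solution_derivative:
  assumes fs: "fundamental_solution a x" and t: "t > 0"
  shows "(x has_real_derivative a * window x t) (at t)"
proof -
  have c: "continuous_on {0..} x" by (rule fundamental_solution_continuous[OF fs])
  have "(primitive (window x) has_real_derivative window x t) (at t)"
    by (rule primitive_has_derivative[OF window_continuous[OF c] t])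
  then have "((\<lambda>t. 1 + a * primitive (window x) t) has_real_derivative a * window x t) (at t)"
    by (auto intro!: derivative_eq_intros)
  then show ?thesis
  proof (rule DERIV_cong_ev[THEN iffD1, OF refl _ refl, rotated])
    show "\<forall>\<^sub>F s in nhds t. 1 + a * primitive (window x) s = x s"
      using eventually_nhds_in_open[of "{0<..}" t] t
      by (auto elim!: eventually_mono simp: fundamental_solution_eq[OF fs] primitive_def)
  qed
qed

lemma integral_exp_le:
  assumes "K > 0" "t \<ge> (0::real)"
  shows "integral {0..t} (\<lambda>s. exp (K * s)) \<le> exp (K * t) / K"
proof -
  have "((\<lambda>s. exp (K * s)) has_integral exp (K * t) / K - exp (K * 0) / K) {0..t}"
    by (rule fundamental_theorem_of_calculus[OF assms(2)])
      (use assms in \<open>auto intro!: derivative_eq_intros simp: has_real_derivative_iff_has_vector_derivative[symmetric]\<close>)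
  then have "integral {0..t} (\<lambda>s. exp (K * s)) = exp (K * t) / K - exp (K * 0) / K"
    by (rule integral_unique)
  also have "\<dots> \<le> exp (K * t) / K" using assms by simp
  finally show ?thesis .
qed

lemma window_abs_le:
  assumes "continuous_on {0..} x" "t \<ge> 0"
  shows "\<bar>window x t\<bar> \<le> integral {0..t} (\<lambda>s. \<bar>x s\<bar>)"
proof -
  have c: "continuous_on {0..r} x" for r by (rule continuous_on_subset[OF assms(1)]) auto
  have i: "x integrable_on {0..r}" "(\<lambda>s. \<bar>x s\<bar>) integrable_on {0..r}" for r
    using c by (auto intro!: integrable_continuous_real continuous_intros)
  have i': "x integrable_on {max 0 (t-1)..t}" "(\<lambda>s. \<bar>x s\<bar>) integrable_on {max 0 (t-1)..t}"
    using continuous_on_subset[OF c[of t], of "{max 0 (t-1)..t}"]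
    by (auto intro!: integrable_continuous_real continuous_intros)
  have "window x t = integral {max 0 (t-1)..t} x"
  proof (cases "t \<ge> 1")
    case True
    have "integral {0..t-1} x + integral {t-1..t} x = integral {0..t} x"
      by (rule Henstock_Kurzweil_Integration.integral_combine) (use True i in auto)
    then show ?thesis using True by (simp add: window_def primitive_def)
  qed (simp add: window_def primitive_def)
  also have "\<bar>\<dots>\<bar> \<le> integral {max 0 (t-1)..t} (\<lambda>s. \<bar>x s\<bar>)"
    using integral_norm_bound_integral[OF i'] by (simp add: i')
  also have "\<dots> \<le> integral {0..t} (\<lambda>s. \<bar>x s\<bar>)"
    by (rule integral_subset_le) (use i i' in auto)
  finally show ?thesis .
qed

text \<open>A Gronwall bound by the maximum trick: if \<open>m\<close> is the maximum of \<open>exp (- K * s) * \<bar>x s\<bar>\<close> on \<open>[0, t]\<close>,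
  attained at \<open>r\<close>, the integral equation at \<open>r\<close> gives \<open>m \<le> exp (- K * r) + m / 2\<close>, since two
  integrations each gain a factor \<open>1 / K\<close> and \<open>2 * \<bar>a\<bar> \<le> K\<^sup>2\<close>.\<close>

lemma fundamental_solution_growth:
  assumes fs: "fundamental_solution a x" and t: "t \<ge> 0"
  shows "\<bar>x t\<bar> \<le> 2 * exp ((1 + 2 * \<bar>a\<bar>) * t)"
proof -
  define K where "K = 1 + 2 * \<bar>a\<bar>"
  have K: "K \<ge> 1" "2 * \<bar>a\<bar> \<le> K\<^sup>2" unfolding K_def by (auto simp: power2_eq_square algebra_simps)
  have c: "continuous_on {0..} x" by (rule fundamental_solution_continuous[OF fs])
  have c': "continuous_on {0..r} x" for r by (rule continuous_on_subset[OF c]) auto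
  have "\<exists>r\<in>{0..t}. \<forall>s\<in>{0..t}. exp (- K * s) * \<bar>x s\<bar> \<le> exp (- K * r) * \<bar>x r\<bar>"
    using t c' by (intro continuous_attains_sup continuous_intros) auto
  then obtain r where r: "0 \<le> r" "r \<le> t" and
    max: "\<And>s. 0 \<le> s \<Longrightarrow> s \<le> t \<Longrightarrow> exp (- K * s) * \<bar>x s\<bar> \<le> exp (- K * r) * \<bar>x r\<bar>"
    by auto
  define m where "m = exp (- K * r) * \<bar>x r\<bar>"
  have m0: "m \<ge> 0" unfolding m_def by simp
  have xs: "\<bar>x s\<bar> \<le> m * exp (K * s)" if "0 \<le> s" "s \<le> t" for s
  proof -
    have "exp (K * s) * (exp (- K * s) * \<bar>x s\<bar>) \<le> exp (K * s) * m"
      using max[OF that] unfolding m_def by (intro mult_left_mono) auto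
    then show ?thesis by (simp add: exp_minus mult.commute field_simps)
  qed
  have ws: "\<bar>window x s\<bar> \<le> m / K * exp (K * s)" if "0 \<le> s" "s \<le> t" for s
  proof -
    have "\<bar>window x s\<bar> \<le> integral {0..s} (\<lambda>s. \<bar>x s\<bar>)" by (rule window_abs_le[OF c that(1)])
    also have "\<dots> \<le> integral {0..s} (\<lambda>s. m * exp (K * s))"
      by (rule integral_le) (use c' xs that in \<open>auto intro!: integrable_continuous_real continuous_intros\<close>)
    also have "\<dots> \<le> m * (exp (K * s) / K)"
      using integral_exp_le[of K s] K that m0 by (simp add: mult_left_mono del: times_divide_eq_right)
    finally show ?thesis by simp
  qed
  have wc: "continuous_on {0..r} (window x)" by (rule window_continuous[OF c])
  have "\<bar>integral {0..r} (window x)\<bar> \<le> integral {0..r} (\<lambda>s. m / K * exp (K * s))"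
    unfolding real_norm_def[symmetric]
  proof (rule integral_norm_bound_integral)
    show "norm (window x s) \<le> m / K * exp (K * s)" if "s \<in> {0..r}" for s
      using ws[of s] that r by simp
  qed (use wc K in \<open>auto intro!: integrable_continuous_real continuous_intros\<close>)
  also have "\<dots> \<le> m / K * (exp (K * r) / K)"
    using integral_exp_le[of K r] K r m0
    by (simp only: integral_mult_right) (intro mult_left_mono, auto)
  finally have iw: "\<bar>integral {0..r} (window x)\<bar> \<le> m * exp (K * r) / K\<^sup>2"
    by (simp add: power2_eq_square)
  have "\<bar>x r\<bar> \<le> 1 + \<bar>a\<bar> * \<bar>integral {0..r} (window x)\<bar>"
    unfolding fundamental_solution_eq[OF fs r(1)] by (metis abs_mult abs_one abs_triangle_ineq)
  also have "\<dots> \<le> 1 + \<bar>a\<bar> * (m * exp (K * r) / K\<^sup>2)"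
    using iw by (intro add_left_mono mult_left_mono) auto
  also have "\<dots> = 1 + (\<bar>a\<bar> / K\<^sup>2) * (m * exp (K * r))" by simp
  also have "\<dots> \<le> 1 + (1/2) * (m * exp (K * r))"
    using K m0 by (intro add_left_mono mult_right_mono) (auto simp: field_simps)
  finally have "\<bar>x r\<bar> \<le> 1 + (1/2) * (m * exp (K * r))" .
  then have "m \<le> exp (- K * r) * (1 + (1/2) * (m * exp (K * r)))"
    unfolding m_def by (intro mult_left_mono) auto
  also have "\<dots> = exp (- K * r) + m / 2" by (simp add: algebra_simps exp_minus)
  finally have "m \<le> 2 * exp (- K * r)" by simp
  also have "\<dots> \<le> 2" using K r by simp
  finally have "m \<le> 2" .
  then have "m * exp (K * t) \<le> 2 * exp (K * t)" by (intro mult_right_mono) auto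
  then show ?thesis using xs[OF t order_refl] unfolding K_def by linarith
qed

lemma fundamental_solution_integral_growth:
  assumes fs: "fundamental_solution a x" and t: "t \<ge> 0"
  shows "integral {0..t} (\<lambda>s. \<bar>x s\<bar>) \<le> 2 * exp ((1 + 2 * \<bar>a\<bar>) * t)"
proof -
  define K where "K = 1 + 2 * \<bar>a\<bar>"
  have K: "K \<ge> 1" unfolding K_def by auto
  have c: "continuous_on {0..t} x"
    by (rule continuous_on_subset[OF fundamental_solution_continuous[OF fs]]) auto
  have "integral {0..t} (\<lambda>s. \<bar>x s\<bar>) \<le> integral {0..t} (\<lambda>s. 2 * exp (K * s))"
    by (rule integral_le) (use c fundamental_solution_growth[OF fs] in
      \<open>auto simp: K_def intro!: integrable_continuous_real continuous_intros\<close>)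
  also have "\<dots> \<le> 2 * (exp (K * t) / K)"
    using integral_exp_le[of K t] K t by simp
  also have "\<dots> \<le> 2 * exp (K * t)" using K by (simp add: field_simps)
  finally show ?thesis unfolding K_def .
qed

lemma window_growth:
  assumes "fundamental_solution a x" "t \<ge> 0"
  shows "\<bar>window x t\<bar> \<le> 2 * exp ((1 + 2 * \<bar>a\<bar>) * t)"
  by (rule order_trans[OF window_abs_le[OF fundamental_solution_continuous] fundamental_solution_integral_growth])
    (use assms in auto)

section \<open>Laplace transforms\<close>

lemma set_integrable_exp_decay:
  fixes f :: "real \<Rightarrow> 'a::euclidean_space"
  assumes m: "continuous_on {0..} f" and k: "k > 0" and b: "\<And>t. t \<ge> 0 \<Longrightarrow> norm (f t) \<le> C * exp (- k * t)"
  shows "set_integrable lborel {0..} f"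
proof -
  have "(\<lambda>x. exp (- k * x)) absolutely_integrable_on {0..}"
    using integrable_on_exp_minus_to_infinity[OF k, of 0]
    by (intro nonnegative_absolutely_integrable_1) auto
  then have i: "set_integrable lborel {0..} (\<lambda>x. exp (- k * x))"
    unfolding set_integrable_def by (subst (asm) integrable_completion) auto
  have "set_integrable lborel {0..} (\<lambda>x. C * exp (- k * x))"
    using i by simp
  moreover have "set_borel_measurable lborel {0..} f"
    using borel_measurable_continuous_on_indicator[OF _ m] unfolding set_borel_measurable_def by simp
  ultimately show ?thesis
    by (rule set_integrable_bound) (use b in \<open>auto intro!: AE_I2 order_trans[OF b]\<close>)
qed

lemma set_integral_mult_complex:
  fixes f :: "real \<Rightarrow> complex"
  shows "(LBINT t:A. c * f t) = c * (LBINT t:A. f t)"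
proof -
  have "(LBINT t:A. c * f t) = (\<integral>t. c * (indicator A t *\<^sub>R f t) \<partial>lborel)"
    unfolding set_lebesgue_integral_def by (simp only: mult_scaleR_right)
  then show ?thesis unfolding set_lebesgue_integral_def by (simp only: integral_mult_right_zero)
qed

definition laplace :: "(real \<Rightarrow> real) \<Rightarrow> complex \<Rightarrow> complex" where
  "laplace f z = (LBINT t:{0..}. exp (- z * complex_of_real t) * complex_of_real (f t))"

lemma laplace_integrable:
  fixes f :: "real \<Rightarrow> real"
  assumes "continuous_on {0..} f" "\<And>t. t \<ge> 0 \<Longrightarrow> \<bar>f t\<bar> \<le> C * exp (K * t)" "Re z > K"
  shows "set_integrable lborel {0..} (\<lambda>t. exp (- z * complex_of_real t) * complex_of_real (f t))"
proof (rule set_integrable_exp_decay[where k = "Re z - K" and C = C])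
  fix t :: real assume t: "t \<ge> 0"
  have "norm (exp (- z * complex_of_real t) * complex_of_real (f t)) = exp (- Re z * t) * \<bar>f t\<bar>"
    by (simp add: norm_mult)
  also have "\<dots> \<le> exp (- Re z * t) * (C * exp (K * t))"
    by (intro mult_left_mono assms t) auto
  also have "\<dots> = C * exp (- (Re z - K) * t)"
    by (simp add: exp_add[symmetric] algebra_simps)
  finally show "norm (exp (- z * complex_of_real t) * complex_of_real (f t)) \<le> \<dots>" .
qed (use assms in \<open>auto intro!: continuous_intros\<close>)

text \<open>Integration by parts on \<open>[0, R]\<close>; the boundary term at \<open>R\<close> vanishes as \<open>R\<close> grows because \<open>Re z\<close>
  exceeds the growth rate.\<close>

lemma laplace_derivative:
  fixes f g :: "real \<Rightarrow> real"
  assumes f: "continuous_on {0..} f" "\<And>t. t \<ge> 0 \<Longrightarrow> \<bar>f t\<bar> \<le> C * exp (K * t)"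
    and g: "continuous_on {0..} g" "\<And>t. t \<ge> 0 \<Longrightarrow> \<bar>g t\<bar> \<le> C' * exp (K * t)"
    and d: "\<And>t. t > 0 \<Longrightarrow> (f has_real_derivative g t) (at t)"
    and z: "Re z > K"
  shows "z * laplace f z = f 0 + laplace g z"
proof -
  define F where "F t = exp (- z * complex_of_real t) * complex_of_real (f t)" for t
  define F' where "F' t = exp (- z * complex_of_real t) * complex_of_real (g t) - z * (exp (- z * complex_of_real t) * complex_of_real (f t))" for t
  have i: "set_integrable lborel {0..} (\<lambda>t. exp (- z * complex_of_real t) * complex_of_real (f t))"
    "set_integrable lborel {0..} (\<lambda>t. exp (- z * complex_of_real t) * complex_of_real (g t))"
    by (rule laplace_integrable[OF f z], assumption) (rule laplace_integrable[OF g z], assumption)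
  have i': "set_integrable lborel {0..} F'"
    unfolding F'_def by (intro set_integral_diff(1) set_integrable_mult_right i)
  have Ic: "(LBINT t:{0..}. F' t) = laplace g z - z * laplace f z"
    unfolding F'_def laplace_def
    by (subst set_integral_diff(2)[OF i(2) set_integrable_mult_right[OF i(1)]])
      (rule arg_cong2[where f = minus, OF refl set_integral_mult_complex])
  have cF: "continuous_on {0..R} F" "continuous_on {0..R} F'" for R
    unfolding F_def F'_def using continuous_on_subset[OF f(1), of "{0..R}"] continuous_on_subset[OF g(1), of "{0..R}"]
    by (auto intro!: continuous_intros)
  have FT: "(LBINT t:{0..R}. F' t) = F R - F 0" if "R \<ge> 0" for R
  proof -
    have "(F' has_integral (F R - F 0)) {0..R}"
    proof (rule fundamental_theorem_of_calculus_interior[OF that cF(1)])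
      fix t assume "t \<in> {0<..<R}"
      then have d': "(f has_vector_derivative g t) (at t)"
        using d[of t] by (simp add: has_real_derivative_iff_has_vector_derivative)
      then have d'': "((\<lambda>t. complex_of_real (f t)) has_vector_derivative complex_of_real (g t)) (at t)"
        by (rule bounded_linear.has_vector_derivative[OF bounded_linear_of_real])
      have e: "((\<lambda>t. exp (- z * complex_of_real t)) has_vector_derivative (- z * exp (- z * complex_of_real t))) (at t)"
      proof -
        have "((\<lambda>w. exp (- z * w)) has_field_derivative (- z * exp (- z * complex_of_real t))) (at (complex_of_real t))"
          by (auto intro!: derivative_eq_intros)
        then show ?thesis by (rule has_vector_derivative_real_field)
      qed
      show "(F has_vector_derivative F' t) (at t)"
        unfolding F_def F'_def
        by (rule has_vector_derivative_eq_rhs[OF has_vector_derivative_mult[OF e d'']]) (simp add: algebra_simps)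
    qed
    then have "integral {0..R} F' = F R - F 0" by (rule integral_unique)
    then show ?thesis by (simp add: set_integral_continuous(2)[OF cF(2)])
  qed
  have "((\<lambda>R. LBINT t:{0..R}. F' t) \<longlongrightarrow> (LBINT t:{0..}. F' t)) at_top"
    by (rule tendsto_set_lebesgue_integral_at_top[OF _ i']) auto
  then have 1: "((\<lambda>R. F R - F 0) \<longlongrightarrow> laplace g z - z * laplace f z) at_top"
    unfolding Ic
    by (rule Lim_transform_eventually) (use eventually_ge_at_top[of 0] in \<open>eventually_elim, auto simp: FT\<close>)
  have "((\<lambda>R. C * exp (- (Re z - K) * R)) \<longlongrightarrow> C * 0) at_top"
  proof (intro tendsto_mult tendsto_const)
    have "filterlim (\<lambda>R. (Re z - K) * R) at_top at_top"
      using z by (intro filterlim_tendsto_pos_mult_at_top[OF tendsto_const]) (auto simp: filterlim_ident)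
    then have "filterlim (\<lambda>R. - ((Re z - K) * R)) at_bot at_top"
      by (simp only: filterlim_uminus_at_top)
    then show "((\<lambda>R. exp (- (Re z - K) * R)) \<longlongrightarrow> 0) at_top"
      unfolding mult_minus_left by (rule filterlim_compose[OF exp_at_bot])
  qed
  then have c0: "((\<lambda>R. C * exp (- (Re z - K) * R)) \<longlongrightarrow> 0) at_top" by simp
  have "(F \<longlongrightarrow> 0) at_top"
  proof (rule Lim_null_comparison[OF _ c0])
    have "norm (F R) \<le> C * exp (- (Re z - K) * R)" if "R \<ge> 0" for R
    proof -
      have "norm (F R) = exp (- Re z * R) * \<bar>f R\<bar>" by (simp add: F_def norm_mult)
      also have "\<dots> \<le> exp (- Re z * R) * (C * exp (K * R))" by (intro mult_left_mono f that) auto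
      also have "\<dots> = C * exp (- (Re z - K) * R)" by (simp add: exp_add[symmetric] algebra_simps)
      finally show ?thesis .
    qed
    then show "\<forall>\<^sub>F R in at_top. norm (F R) \<le> C * exp (- (Re z - K) * R)"
      by (intro eventually_mono[OF eventually_ge_at_top[of 0]])
  qed
  then have "((\<lambda>R. F R - F 0) \<longlongrightarrow> 0 - F 0) at_top" by (intro tendsto_intros)
  with 1 have "laplace g z - z * laplace f z = 0 - F 0"
    using tendsto_unique trivial_limit_at_top_linorder by blast
  then show ?thesis by (simp add: F_def algebra_simps)
qed

lemma laplace_shift:
  fixes f :: "real \<Rightarrow> real"
  assumes "\<And>t. t \<le> 0 \<Longrightarrow> f t = 0"
  shows "laplace (\<lambda>t. f (t - 1)) z = exp (- z) * laplace f z"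
proof -
  have "laplace (\<lambda>t. f (t - 1)) z = \<bar>1\<bar> *\<^sub>R (\<integral>s. indicator {0..} (1 + 1 * s) *\<^sub>R (exp (- z * complex_of_real (1 + 1 * s)) * complex_of_real (f (1 + 1 * s - 1))) \<partial>lborel)"
    unfolding laplace_def set_lebesgue_integral_def by (rule lborel_integral_real_affine) simp
  also have "\<dots> = (\<integral>s. exp (- z) * (indicator {0..} s *\<^sub>R (exp (- z * complex_of_real s) * complex_of_real (f s))) \<partial>lborel)"
    by (simp, rule Bochner_Integration.integral_cong)
      (auto simp: indicator_def assms algebra_simps exp_diff exp_minus divide_inverse)
  also have "\<dots> = exp (- z) * laplace f z"
    unfolding laplace_def set_lebesgue_integral_def by (simp only: integral_mult_right_zero)
  finally show ?thesis .
qed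

text \<open>With \<open>U\<close> the primitive of \<open>x\<close>, the transforms satisfy \<open>z * LU = Lx\<close>, \<open>z * Lx = 1 + a * L(window x)\<close>
  and \<open>L(window x) = (1 - exp (- z)) * LU\<close>; eliminating \<open>Lx\<close> and \<open>LU\<close> gives the claim.\<close>

lemma laplace_window:
  assumes fs: "fundamental_solution a x" and z: "Re z > 1 + 2 * \<bar>a\<bar>"
  shows "(z\<^sup>2 - a * (1 - exp (- z))) * laplace (window x) z = 1 - exp (- z)"
proof -
  define K where "K = 1 + 2 * \<bar>a\<bar>"
  have K: "K \<ge> 1" unfolding K_def by auto
  have c: "continuous_on {0..} x" by (rule fundamental_solution_continuous[OF fs])
  have c': "continuous_on {0..r} x" for r by (rule continuous_on_subset[OF c]) auto
  have bx: "\<bar>x t\<bar> \<le> 2 * exp (K * t)" if "t \<ge> 0" for t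
    using fundamental_solution_growth[OF fs that] by (simp add: K_def)
  have bi: "integral {0..t} (\<lambda>s. \<bar>x s\<bar>) \<le> 2 * exp (K * t)" if "t \<ge> 0" for t
    using fundamental_solution_integral_growth[OF fs that] by (simp add: K_def)
  have bU: "\<bar>primitive x t\<bar> \<le> 2 * exp (K * t)" if "t \<ge> 0" for t
  proof -
    have "\<bar>primitive x t\<bar> \<le> integral {0..t} (\<lambda>s. \<bar>x s\<bar>)"
      unfolding primitive_def using integral_norm_bound_integral[of x "{0..t}" "\<lambda>s. \<bar>x s\<bar>"] c'
      by (auto intro!: integrable_continuous_real continuous_intros)
    then show ?thesis using bi[OF that] by simp
  qed
  have bw: "\<bar>window x t\<bar> \<le> 2 * exp (K * t)" if "t \<ge> 0" for t
    using window_growth[OF fs that] by (simp add: K_def)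
  have bU1: "\<bar>primitive x (t-1)\<bar> \<le> 2 * exp (K * t)" if "t \<ge> 0" for t
  proof (cases "t \<ge> 1")
    case True
    then have "\<bar>primitive x (t-1)\<bar> \<le> 2 * exp (K * (t-1))" using bU by simp
    also have "\<dots> \<le> 2 * exp (K * t)" using K by simp
    finally show ?thesis .
  qed simp
  have zK: "Re z > K" using z by (simp add: K_def)
  have 1: "z * laplace (primitive x) z = primitive x 0 + laplace x z"
    by (rule laplace_derivative[OF primitive_continuous[OF c] bU c bx primitive_has_derivative[OF c] zK])
  have 2: "z * laplace x z = x 0 + laplace (\<lambda>t. a * window x t) z"
  proof (rule laplace_derivative[OF c bx _ _ _ zK])
    show "continuous_on {0..} (\<lambda>t. a * window x t)" by (intro continuous_intros window_continuous c)
    show "\<bar>a * window x t\<bar> \<le> (\<bar>a\<bar> * 2) * exp (K * t)" if "0 \<le> t" for t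
      using mult_left_mono[OF bw[OF that], of "\<bar>a\<bar>"] by (simp add: abs_mult mult.assoc)
    show "(x has_real_derivative a * window x t) (at t)" if "0 < t" for t
      by (rule fundamental_solution_derivative[OF fs that])
  qed
  have i: "set_integrable lborel {0..} (\<lambda>t. exp (- z * complex_of_real t) * complex_of_real (primitive x t))"
    "set_integrable lborel {0..} (\<lambda>t. exp (- z * complex_of_real t) * complex_of_real (primitive x (t - 1)))"
    subgoal by (rule laplace_integrable[OF primitive_continuous[OF c] bU zK])
    subgoal
      apply (rule laplace_integrable[OF _ bU1 zK])
      by (rule continuous_on_compose2[OF primitive_continuous[OF c, of UNIV]]) (auto intro: continuous_intros)
    done
  have 3: "laplace (window x) z = laplace (primitive x) z - exp (- z) * laplace (primitive x) z"
  proof -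
    have "laplace (window x) z = laplace (primitive x) z - laplace (\<lambda>t. primitive x (t - 1)) z"
      unfolding laplace_def window_def
      by (subst set_integral_diff(2)[symmetric, OF i]) (simp add: algebra_simps)
    then show ?thesis by (simp add: laplace_shift)
  qed
  have 4: "laplace (\<lambda>t. a * window x t) z = a * laplace (window x) z"
    unfolding laplace_def set_integral_mult_complex[symmetric] by (simp add: mult.left_commute)
  have x0: "x 0 = 1" using fundamental_solution_eq[OF fs, of 0] by simp
  have "z\<^sup>2 * laplace (primitive x) z = 1 + a * laplace (window x) z"
    using 1 2 4 x0 by (simp add: power2_eq_square mult.assoc)
  moreover have "z\<^sup>2 * laplace (window x) z = (1 - exp (-z)) * (z\<^sup>2 * laplace (primitive x) z)"
    unfolding 3 by (simp add: algebra_simps)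
  ultimately have "z\<^sup>2 * laplace (window x) z = (1 - exp (-z)) * (1 + a * laplace (window x) z)"
    by simp
  then show ?thesis by (simp add: algebra_simps)
qed

section \<open>The characteristic function of the delay equation\<close>

text \<open>The entire function that is the Laplace transform of the uniform density on \<open>[0, 1]\<close>. Dividing the
  equation for the transform of \<open>window x\<close> by \<open>z\<close> produces it and removes the spurious root \<open>z = 0\<close>.\<close>

definition expm1_quotient :: "complex \<Rightarrow> complex" where
  "expm1_quotient z = (if z = 0 then 1 else (1 - exp (- z)) / z)"

lemma expm1_quotient_mult: "z * expm1_quotient z = 1 - exp (- z)"
  by (simp add: expm1_quotient_def)

lemma expm1_quotient_holomorphic: "expm1_quotient holomorphic_on UNIV"
proof (rule no_isolated_singularity'[where K = "{0}"])
  show "(expm1_quotient \<longlongrightarrow> expm1_quotient z) (at z within UNIV)" if "z \<in> {0}" for z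
  proof -
    have "((\<lambda>z::complex. - exp (- z)) has_field_derivative 1) (at 0)"
      by (auto intro!: derivative_eq_intros)
    then have "(\<lambda>z::complex. (- exp (- z) - (- exp (- 0))) / (z - 0)) \<midarrow>0\<rightarrow> 1"
      unfolding has_field_derivative_iff by simp
    then have "expm1_quotient \<midarrow>0\<rightarrow> 1"
      by (rule Lim_transform_eventually)
        (auto simp: expm1_quotient_def eventually_at intro!: exI[of _ 1])
    then show ?thesis using that by (simp add: expm1_quotient_def)
  qed
  have "(\<lambda>z. (1 - exp (- z)) / z) holomorphic_on UNIV - {0}"
    by (intro holomorphic_intros) auto
  then show "expm1_quotient holomorphic_on UNIV - {0}"
    by (rule holomorphic_transform) (auto simp: expm1_quotient_def)
qed auto

text \<open>The characteristic function of the delay equation with \<open>a = - b\<close>: its roots are the exponents \<open>z\<close>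
  for which \<open>exp (z * t)\<close> solves the equation without noise.\<close>

definition char_fun :: "real \<Rightarrow> complex \<Rightarrow> complex" where
  "char_fun b z = z + b * expm1_quotient z"

lemma char_fun_holomorphic: "char_fun b holomorphic_on UNIV"
  unfolding char_fun_def[abs_def]
  by (intro holomorphic_intros expm1_quotient_holomorphic)

lemma char_fun_mult: "z * char_fun b z = z\<^sup>2 + b * (1 - exp (- z))"
  unfolding char_fun_def expm1_quotient_mult[symmetric] by (simp add: algebra_simps power2_eq_square)

text \<open>Roots with real part bounded below lie in a disc; this is the source of both the bound \<open>\<bar>Im z\<bar> < pi\<close>
  in the right half plane and the compactness that turns absence of roots into a zero-free strip.\<close>

lemma char_fun_root_bound:
  assumes "char_fun b z = 0" "b \<ge> 0"
  shows "(cmod z)\<^sup>2 \<le> b * (1 + exp (- Re z))"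
proof -
  have "z\<^sup>2 = - (b * (1 - exp (- z)))"
    using char_fun_mult[of z b] assms by (simp add: add_eq_0_iff2)
  then have "(cmod z)\<^sup>2 = b * cmod (1 - exp (- z))"
    using assms by (metis norm_power norm_minus_cancel norm_mult norm_of_real abs_of_nonneg)
  also have "\<dots> \<le> b * (1 + exp (- Re z))"
    using assms(2) norm_triangle_ineq4[of 1 "exp (-z)"] by (intro mult_left_mono) auto
  finally show ?thesis .
qed

text \<open>The stability condition. For a root with \<open>Re z \<ge> 0\<close> the bound on roots gives
  \<open>(Im z)\<^sup>2 \<le> 2 * b < pi\<^sup>2\<close>, so \<open>Im z * sin (Im z) > 0\<close> unless \<open>z\<close> is real. But the imaginary part
  of the equation, multiplied by \<open>Im z\<close>, equates a sum of \<open>b * exp (- Re z) * (Im z * sin (Im z))\<close>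
  and a nonnegative term to zero. Real roots are excluded by signs. At \<open>b = pi\<^sup>2 / 2\<close> the root
  \<open>z = \<i> * pi\<close> appears, so the bound on \<open>b\<close> is sharp.\<close>

lemma char_fun_nonzero_Re_nonneg:
  assumes b: "0 < b" "b < pi\<^sup>2 / 2" and z: "Re z \<ge> 0"
  shows "char_fun b z \<noteq> 0"
proof
  assume 0: "char_fun b z = 0"
  have "z \<noteq> 0" using 0 b by (auto simp: char_fun_def expm1_quotient_def)
  have eq: "z\<^sup>2 + b * (1 - exp (- z)) = 0" using char_fun_mult[of z b] 0 by simp
  have re: "(Re z)\<^sup>2 - (Im z)\<^sup>2 + b * (1 - exp (- Re z) * cos (Im z)) = 0"
    using arg_cong[OF eq, of Re] by (simp add: Re_exp Re_power2)
  have im: "2 * Re z * Im z + b * (exp (- Re z) * sin (Im z)) = 0"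
    using arg_cong[OF eq, of Im] by (simp add: Im_exp Im_power2)
  have "(Im z)\<^sup>2 \<le> (cmod z)\<^sup>2" by (simp add: cmod_power2)
  also have "\<dots> \<le> b * (1 + exp (- Re z))" using char_fun_root_bound[OF 0] b by simp
  also have "\<dots> \<le> b * 2" using b z by (intro mult_left_mono) auto
  also have "\<dots> < pi\<^sup>2" using b by simp
  finally have "\<bar>Im z\<bar> < pi" by (metis abs_le_square_iff abs_of_pos linorder_not_le pi_gt_zero)
  show False
  proof (cases "Im z = 0")
    case True
    with re have r: "(Re z)\<^sup>2 + b * (1 - exp (- Re z)) = 0" by simp
    have "b * (1 - exp (- Re z)) \<ge> 0" using b z by simp
    with r have "Re z = 0" using zero_le_power2[of "Re z"] by (smt (verit) power2_less_eq_zero_iff)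
    with True \<open>z \<noteq> 0\<close> show False by (simp add: complex_eq_iff)
  next
    case False
    have "Im z * sin (Im z) > 0"
    proof (cases "Im z > 0")
      case True then show ?thesis using sin_gt_zero[of "Im z"] \<open>\<bar>Im z\<bar> < pi\<close> by simp
    next
      case f: False then show ?thesis using sin_gt_zero[of "- Im z"] \<open>\<bar>Im z\<bar> < pi\<close> False
        by (simp add: mult_neg_neg)
    qed
    then have "b * exp (- Re z) * (Im z * sin (Im z)) > 0" using b by simp
    moreover have "2 * Re z * (Im z)\<^sup>2 \<ge> 0" using z by simp
    moreover have "2 * Re z * (Im z)\<^sup>2 + b * exp (- Re z) * (Im z * sin (Im z)) = 0"
      using arg_cong[OF im, of "\<lambda>w. Im z * w"] by (simp add: algebra_simps power2_eq_square)
    ultimately show False by linarith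
  qed
qed

text \<open>The roots with \<open>Re z \<ge> -1\<close> form a compact set, so their real parts have a maximum, which is
  negative.\<close>

lemma char_fun_zero_free_strip:
  assumes b: "0 < b" "b < pi\<^sup>2 / 2"
  shows "\<exists>c>0. c \<le> 1 \<and> (\<forall>z. Re z \<ge> - c \<longrightarrow> char_fun b z \<noteq> 0)"
proof -
  define R where "R = b * (1 + exp 1)"
  define S where "S = {z. char_fun b z = 0} \<inter> {z. Re z \<ge> -1}"
  have cont: "continuous_on UNIV (char_fun b)"
    by (rule holomorphic_on_imp_continuous_on[OF char_fun_holomorphic])
  have "closed {z. char_fun b z = 0}"
    using continuous_closed_vimage[of "{0}" "char_fun b"] cont
    by (auto simp: vimage_def continuous_on_eq_continuous_at)
  then have "closed S" unfolding S_def by (intro closed_Int closed_halfspace_Re_ge)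
  moreover have "bounded S"
  proof (rule boundedI)
    fix z assume "z \<in> S"
    then have z: "char_fun b z = 0" "Re z \<ge> -1" by (auto simp: S_def)
    have "(cmod z)\<^sup>2 \<le> b * (1 + exp (- Re z))" using char_fun_root_bound[OF z(1)] b by simp
    also have "\<dots> \<le> R" unfolding R_def using b z by (intro mult_left_mono) auto
    finally show "cmod z \<le> sqrt R" by (simp add: real_le_rsqrt)
  qed
  ultimately have cS: "compact S" by (simp add: compact_eq_bounded_closed)
  show ?thesis
  proof (cases "S = {}")
    case True
    then show ?thesis by (intro exI[of _ 1]) (auto simp: S_def)
  next
    case False
    have "\<exists>w\<in>S. \<forall>z\<in>S. Re z \<le> Re w"
      by (rule continuous_attains_sup[OF cS False]) (intro continuous_intros)
    then obtain w where w: "w \<in> S" "\<And>z. z \<in> S \<Longrightarrow> Re z \<le> Re w" by auto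
    have "Re w < 0" using w(1) char_fun_nonzero_Re_nonneg[OF b, of w] by (auto simp: S_def not_le[symmetric])
    moreover have "Re w \<ge> -1" using w(1) by (simp add: S_def)
    moreover have "char_fun b z \<noteq> 0" if "Re z \<ge> - (- Re w / 2)" for z
    proof
      assume "char_fun b z = 0"
      then have "z \<in> S" using that \<open>Re w \<ge> -1\<close> \<open>Re w < 0\<close> by (auto simp: S_def)
      then show False using w(2)[of z] that \<open>Re w < 0\<close> by auto
    qed
    ultimately show ?thesis by (intro exI[of _ "- Re w / 2"]) auto
  qed
qed

text \<open>Near the origin this is compactness; for large \<open>\<bar>z\<bar>\<close> the quotient equals
  \<open>(1 - exp (- z)) / (z\<^sup>2 + b * (1 - exp (- z)))\<close>, which is of order \<open>1 / \<bar>z\<bar>\<^sup>2\<close> where \<open>Re z\<close> is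
  bounded below. The quadratic decay makes the inversion integral converge absolutely on every
  vertical line of the strip.\<close>

lemma transfer_function_bound:
  assumes b: "0 < b" and nz: "\<And>z. Re z \<ge> - c \<Longrightarrow> char_fun b z \<noteq> 0" and c: "c \<ge> 0"
  shows "\<exists>B\<ge>0. \<forall>z. - c \<le> Re z \<and> Re z \<le> s \<longrightarrow>
    cmod (expm1_quotient z / char_fun b z) \<le> B / (1 + (Im z)\<^sup>2)"
proof -
  define m where "m = 1 + exp c"
  \<comment> \<open>Beyond this radius the delayed term is at most half of \<open>z\<^sup>2\<close>.\<close>
  define R where "R = 1 + 2 * b * m"
  have m: "m \<ge> 2" unfolding m_def using c by simp
  have R1: "R \<ge> 1" unfolding R_def using b m by simp
  have m': "cmod (1 - exp (- z)) \<le> m" if "Re z \<ge> - c" for z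
    using norm_triangle_ineq4[of 1 "exp (-z)"] that unfolding m_def
    by (smt (verit) exp_le_cancel_iff norm_exp_eq_Re norm_one uminus_complex.sel(1))
  let ?H = "\<lambda>z. expm1_quotient z / char_fun b z"
  let ?S = "{z. - c \<le> Re z} \<inter> cball 0 R"
  have cS: "compact ?S"
    using closed_Int[OF closed_halfspace_Re_ge closed_cball]
    by (auto simp: compact_eq_bounded_closed intro!: bounded_Int)
  have "continuous_on ?S (\<lambda>z. (1 + (Im z)\<^sup>2) * cmod (?H z))"
  proof (intro continuous_intros)
    show "continuous_on ?S expm1_quotient" "continuous_on ?S (char_fun b)"
      using holomorphic_on_imp_continuous_on[OF expm1_quotient_holomorphic]
        holomorphic_on_imp_continuous_on[OF char_fun_holomorphic] continuous_on_subset by blast+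
  qed (use nz in auto)
  then have "compact ((\<lambda>z. (1 + (Im z)\<^sup>2) * cmod (?H z)) ` ?S)"
    using cS by (rule compact_continuous_image)
  then have "bdd_above ((\<lambda>z. (1 + (Im z)\<^sup>2) * cmod (?H z)) ` ?S)"
    by (intro bounded_imp_bdd_above compact_imp_bounded)
  then obtain B0 where "\<forall>y\<in>(\<lambda>z. (1 + (Im z)\<^sup>2) * cmod (?H z)) ` ?S. y \<le> B0"
    unfolding bdd_above_def by blast
  then have B0: "\<And>z. z \<in> ?S \<Longrightarrow> (1 + (Im z)\<^sup>2) * cmod (?H z) \<le> B0" by blast
  define B where "B = max (max B0 0) (4 * m)"
  have "cmod (?H z) \<le> B / (1 + (Im z)\<^sup>2)" if z: "- c \<le> Re z" for z
  proof (cases "cmod z \<le> R")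
    case True
    then have "(1 + (Im z)\<^sup>2) * cmod (?H z) \<le> B" using B0[of z] z by (auto simp: B_def)
    moreover have "1 + (Im z)\<^sup>2 > 0" by (simp add: add_pos_nonneg)
    ultimately show ?thesis by (simp add: pos_le_divide_eq mult.commute)
  next
    case False
    then have zR: "cmod z \<ge> R" by simp
    then have z0: "z \<noteq> 0" using R1 by auto
    have "R * 1 \<le> cmod z * cmod z" using zR R1 by (intro mult_mono) auto
    then have z2: "(cmod z)\<^sup>2 \<ge> R" by (simp add: power2_eq_square)
    have h: "?H z = (1 - exp (- z)) / (z\<^sup>2 + b * (1 - exp (- z)))"
    proof -
      have "?H z = (z * expm1_quotient z) / (z * char_fun b z)" using z0 by simp
      then show ?thesis by (simp only: char_fun_mult expm1_quotient_mult)
    qed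
    have "cmod (b * (1 - exp (- z))) \<le> b * m" using m'[OF z] b by (simp add: norm_mult mult_left_mono)
    also have "\<dots> \<le> (cmod z)\<^sup>2 / 2" using z2 unfolding R_def by simp
    finally have "cmod (z\<^sup>2) - cmod (b * (1 - exp (- z))) \<ge> (cmod z)\<^sup>2 / 2" by (simp add: norm_power)
    then have d: "cmod (z\<^sup>2 + b * (1 - exp (- z))) \<ge> (cmod z)\<^sup>2 / 2"
      using norm_diff_ineq[of "z\<^sup>2" "b * (1 - exp (- z))"] by linarith
    have "(Im z)\<^sup>2 \<le> (cmod z)\<^sup>2" by (simp add: cmod_power2)
    then have i: "1 + (Im z)\<^sup>2 \<le> 2 * (cmod z)\<^sup>2" using z2 R1 by simp
    have p: "1 + (Im z)\<^sup>2 > 0" by (simp add: add_pos_nonneg)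
    have "cmod (?H z) \<le> m / ((cmod z)\<^sup>2 / 2)"
      unfolding h norm_divide using m'[OF z] d z0 m by (intro frac_le) auto
    also have "\<dots> \<le> m / ((1 + (Im z)\<^sup>2) / 4)"
      using i p m z0 by (intro divide_left_mono) (auto intro!: mult_pos_pos simp del: zero_less_mult_iff)
    also have "\<dots> = 4 * m / (1 + (Im z)\<^sup>2)" by simp
    also have "\<dots> \<le> B / (1 + (Im z)\<^sup>2)" using p by (intro divide_right_mono) (auto simp: B_def)
    finally show ?thesis .
  qed
  then show ?thesis by (intro exI[of _ B]) (auto simp: B_def)
qed

section \<open>Fourier inversion\<close>

lemma integral_iexp_std_normal_density:
  "(\<integral>r. iexp (q * r) * complex_of_real (std_normal_density r) \<partial>lborel) = exp (- q\<^sup>2 / 2)"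
proof -
  have "char std_normal_distribution q = (\<integral>r. std_normal_density r *\<^sub>R iexp (q * r) \<partial>lborel)"
    unfolding char_def by (rule integral_density) auto
  also have "\<dots> = (\<integral>r. iexp (q * r) * complex_of_real (std_normal_density r) \<partial>lborel)"
    by (simp add: scaleR_conv_of_real mult.commute)
  finally show ?thesis by (simp add: char_std_normal_distribution)
qed

lemma integral_iexp_scaled_normal:
  assumes e: "e > 0"
  shows "(\<integral>w. iexp (w * q) * complex_of_real (std_normal_density (e * w)) \<partial>lborel)
    = complex_of_real (sqrt (2 * pi) / e * std_normal_density (q / e))"
proof -
  have "(\<integral>r. iexp ((q / e) * r) * complex_of_real (std_normal_density r) \<partial>lborel) =
    \<bar>e\<bar> *\<^sub>R (\<integral>w. iexp ((q / e) * (0 + e * w)) * complex_of_real (std_normal_density (0 + e * w)) \<partial>lborel)"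
    using e by (intro lborel_integral_real_affine) simp
  also have "\<dots> = complex_of_real e * (\<integral>w. iexp (w * q) * complex_of_real (std_normal_density (e * w)) \<partial>lborel)"
    using e by (simp add: scaleR_conv_of_real mult.commute)
  finally have "complex_of_real e * (\<integral>w. iexp (w * q) * complex_of_real (std_normal_density (e * w)) \<partial>lborel)
    = complex_of_real (sqrt (2 * pi) * std_normal_density (q / e))"
    unfolding integral_iexp_std_normal_density by (simp add: std_normal_density_def)
  then show ?thesis using e by (simp add: field_simps)
qed

lemma integrable_std_normal_density: "integrable lborel std_normal_density"
  using integrable_normal_moment[of 1 0 0] by simp

text \<open>The classical argument with a Gaussian regulariser: inserting the factor
  \<open>std_normal_density (\<epsilon> * w)\<close> makes the double integral absolutely convergent, Fubini turns it into
  a convolution of \<open>u\<close> with a normal density of standard deviation \<open>\<epsilon>\<close>, and both sides converge as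
  \<open>\<epsilon>\<close> tends to zero.\<close>

theorem fourier_inversion:
  fixes u :: "real \<Rightarrow> real" and v :: "real \<Rightarrow> complex"
  assumes cu: "continuous_on UNIV u" and bu: "\<And>s. \<bar>u s\<bar> \<le> C" and iu: "integrable lborel u"
    and v: "\<And>w. v w = (\<integral>s. iexp (- (w * s)) * complex_of_real (u s) \<partial>lborel)"
    and iv: "integrable lborel v"
  shows "(\<integral>w. v w * iexp (w * t) \<partial>lborel) = 2 * pi * u t"
proof -
  note [measurable] = borel_measurable_continuous_onI[OF cu]
  have vm[measurable]: "v \<in> borel_measurable borel" using iv by auto
  have ul[measurable]: "u \<in> borel_measurable lborel" by simp
  define \<epsilon> where "\<epsilon> n = 1 / real (Suc n)" for n
  have e0: "\<epsilon> n > 0" for n by (simp add: \<epsilon>_def)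
  have e_lim: "\<epsilon> \<longlonglongrightarrow> 0" unfolding \<epsilon>_def using LIMSEQ_inverse_real_of_nat by (simp add: inverse_eq_divide)
  define I where "I n = (\<integral>w. v w * iexp (w * t) * complex_of_real (std_normal_density (\<epsilon> n * w)) \<partial>lborel)" for n
  have sle: "std_normal_density r \<le> 1 / sqrt (2 * pi)" for r
    by (simp add: std_normal_density_def divide_right_mono)
  have cn: "continuous_on UNIV std_normal_density"
    unfolding std_normal_density_def[abs_def] by (intro continuous_intros) auto
  have cn': "(\<lambda>n. std_normal_density (\<epsilon> n * w)) \<longlonglongrightarrow> std_normal_density 0" for w
  proof -
    have "(\<lambda>n. \<epsilon> n * w) \<longlonglongrightarrow> 0 * w" by (intro tendsto_intros e_lim)
    then have "(\<lambda>n. \<epsilon> n * w) \<longlonglongrightarrow> 0" by simp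
    then show ?thesis by (rule continuous_on_tendsto_compose[OF cn]) auto
  qed
  have lim1: "I \<longlonglongrightarrow> (\<integral>w. v w * iexp (w * t) * complex_of_real (std_normal_density 0) \<partial>lborel)"
    unfolding I_def
  proof (rule integral_dominated_convergence[where w = "\<lambda>w. norm (v w) * (1 / sqrt (2 * pi))"])
    show "AE w in lborel. (\<lambda>n. v w * iexp (w * t) * complex_of_real (std_normal_density (\<epsilon> n * w)))
      \<longlonglongrightarrow> v w * iexp (w * t) * complex_of_real (std_normal_density 0)"
      by (intro AE_I2 tendsto_intros cn')
    show "AE w in lborel. norm (v w * iexp (w * t) * complex_of_real (std_normal_density (\<epsilon> n * w)))
      \<le> norm (v w) * (1 / sqrt (2 * pi))" for n
    proof (rule AE_I2)
      fix w
      have "norm (v w) * std_normal_density (\<epsilon> n * w) \<le> norm (v w) * (1 / sqrt (2 * pi))"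
        by (intro mult_left_mono sle) simp
      then show "norm (v w * iexp (w * t) * complex_of_real (std_normal_density (\<epsilon> n * w)))
        \<le> norm (v w) * (1 / sqrt (2 * pi))" by (simp add: norm_mult)
    qed
  qed (use iv in auto)
  have lim2: "I \<longlonglongrightarrow> complex_of_real (sqrt (2 * pi) * u t)"
  proof -
    have In: "I n = complex_of_real (sqrt (2 * pi) * (\<integral>r. u (t - \<epsilon> n * r) * std_normal_density r \<partial>lborel))" for n
    proof -
      have int2: "integrable lborel (\<lambda>w. std_normal_density (\<epsilon> n * w))"
        using lborel_integrable_real_affine[OF integrable_std_normal_density, of "\<epsilon> n" 0] e0[of n] by simp
      have I: "integrable (lborel \<Otimes>\<^sub>M lborel) (\<lambda>(w, s). iexp (w * (t - s)) * complex_of_real (u s) * complex_of_real (std_normal_density (\<epsilon> n * w)))"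
      proof (rule lborel_pair.Fubini_integrable)
        show "integrable lborel (\<lambda>w. \<integral>s. norm (case (w, s) of (w, s) \<Rightarrow> iexp (w * (t - s)) * complex_of_real (u s) * complex_of_real (std_normal_density (\<epsilon> n * w))) \<partial>lborel)"
          using int2 by (simp add: norm_mult)
        show "AE w in lborel. integrable lborel (\<lambda>s. case (w, s) of (w, s) \<Rightarrow> iexp (w * (t - s)) * complex_of_real (u s) * complex_of_real (std_normal_density (\<epsilon> n * w)))"
        proof (intro AE_I2)
          fix w
          have "integrable lborel (\<lambda>s. iexp (w * (t - s)) * complex_of_real (u s))"
            by (rule Bochner_Integration.integrable_bound[OF iu]) (auto simp: norm_mult)
          then show "integrable lborel (\<lambda>s. case (w, s) of (w, s) \<Rightarrow> iexp (w * (t - s)) * complex_of_real (u s) * complex_of_real (std_normal_density (\<epsilon> n * w)))"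
            by simp
        qed
      qed measurable
      have "I n = (\<integral>w. (\<integral>s. iexp (w * (t - s)) * complex_of_real (u s) * complex_of_real (std_normal_density (\<epsilon> n * w)) \<partial>lborel) \<partial>lborel)"
        unfolding I_def
      proof (rule Bochner_Integration.integral_cong[OF refl])
        fix w
        have "v w * iexp (w * t) = (\<integral>s. iexp (- (w * s)) * complex_of_real (u s) * iexp (w * t) \<partial>lborel)"
          unfolding v by (rule integral_mult_left_zero[symmetric])
        also have "\<dots> = (\<integral>s. iexp (w * (t - s)) * complex_of_real (u s) \<partial>lborel)"
          by (rule Bochner_Integration.integral_cong[OF refl])
            (simp add: right_diff_distrib exp_diff exp_minus divide_inverse mult.commute mult.left_commute)
        finally show "v w * iexp (w * t) * complex_of_real (std_normal_density (\<epsilon> n * w)) =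
          (\<integral>s. iexp (w * (t - s)) * complex_of_real (u s) * complex_of_real (std_normal_density (\<epsilon> n * w)) \<partial>lborel)"
          by (simp only: integral_mult_left_zero)
      qed
      also have "\<dots> = (\<integral>s. (\<integral>w. iexp (w * (t - s)) * complex_of_real (u s) * complex_of_real (std_normal_density (\<epsilon> n * w)) \<partial>lborel) \<partial>lborel)"
        by (rule lborel_pair.Fubini_integral[OF I, symmetric])
      also have "\<dots> = (\<integral>s. complex_of_real (u s * (sqrt (2 * pi) / \<epsilon> n * std_normal_density ((t - s) / \<epsilon> n))) \<partial>lborel)"
      proof (rule Bochner_Integration.integral_cong[OF refl])
        fix s
        have "(\<integral>w. iexp (w * (t - s)) * complex_of_real (u s) * complex_of_real (std_normal_density (\<epsilon> n * w)) \<partial>lborel)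
          = (\<integral>w. complex_of_real (u s) * (iexp (w * (t - s)) * complex_of_real (std_normal_density (\<epsilon> n * w))) \<partial>lborel)"
          by (rule Bochner_Integration.integral_cong[OF refl]) (simp only: mult_ac)
        also have "\<dots> = complex_of_real (u s) * complex_of_real (sqrt (2 * pi) / \<epsilon> n * std_normal_density ((t - s) / \<epsilon> n))"
          by (simp only: integral_mult_right_zero integral_iexp_scaled_normal[OF e0])
        finally show "(\<integral>w. iexp (w * (t - s)) * complex_of_real (u s) * complex_of_real (std_normal_density (\<epsilon> n * w)) \<partial>lborel)
          = complex_of_real (u s * (sqrt (2 * pi) / \<epsilon> n * std_normal_density ((t - s) / \<epsilon> n)))" by simp
      qed
      also have "\<dots> = complex_of_real (\<integral>s. u s * (sqrt (2 * pi) / \<epsilon> n * std_normal_density ((t - s) / \<epsilon> n)) \<partial>lborel)"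
        by (rule integral_complex_of_real)
      also have "(\<integral>s. u s * (sqrt (2 * pi) / \<epsilon> n * std_normal_density ((t - s) / \<epsilon> n)) \<partial>lborel)
        = \<bar>- \<epsilon> n\<bar> *\<^sub>R (\<integral>r. u (t + - \<epsilon> n * r) * (sqrt (2 * pi) / \<epsilon> n * std_normal_density ((t - (t + - \<epsilon> n * r)) / \<epsilon> n)) \<partial>lborel)"
        using e0[of n] by (intro lborel_integral_real_affine) simp
      also have "\<dots> = \<epsilon> n * (\<integral>r. (sqrt (2 * pi) / \<epsilon> n) * (u (t - \<epsilon> n * r) * std_normal_density r) \<partial>lborel)"
        using e0[of n] by (simp add: mult_ac)
      also have "\<dots> = sqrt (2 * pi) * (\<integral>r. u (t - \<epsilon> n * r) * std_normal_density r \<partial>lborel)"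
        using e0[of n] by (simp only: integral_mult_right_zero) simp
      finally show ?thesis .
    qed
    have "(\<lambda>n. \<integral>r. u (t - \<epsilon> n * r) * std_normal_density r \<partial>lborel) \<longlonglongrightarrow> (\<integral>r. u t * std_normal_density r \<partial>lborel)"
    proof (rule integral_dominated_convergence[where w = "\<lambda>r. C * std_normal_density r"])
      show "AE r in lborel. (\<lambda>n. u (t - \<epsilon> n * r) * std_normal_density r) \<longlonglongrightarrow> u t * std_normal_density r"
      proof (intro AE_I2 tendsto_mult tendsto_const)
        fix r
        have "(\<lambda>n. t - \<epsilon> n * r) \<longlonglongrightarrow> t - 0 * r" by (intro tendsto_intros e_lim)
        then have "(\<lambda>n. t - \<epsilon> n * r) \<longlonglongrightarrow> t" by simp
        then show "(\<lambda>n. u (t - \<epsilon> n * r)) \<longlonglongrightarrow> u t" by (rule continuous_on_tendsto_compose[OF cu]) auto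
      qed
      show "AE r in lborel. norm (u (t - \<epsilon> n * r) * std_normal_density r) \<le> C * std_normal_density r" for n
        using bu by (intro AE_I2) (auto simp: abs_mult intro!: mult_right_mono)
    qed (use integrable_std_normal_density in auto)
    then have "(\<lambda>n. \<integral>r. u (t - \<epsilon> n * r) * std_normal_density r \<partial>lborel) \<longlonglongrightarrow> u t"
      by simp
    then show ?thesis unfolding In by (intro tendsto_intros)
  qed
  have "(\<integral>w. v w * iexp (w * t) * complex_of_real (std_normal_density 0) \<partial>lborel) = complex_of_real (sqrt (2 * pi) * u t)"
    by (rule LIMSEQ_unique[OF lim1 lim2])
  then have "(\<integral>w. v w * iexp (w * t) \<partial>lborel) * complex_of_real (std_normal_density 0) = complex_of_real (sqrt (2 * pi) * u t)"
    by (simp only: integral_mult_left_zero)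
  note A = this
  have d: "std_normal_density 0 * sqrt (2 * pi) = 1" by (simp add: std_normal_density_def)
  have "(\<integral>w. v w * iexp (w * t) \<partial>lborel) = (\<integral>w. v w * iexp (w * t) \<partial>lborel) * complex_of_real (std_normal_density 0 * sqrt (2 * pi))"
    by (simp only: d of_real_1 mult_1_right)
  also have "\<dots> = complex_of_real (sqrt (2 * pi) * u t) * complex_of_real (sqrt (2 * pi))"
    by (simp only: of_real_mult[of "std_normal_density 0"] mult.assoc[symmetric] A)
  also have "\<dots> = complex_of_real (sqrt (2 * pi) * u t * sqrt (2 * pi))" by (simp only: of_real_mult)
  also have "sqrt (2 * pi) * u t * sqrt (2 * pi) = 2 * pi * u t"
    by (metis mult.commute mult.left_commute pi_ge_zero real_sqrt_mult_self abs_of_nonneg mult_nonneg_nonneg zero_le_numeral)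
  finally show ?thesis .
qed

section \<open>Exponential decay of the integrated fundamental solution\<close>

lemma integral_inverse_square_le:
  assumes "R \<ge> (0::real)" "B \<ge> 0"
  shows "(\<lambda>w. B / (1 + w\<^sup>2)) integrable_on {-R..R}" "integral {-R..R} (\<lambda>w. B / (1 + w\<^sup>2)) \<le> B * pi"
proof -
  have "((\<lambda>w. B / (1 + w\<^sup>2)) has_integral (B * arctan R - B * arctan (- R))) {-R..R}"
    by (rule fundamental_theorem_of_calculus)
      (use assms in \<open>auto intro!: derivative_eq_intros simp: has_real_derivative_iff_has_vector_derivative[symmetric] field_simps\<close>)
  then show "(\<lambda>w. B / (1 + w\<^sup>2)) integrable_on {-R..R}" "integral {-R..R} (\<lambda>w. B / (1 + w\<^sup>2)) \<le> B * pi"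
    using arctan_bounded[of R] assms mult_left_mono[of "2 * arctan R" pi B] by (auto simp: integral_unique arctan_minus algebra_simps)
qed

lemma integrable_inverse_square: "integrable lborel (\<lambda>w::real. 1 / (1 + w\<^sup>2))"
  using integrable_inverse_1_plus_square
  by (simp add: set_integrable_def einterval_def inverse_eq_divide)

lemma vertical_line_integral:
  assumes P: "\<And>z. Re z > - c \<Longrightarrow> (P has_field_derivative f z) (at z)" and s: "s > - c" and R: "R \<ge> 0"
  shows "((\<lambda>w. \<i> * f (Complex s w)) has_integral (P (Complex s R) - P (Complex s (- R)))) {-R..R}"
proof (rule fundamental_theorem_of_calculus)
  fix w assume "w \<in> {-R..R}"
  have "((\<lambda>z. complex_of_real s + \<i> * z) has_field_derivative \<i>) (at (complex_of_real w))"
    by (auto intro!: derivative_eq_intros)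
  then have "((\<lambda>w. Complex s w) has_vector_derivative \<i>) (at w within {-R..R})"
    unfolding Complex_eq by (intro has_vector_derivative_at_within[OF has_vector_derivative_real_field])
  moreover have "(P has_field_derivative f (Complex s w)) (at (Complex s w))"
    using P s by simp
  ultimately show "((\<lambda>w. P (Complex s w)) has_vector_derivative \<i> * f (Complex s w)) (at w within {-R..R})"
    by (auto intro: field_vector_diff_chain_within[unfolded o_def] DERIV_subset)
qed (use R in auto)

text \<open>The transform of \<open>window x\<close> is \<open>H = expm1_quotient / char_fun (- a)\<close>, at first only on the line
  \<open>Re z = s\<close> far to the right, where Fourier inversion recovers \<open>window x t\<close> from it. Since \<open>H\<close> is
  holomorphic beyond the line \<open>Re z = - d\<close> and decays quadratically, the line of integration may be
  moved there, and \<open>exp (z * t)\<close> then supplies the factor \<open>exp (- d * t)\<close>.\<close>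

theorem window_exponential_decay:
  assumes fs: "fundamental_solution a x" and a: "a \<in> {- (pi\<^sup>2 / 2)<..<0}"
  shows "\<exists>C\<ge>0. \<exists>d>0. \<forall>t. \<bar>window x t\<bar> \<le> C * exp (- d * t)"
proof -
  define b where "b = - a"
  have b: "0 < b" "b < pi\<^sup>2 / 2" using a by (auto simp: b_def)
  \<comment> \<open>One unit beyond the growth rate of \<open>x\<close>, so that \<open>u\<close> below is integrable.\<close>
  define s where "s = 2 + 2 * \<bar>a\<bar>"
  have s2: "s \<ge> 2" by (simp add: s_def)
  obtain c where c: "c > 0" "c \<le> 1" and nz: "\<And>z. Re z \<ge> - c \<Longrightarrow> char_fun b z \<noteq> 0"
    using char_fun_zero_free_strip[OF b] by auto
  define H where "H z = expm1_quotient z / char_fun b z" for z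
  obtain B where B0: "B \<ge> 0" and B: "\<And>z. - c \<le> Re z \<Longrightarrow> Re z \<le> s \<Longrightarrow> cmod (H z) \<le> B / (1 + (Im z)\<^sup>2)"
    using transfer_function_bound[OF b(1) nz, of c s] c unfolding H_def by auto
  define S where "S = {z. Re z > - c}"
  have S: "open S" "convex S" unfolding S_def by (auto simp: open_halfspace_Re_gt convex_halfspace_Re_gt)
  have Hh: "H holomorphic_on S" unfolding H_def[abs_def]
    by (intro holomorphic_intros holomorphic_on_subset[OF expm1_quotient_holomorphic]
        holomorphic_on_subset[OF char_fun_holomorphic]) (use nz in \<open>auto simp: S_def\<close>)
  define y where "y = window x"
  have xc: "continuous_on {0..} x" by (rule fundamental_solution_continuous[OF fs])
  have yc: "continuous_on A y" for A unfolding y_def by (rule window_continuous[OF xc])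
  define K where "K = 1 + 2 * \<bar>a\<bar>"
  have K1: "K \<ge> 1" by (simp add: K_def)
  have yb: "\<bar>y t\<bar> \<le> 2 * exp (K * t)" if "t \<ge> 0" for t
    using window_growth[OF fs that] by (simp add: y_def K_def)
  have lap: "laplace y (Complex s w) = H (Complex s w)" for w
  proof -
    let ?z = "Complex s w"
    have z0: "?z \<noteq> 0" using s2 by (auto simp: complex_eq_iff)
    have "(?z\<^sup>2 + b * (1 - exp (- ?z))) * laplace y ?z = 1 - exp (- ?z)"
      using laplace_window[OF fs, of ?z] unfolding y_def b_def s_def by simp
    then have "?z * (char_fun b ?z * laplace y ?z) = ?z * expm1_quotient ?z"
      by (simp only: mult.assoc[symmetric] char_fun_mult expm1_quotient_mult)
    then have "char_fun b ?z * laplace y ?z = expm1_quotient ?z" using z0 by simp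
    then show ?thesis using nz[of ?z] s2 c unfolding H_def by (simp add: field_simps)
  qed
  define u where "u t = exp (- s * t) * y t" for t
  have ui: "integrable lborel u" and uC: "\<bar>u t\<bar> \<le> 2" for t
  proof -
    have "set_integrable lborel {0..} (\<lambda>t. exp (- complex_of_real s * complex_of_real t) * complex_of_real (y t))"
      by (rule laplace_integrable[OF yc yb]) (auto simp: s_def K_def)
    then have "integrable lborel (\<lambda>t. norm (indicator {0..} t *\<^sub>R (exp (- complex_of_real s * complex_of_real t) * complex_of_real (y t))))"
      unfolding set_integrable_def by (rule integrable_norm)
    then show "integrable lborel u"
    proof (rule Bochner_Integration.integrable_bound)
      have "continuous_on UNIV u" unfolding u_def[abs_def] by (intro continuous_intros yc)
      then show "u \<in> borel_measurable lborel" by (simp add: borel_measurable_continuous_onI)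
      have "norm (u t) \<le> norm (norm (indicator {0..} t *\<^sub>R (exp (- complex_of_real s * complex_of_real t) * complex_of_real (y t))))" for t
        by (cases "t \<ge> 0") (auto simp: u_def y_def norm_mult abs_mult)
      then show "AE t in lborel. norm (u t) \<le> norm (norm (indicator {0..} t *\<^sub>R (exp (- complex_of_real s * complex_of_real t) * complex_of_real (y t))))"
        by (intro AE_I2)
    qed
    show "\<bar>u t\<bar> \<le> 2"
    proof (cases "t \<ge> 0")
      case True
      have "\<bar>u t\<bar> = exp (- s * t) * \<bar>y t\<bar>" by (simp add: u_def abs_mult)
      also have "\<dots> \<le> exp (- s * t) * (2 * exp (K * t))" by (intro mult_left_mono yb True) auto
      also have "\<dots> = 2 * exp (- t)" by (simp add: exp_add[symmetric] s_def K_def algebra_simps)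
      also have "\<dots> \<le> 2" using True by simp
      finally show ?thesis .
    qed (simp add: u_def y_def)
  qed
  have lineC: "continuous_on UNIV (\<lambda>w. Complex s w)"
    unfolding Complex_eq by (intro continuous_intros)
  have Hs: "continuous_on UNIV (\<lambda>w. H (Complex s w))"
    by (rule continuous_on_compose2[OF holomorphic_on_imp_continuous_on[OF Hh] lineC])
      (use s2 c in \<open>auto simp: S_def\<close>)
  have Hi: "integrable lborel (\<lambda>w. H (Complex s w))"
  proof (rule Bochner_Integration.integrable_bound)
    show "integrable lborel (\<lambda>w::real. B * (1 / (1 + w\<^sup>2)))"
      by (rule integrable_mult_right) (rule integrable_inverse_square)
    show "(\<lambda>w. H (Complex s w)) \<in> borel_measurable lborel"
      using Hs by (simp add: borel_measurable_continuous_onI)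
    show "AE w in lborel. norm (H (Complex s w)) \<le> norm (B * (1 / (1 + w\<^sup>2)))"
      using B[of "Complex s _"] s2 c B0 by (intro AE_I2) (auto simp: abs_mult)
  qed
  have inv: "(\<integral>w. H (Complex s w) * iexp (w * t) \<partial>lborel) = complex_of_real (2 * pi * u t)" for t
  proof (rule fourier_inversion[OF _ uC ui _ Hi])
    show "continuous_on UNIV u" unfolding u_def[abs_def] by (intro continuous_intros yc)
    fix w
    show "H (Complex s w) = (\<integral>r. iexp (- (w * r)) * complex_of_real (u r) \<partial>lborel)"
      unfolding lap[symmetric] laplace_def set_lebesgue_integral_def
    proof (rule Bochner_Integration.integral_cong[OF refl])
      fix r
      show "indicator {0..} r *\<^sub>R (exp (- Complex s w * complex_of_real r) * complex_of_real (y r)) =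
        iexp (- (w * r)) * complex_of_real (u r)"
      proof (cases "r \<ge> 0")
        case True
        have "- Complex s w * complex_of_real r = complex_of_real (- s * r) + \<i> * complex_of_real (- (w * r))"
          by (simp add: complex_eq_iff)
        then have "exp (- Complex s w * complex_of_real r) = complex_of_real (exp (- s * r)) * iexp (- (w * r))"
          by (simp only: exp_add exp_of_real)
        then show ?thesis using True by (simp add: u_def mult_ac)
      qed (simp add: u_def y_def)
    qed
  qed
  \<comment> \<open>Strictly inside the strip, so that both lines lie in the open set on which \<open>H\<close> is holomorphic.\<close>
  define d where "d = c / 2"
  have d: "d > 0" "- d > - c" "d \<le> 1" using c by (auto simp: d_def)
  have main: "\<bar>y t\<bar> \<le> B / 2 * exp (- d * t)" if t: "t \<ge> 0" for t
  proof -
    define f where "f z = H z * exp (z * complex_of_real t)" for z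
    have "f holomorphic_on S" unfolding f_def[abs_def] by (intro holomorphic_intros Hh)
    \<comment> \<open>A primitive replaces the contour: the integrals over the sides of a rectangle are differences of its values.\<close>
    then obtain P where "\<And>z. z \<in> S \<Longrightarrow> (P has_field_derivative f z) (at z within S)"
      using holomorphic_convex_primitive'[OF S(2,1)] by metis
    then have P: "\<And>z. Re z > - c \<Longrightarrow> (P has_field_derivative f z) (at z)"
      using at_within_open[OF _ S(1)] by (metis S_def mem_Collect_eq)
    have fB: "cmod (f (Complex r w)) \<le> B / (1 + w\<^sup>2) * exp (r * t)" if "- d \<le> r" "r \<le> s" for r w
    proof -
      have "cmod (f (Complex r w)) = cmod (H (Complex r w)) * exp (r * t)" by (simp add: f_def norm_mult)
      also have "\<dots> \<le> B / (1 + w\<^sup>2) * exp (r * t)"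
        using B[of "Complex r w"] that d by (intro mult_right_mono) auto
      finally show ?thesis .
    qed
    have fc: "continuous_on {-R..R} (\<lambda>w. f (Complex r w))" if "- d \<le> r" for r R
    proof (rule continuous_on_compose2[where g = f and t = S])
      show "continuous_on S f" by (rule holomorphic_on_imp_continuous_on) fact
      show "continuous_on {-R..R} (Complex r)" unfolding Complex_eq by (intro continuous_intros)
    qed (use that d in \<open>auto simp: S_def\<close>)
    have bound: "cmod (integral {-R..R} (\<lambda>w. f (Complex s w))) \<le> B * pi * exp (- d * t) + 2 * ((B / (1 + R\<^sup>2) * exp (s * t)) * (s + d))"
      if R: "R \<ge> 0" for R
    proof -
      have v: "\<i> * integral {-R..R} (\<lambda>w. f (Complex r w)) = P (Complex r R) - P (Complex r (- R))"
        if "- d \<le> r" for r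
      proof -
        have "integral {-R..R} (\<lambda>w. \<i> * f (Complex r w)) = P (Complex r R) - P (Complex r (- R))"
          by (rule integral_unique, rule vertical_line_integral[OF P _ R]) (use that d in auto)
        then show ?thesis by simp
      qed
      \<comment> \<open>The horizontal sides of the rectangle, on which \<open>f\<close> is of order \<open>1 / R\<^sup>2\<close>.\<close>
      have h: "cmod (P (Complex s w) - P (Complex (- d) w)) \<le> (B / (1 + R\<^sup>2) * exp (s * t)) * (s + d)"
        if w: "w = R \<or> w = - R" for w
      proof -
        have "norm (P (Complex s w) - P (Complex (- d) w)) \<le> (B / (1 + R\<^sup>2) * exp (s * t)) * norm (Complex s w - Complex (- d) w)"
        proof (rule field_differentiable_bound)
          let ?L = "{z. w \<le> Im z} \<inter> {z. Im z \<le> w} \<inter> {z. - d \<le> Re z} \<inter> {z. Re z \<le> s}"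
          show "convex ?L"
            by (intro convex_Int convex_halfspace_Im_ge convex_halfspace_Im_le convex_halfspace_Re_ge convex_halfspace_Re_le)
          show "(P has_field_derivative f z) (at z within ?L)" if "z \<in> ?L" for z
            by (rule DERIV_subset[OF P]) (use that d in auto)
          show "norm (f z) \<le> B / (1 + R\<^sup>2) * exp (s * t)" if z: "z \<in> ?L" for z
          proof -
            have "norm (f z) \<le> B / (1 + w\<^sup>2) * exp (Re z * t)"
            proof -
              have "Complex (Re z) w = z" using z by (auto simp: complex_eq_iff)
              then show ?thesis using fB[of "Re z" w] z by simp
            qed
            also have "\<dots> \<le> B / (1 + w\<^sup>2) * exp (s * t)"
              using z t B0 by (intro mult_left_mono divide_nonneg_nonneg) (auto intro!: mult_right_mono)
            also have "w\<^sup>2 = R\<^sup>2" using w by auto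
            finally show ?thesis .
          qed
        qed (use d s2 in auto)
        also have "Complex s w - Complex (- d) w = complex_of_real (s + d)" by (simp add: complex_eq_iff)
        finally show ?thesis using s2 d by (simp del: of_real_add)
      qed
      have "cmod (integral {-R..R} (\<lambda>w. f (Complex (- d) w))) \<le> integral {-R..R} (\<lambda>w. (B * exp (- d * t)) / (1 + w\<^sup>2))"
      proof (rule integral_norm_bound_integral)
        show "(\<lambda>w. f (Complex (- d) w)) integrable_on {-R..R}"
          by (rule integrable_continuous_real[OF fc]) simp
        show "cmod (f (Complex (- d) w)) \<le> (B * exp (- d * t)) / (1 + w\<^sup>2)" for w
          using fB[of "- d" w] d s2 by simp
      qed (use integral_inverse_square_le(1)[OF R] B0 in simp)
      also have "\<dots> \<le> (B * exp (- d * t)) * pi"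
        by (rule integral_inverse_square_le(2)[OF R]) (use B0 in simp)
      finally have L: "cmod (integral {-R..R} (\<lambda>w. f (Complex (- d) w))) \<le> B * pi * exp (- d * t)" by (simp add: mult_ac)
      have "\<i> * integral {-R..R} (\<lambda>w. f (Complex s w)) =
        \<i> * integral {-R..R} (\<lambda>w. f (Complex (- d) w)) + ((P (Complex s R) - P (Complex (- d) R)) - (P (Complex s (- R)) - P (Complex (- d) (- R))))"
        unfolding v[OF order_refl] using v[of s] d s2 by (simp add: algebra_simps)
      moreover have "cmod (p + (q - r)) \<le> cmod p + (cmod q + cmod r)" for p q r
        using norm_triangle_ineq[of p "q - r"] norm_triangle_ineq4[of q r] by linarith
      ultimately have "cmod (\<i> * integral {-R..R} (\<lambda>w. f (Complex s w))) \<le>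
        cmod (\<i> * integral {-R..R} (\<lambda>w. f (Complex (- d) w))) + (cmod (P (Complex s R) - P (Complex (- d) R)) + cmod (P (Complex s (- R)) - P (Complex (- d) (- R))))"
        by (simp only:)
      then have "cmod (integral {-R..R} (\<lambda>w. f (Complex s w))) \<le>
        cmod (integral {-R..R} (\<lambda>w. f (Complex (- d) w))) + (cmod (P (Complex s R) - P (Complex (- d) R)) + cmod (P (Complex s (- R)) - P (Complex (- d) (- R))))"
        unfolding norm_mult norm_ii mult_1_left .
      from order_trans[OF this add_mono[OF L add_mono[OF h[of R, OF disjI1[OF refl]] h[of "- R", OF disjI2[OF refl]]]]]
      show ?thesis unfolding mult_2 .
    qed
    have fi: "integrable lborel (\<lambda>w. f (Complex s w))"
    proof (rule Bochner_Integration.integrable_bound)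
      show "integrable lborel (\<lambda>w. exp (s * t) *\<^sub>R H (Complex s w))" by (intro integrable_scaleR_right Hi)
      have "continuous_on UNIV (\<lambda>w. f (Complex s w))"
        unfolding f_def by (intro continuous_intros Hs lineC)
      then show "(\<lambda>w. f (Complex s w)) \<in> borel_measurable lborel" by (simp add: borel_measurable_continuous_onI)
    qed (auto simp: f_def norm_mult)
    have lim: "(\<lambda>n. integral {- real n..real n} (\<lambda>w. f (Complex s w))) \<longlonglongrightarrow> (\<integral>w. f (Complex s w) \<partial>lborel)"
    proof -
      have "(\<lambda>n. (\<integral>w. indicator {- real n..real n} w *\<^sub>R f (Complex s w) \<partial>lborel)) \<longlonglongrightarrow> (\<integral>w. f (Complex s w) \<partial>lborel)"
      proof (rule integral_dominated_convergence[where w = "\<lambda>w. norm (f (Complex s w))"])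
        show "AE w in lborel. (\<lambda>n. indicator {- real n..real n} w *\<^sub>R f (Complex s w)) \<longlonglongrightarrow> f (Complex s w)"
        proof (intro AE_I2 tendsto_eventually)
          fix w :: real
          obtain N :: nat where "\<bar>w\<bar> \<le> real N" using real_arch_simple by blast
          then show "\<forall>\<^sub>F n in sequentially. indicator {- real n..real n} w *\<^sub>R f (Complex s w) = f (Complex s w)"
            by (intro eventually_sequentiallyI[of N]) (auto simp: indicator_def)
        qed
      qed (use fi in \<open>auto simp: indicator_def\<close>)
      moreover have "(\<integral>w. indicator {- real n..real n} w *\<^sub>R f (Complex s w) \<partial>lborel) = integral {- real n..real n} (\<lambda>w. f (Complex s w))" for n
        using set_integral_continuous(2)[OF fc[of s "real n"]] d s2 unfolding set_lebesgue_integral_def by simp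
      ultimately show ?thesis by simp
    qed
    have bl: "(\<lambda>n. B * pi * exp (- d * t) + 2 * ((B / (1 + (real n)\<^sup>2) * exp (s * t)) * (s + d))) \<longlonglongrightarrow> B * pi * exp (- d * t) + 2 * ((0 * exp (s * t)) * (s + d))"
    proof (intro tendsto_intros)
      have "filterlim (\<lambda>n. 1 + (real n)\<^sup>2) at_top sequentially"
        by (intro filterlim_tendsto_add_at_top[OF tendsto_const] filterlim_pow_at_top filterlim_real_sequentially) auto
      then show "(\<lambda>n. B / (1 + (real n)\<^sup>2)) \<longlonglongrightarrow> 0"
        by (intro tendsto_divide_0[OF tendsto_const] filterlim_at_top_imp_at_infinity)
    qed
    have "cmod (\<integral>w. f (Complex s w) \<partial>lborel) \<le> B * pi * exp (- d * t) + 2 * ((0 * exp (s * t)) * (s + d))"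
      by (rule LIMSEQ_le[OF tendsto_norm[OF lim] bl]) (use bound in auto)
    also have "(\<integral>w. f (Complex s w) \<partial>lborel) = complex_of_real (2 * pi * y t)"
    proof -
      have "(\<integral>w. f (Complex s w) \<partial>lborel) = (\<integral>w. complex_of_real (exp (s * t)) * (H (Complex s w) * iexp (w * t)) \<partial>lborel)"
      proof (rule Bochner_Integration.integral_cong[OF refl])
        fix w
        have "Complex s w * complex_of_real t = complex_of_real (s * t) + \<i> * complex_of_real (w * t)"
          by (simp add: complex_eq_iff)
        then have "exp (Complex s w * complex_of_real t) = complex_of_real (exp (s * t)) * iexp (w * t)"
          by (simp only: exp_add exp_of_real)
        then show "f (Complex s w) = complex_of_real (exp (s * t)) * (H (Complex s w) * iexp (w * t))"
          by (simp add: f_def mult_ac)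
      qed
      also have "\<dots> = complex_of_real (exp (s * t)) * complex_of_real (2 * pi * u t)"
        by (simp only: integral_mult_right_zero inv)
      also have "\<dots> = complex_of_real (exp (s * t) * (2 * pi * u t))" by simp
      also have "exp (s * t) * (2 * pi * u t) = 2 * pi * y t" by (simp add: u_def exp_minus)
      finally show ?thesis .
    qed
    finally have "2 * pi * \<bar>y t\<bar> \<le> B * pi * exp (- d * t)" by (simp add: norm_mult)
    then show ?thesis by simp
  qed
  have "\<bar>window x t\<bar> \<le> B / 2 * exp (- d * t)" for t
    using main[of t] B0 by (cases "t \<ge> 0") (auto simp: y_def)
  then show ?thesis using B0 d by (intro exI[of _ "B/2"] conjI exI[of _ d]) auto
qed

section \<open>Finite Gaussian white noise\<close>

text \<open>The parameter is the variance, so that \<open>gauss (t - s)\<close> is the law of \<open>W t - W s\<close>.\<close>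

definition gauss :: "real \<Rightarrow> real measure" where
  "gauss \<delta> = density lborel (normal_density 0 (sqrt \<delta>))"

abbreviation noise :: "real \<Rightarrow> nat \<Rightarrow> (nat \<Rightarrow> real) measure" where
  "noise \<delta> n \<equiv> Pi\<^sub>M {..<n} (\<lambda>_. gauss \<delta>)"

lemma sets_gauss [simp, measurable_cong]: "sets (gauss \<delta>) = sets borel"
  by (simp add: gauss_def)

lemma space_gauss [simp]: "space (gauss \<delta>) = UNIV"
  by (simp add: gauss_def)

lemma prob_space_gauss: "\<delta> > 0 \<Longrightarrow> prob_space (gauss \<delta>)"
  unfolding gauss_def by (rule prob_space_normal_density) simp

lemma nn_integral_noise_Suc:
  assumes d: "\<delta> > 0" and f: "f \<in> borel_measurable (noise \<delta> (Suc n))"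
  shows "(\<integral>\<^sup>+x. f x \<partial>noise \<delta> (Suc n)) = (\<integral>\<^sup>+x. (\<integral>\<^sup>+y. f (x(n := y)) \<partial>gauss \<delta>) \<partial>noise \<delta> n)"
proof -
  interpret prob_space "gauss \<delta>" by (rule prob_space_gauss[OF d])
  interpret product_sigma_finite "\<lambda>_::nat. gauss \<delta>" by standard
  show ?thesis
    using product_nn_integral_insert[of "{..<n}" n f] f by (simp add: lessThan_Suc)
qed

lemma integral_noise_Suc:
  fixes f :: "_ \<Rightarrow> complex"
  assumes d: "\<delta> > 0" and f: "integrable (noise \<delta> (Suc n)) f"
  shows "(\<integral>x. f x \<partial>noise \<delta> (Suc n)) = (\<integral>x. (\<integral>y. f (x(n := y)) \<partial>gauss \<delta>) \<partial>noise \<delta> n)"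
proof -
  interpret prob_space "gauss \<delta>" by (rule prob_space_gauss[OF d])
  interpret product_sigma_finite "\<lambda>_::nat. gauss \<delta>" by standard
  show ?thesis
    using product_integral_insert[of "{..<n}" n f] f by (simp add: lessThan_Suc)
qed

lemma prob_space_noise: "\<delta> > 0 \<Longrightarrow> prob_space (noise \<delta> n)"
  by (intro prob_space_PiM prob_space_gauss)

lemma nn_integral_gauss:
  assumes "F \<in> borel_measurable borel"
  shows "(\<integral>\<^sup>+y. F y \<partial>gauss \<delta>) = (\<integral>\<^sup>+y. ennreal (normal_density 0 (sqrt \<delta>) y) * F y \<partial>lborel)"
  unfolding gauss_def using assms by (intro nn_integral_density) auto

text \<open>The one-dimensional Cameron-Martin formula, by translating the density.\<close>

lemma nn_integral_gauss_shift:
  assumes d: "\<delta> > 0" and [measurable]: "F \<in> borel_measurable borel"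
  shows "(\<integral>\<^sup>+y. F (y + m) \<partial>gauss \<delta>) = (\<integral>\<^sup>+y. F y * ennreal (exp (m * y / \<delta> - m\<^sup>2 / (2 * \<delta>))) \<partial>gauss \<delta>)"
proof -
  have "(\<integral>\<^sup>+y. F y * ennreal (exp (m * y / \<delta> - m\<^sup>2 / (2 * \<delta>))) \<partial>gauss \<delta>)
    = (\<integral>\<^sup>+y. ennreal (normal_density 0 (sqrt \<delta>) y) * (F y * ennreal (exp (m * y / \<delta> - m\<^sup>2 / (2 * \<delta>)))) \<partial>lborel)"
    by (rule nn_integral_gauss) simp
  also have "\<dots> = (\<integral>\<^sup>+y. ennreal (normal_density 0 (sqrt \<delta>) (y - m)) * F y \<partial>lborel)"
  proof (rule nn_integral_cong)
    fix y
    have e: "- (y - m)\<^sup>2 / (2 * \<delta>) = - y\<^sup>2 / (2 * \<delta>) + (m * y / \<delta> - m\<^sup>2 / (2 * \<delta>))"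
      using d by (simp add: power2_eq_square field_simps)
    have "normal_density 0 (sqrt \<delta>) y * exp (m * y / \<delta> - m\<^sup>2 / (2 * \<delta>)) = normal_density 0 (sqrt \<delta>) (y - m)"
    proof -
      have "exp (- (y - m)\<^sup>2 / (2 * \<delta>)) = exp (- y\<^sup>2 / (2 * \<delta>)) * exp (m * y / \<delta> - m\<^sup>2 / (2 * \<delta>))"
        by (simp only: e exp_add)
      then show ?thesis using d unfolding normal_density_def by simp
    qed
    then show "ennreal (normal_density 0 (sqrt \<delta>) y) * (F y * ennreal (exp (m * y / \<delta> - m\<^sup>2 / (2 * \<delta>))))
      = ennreal (normal_density 0 (sqrt \<delta>) (y - m)) * F y"
      by (metis ennreal_mult'' exp_ge_zero mult.assoc mult.commute)
  qed
  also have "\<dots> = ennreal \<bar>1\<bar> * (\<integral>\<^sup>+y. ennreal (normal_density 0 (sqrt \<delta>) ((m + 1 * y) - m)) * F (m + 1 * y) \<partial>lborel)"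
    by (rule nn_integral_real_affine) auto
  also have "\<dots> = (\<integral>\<^sup>+y. F (y + m) \<partial>gauss \<delta>)"
    by (subst nn_integral_gauss) (auto simp: add.commute)
  finally show ?thesis by simp
qed

lemma integral_iexp_gauss:
  assumes d: "\<delta> > 0"
  shows "(\<integral>y. iexp (q * y) \<partial>gauss \<delta>) = complex_of_real (exp (- q\<^sup>2 * \<delta> / 2))"
proof -
  let ?s = "sqrt \<delta>"
  have s: "?s > 0" using d by simp
  have "(\<integral>y. iexp (q * y) \<partial>gauss \<delta>) = (\<integral>y. normal_density 0 ?s y *\<^sub>R iexp (q * y) \<partial>lborel)"
    unfolding gauss_def by (rule integral_density) auto
  also have "\<dots> = \<bar>?s\<bar> *\<^sub>R (\<integral>y. normal_density 0 ?s (0 + ?s * y) *\<^sub>R iexp (q * (0 + ?s * y)) \<partial>lborel)"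
    using s by (intro lborel_integral_real_affine) simp
  also have "\<dots> = (\<integral>y. ?s *\<^sub>R (normal_density 0 ?s (0 + ?s * y) *\<^sub>R iexp (q * (0 + ?s * y))) \<partial>lborel)"
    using s by (simp only: integral_scaleR_right abs_of_pos)
  also have "\<dots> = (\<integral>y. iexp ((q * ?s) * y) * complex_of_real (std_normal_density y) \<partial>lborel)"
  proof (rule Bochner_Integration.integral_cong[OF refl])
    fix y
    have "?s * normal_density 0 ?s (?s * y) = std_normal_density y"
      using d by (simp add: normal_density_def std_normal_density_def real_sqrt_mult power_mult_distrib field_simps)
    then show "?s *\<^sub>R (normal_density 0 ?s (0 + ?s * y) *\<^sub>R iexp (q * (0 + ?s * y))) =
      iexp ((q * ?s) * y) * complex_of_real (std_normal_density y)"
      by (simp add: scaleR_conv_of_real mult_ac flip: of_real_mult)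
  qed
  also have "\<dots> = exp (- (q * ?s)\<^sup>2 / 2)" by (rule integral_iexp_std_normal_density)
  finally show ?thesis using d by (simp add: power_mult_distrib)
qed

section \<open>The Euler scheme and its likelihood ratio\<close>

text \<open>The Riemann sum of step \<open>1 / N\<close> for the integral of the path over a unit window. In an array \<open>v\<close> of
  grid values the index \<open>i\<close> stands for the time \<open>i / N - 1\<close>; hence \<open>v (N + k)\<close> is the value at time
  \<open>k / N\<close> and \<open>v k, \<dots>, v (N + k - 1)\<close> are the values over the unit interval before it.\<close>

definition drift :: "nat \<Rightarrow> (nat \<Rightarrow> real) \<Rightarrow> nat \<Rightarrow> real" where
  "drift N v k = (\<Sum>j<N. v (k + j)) / real N"

function euler :: "nat \<Rightarrow> real \<Rightarrow> (nat \<Rightarrow> real) \<Rightarrow> (nat \<Rightarrow> real) \<Rightarrow> nat \<Rightarrow> real" where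
  "euler N a p \<xi> i = (if i \<le> N then p i else
     euler N a p \<xi> (i - 1) + a / real N * ((\<Sum>j<N. euler N a p \<xi> (i - 1 - N + j)) / real N) + \<xi> (i - 1 - N))"
  by auto
termination by (relation "Wellfounded.measure (\<lambda>(N, a, p, \<xi>, i). i)") auto

declare euler.simps [simp del]

lemma euler_init: "i \<le> N \<Longrightarrow> euler N a p \<xi> i = p i"
  by (subst euler.simps) simp

lemma euler_Suc: "euler N a p \<xi> (Suc (N + k)) =
   euler N a p \<xi> (N + k) + a / real N * drift N (euler N a p \<xi>) k + \<xi> k"
  by (subst euler.simps) (simp add: drift_def)

lemma euler_cong:
  assumes "\<And>i. i \<le> N \<Longrightarrow> p i = q i" "\<And>k. k < n \<Longrightarrow> \<xi> k = \<eta> k" "i \<le> N + n"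
  shows "euler N a p \<xi> i = euler N a q \<eta> i"
  using assms(3)
proof (induction i rule: less_induct)
  case (less i)
  show ?case
  proof (cases "i \<le> N")
    case False
    then obtain k where i: "i = Suc (N + k)" using less_iff_Suc_add[of N i] by auto
    have "drift N (euler N a p \<xi>) k = drift N (euler N a q \<eta>) k"
      unfolding drift_def using less i by (intro arg_cong2[where f = "(/)"] sum.cong refl less.IH) auto
    then show ?thesis using less i assms(2)[of k] by (simp add: euler_Suc)
  qed (simp add: euler_init assms(1))
qed

lemma measurable_euler:
  assumes "\<And>i. i \<le> N \<Longrightarrow> (\<lambda>\<omega>. p \<omega> i) \<in> borel_measurable M"
    "\<And>k. k < n \<Longrightarrow> (\<lambda>\<omega>. \<xi> \<omega> k) \<in> borel_measurable M" "i \<le> N + n"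
  shows "(\<lambda>\<omega>. euler N a (p \<omega>) (\<xi> \<omega>) i) \<in> borel_measurable M"
  using assms(3)
proof (induction i rule: less_induct)
  case (less i)
  show ?case
  proof (cases "i \<le> N")
    case True then show ?thesis using assms(1) by (simp add: euler_init)
  next
    case False
    then obtain k where i: "i = Suc (N + k)" using less_iff_Suc_add[of N i] by auto
    have [measurable]: "(\<lambda>\<omega>. euler N a (p \<omega>) (\<xi> \<omega>) j) \<in> borel_measurable M" if "j \<le> N + k" for j
      using less that i by auto
    have [measurable]: "(\<lambda>\<omega>. \<xi> \<omega> k) \<in> borel_measurable M" using assms(2) less i by auto
    have "(\<lambda>\<omega>. (\<Sum>j<N. euler N a (p \<omega>) (\<xi> \<omega>) (k + j))) \<in> borel_measurable M"
      by (rule borel_measurable_sum) simp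
    then show ?thesis unfolding i euler_Suc drift_def by simp
  qed
qed

text \<open>The first \<open>N + n + 1\<close> values of the scheme, continued by zero so that they form a single random
  element of the space of sequences, whatever the number \<open>n\<close> of steps.\<close>

definition euler_path :: "nat \<Rightarrow> real \<Rightarrow> (nat \<Rightarrow> real) \<Rightarrow> nat \<Rightarrow> (nat \<Rightarrow> real) \<Rightarrow> nat \<Rightarrow> real" where
  "euler_path N a p n \<xi> i = (if i \<le> N + n then euler N a p \<xi> i else 0)"

abbreviation seqs :: "(nat \<Rightarrow> real) measure" where
  "seqs \<equiv> Pi\<^sub>M UNIV (\<lambda>_. borel)"

lemma measurable_seqsI:
  "(\<And>i. (\<lambda>\<omega>. X \<omega> i) \<in> borel_measurable M) \<Longrightarrow> X \<in> M \<rightarrow>\<^sub>M seqs"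
  by (rule measurable_PiM_single') auto

lemma measurable_euler_path:
  assumes "\<And>i. i \<le> N \<Longrightarrow> (\<lambda>\<omega>. p \<omega> i) \<in> borel_measurable M"
    "\<And>k. k < n \<Longrightarrow> (\<lambda>\<omega>. \<xi> \<omega> k) \<in> borel_measurable M"
  shows "(\<lambda>\<omega>. euler_path N a (p \<omega>) n (\<xi> \<omega>)) \<in> M \<rightarrow>\<^sub>M seqs"
proof (rule measurable_seqsI)
  fix i
  show "(\<lambda>\<omega>. euler_path N a (p \<omega>) n (\<xi> \<omega>) i) \<in> borel_measurable M"
    unfolding euler_path_def by (cases "i \<le> N + n") (auto intro: measurable_euler assms)
qed

lemma measurable_euler_path_noise [measurable]:
  "euler_path N a p n \<in> noise \<delta> n \<rightarrow>\<^sub>M seqs"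
  using measurable_euler_path[of N "\<lambda>_. p" "noise \<delta> n" n "\<lambda>\<xi>. \<xi>" a] by simp

text \<open>One time step as an operation on arrays; it turns statements about \<open>Suc n\<close> steps into statements
  about \<open>n\<close> steps followed by one more Gaussian variable.\<close>

definition euler_step :: "nat \<Rightarrow> nat \<Rightarrow> real \<Rightarrow> real \<Rightarrow> (nat \<Rightarrow> real) \<Rightarrow> nat \<Rightarrow> real" where
  "euler_step N n a y v = v(Suc (N + n) := v (N + n) + a / real N * drift N v n + y)"

lemma measurable_drift [measurable]: "(\<lambda>v. drift N v k) \<in> borel_measurable seqs"
  unfolding drift_def by measurable

lemma measurable_euler_step [measurable]:
  "(\<lambda>(v, y). euler_step N n a y v) \<in> seqs \<Otimes>\<^sub>M borel \<rightarrow>\<^sub>M seqs"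
proof (rule measurable_seqsI)
  fix i
  show "(\<lambda>x. (case x of (v, y) \<Rightarrow> euler_step N n a y v) i) \<in> borel_measurable (seqs \<Otimes>\<^sub>M borel)"
  proof (cases "i = Suc (N + n)")
    case True
    then show ?thesis by (simp add: euler_step_def case_prod_unfold)
  next
    case False
    then show ?thesis by (simp add: euler_step_def case_prod_unfold)
  qed
qed

lemma drift_euler_path:
  assumes "k \<le> n"
  shows "drift N (euler_path N a p n \<xi>) k = drift N (euler N a p \<xi>) k"
  unfolding drift_def using assms by (intro arg_cong2[where f = "(/)"] sum.cong) (auto simp: euler_path_def)

lemma euler_path_Suc:
  "euler_path N a p (Suc n) (\<xi>(n := y)) = euler_step N n a y (euler_path N a p n \<xi>)"
proof
  fix i
  have c: "euler N a p (\<xi>(n := y)) j = euler N a p \<xi> j" if "j \<le> N + n" for j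
    by (rule euler_cong[OF _ _ that]) auto
  have d: "drift N (euler N a p (\<xi>(n := y))) n = drift N (euler N a p \<xi>) n"
    unfolding drift_def by (intro arg_cong2[where f = "(/)"] sum.cong refl c) auto
  consider "i \<le> N + n" | "i = Suc (N + n)" | "i > Suc (N + n)" by linarith
  then show "euler_path N a p (Suc n) (\<xi>(n := y)) i = euler_step N n a y (euler_path N a p n \<xi>) i"
  proof cases
    case 1 then show ?thesis by (simp add: euler_path_def euler_step_def c)
  next
    case 2 then show ?thesis
      by (simp add: euler_step_def drift_euler_path) (simp add: euler_path_def euler_Suc c d)
  next
    case 3 then show ?thesis by (simp add: euler_path_def euler_step_def)
  qed
qed

text \<open>These two sums are the discrete counterparts of the integrals of \<open>Y\<close> against \<open>X\<close> and of \<open>Y\<^sup>2\<close>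
  against time, where \<open>Y t\<close> is the integral of \<open>X\<close> over \<open>[t - 1, t]\<close>.\<close>

definition sum_drift_inc :: "nat \<Rightarrow> nat \<Rightarrow> (nat \<Rightarrow> real) \<Rightarrow> real" where
  "sum_drift_inc N n v = (\<Sum>k<n. drift N v k * (v (Suc (N + k)) - v (N + k)))"

definition sum_drift_sq :: "nat \<Rightarrow> nat \<Rightarrow> (nat \<Rightarrow> real) \<Rightarrow> real" where
  "sum_drift_sq N n v = (\<Sum>k<n. (drift N v k)\<^sup>2) / real N"

lemma measurable_sum_drift [measurable]:
  "sum_drift_inc N n \<in> borel_measurable seqs" "sum_drift_sq N n \<in> borel_measurable seqs"
  unfolding sum_drift_inc_def[abs_def] sum_drift_sq_def[abs_def] by measurable

text \<open>The Girsanov exponent for changing the parameter from \<open>a\<close> to \<open>b\<close>, as a function of the stochastic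
  integral \<open>i\<close> and the energy \<open>q\<close>.\<close>

definition loglik :: "real \<Rightarrow> real \<Rightarrow> real \<Rightarrow> real \<Rightarrow> real" where
  "loglik a b i q = (b - a) * i - (b\<^sup>2 - a\<^sup>2) / 2 * q"

lemma drift_euler_step: "k \<le> n \<Longrightarrow> drift N (euler_step N n a y v) k = drift N v k"
  unfolding drift_def euler_step_def by (intro arg_cong2[where f = "(/)"] sum.cong) auto

lemma sum_drift_euler_step:
  "sum_drift_inc N (Suc n) (euler_step N n a y v) = sum_drift_inc N n v + drift N v n * (a / N * drift N v n + y)"
  "sum_drift_sq N (Suc n) (euler_step N n a y v) = sum_drift_sq N n v + (drift N v n)\<^sup>2 / N"
proof -
  have s: "euler_step N n a y v j = v j" if "j \<le> N + n" for j using that by (simp add: euler_step_def)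
  have s': "euler_step N n a y v (Suc (N + n)) = v (N + n) + a / N * drift N v n + y" by (simp add: euler_step_def)
  show "sum_drift_inc N (Suc n) (euler_step N n a y v) = sum_drift_inc N n v + drift N v n * (a / N * drift N v n + y)"
    unfolding sum_drift_inc_def by (simp add: drift_euler_step s s' algebra_simps)
  show "sum_drift_sq N (Suc n) (euler_step N n a y v) = sum_drift_sq N n v + (drift N v n)\<^sup>2 / N"
    unfolding sum_drift_sq_def by (simp add: drift_euler_step add_divide_distrib)
qed

text \<open>Induction on the number of steps: changing the parameter in the last step shifts its Gaussian
  variable by \<open>m = (b - a) / N * drift\<close>, and the Cameron-Martin density of this shift is exactly the
  factor by which the exponential of \<open>loglik\<close> grows.\<close>

theorem discrete_girsanov:
  assumes N: "N > 0" and f: "f \<in> borel_measurable seqs"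
  shows "(\<integral>\<^sup>+\<xi>. f (euler_path N b p n \<xi>) \<partial>noise (1 / N) n) =
    (\<integral>\<^sup>+\<xi>. f (euler_path N a p n \<xi>) *
      ennreal (exp (loglik a b (sum_drift_inc N n (euler_path N a p n \<xi>)) (sum_drift_sq N n (euler_path N a p n \<xi>))))
      \<partial>noise (1 / N) n)"
  using f
proof (induction n arbitrary: f)
  case 0
  have "euler_path N b p 0 \<xi> = euler_path N a p 0 \<xi>" for \<xi>
    by (rule ext) (simp add: euler_path_def euler_init)
  then show ?case by (simp add: loglik_def sum_drift_inc_def sum_drift_sq_def)
next
  case (Suc n)
  note [measurable] = Suc.prems
  let ?d = "1 / real N"
  have d: "?d > 0" using N by simp
  let ?L = "\<lambda>n v. ennreal (exp (loglik a b (sum_drift_inc N n v) (sum_drift_sq N n v)))"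
  have Lm [measurable]: "?L m \<in> borel_measurable seqs" for m
    unfolding loglik_def by measurable
  define g where "g v = (\<integral>\<^sup>+y. f (euler_step N n b y v) \<partial>gauss ?d)" for v
  interpret prob_space "gauss ?d" by (rule prob_space_gauss[OF d])
  have sm: "(\<lambda>(v, y). euler_step N n c y v) \<in> seqs \<Otimes>\<^sub>M gauss ?d \<rightarrow>\<^sub>M seqs" for c
    using measurable_euler_step[of N n c]
      measurable_cong_sets[OF sets_pair_measure_cong[OF refl sets_gauss] refl] by blast
  have gm: "g \<in> borel_measurable seqs"
    unfolding g_def using measurable_compose[OF sm Suc.prems]
    by (intro borel_measurable_nn_integral) (simp add: case_prod_unfold)
  have st [measurable]: "(\<lambda>y. euler_step N n c y v) \<in> borel \<rightarrow>\<^sub>M seqs" for c v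
  proof (rule measurable_seqsI)
    show "(\<lambda>y. euler_step N n c y v i) \<in> borel_measurable borel" for i
      by (cases "i = Suc (N + n)") (auto simp: euler_step_def)
  qed
  have g: "g v * ?L n v = (\<integral>\<^sup>+y. f (euler_step N n a y v) * ?L (Suc n) (euler_step N n a y v) \<partial>gauss ?d)" for v
  proof -
    \<comment> \<open>The two parameters lead to the same value of the scheme if the noise variable is shifted by \<open>m\<close>.\<close>
    define m where "m = (b - a) / N * drift N v n"
    have e: "exp (loglik a b (sum_drift_inc N (Suc n) (euler_step N n a y v)) (sum_drift_sq N (Suc n) (euler_step N n a y v)))
      = exp (loglik a b (sum_drift_inc N n v) (sum_drift_sq N n v)) * exp (m * y / ?d - m\<^sup>2 / (2 * ?d))" for y
      unfolding exp_add[symmetric] sum_drift_euler_step loglik_def m_def using N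
      by (simp add: field_simps power2_eq_square)
    have "g v = (\<integral>\<^sup>+y. f (euler_step N n a (y + m) v) \<partial>gauss ?d)"
      unfolding g_def euler_step_def m_def by (simp add: algebra_simps diff_divide_distrib)
    also have "\<dots> = (\<integral>\<^sup>+y. f (euler_step N n a y v) * ennreal (exp (m * y / ?d - m\<^sup>2 / (2 * ?d))) \<partial>gauss ?d)"
      by (rule nn_integral_gauss_shift[OF d]) measurable
    finally have "g v * ?L n v = (\<integral>\<^sup>+y. f (euler_step N n a y v) * ennreal (exp (m * y / ?d - m\<^sup>2 / (2 * ?d))) * ?L n v \<partial>gauss ?d)"
      by (subst nn_integral_multc) auto
    then show ?thesis unfolding e by (simp add: ennreal_mult mult_ac)
  qed
  have "(\<integral>\<^sup>+\<xi>. f (euler_path N b p (Suc n) \<xi>) \<partial>noise ?d (Suc n)) = (\<integral>\<^sup>+\<xi>. g (euler_path N b p n \<xi>) \<partial>noise ?d n)"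
    by (subst nn_integral_noise_Suc[OF d]) (auto simp: euler_path_Suc g_def)
  also have "\<dots> = (\<integral>\<^sup>+\<xi>. g (euler_path N a p n \<xi>) * ?L n (euler_path N a p n \<xi>) \<partial>noise ?d n)"
    by (rule Suc.IH[OF gm])
  also have "\<dots> = (\<integral>\<^sup>+\<xi>. f (euler_path N a p (Suc n) \<xi>) * ?L (Suc n) (euler_path N a p (Suc n) \<xi>) \<partial>noise ?d (Suc n))"
    by (subst nn_integral_noise_Suc[OF d]) (auto simp: euler_path_Suc g)
  finally show ?case .
qed

section \<open>Martingale transforms of Gaussian noise\<close>

text \<open>The discrete form of the exponential martingale \<open>exp (\<i> * s * M + s\<^sup>2 / 2 * [M])\<close>. Integrating out
  the last variable, on which no \<open>h k\<close> involved depends, multiplies by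
  \<open>exp (- (s * h n)\<^sup>2 * \<delta> / 2)\<close>, which cancels the last summand of the bracket. The bound on the
  bracket makes the integrand bounded.\<close>

lemma integral_exp_martingale_transform:
  fixes h :: "nat \<Rightarrow> (nat \<Rightarrow> real) \<Rightarrow> real"
  assumes d: "\<delta> > 0"
    and hm: "\<And>k m. k \<le> m \<Longrightarrow> h k \<in> borel_measurable (noise \<delta> m)"
    and adapted: "\<And>k j x y. k \<le> j \<Longrightarrow> h k (x(j := y)) = h k x"
    and bounded: "\<And>m x. (\<Sum>k<m. (h k x)\<^sup>2) * \<delta> \<le> c"
  shows "integrable (noise \<delta> n) (\<lambda>x. exp (\<i> * complex_of_real (s * (\<Sum>k<n. h k x * x k)) + complex_of_real (s\<^sup>2 / 2 * ((\<Sum>k<n. (h k x)\<^sup>2) * \<delta>))))"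
      (is "integrable _ (?F n)")
    and "(\<integral>x. exp (\<i> * complex_of_real (s * (\<Sum>k<n. h k x * x k)) + complex_of_real (s\<^sup>2 / 2 * ((\<Sum>k<n. (h k x)\<^sup>2) * \<delta>))) \<partial>noise \<delta> n) = 1"
proof -
  have int: "integrable (noise \<delta> n) (?F n)" for n
  proof -
    interpret prob_space "noise \<delta> n" by (rule prob_space_noise[OF d])
    note [measurable] = hm[of _ n]
    show ?thesis
    proof (rule integrable_const_bound[where B = "exp (s\<^sup>2 / 2 * c)"])
      show "AE x in noise \<delta> n. cmod (?F n x) \<le> exp (s\<^sup>2 / 2 * c)"
        using bounded[of _ n] by (intro AE_I2) (simp del: of_real_mult of_real_sum of_real_divide of_real_power add: mult_left_mono)
    qed measurable
  qed
  show "integrable (noise \<delta> n) (?F n)" by (rule int)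
  show "(\<integral>x. ?F n x \<partial>noise \<delta> n) = 1"
  proof (induction n)
    case 0
    interpret prob_space "noise \<delta> 0" by (rule prob_space_noise[OF d])
    show ?case using prob_space by simp
  next
    case (Suc n)
    have "(\<integral>x. ?F (Suc n) x \<partial>noise \<delta> (Suc n)) = (\<integral>x. (\<integral>y. ?F (Suc n) (x(n := y)) \<partial>gauss \<delta>) \<partial>noise \<delta> n)"
      by (rule integral_noise_Suc[OF d int])
    also have "\<dots> = (\<integral>x. ?F n x \<partial>noise \<delta> n)"
    proof (rule Bochner_Integration.integral_cong[OF refl])
      fix x
      define q where "q = s * h n x"
      have F: "?F (Suc n) (x(n := y)) = ?F n x * complex_of_real (exp (q\<^sup>2 * \<delta> / 2)) * iexp (q * y)" for y
      proof -
        have 1: "(\<Sum>k<Suc n. h k (x(n := y)) * (x(n := y)) k) = (\<Sum>k<n. h k x * x k) + h n x * y"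
          by (simp add: adapted)
        have 2: "(\<Sum>k<Suc n. (h k (x(n := y)))\<^sup>2) = (\<Sum>k<n. (h k x)\<^sup>2) + (h n x)\<^sup>2"
          by (simp add: adapted)
        have 3: "\<i> * complex_of_real (s * ((\<Sum>k<n. h k x * x k) + h n x * y)) + complex_of_real (s\<^sup>2 / 2 * (((\<Sum>k<n. (h k x)\<^sup>2) + (h n x)\<^sup>2) * \<delta>))
          = (\<i> * complex_of_real (s * (\<Sum>k<n. h k x * x k)) + complex_of_real (s\<^sup>2 / 2 * ((\<Sum>k<n. (h k x)\<^sup>2) * \<delta>)))
          + complex_of_real (q\<^sup>2 * \<delta> / 2) + \<i> * complex_of_real (q * y)"
          unfolding q_def by (simp add: algebra_simps power2_eq_square add_divide_distrib)
        show ?thesis unfolding 1 2 3 by (simp only: exp_add exp_of_real)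
      qed
      have "(\<integral>y. ?F (Suc n) (x(n := y)) \<partial>gauss \<delta>) = ?F n x * complex_of_real (exp (q\<^sup>2 * \<delta> / 2)) * complex_of_real (exp (- q\<^sup>2 * \<delta> / 2))"
        unfolding F by (simp only: integral_mult_right_zero integral_iexp_gauss[OF d])
      also have "complex_of_real (exp (q\<^sup>2 * \<delta> / 2)) * complex_of_real (exp (- q\<^sup>2 * \<delta> / 2)) = 1"
        by (simp flip: of_real_mult exp_add)
      then have "?F n x * complex_of_real (exp (q\<^sup>2 * \<delta> / 2)) * complex_of_real (exp (- q\<^sup>2 * \<delta> / 2)) = ?F n x"
        by (simp only: mult.assoc mult_1_right)
      finally show "(\<integral>y. ?F (Suc n) (x(n := y)) \<partial>gauss \<delta>) = ?F n x" .
    qed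
    also have "\<dots> = 1" by (rule Suc.IH)
    finally show ?case .
  qed
qed

section \<open>Quadratic forms in Gaussian noise\<close>

text \<open>The Hermite polynomials \<open>1\<close>, \<open>y\<close>, \<open>y\<^sup>2 - \<delta>\<close> are orthogonal with squared norms \<open>1\<close>, \<open>\<delta>\<close>, \<open>2 * \<delta>\<^sup>2\<close>.\<close>

lemma nn_integral_gauss_quadratic:
  assumes d: "\<delta> > 0"
  shows "(\<integral>\<^sup>+y. ennreal ((\<alpha> + \<beta> * y + \<gamma> * (y\<^sup>2 - \<delta>))\<^sup>2) \<partial>gauss \<delta>) = ennreal (\<alpha>\<^sup>2 + \<delta> * \<beta>\<^sup>2 + 2 * \<delta>\<^sup>2 * \<gamma>\<^sup>2)"
proof -
  let ?\<phi> = "normal_density 0 (sqrt \<delta>)"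
  have s: "sqrt \<delta> > 0" using d by simp
  note e = normal_moment_even[OF s, of 0] and o = normal_moment_odd[OF s, of 0]
  have m0: "has_bochner_integral lborel ?\<phi> 1" using e[of 0] by simp
  have m1: "has_bochner_integral lborel (\<lambda>y. ?\<phi> y * y) 0" using o[of 0] by simp
  have m2: "has_bochner_integral lborel (\<lambda>y. ?\<phi> y * y\<^sup>2) \<delta>" using e[of 1] d by (simp add: fact_numeral)
  have m3: "has_bochner_integral lborel (\<lambda>y. ?\<phi> y * y ^ 3) 0" using o[of 1] by (simp add: eval_nat_numeral)
  have m4: "has_bochner_integral lborel (\<lambda>y. ?\<phi> y * y ^ 4) (3 * \<delta>\<^sup>2)"
    using e[of 2] d by (simp add: fact_numeral power2_eq_square)
  let ?A = "\<alpha> - \<gamma> * \<delta>"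
  have "has_bochner_integral lborel (\<lambda>y. ?A\<^sup>2 * ?\<phi> y + 2 * ?A * \<beta> * (?\<phi> y * y) + (\<beta>\<^sup>2 + 2 * ?A * \<gamma>) * (?\<phi> y * y\<^sup>2)
      + 2 * \<beta> * \<gamma> * (?\<phi> y * y ^ 3) + \<gamma>\<^sup>2 * (?\<phi> y * y ^ 4))
    (?A\<^sup>2 * 1 + 2 * ?A * \<beta> * 0 + (\<beta>\<^sup>2 + 2 * ?A * \<gamma>) * \<delta> + 2 * \<beta> * \<gamma> * 0 + \<gamma>\<^sup>2 * (3 * \<delta>\<^sup>2))"
    by (intro has_bochner_integral_add has_bochner_integral_mult_right m0 m1 m2 m3 m4)
  moreover have "(\<lambda>y. ?A\<^sup>2 * ?\<phi> y + 2 * ?A * \<beta> * (?\<phi> y * y) + (\<beta>\<^sup>2 + 2 * ?A * \<gamma>) * (?\<phi> y * y\<^sup>2)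
      + 2 * \<beta> * \<gamma> * (?\<phi> y * y ^ 3) + \<gamma>\<^sup>2 * (?\<phi> y * y ^ 4)) = (\<lambda>y. ?\<phi> y * (\<alpha> + \<beta> * y + \<gamma> * (y\<^sup>2 - \<delta>))\<^sup>2)"
    by (rule ext) (simp add: algebra_simps power2_eq_square power3_eq_cube power4_eq_xxxx)
  moreover have "?A\<^sup>2 * 1 + 2 * ?A * \<beta> * 0 + (\<beta>\<^sup>2 + 2 * ?A * \<gamma>) * \<delta> + 2 * \<beta> * \<gamma> * 0 + \<gamma>\<^sup>2 * (3 * \<delta>\<^sup>2)
    = \<alpha>\<^sup>2 + \<delta> * \<beta>\<^sup>2 + 2 * \<delta>\<^sup>2 * \<gamma>\<^sup>2"
    by (simp add: algebra_simps power2_eq_square)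
  ultimately have H: "has_bochner_integral lborel (\<lambda>y. ?\<phi> y * (\<alpha> + \<beta> * y + \<gamma> * (y\<^sup>2 - \<delta>))\<^sup>2) (\<alpha>\<^sup>2 + \<delta> * \<beta>\<^sup>2 + 2 * \<delta>\<^sup>2 * \<gamma>\<^sup>2)"
    by (simp only:)
  have "(\<integral>\<^sup>+y. ennreal ((\<alpha> + \<beta> * y + \<gamma> * (y\<^sup>2 - \<delta>))\<^sup>2) \<partial>gauss \<delta>)
    = (\<integral>\<^sup>+y. ennreal (?\<phi> y * (\<alpha> + \<beta> * y + \<gamma> * (y\<^sup>2 - \<delta>))\<^sup>2) \<partial>lborel)"
    by (subst nn_integral_gauss) (auto simp: ennreal_mult)
  also have "\<dots> = ennreal (\<alpha>\<^sup>2 + \<delta> * \<beta>\<^sup>2 + 2 * \<delta>\<^sup>2 * \<gamma>\<^sup>2)"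
    using H by (subst nn_integral_eq_integral) (auto simp: has_bochner_integral_iff)
  finally show ?thesis .
qed

lemma nn_integral_noise_linear:
  assumes d: "\<delta> > 0"
  shows "(\<integral>\<^sup>+x. ennreal ((\<Sum>k<n. c k * x k)\<^sup>2) \<partial>noise \<delta> n) = ennreal (\<delta> * (\<Sum>k<n. (c k)\<^sup>2))"
proof (induction n)
  case 0 then show ?case by simp
next
  case (Suc n)
  interpret prob_space "noise \<delta> n" by (rule prob_space_noise[OF d])
  have "(\<integral>\<^sup>+x. ennreal ((\<Sum>k<Suc n. c k * x k)\<^sup>2) \<partial>noise \<delta> (Suc n)) =
    (\<integral>\<^sup>+x. (\<integral>\<^sup>+y. ennreal ((\<Sum>k<Suc n. c k * (x(n := y)) k)\<^sup>2) \<partial>gauss \<delta>) \<partial>noise \<delta> n)"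
    by (rule nn_integral_noise_Suc[OF d]) measurable
  also have "\<dots> = (\<integral>\<^sup>+x. ennreal ((\<Sum>k<n. c k * x k)\<^sup>2 + \<delta> * (c n)\<^sup>2) \<partial>noise \<delta> n)"
    using nn_integral_gauss_quadratic[OF d, where \<gamma> = 0 and \<beta> = "c n"] by simp
  also have "\<dots> = (\<integral>\<^sup>+x. ennreal ((\<Sum>k<n. c k * x k)\<^sup>2) + ennreal (\<delta> * (c n)\<^sup>2) \<partial>noise \<delta> n)"
    using d by (simp add: ennreal_plus)
  also have "\<dots> = ennreal (\<delta> * (\<Sum>k<n. (c k)\<^sup>2)) + ennreal (\<delta> * (c n)\<^sup>2)"
    by (subst nn_integral_add) (auto simp: Suc.IH emeasure_space_1)
  also have "\<dots> = ennreal (\<delta> * (\<Sum>k<Suc n. (c k)\<^sup>2))"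
    using d by (subst ennreal_plus[symmetric]) (auto simp: algebra_simps intro!: mult_nonneg_nonneg sum_nonneg)
  finally show ?case .
qed

text \<open>The variance formula for the second Wiener chaos, by induction: adding a variable \<open>y\<close> adds
  \<open>B * y + A n n * (y\<^sup>2 - \<delta>)\<close> with \<open>B\<close> linear in the earlier variables, and \<open>1\<close>, \<open>y\<close>, \<open>y\<^sup>2 - \<delta>\<close> are
  orthogonal under \<open>gauss \<delta>\<close>.\<close>

lemma nn_integral_noise_quadratic_form:
  assumes d: "\<delta> > 0" and sym: "\<And>j k. A j k = A k j"
  shows "(\<integral>\<^sup>+x. ennreal (((\<Sum>j<n. \<Sum>k<n. A j k * x j * x k) - \<delta> * (\<Sum>k<n. A k k))\<^sup>2) \<partial>noise \<delta> n)
    = ennreal (2 * \<delta>\<^sup>2 * (\<Sum>j<n. \<Sum>k<n. (A j k)\<^sup>2))"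
proof (induction n)
  case 0 then show ?case by simp
next
  case (Suc n)
  let ?q = "\<lambda>n x. (\<Sum>j<n. \<Sum>k<n. A j k * x j * x k) - \<delta> * (\<Sum>k<n. A k k)"
  let ?B = "\<lambda>x. \<Sum>j<n. (2 * A j n) * x j"
  have q: "?q (Suc n) (x(n := y)) = ?q n x + ?B x * y + A n n * (y\<^sup>2 - \<delta>)" for x y
  proof -
    have r: "(\<Sum>k<n. A n k * y * x k) = (\<Sum>k<n. A k n * x k * y)"
      by (rule sum.cong[OF refl], subst sym) simp
    have B: "?B x * y = (\<Sum>k<n. A k n * x k * y) + (\<Sum>k<n. A k n * x k * y)"
      unfolding sum_distrib_right sum.distrib[symmetric] by (rule sum.cong) auto
    show ?thesis unfolding B by (simp add: sum.distrib r) (simp add: algebra_simps power2_eq_square)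
  qed
  have "(\<integral>\<^sup>+x. ennreal ((?q (Suc n) x)\<^sup>2) \<partial>noise \<delta> (Suc n)) =
    (\<integral>\<^sup>+x. (\<integral>\<^sup>+y. ennreal ((?q (Suc n) (x(n := y)))\<^sup>2) \<partial>gauss \<delta>) \<partial>noise \<delta> n)"
    by (rule nn_integral_noise_Suc[OF d]) measurable
  also have "\<dots> = (\<integral>\<^sup>+x. ennreal ((?q n x)\<^sup>2 + \<delta> * (?B x)\<^sup>2 + 2 * \<delta>\<^sup>2 * (A n n)\<^sup>2) \<partial>noise \<delta> n)"
    unfolding q nn_integral_gauss_quadratic[OF d] ..
  also have "\<dots> = (\<integral>\<^sup>+x. ennreal ((?q n x)\<^sup>2) + ennreal \<delta> * ennreal ((?B x)\<^sup>2) + ennreal (2 * \<delta>\<^sup>2 * (A n n)\<^sup>2) \<partial>noise \<delta> n)"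
    using d by (simp add: ennreal_plus ennreal_mult)
  also have "\<dots> = ennreal (2 * \<delta>\<^sup>2 * (\<Sum>j<n. \<Sum>k<n. (A j k)\<^sup>2)) + ennreal \<delta> * ennreal (\<delta> * (\<Sum>k<n. (2 * A k n)\<^sup>2)) + ennreal (2 * \<delta>\<^sup>2 * (A n n)\<^sup>2)"
  proof -
    interpret prob_space "noise \<delta> n" by (rule prob_space_noise[OF d])
    show ?thesis
      by (subst nn_integral_add, measurable, subst nn_integral_add, measurable, subst nn_integral_cmult, measurable)
        (simp only: Suc.IH nn_integral_noise_linear[OF d] nn_integral_const emeasure_space_1 mult_1_right)
  qed
  also have "\<dots> = ennreal (2 * \<delta>\<^sup>2 * (\<Sum>j<n. \<Sum>k<n. (A j k)\<^sup>2) + \<delta> * (\<delta> * (\<Sum>k<n. (2 * A k n)\<^sup>2)) + 2 * \<delta>\<^sup>2 * (A n n)\<^sup>2)"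
    using d by (simp add: ennreal_plus ennreal_mult sum_nonneg)
  also have "2 * \<delta>\<^sup>2 * (\<Sum>j<n. \<Sum>k<n. (A j k)\<^sup>2) + \<delta> * (\<delta> * (\<Sum>k<n. (2 * A k n)\<^sup>2)) + 2 * \<delta>\<^sup>2 * (A n n)\<^sup>2
    = 2 * \<delta>\<^sup>2 * (\<Sum>j<Suc n. \<Sum>k<Suc n. (A j k)\<^sup>2)"
  proof -
    have r: "(\<Sum>k<n. (A n k)\<^sup>2) = (\<Sum>k<n. (A k n)\<^sup>2)"
      by (rule sum.cong[OF refl], subst sym) simp
    have B: "(\<Sum>k<n. (2 * A k n)\<^sup>2) = 4 * (\<Sum>k<n. (A k n)\<^sup>2)"
      unfolding sum_distrib_left by (rule sum.cong) (auto simp: power_mult_distrib)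
    show ?thesis unfolding B by (simp add: sum.distrib r) (simp add: algebra_simps power2_eq_square)
  qed
  finally show ?case .
qed

section \<open>Moving integrals of continuous paths\<close>

definition moving :: "(real \<Rightarrow> real) \<Rightarrow> real \<Rightarrow> real" where
  "moving x s = integral {s-1..s} x"

definition steps :: "real \<Rightarrow> nat \<Rightarrow> nat" where
  "steps T N = nat \<lfloor>real N * T\<rfloor>"

text \<open>The grid starts at time \<open>-1\<close>, which explains the shift by \<open>N\<close> between array indices and time steps.\<close>

definition grid :: "(real \<Rightarrow> real) \<Rightarrow> nat \<Rightarrow> nat \<Rightarrow> real" where
  "grid x N i = x (real i / real N - 1)"

lemma steps_le: "T \<ge> 0 \<Longrightarrow> real (steps T N) \<le> real N * T"
  unfolding steps_def by simp

lemma index_le_steps: "T \<ge> 0 \<Longrightarrow> N > 0 \<Longrightarrow> k \<le> steps T N \<Longrightarrow> real k / real N \<le> T"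
  using steps_le[of T N] by (simp add: divide_le_eq mult.commute)

lemma steps_ge: "T \<ge> 0 \<Longrightarrow> real N * T < real (steps T N) + 1"
  unfolding steps_def by simp

lemma moving_shift:
  assumes x: "continuous_on {-1..} x" and s: "s \<ge> 0"
  shows "moving x s = integral {-1..0} (\<lambda>u. x (s + u))"
proof -
  have c: "continuous_on {s-1..s} x" by (rule continuous_on_subset[OF x]) (use s in auto)
  have c': "continuous_on {-1..0} (\<lambda>u. x (s + u))"
    by (rule continuous_on_compose2[OF x]) (use s in \<open>auto intro!: continuous_intros\<close>)
  show ?thesis
    using set_integral_shift[where f = x and s = s] set_integral_continuous(2)[OF c] set_integral_continuous(2)[OF c']
    by (simp add: moving_def)
qed

lemma integral_uniform_partition:
  fixes x :: "real \<Rightarrow> real"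
  assumes d: "d \<ge> 0" and x: "continuous_on {c..c + real m * d} x"
  shows "integral {c..c + real m * d} x = (\<Sum>j<m. integral {c + real j * d..c + real (Suc j) * d} x)"
  using x
proof (induction m)
  case 0 then show ?case by simp
next
  case (Suc m)
  have le: "c + real m * d \<le> c + real (Suc m) * d" "c \<le> c + real m * d" using d by (auto simp: algebra_simps)
  have "integral {c..c + real m * d} x + integral {c + real m * d..c + real (Suc m) * d} x = integral {c..c + real (Suc m) * d} x"
    by (rule Henstock_Kurzweil_Integration.integral_combine[OF le(2,1)]) (rule integrable_continuous_real[OF Suc.prems])
  moreover have "integral {c..c + real m * d} x = (\<Sum>j<m. integral {c + real j * d..c + real (Suc j) * d} x)"
    by (rule Suc.IH) (rule continuous_on_subset[OF Suc.prems], use le in auto)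
  ultimately show ?case by simp
qed

lemma integral_close_constant:
  fixes f :: "real \<Rightarrow> real"
  assumes "a \<le> b" "continuous_on {a..b} f" "\<And>t. t \<in> {a..b} \<Longrightarrow> \<bar>f t - y\<bar> \<le> e"
  shows "\<bar>integral {a..b} f - (b - a) * y\<bar> \<le> e * (b - a)"
proof -
  have i: "f integrable_on {a..b}" by (rule integrable_continuous_real) fact
  have "integral {a..b} f - (b - a) * y = integral {a..b} (\<lambda>t. f t - y)"
    using assms(1) by (subst Henstock_Kurzweil_Integration.integral_diff[OF i]) auto
  also have "norm \<dots> \<le> e * (b - a)"
    by (rule integral_bound) (use assms in \<open>auto intro!: continuous_intros\<close>)
  finally show ?thesis by simp
qed

lemma moving_close:
  assumes x: "continuous_on {-1..} x" and s: "0 \<le> s" "0 \<le> t"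
    and uc: "\<And>u. u \<in> {-1..0} \<Longrightarrow> \<bar>x (s + u) - x (t + u)\<bar> \<le> e"
  shows "\<bar>moving x s - moving x t\<bar> \<le> e"
proof -
  have c: "continuous_on {-1..0} (\<lambda>u. x (s + u))" "continuous_on {-1..0} (\<lambda>u. x (t + u))"
    by (rule continuous_on_compose2[OF x]; use s in \<open>auto intro!: continuous_intros\<close>)+
  have "moving x s - moving x t = integral {-1..0} (\<lambda>u. x (s + u) - x (t + u))"
    unfolding moving_shift[OF x s(1)] moving_shift[OF x s(2)]
    by (rule Henstock_Kurzweil_Integration.integral_diff[symmetric]) (auto intro!: integrable_continuous_real c)
  also have "norm \<dots> \<le> e * (0 - (-1))"
    by (rule integral_bound) (use uc in \<open>auto intro!: continuous_intros c\<close>)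
  finally show ?thesis by simp
qed

lemma moving_continuous:
  assumes x: "continuous_on {-1..} x"
  shows "continuous_on {0..T} (moving x)"
  unfolding continuous_on_iff
proof (intro ballI allI impI)
  fix s e :: real assume s: "s \<in> {0..T}" and e: "e > 0"
  have "uniformly_continuous_on {-1..T} x"
    by (rule compact_uniformly_continuous) (auto intro: continuous_on_subset[OF x])
  then obtain d where d: "d > 0" "\<And>u v. u \<in> {-1..T} \<Longrightarrow> v \<in> {-1..T} \<Longrightarrow> dist u v < d \<Longrightarrow> dist (x u) (x v) < e / 2"
    unfolding uniformly_continuous_on_def using half_gt_zero[OF e] by (metis dist_commute)
  have "\<bar>moving x t - moving x s\<bar> \<le> e / 2" if "t \<in> {0..T}" "dist t s < d" for t
  proof (rule moving_close[OF x])
    show "\<bar>x (t + u) - x (s + u)\<bar> \<le> e / 2" if "u \<in> {-1..0}" for u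
      using d(2)[of "t + u" "s + u"] that s \<open>t \<in> {0..T}\<close> \<open>dist t s < d\<close> by (auto simp: dist_real_def)
  qed (use that s in auto)
  then show "\<exists>d>0. \<forall>t\<in>{0..T}. dist t s < d \<longrightarrow> dist (moving x t) (moving x s) < e"
    using d(1) e by (intro exI[of _ d]) (force simp: dist_real_def)
qed

text \<open>On each of the \<open>N\<close> cells of the window the path differs from its value at the left end by at most
  \<open>e\<close>.\<close>

lemma drift_grid_close:
  assumes x: "continuous_on {-1..} x" and N: "N > 0"
    and uc: "\<And>u v. u \<in> {-1..T} \<Longrightarrow> v \<in> {-1..T} \<Longrightarrow> \<bar>u - v\<bar> \<le> 1 / N \<Longrightarrow> \<bar>x u - x v\<bar> \<le> e"
    and k: "real k / real N \<le> T"
  shows "\<bar>drift N (grid x N) k - moving x (real k / real N)\<bar> \<le> e"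
proof -
  define c where "c = real k / real N - 1"
  have c: "c \<ge> -1" "c + 1 \<le> T" using k by (auto simp: c_def)
  have m: "moving x (real k / real N) = (\<Sum>j<N. integral {c + real j * (1 / N)..c + real (Suc j) * (1 / N)} x)"
  proof -
    have "c + real N * (1 / N) = c + 1" using N by simp
    then have "moving x (real k / real N) = integral {c..c + real N * (1 / N)} x"
      by (simp add: moving_def c_def)
    also have "\<dots> = (\<Sum>j<N. integral {c + real j * (1 / N)..c + real (Suc j) * (1 / N)} x)"
      by (rule integral_uniform_partition) (use c in \<open>auto intro: continuous_on_subset[OF x]\<close>)
    finally show ?thesis .
  qed
  have dr: "drift N (grid x N) k = (\<Sum>j<N. (1 / N) * x (c + real j * (1 / N)))"
    unfolding drift_def grid_def c_def sum_divide_distrib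
    by (rule sum.cong) (auto simp: add_divide_distrib algebra_simps)
  have "\<bar>moving x (real k / real N) - drift N (grid x N) k\<bar> \<le> (\<Sum>j<N. e * (1 / N))"
    unfolding m dr sum_subtractf[symmetric]
  proof (rule order_trans[OF sum_abs sum_mono])
    fix j assume "j \<in> {..<N}"
    then have j: "real (Suc j) * (1 / N) \<le> 1" using N by (simp add: field_simps)
    have l: "c + real (Suc j) * (1 / N) - (c + real j * (1 / N)) = 1 / N"
      by (simp add: add_divide_distrib)
    have "\<bar>integral {c + real j * (1 / N)..c + real (Suc j) * (1 / N)} x - (c + real (Suc j) * (1 / N) - (c + real j * (1 / N))) * x (c + real j * (1 / N))\<bar>
      \<le> e * (c + real (Suc j) * (1 / N) - (c + real j * (1 / N)))"
    proof (rule integral_close_constant)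
      have "0 \<le> real j / real N" by simp
      then have nj: "-1 \<le> c + real j / real N" using c(1) by linarith
      then show "continuous_on {c + real j * (1 / N)..c + real (Suc j) * (1 / N)} x"
        using c nj by (intro continuous_on_subset[OF x]) auto
      fix t assume t: "t \<in> {c + real j * (1 / N)..c + real (Suc j) * (1 / N)}"
      show "\<bar>x t - x (c + real j * (1 / N))\<bar> \<le> e"
        using t j c l nj by (intro uc) auto
    qed (simp add: add_divide_distrib)
    then show "\<bar>integral {c + real j * (1 / N)..c + real (Suc j) * (1 / N)} x - 1 / N * x (c + real j * (1 / N))\<bar> \<le> e * (1 / N)"
      unfolding l .
  qed
  also have "\<dots> = e" using N by simp
  finally show ?thesis by (simp add: abs_minus_commute)
qed

lemma drift_close:
  assumes "N > 0" "\<And>i. i \<le> N + k \<Longrightarrow> \<bar>v i - v' i\<bar> \<le> e"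
  shows "\<bar>drift N v k - drift N v' k\<bar> \<le> e"
proof -
  have "\<bar>(\<Sum>j<N. v (k + j)) - (\<Sum>j<N. v' (k + j))\<bar> \<le> (\<Sum>j<N. e)"
    unfolding sum_subtractf[symmetric] by (rule order_trans[OF sum_abs sum_mono]) (use assms(2) in auto)
  then show ?thesis using assms(1) unfolding drift_def
    by (simp add: diff_divide_distrib[symmetric] divide_le_eq mult.commute)
qed

section \<open>Pathwise convergence of the Euler scheme\<close>

text \<open>The equation for a single path, with the moving integral in place of the inner integral and the
  driving path normalised to start at zero.\<close>

definition pathwise_solution :: "real \<Rightarrow> (real \<Rightarrow> real) \<Rightarrow> (real \<Rightarrow> real) \<Rightarrow> bool" where
  "pathwise_solution a w x \<longleftrightarrow> continuous_on {-1..} x \<and> continuous_on {0..} w \<and> w 0 = 0 \<and>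
     (\<forall>t\<ge>0. x t = x 0 + a * integral {0..t} (moving x) + w t)"

definition increments :: "(real \<Rightarrow> real) \<Rightarrow> nat \<Rightarrow> nat \<Rightarrow> real" where
  "increments w N k = w (real (Suc k) / real N) - w (real k / real N)"

text \<open>A discrete Gronwall argument. In one step the error grows by at most \<open>\<bar>a\<bar> / N\<close> times the sum of the
  largest previous error and \<open>2 * e\<close>, one \<open>e\<close> for replacing the moving integral by a Riemann sum and
  one for freezing it over the step; the bound \<open>D k = 2 * e * ((1 + \<bar>a\<bar> / N) ^ k - 1)\<close> solves the
  corresponding recursion with equality. The noise increments cancel exactly, so continuity of the
  path is all that enters.\<close>

lemma euler_error:
  assumes sol: "pathwise_solution a w x" and N: "N > 0" and e: "e \<ge> 0"
    and uc: "\<And>u v. u \<in> {-1..T} \<Longrightarrow> v \<in> {-1..T} \<Longrightarrow> \<bar>u - v\<bar> \<le> 1 / N \<Longrightarrow> \<bar>x u - x v\<bar> \<le> e"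
    and k: "real k / real N \<le> T" and i: "i \<le> N + k"
  shows "\<bar>euler N a (grid x N) (increments w N) i - grid x N i\<bar> \<le> 2 * e * ((1 + \<bar>a\<bar> / N) ^ k - 1)"
  using k i
proof (induction k arbitrary: i)
  case 0
  then show ?case by (simp add: euler_init)
next
  case (Suc k)
  note x = sol[unfolded pathwise_solution_def, THEN conjunct1]
  have eq: "x r = x 0 + a * integral {0..r} (moving x) + w r" if "r \<ge> 0" for r
    using sol that unfolding pathwise_solution_def by blast
  let ?E = "euler N a (grid x N) (increments w N)" and ?\<alpha> = "\<bar>a\<bar> / N"
  let ?D = "\<lambda>k. 2 * e * ((1 + ?\<alpha>) ^ k - 1)"
  have kT: "real k / real N \<le> T" using Suc.prems(1) by (simp add: add_divide_distrib) (smt (verit) divide_nonneg_nonneg of_nat_0_le_iff)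
  note IH = Suc.IH[OF kT]
  have \<alpha>0: "?\<alpha> \<ge> 0" by simp
  show ?case
  proof (cases "i \<le> N + k")
    case True
    have "(1 + ?\<alpha>) ^ k \<le> (1 + ?\<alpha>) ^ Suc k" by (rule power_increasing) auto
    then have "?D k \<le> ?D (Suc k)" using e by (intro mult_left_mono) auto
    then show ?thesis using IH[OF True] by linarith
  next
    case False
    then have i: "i = Suc (N + k)" using Suc.prems(2) by simp
    define s where "s = real k / real N"
    define t where "t = real (Suc k) / real N"
    have st: "0 \<le> s" "s \<le> t" "t - s = 1 / N" "t \<le> T" using Suc.prems(1)
      by (auto simp: s_def t_def divide_right_mono add_divide_distrib)
    have g: "grid x N (N + k) = x s" "grid x N (Suc (N + k)) = x t"
      using N by (auto simp: grid_def s_def t_def add_divide_distrib)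
    have mc: "continuous_on {0..t} (moving x)" by (rule moving_continuous[OF x])
    have "x t - x s = a * (integral {0..t} (moving x) - integral {0..s} (moving x)) + (w t - w s)"
    proof -
      have "x t = x 0 + a * integral {0..t} (moving x) + w t" "x s = x 0 + a * integral {0..s} (moving x) + w s"
        by (rule eq; use st in linarith)+
      then show ?thesis by (simp add: algebra_simps)
    qed
    also have "integral {0..t} (moving x) - integral {0..s} (moving x) = integral {s..t} (moving x)"
      using Henstock_Kurzweil_Integration.integral_combine[OF st(1,2) integrable_continuous_real[OF mc]] by simp
    finally have xt: "x t = x s + a * integral {s..t} (moving x) + increments w N k"
      by (simp add: increments_def s_def t_def)
    have E: "?E (Suc (N + k)) - grid x N (Suc (N + k)) = (?E (N + k) - x s) + a * (drift N ?E k / N - integral {s..t} (moving x))"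
      unfolding g xt by (simp add: euler_Suc algebra_simps)
    have dE: "\<bar>drift N ?E k - drift N (grid x N) k\<bar> \<le> ?D k"
      by (rule drift_close[OF N IH])
    have dg: "\<bar>drift N (grid x N) k - moving x s\<bar> \<le> e"
      unfolding s_def by (rule drift_grid_close[OF x N uc kT]) auto
    have "\<bar>integral {s..t} (moving x) - (t - s) * moving x s\<bar> \<le> e * (t - s)"
    proof (rule integral_close_constant[OF st(2)])
      show "continuous_on {s..t} (moving x)" by (rule continuous_on_subset[OF mc]) (use st in auto)
      fix r assume r: "r \<in> {s..t}"
      show "\<bar>moving x r - moving x s\<bar> \<le> e"
        using r st by (intro moving_close[OF x] uc) auto
    qed
    then have mi: "\<bar>integral {s..t} (moving x) - moving x s / N\<bar> \<le> e / N" unfolding st(3) by simp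
    have "\<bar>drift N ?E k - moving x s\<bar> \<le> ?D k + e" using dE dg by linarith
    then have "\<bar>drift N ?E k / N - moving x s / N\<bar> \<le> (?D k + e) / N"
      unfolding diff_divide_distrib[symmetric] abs_divide by (simp add: divide_right_mono)
    then have "\<bar>drift N ?E k / N - integral {s..t} (moving x)\<bar> \<le> (?D k + e) / N + e / N"
      using mi by linarith
    also have "\<dots> = (?D k + 2 * e) / N" by (simp add: add_divide_distrib)
    finally have "\<bar>a\<bar> * \<bar>drift N ?E k / N - integral {s..t} (moving x)\<bar> \<le> \<bar>a\<bar> * ((?D k + 2 * e) / N)"
      by (intro mult_left_mono) auto
    moreover have "\<bar>?E (N + k) - x s\<bar> \<le> ?D k" using IH[of "N + k"] g by simp
    moreover have "\<bar>?E (Suc (N + k)) - grid x N (Suc (N + k))\<bar> \<le> \<bar>?E (N + k) - x s\<bar> + \<bar>a\<bar> * \<bar>drift N ?E k / N - integral {s..t} (moving x)\<bar>"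
      unfolding E abs_mult[symmetric] by (rule abs_triangle_ineq)
    ultimately have "\<bar>?E (Suc (N + k)) - grid x N (Suc (N + k))\<bar> \<le> ?D k + \<bar>a\<bar> * ((?D k + 2 * e) / N)"
      by linarith
    also have "\<dots> = ?D (Suc k)"
    proof -
      have "d + \<bar>a\<bar> * ((d + 2 * e) / N) = 2 * e * ((1 + \<bar>a\<bar> / N) * q - 1)" if "d = 2 * e * (q - 1)" for d q
        using N unfolding that by (simp add: field_simps)
      then show ?thesis unfolding power_Suc by blast
    qed
    finally show ?thesis unfolding i .
  qed
qed

text \<open>Uniform closeness of two triangular arrays whose rows \<open>N\<close> have length \<open>m N\<close>. This is how uniform
  convergence on a time interval is expressed for paths sampled on ever finer grids.\<close>

definition close_arrays :: "(nat \<Rightarrow> nat) \<Rightarrow> (nat \<Rightarrow> nat \<Rightarrow> real) \<Rightarrow> (nat \<Rightarrow> nat \<Rightarrow> real) \<Rightarrow> bool" where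
  "close_arrays m u v \<longleftrightarrow> (\<forall>e>0. \<forall>\<^sub>F N in sequentially. \<forall>k<m N. \<bar>u N k - v N k\<bar> \<le> e)"

lemma uniform_continuity_grid:
  assumes x: "continuous_on {c..T} (x :: real \<Rightarrow> real)" and e: "e > 0"
  shows "\<forall>\<^sub>F N in sequentially. N > 0 \<and> (\<forall>u\<in>{c..T}. \<forall>v\<in>{c..T}. \<bar>u - v\<bar> \<le> 1 / real N \<longrightarrow> \<bar>x u - x v\<bar> \<le> e)"
proof -
  have "uniformly_continuous_on {c..T} x"
    by (rule compact_uniformly_continuous[OF x]) auto
  then obtain d where d: "d > 0" "\<And>u v. u \<in> {c..T} \<Longrightarrow> v \<in> {c..T} \<Longrightarrow> dist v u < d \<Longrightarrow> dist (x v) (x u) < e"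
    unfolding uniformly_continuous_on_def using e by metis
  have "\<forall>\<^sub>F N in sequentially. 1 / real N < d"
    using order_tendstoD(2)[OF lim_1_over_n d(1)] .
  then show ?thesis using eventually_gt_at_top[of 0]
  proof eventually_elim
    case (elim N)
    show ?case
    proof (intro conjI ballI impI)
      fix u v assume "u \<in> {c..T}" "v \<in> {c..T}" "\<bar>u - v\<bar> \<le> 1 / real N"
      then show "\<bar>x u - x v\<bar> \<le> e" using d(2)[of v u] elim by (auto simp: dist_real_def)
    qed (use elim in simp)
  qed
qed

text \<open>Over \<open>steps T N \<le> N * T\<close> steps the factor \<open>(1 + \<bar>a\<bar> / N) ^ k\<close> stays below \<open>exp (\<bar>a\<bar> * T)\<close>, while the
  modulus of continuity \<open>e\<close> of the path on scale \<open>1 / N\<close> tends to zero.\<close>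

theorem euler_converges:
  assumes sol: "pathwise_solution a w x" and T: "T \<ge> 0"
  shows "close_arrays (\<lambda>N. Suc (N + steps T N)) (\<lambda>N. euler N a (grid x N) (increments w N)) (grid x)"
  unfolding close_arrays_def
proof (intro allI impI)
  fix e :: real assume e: "e > 0"
  have x: "continuous_on {-1..T} x" using sol unfolding pathwise_solution_def
    by (auto intro: continuous_on_subset)
  define \<eta> where "\<eta> = e / (2 * exp (\<bar>a\<bar> * T))"
  have \<eta>: "\<eta> > 0" using e by (simp add: \<eta>_def)
  show "\<forall>\<^sub>F N in sequentially. \<forall>i<Suc (N + steps T N). \<bar>euler N a (grid x N) (increments w N) i - grid x N i\<bar> \<le> e"
    using uniform_continuity_grid[OF x \<eta>]
  proof eventually_elim
    case (elim N)
    then have N: "N > 0" by simp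
    show ?case
    proof (intro allI impI)
      fix i assume i: "i < Suc (N + steps T N)"
      let ?n = "steps T N"
      have n: "real ?n / real N \<le> T" by (rule index_le_steps[OF T N order_refl])
      have "\<bar>euler N a (grid x N) (increments w N) i - grid x N i\<bar> \<le> 2 * \<eta> * ((1 + \<bar>a\<bar> / N) ^ ?n - 1)"
        by (rule euler_error[OF sol N _ _ n]) (use \<eta> elim i in auto)
      also have "(1 + \<bar>a\<bar> / N) ^ ?n \<le> exp (\<bar>a\<bar> / N) ^ ?n"
        by (intro power_mono exp_ge_add_one_self) (auto intro: add_nonneg_nonneg)
      also have "\<dots> = exp (\<bar>a\<bar> * (real ?n / N))" by (simp add: exp_of_nat_mult[symmetric] mult_ac)
      also have "\<dots> \<le> exp (\<bar>a\<bar> * T)"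
        unfolding exp_le_cancel_iff by (rule mult_left_mono[OF n]) simp
      finally have "\<bar>euler N a (grid x N) (increments w N) i - grid x N i\<bar> \<le> 2 * \<eta> * (exp (\<bar>a\<bar> * T) - 1)"
        using \<eta> by (simp add: mult_left_mono)
      also have "\<dots> \<le> 2 * \<eta> * exp (\<bar>a\<bar> * T)" using \<eta> by simp
      also have "\<dots> = e" by (simp add: \<eta>_def)
      finally show "\<bar>euler N a (grid x N) (increments w N) i - grid x N i\<bar> \<le> e" .
    qed
  qed
qed

section \<open>Riemann sums over arrays\<close>

lemma tendsto_if_close:
  fixes s :: "nat \<Rightarrow> real"
  assumes "K \<ge> 0" "\<And>e. e > 0 \<Longrightarrow> \<forall>\<^sub>F N in sequentially. \<bar>s N - L\<bar> \<le> K * e"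
  shows "s \<longlonglongrightarrow> L"
proof (rule tendstoI)
  fix e :: real assume e: "e > 0"
  have "K * (e / (K + 1)) < e" using assms(1) e by (simp add: field_simps)
  moreover have "\<forall>\<^sub>F N in sequentially. \<bar>s N - L\<bar> \<le> K * (e / (K + 1))"
    using assms(1) e by (intro assms(2)) simp
  ultimately show "\<forall>\<^sub>F N in sequentially. dist (s N) L < e"
    by (auto elim!: eventually_mono simp: dist_real_def)
qed

lemma eventually_index_le_steps:
  assumes "T \<ge> 0"
  shows "\<forall>\<^sub>F N in sequentially. N > 0 \<and> (\<forall>k\<le>steps T N. real k / real N \<in> {0..T})"
  using eventually_gt_at_top[of 0]
  by eventually_elim (auto intro: index_le_steps[OF assms])

lemma steps_over_N_ge:
  assumes "T \<ge> 0" "N > 0"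
  shows "T - 1 / real N \<le> real (steps T N) / real N"
proof -
  have "T * real N \<le> real (steps T N) + 1" using steps_ge[OF assms(1), of N] by (simp add: mult.commute)
  then have "T \<le> (real (steps T N) + 1) / real N" using assms(2) by (simp add: pos_le_divide_eq)
  then show ?thesis by (simp add: add_divide_distrib)
qed

lemma steps_over_N:
  assumes T: "T \<ge> 0"
  shows "(\<lambda>N. real (steps T N) / real N) \<longlonglongrightarrow> T"
proof (rule real_tendsto_sandwich)
  show "\<forall>\<^sub>F N in sequentially. T - 1 / real N \<le> real (steps T N) / real N"
    using eventually_gt_at_top[of 0] by eventually_elim (rule steps_over_N_ge[OF T])
  show "\<forall>\<^sub>F N in sequentially. real (steps T N) / real N \<le> T"
    using eventually_index_le_steps[OF T] by eventually_elim auto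
  have "(\<lambda>N. T - 1 / real N) \<longlonglongrightarrow> T - 0" by (intro tendsto_intros lim_1_over_n)
  then show "(\<lambda>N. T - 1 / real N) \<longlonglongrightarrow> T" by simp
qed simp

lemma riemann_sum_converges:
  assumes T: "T \<ge> 0" and g: "continuous_on {0..T} g"
    and close: "close_arrays (steps T) u (\<lambda>N k. g (real k / real N))"
  shows "(\<lambda>N. (\<Sum>k<steps T N. u N k) / real N) \<longlonglongrightarrow> integral {0..T} g"
proof (rule tendsto_if_close[where K = "2 * T + 1"])
  have "bounded (g ` {0..T})"
    by (intro compact_imp_bounded compact_continuous_image g) auto
  then obtain B where "\<forall>y\<in>g ` {0..T}. \<bar>y\<bar> \<le> B" unfolding bounded_real by blast
  then have B: "\<And>t. 0 \<le> t \<Longrightarrow> t \<le> T \<Longrightarrow> \<bar>g t\<bar> \<le> B" by auto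
  have B0: "B \<ge> 0" using B[of 0] T by simp
  fix e :: real assume e: "e > 0"
  have "(\<lambda>N. B * (1 / real N)) \<longlonglongrightarrow> B * 0" by (intro tendsto_intros lim_1_over_n)
  then have "\<forall>\<^sub>F N in sequentially. B * (1 / real N) < e" using e by (auto dest!: order_tendstoD(2))
  moreover have "\<forall>\<^sub>F N in sequentially. \<forall>k<steps T N. \<bar>u N k - g (real k / real N)\<bar> \<le> e"
    using close e unfolding close_arrays_def by blast
  ultimately show "\<forall>\<^sub>F N in sequentially. \<bar>(\<Sum>k<steps T N. u N k) / real N - integral {0..T} g\<bar> \<le> (2 * T + 1) * e"
    using uniform_continuity_grid[OF g e]
  proof eventually_elim
    case (elim N)
    then have N: "N > 0" by simp
    let ?n = "steps T N" and ?d = "1 / real N"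
    have nT: "real ?n * ?d \<le> T" using index_le_steps[OF T N order_refl] by simp
    have c: "continuous_on {a..b} g" if "0 \<le> a" "b \<le> T" for a b
      by (rule continuous_on_subset[OF g]) (use that in auto)
    have "integral {0..0 + real ?n * ?d} g = (\<Sum>j<?n. integral {0 + real j * ?d..0 + real (Suc j) * ?d} g)"
      by (rule integral_uniform_partition) (use nT in \<open>auto intro: c\<close>)
    then have p: "integral {0..real ?n * ?d} g = (\<Sum>j<?n. integral {real j * ?d..real (Suc j) * ?d} g)" by simp
    have l: "real (Suc j) * ?d - real j * ?d = ?d" for j by (simp add: add_divide_distrib)
    have "\<bar>integral {0..real ?n * ?d} g - (\<Sum>k<?n. g (real k / real N) * ?d)\<bar> \<le> (\<Sum>k<?n. e * ?d)"
      unfolding p sum_subtractf[symmetric]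
    proof (rule order_trans[OF sum_abs sum_mono])
      fix k assume "k \<in> {..<?n}"
      then have "real (Suc k) * ?d \<le> real ?n * ?d" by (intro mult_right_mono) auto
      then have k: "real (Suc k) * ?d \<le> T" using nT by linarith
      have k0: "0 \<le> real k * ?d" by simp
      have "\<bar>integral {real k * ?d..real (Suc k) * ?d} g - (real (Suc k) * ?d - real k * ?d) * g (real k / real N)\<bar> \<le> e * (real (Suc k) * ?d - real k * ?d)"
      proof (rule integral_close_constant)
        show "continuous_on {real k * ?d..real (Suc k) * ?d} g" by (rule c[OF k0 k])
        fix t assume t: "t \<in> {real k * ?d..real (Suc k) * ?d}"
        have "t \<in> {0..T}" "real k / real N \<in> {0..T}" "\<bar>t - real k / real N\<bar> \<le> 1 / real N"
        proof -
          have t': "real k * ?d \<le> t" "t \<le> real (Suc k) * ?d" using t by auto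
          have kN: "real k / real N = real k * ?d" and d0: "0 \<le> ?d" by simp_all
          show "t \<in> {0..T}" using k0 k t' unfolding atLeastAtMost_iff by linarith
          show "real k / real N \<in> {0..T}" using k0 k d0 l[of k] unfolding atLeastAtMost_iff kN by linarith
          show "\<bar>t - real k / real N\<bar> \<le> 1 / real N" using t' l[of k] unfolding kN abs_le_iff by linarith
        qed
        then show "\<bar>g t - g (real k / real N)\<bar> \<le> e" using elim by blast
      qed (simp add: divide_right_mono)
      then show "\<bar>integral {real k * ?d..real (Suc k) * ?d} g - g (real k / real N) * ?d\<bar> \<le> e * ?d"
        unfolding l by (simp add: mult.commute)
    qed
    also have "\<dots> = e * (real ?n * ?d)" by simp
    also have "\<dots> \<le> e * T" using nT e by (intro mult_left_mono) auto
    finally have 1: "\<bar>integral {0..real ?n * ?d} g - (\<Sum>k<?n. g (real k / real N) * ?d)\<bar> \<le> e * T" .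
    have "\<bar>(\<Sum>k<?n. u N k * ?d) - (\<Sum>k<?n. g (real k / real N) * ?d)\<bar> \<le> (\<Sum>k<?n. e * ?d)"
      unfolding sum_subtractf[symmetric] left_diff_distrib[symmetric]
      by (rule order_trans[OF sum_abs sum_mono]) (use elim in \<open>auto simp: abs_mult intro!: divide_right_mono\<close>)
    also have "\<dots> = e * (real ?n * ?d)" by simp
    also have "\<dots> \<le> e * T" using nT e by (intro mult_left_mono) auto
    finally have 2: "\<bar>(\<Sum>k<?n. u N k * ?d) - (\<Sum>k<?n. g (real k / real N) * ?d)\<bar> \<le> e * T" .
    have s: "integral {0..real ?n * ?d} g + integral {real ?n * ?d..T} g = integral {0..T} g"
      by (rule Henstock_Kurzweil_Integration.integral_combine)
        (use nT g in \<open>auto intro: integrable_continuous_real\<close>)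
    have "norm (integral {real ?n * ?d..T} g) \<le> B * (T - real ?n * ?d)"
    proof (rule integral_bound[OF nT])
      have n0: "0 \<le> real ?n * ?d" by simp
      show "continuous_on {real ?n * ?d..T} g" by (rule c[OF n0 order_refl])
      show "norm (g t) \<le> B" if "t \<in> {real ?n * ?d..T}" for t
        using B[of t] n0 that unfolding atLeastAtMost_iff real_norm_def by linarith
    qed
    also have "\<dots> \<le> B * ?d"
      using steps_over_N_ge[OF T N] B0 by (intro mult_left_mono) auto
    finally have 3: "\<bar>integral {real ?n * ?d..T} g\<bar> \<le> e" using elim by simp
    have "(\<Sum>k<?n. u N k) / real N = (\<Sum>k<?n. u N k * ?d)" by (simp add: sum_divide_distrib)
    then have "\<bar>(\<Sum>k<?n. u N k) / real N - integral {0..T} g\<bar> \<le> e * T + e * T + e"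
      using 1 2 3 s by linarith
    then show ?case by (simp add: algebra_simps)
  qed
qed (use T in simp)

lemma close_arrays_trans:
  assumes "close_arrays m u v" "close_arrays m v w" shows "close_arrays m u w"
  unfolding close_arrays_def
proof (intro allI impI)
  fix e :: real assume "e > 0"
  then have "e / 2 > 0" by simp
  then have "\<forall>\<^sub>F N in sequentially. \<forall>k<m N. \<bar>u N k - v N k\<bar> \<le> e / 2" "\<forall>\<^sub>F N in sequentially. \<forall>k<m N. \<bar>v N k - w N k\<bar> \<le> e / 2"
    using assms unfolding close_arrays_def by blast+
  then show "\<forall>\<^sub>F N in sequentially. \<forall>k<m N. \<bar>u N k - w N k\<bar> \<le> e"
    by eventually_elim (smt (verit) field_sum_of_halves)
qed

lemma close_arrays_diff:
  assumes "close_arrays m u u'" "close_arrays m v v'"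
  shows "close_arrays m (\<lambda>N k. u N k - v N k) (\<lambda>N k. u' N k - v' N k)"
  unfolding close_arrays_def
proof (intro allI impI)
  fix e :: real assume "e > 0"
  then have "e / 2 > 0" by simp
  then have "\<forall>\<^sub>F N in sequentially. \<forall>k<m N. \<bar>u N k - u' N k\<bar> \<le> e / 2" "\<forall>\<^sub>F N in sequentially. \<forall>k<m N. \<bar>v N k - v' N k\<bar> \<le> e / 2"
    using assms unfolding close_arrays_def by blast+
  then show "\<forall>\<^sub>F N in sequentially. \<forall>k<m N. \<bar>(u N k - v N k) - (u' N k - v' N k)\<bar> \<le> e"
    by eventually_elim (smt (verit) field_sum_of_halves)
qed

lemma close_arrays_mult:
  assumes "close_arrays m u u'" "close_arrays m v v'"
    and b: "\<forall>\<^sub>F N in sequentially. \<forall>k<m N. \<bar>u' N k\<bar> \<le> B \<and> \<bar>v' N k\<bar> \<le> B"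
  shows "close_arrays m (\<lambda>N k. u N k * v N k) (\<lambda>N k. u' N k * v' N k)"
  unfolding close_arrays_def
proof (intro allI impI)
  fix e :: real assume e: "e > 0"
  define C where "C = \<bar>B\<bar> + 1"
  define d where "d = min 1 (e / (3 * C))"
  have C: "C \<ge> 1" by (simp add: C_def)
  have "d \<le> e / (3 * C)" by (simp add: d_def)
  then have d3: "d * (3 * C) \<le> e" using C by (subst (asm) pos_le_divide_eq) auto
  have d: "d > 0" "d \<le> 1" using e C by (auto simp: d_def)
  have tri: "\<bar>p + q + r\<bar> \<le> \<bar>p\<bar> + \<bar>q\<bar> + \<bar>r\<bar>" for p q r :: real by linarith
  have "\<forall>\<^sub>F N in sequentially. \<forall>k<m N. \<bar>u N k - u' N k\<bar> \<le> d" "\<forall>\<^sub>F N in sequentially. \<forall>k<m N. \<bar>v N k - v' N k\<bar> \<le> d"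
    using assms d(1) unfolding close_arrays_def by blast+
  then show "\<forall>\<^sub>F N in sequentially. \<forall>k<m N. \<bar>u N k * v N k - u' N k * v' N k\<bar> \<le> e"
    using b
  proof eventually_elim
    case (elim N)
    show ?case
    proof (intro allI impI)
      fix k assume k: "k < m N"
      have "\<bar>u' N k\<bar> \<le> B \<and> \<bar>v' N k\<bar> \<le> B" "B \<le> C" using elim(3) k by (blast, simp add: C_def)
      then have 1: "\<bar>u N k - u' N k\<bar> \<le> d" "\<bar>v N k - v' N k\<bar> \<le> d" "\<bar>u' N k\<bar> \<le> C" "\<bar>v' N k\<bar> \<le> C"
        using elim(1,2) k by (blast, blast, linarith, linarith)
      have C0: "0 \<le> C" and d0: "0 \<le> d" using C d by auto
      have m1: "\<bar>u N k - u' N k\<bar> * \<bar>v N k - v' N k\<bar> \<le> d * 1"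
        by (rule mult_mono[OF 1(1) order_trans[OF 1(2) d(2)] d0 abs_ge_zero])
      have m2: "\<bar>u N k - u' N k\<bar> * \<bar>v' N k\<bar> \<le> d * C"
        by (rule mult_mono[OF 1(1) 1(4) d0 abs_ge_zero])
      have m3: "\<bar>u' N k\<bar> * \<bar>v N k - v' N k\<bar> \<le> C * d"
        by (rule mult_mono[OF 1(3) 1(2) C0 abs_ge_zero])
      have "u N k * v N k - u' N k * v' N k = (u N k - u' N k) * (v N k - v' N k) + (u N k - u' N k) * v' N k + u' N k * (v N k - v' N k)"
        by (simp add: algebra_simps)
      also have "\<bar>\<dots>\<bar> \<le> \<bar>u N k - u' N k\<bar> * \<bar>v N k - v' N k\<bar> + \<bar>u N k - u' N k\<bar> * \<bar>v' N k\<bar> + \<bar>u' N k\<bar> * \<bar>v N k - v' N k\<bar>"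
        unfolding abs_mult[symmetric] by (rule tri)
      also have "\<dots> \<le> d * 1 + d * C + C * d"
        by (rule add_mono[OF add_mono[OF m1 m2] m3])
      also have "\<dots> \<le> d * (3 * C)" using d(1) C mult_left_mono[of 1 C d] by (simp add: algebra_simps)
      also have "\<dots> \<le> e" by (rule d3)
      finally show "\<bar>u N k * v N k - u' N k * v' N k\<bar> \<le> e" .
    qed
  qed
qed

lemma close_arrays_mono:
  assumes "close_arrays m u v" "\<And>N k. k < m' N \<Longrightarrow> k < m N"
  shows "close_arrays m' u v"
  using assms unfolding close_arrays_def by (auto elim!: eventually_mono)

lemma close_arrays_compose:
  assumes "close_arrays m u v" "\<And>N k. k < m' N \<Longrightarrow> f N k < m N"
  shows "close_arrays m' (\<lambda>N k. u N (f N k)) (\<lambda>N k. v N (f N k))"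
  using assms unfolding close_arrays_def by (auto elim!: eventually_mono)

section \<open>The energy and the drift integral\<close>

definition energy :: "real \<Rightarrow> (real \<Rightarrow> real) \<Rightarrow> real" where
  "energy T x = integral {0..T} (\<lambda>s. (moving x s)\<^sup>2)"

text \<open>This is the stochastic integral of \<open>Y = moving x\<close> against \<open>x\<close>, integrated by parts: \<open>Y\<close> is
  continuously differentiable with derivative \<open>x s - x (s - 1)\<close>, so the integral is defined for
  every continuous path.\<close>

definition drift_integral :: "real \<Rightarrow> (real \<Rightarrow> real) \<Rightarrow> real" where
  "drift_integral T x = moving x T * x T - moving x 0 * x 0 - integral {0..T} (\<lambda>s. x s * (x s - x (s - 1)))"

lemma drift_Suc: "drift N v (Suc k) = drift N v k + (v (N + k) - v k) / real N"
proof -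
  have "(\<Sum>j<Suc N. v (k + j)) = v k + (\<Sum>j<N. v (Suc k + j))"
    by (subst sum.lessThan_Suc_shift) simp
  then have "(\<Sum>j<N. v (Suc k + j)) = (\<Sum>j<N. v (k + j)) + (v (N + k) - v k)" by (simp add: add.commute)
  then show ?thesis by (simp add: drift_def add_divide_distrib)
qed

text \<open>Summation by parts, the discrete version of the formula that defines \<open>drift_integral\<close>; after it
  every term converges for a fixed path.\<close>

lemma sum_drift_inc_by_parts:
  "sum_drift_inc N n v = drift N v n * v (N + n) - drift N v 0 * v N
    - (\<Sum>k<n. v (Suc (N + k)) * (v (N + k) - v k)) / real N"
  unfolding sum_drift_inc_def
  by (induction n) (simp_all add: drift_Suc algebra_simps add_divide_distrib diff_divide_distrib)

text \<open>The step function with the given grid values; through it a functional of paths can be evaluated on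
  an array.\<close>

definition step_path :: "nat \<Rightarrow> (nat \<Rightarrow> real) \<Rightarrow> real \<Rightarrow> real" where
  "step_path N u t = u (nat \<lfloor>(t + 1) * real N\<rfloor>)"

context
  fixes x :: "real \<Rightarrow> real" and T :: real and v :: "nat \<Rightarrow> nat \<Rightarrow> real"
  assumes x: "continuous_on {-1..} x" and T: "T \<ge> 0"
    and close: "close_arrays (\<lambda>N. Suc (N + steps T N)) v (grid x)"
begin

lemma path_bounded: "\<exists>B. \<forall>t\<in>{-1..T}. \<bar>x t\<bar> \<le> B"
proof -
  have "bounded (x ` {-1..T})"
    by (intro compact_imp_bounded compact_continuous_image continuous_on_subset[OF x]) auto
  then show ?thesis unfolding bounded_real by auto
qed

lemma moving_bounded: "\<exists>B. \<forall>t\<in>{0..T}. \<bar>moving x t\<bar> \<le> B"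
proof -
  have "bounded (moving x ` {0..T})"
    by (intro compact_imp_bounded compact_continuous_image moving_continuous[OF x]) auto
  then show ?thesis unfolding bounded_real by auto
qed

lemma close_drift: "close_arrays (\<lambda>N. Suc (steps T N)) (\<lambda>N. drift N (v N)) (\<lambda>N k. moving x (real k / real N))"
proof (rule close_arrays_trans[where v = "\<lambda>N. drift N (grid x N)"])
  show "close_arrays (\<lambda>N. Suc (steps T N)) (\<lambda>N. drift N (v N)) (\<lambda>N. drift N (grid x N))"
    unfolding close_arrays_def
  proof (intro allI impI)
    fix e :: real assume "e > 0"
    then have "\<forall>\<^sub>F N in sequentially. \<forall>k<Suc (N + steps T N). \<bar>v N k - grid x N k\<bar> \<le> e"
      using close unfolding close_arrays_def by blast
    then show "\<forall>\<^sub>F N in sequentially. \<forall>k<Suc (steps T N). \<bar>drift N (v N) k - drift N (grid x N) k\<bar> \<le> e"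
      using eventually_gt_at_top[of 0] by eventually_elim (intro allI impI drift_close, auto)
  qed
  show "close_arrays (\<lambda>N. Suc (steps T N)) (\<lambda>N. drift N (grid x N)) (\<lambda>N k. moving x (real k / real N))"
    unfolding close_arrays_def
  proof (intro allI impI)
    fix e :: real assume "e > 0"
    from uniform_continuity_grid[OF continuous_on_subset[OF x] this, of "-1" T]
    show "\<forall>\<^sub>F N in sequentially. \<forall>k<Suc (steps T N). \<bar>drift N (grid x N) k - moving x (real k / real N)\<bar> \<le> e"
      by (auto elim!: eventually_mono intro!: drift_grid_close[OF x] index_le_steps[OF T])
  qed
qed

lemma sum_drift_sq_converges: "(\<lambda>N. sum_drift_sq N (steps T N) (v N)) \<longlonglongrightarrow> energy T x"
  unfolding sum_drift_sq_def energy_def power2_eq_square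
proof (rule riemann_sum_converges[OF T])
  show "continuous_on {0..T} (\<lambda>s. moving x s * moving x s)" by (intro continuous_intros moving_continuous x)
  obtain B where B: "\<forall>t\<in>{0..T}. \<bar>moving x t\<bar> \<le> B" using moving_bounded by auto
  have "\<forall>\<^sub>F N in sequentially. \<forall>k<steps T N. \<bar>moving x (real k / real N)\<bar> \<le> B \<and> \<bar>moving x (real k / real N)\<bar> \<le> B"
    using eventually_index_le_steps[OF T] by eventually_elim (use B in auto)
  moreover have "close_arrays (steps T) (\<lambda>N. drift N (v N)) (\<lambda>N k. moving x (real k / real N))"
    by (rule close_arrays_mono[OF close_drift]) simp
  ultimately show "close_arrays (steps T) (\<lambda>N k. drift N (v N) k * drift N (v N) k) (\<lambda>N k. moving x (real k / real N) * moving x (real k / real N))"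
    by (intro close_arrays_mult)
qed

lemma close_arrays_last:
  assumes "close_arrays (\<lambda>N. Suc (steps T N)) u (\<lambda>N k. g (real k / real N))" "continuous_on {0..T} g"
  shows "(\<lambda>N. u N (steps T N)) \<longlonglongrightarrow> g T" and "(\<lambda>N. u N 0) \<longlonglongrightarrow> g 0"
proof -
  have "(\<lambda>N. g (real (steps T N) / real N)) \<longlonglongrightarrow> g T"
  proof (rule continuous_on_tendsto_compose[OF assms(2) steps_over_N[OF T]])
    show "\<forall>\<^sub>F N in sequentially. real (steps T N) / real N \<in> {0..T}"
      using eventually_index_le_steps[OF T] by eventually_elim auto
  qed (use T in simp)
  moreover have "(\<lambda>N. u N (steps T N) - g (real (steps T N) / real N)) \<longlonglongrightarrow> 0"
    by (rule tendsto_if_close[of 1]) (use assms(1) in \<open>auto simp: close_arrays_def elim!: eventually_mono\<close>)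
  ultimately have "(\<lambda>N. (u N (steps T N) - g (real (steps T N) / real N)) + g (real (steps T N) / real N)) \<longlonglongrightarrow> 0 + g T"
    by (intro tendsto_intros)
  then show "(\<lambda>N. u N (steps T N)) \<longlonglongrightarrow> g T" by simp
  show "(\<lambda>N. u N 0) \<longlonglongrightarrow> g 0"
  proof (rule tendsto_if_close[of 1])
    fix e :: real assume "e > 0"
    then have "\<forall>\<^sub>F N in sequentially. \<forall>k<Suc (steps T N). \<bar>u N k - g (real k / real N)\<bar> \<le> e"
      using assms(1) unfolding close_arrays_def by blast
    then show "\<forall>\<^sub>F N in sequentially. \<bar>u N 0 - g 0\<bar> \<le> 1 * e"
      by eventually_elim (drule spec[of _ 0], simp)
  qed simp
qed

lemma close_grid_shift:
  "close_arrays (\<lambda>N. Suc (steps T N)) (\<lambda>N k. v N (N + k)) (\<lambda>N k. x (real k / real N))"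
proof -
  have "close_arrays (\<lambda>N. Suc (steps T N)) (\<lambda>N k. v N (N + k)) (\<lambda>N k. grid x N (N + k))"
    by (rule close_arrays_compose[OF close]) simp
  moreover have "close_arrays (\<lambda>N. Suc (steps T N)) (\<lambda>N k. grid x N (N + k)) (\<lambda>N k. x (real k / real N))"
    unfolding close_arrays_def
  proof (intro allI impI)
    fix e :: real assume "e > 0"
    show "\<forall>\<^sub>F N in sequentially. \<forall>k<Suc (steps T N). \<bar>grid x N (N + k) - x (real k / real N)\<bar> \<le> e"
      using eventually_gt_at_top[of 0]
      by eventually_elim (use \<open>e > 0\<close> in \<open>simp add: grid_def add_divide_distrib\<close>)
  qed
  ultimately show ?thesis by (rule close_arrays_trans)
qed

lemma sum_drift_inc_converges: "(\<lambda>N. sum_drift_inc N (steps T N) (v N)) \<longlonglongrightarrow> drift_integral T x"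
  unfolding sum_drift_inc_by_parts drift_integral_def
proof (intro tendsto_diff tendsto_mult)
  have xc: "continuous_on {0..T} x" by (rule continuous_on_subset[OF x]) auto
  show "(\<lambda>N. drift N (v N) (steps T N)) \<longlonglongrightarrow> moving x T" "(\<lambda>N. drift N (v N) 0) \<longlonglongrightarrow> moving x 0"
    by (rule close_arrays_last[OF close_drift moving_continuous[OF x]])+
  show "(\<lambda>N. v N (N + steps T N)) \<longlonglongrightarrow> x T" by (rule close_arrays_last(1)[OF close_grid_shift xc])
  show "(\<lambda>N. v N N) \<longlonglongrightarrow> x 0" using close_arrays_last(2)[OF close_grid_shift xc] by simp
  show "(\<lambda>N. (\<Sum>k<steps T N. v N (Suc (N + k)) * (v N (N + k) - v N k)) / real N) \<longlonglongrightarrow> integral {0..T} (\<lambda>s. x s * (x s - x (s - 1)))"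
  proof (rule riemann_sum_converges[OF T])
    have "continuous_on {0..T} (\<lambda>s. x (s - 1))"
      by (rule continuous_on_compose2[OF x]) (auto intro!: continuous_intros)
    then show "continuous_on {0..T} (\<lambda>s. x s * (x s - x (s - 1)))" by (intro continuous_intros xc)
    obtain B where B: "\<forall>t\<in>{-1..T}. \<bar>x t\<bar> \<le> B" using path_bounded by auto
    have c1: "close_arrays (steps T) (\<lambda>N k. v N (N + k)) (\<lambda>N k. x (real k / real N))"
      by (rule close_arrays_mono[OF close_grid_shift]) simp
    have c2: "close_arrays (steps T) (\<lambda>N k. v N k) (\<lambda>N k. x (real k / real N - 1))"
      using close_arrays_mono[OF close, of "steps T"] by (simp add: grid_def[abs_def])
    have c3: "close_arrays (steps T) (\<lambda>N k. v N (Suc (N + k))) (\<lambda>N k. x (real k / real N))"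
    proof (rule close_arrays_trans)
      show "close_arrays (steps T) (\<lambda>N k. v N (Suc (N + k))) (\<lambda>N k. x (real (Suc k) / real N))"
        using close_arrays_compose[OF close_grid_shift, of "steps T" "\<lambda>N. Suc"] by simp
      show "close_arrays (steps T) (\<lambda>N k. x (real (Suc k) / real N)) (\<lambda>N k. x (real k / real N))"
        unfolding close_arrays_def
      proof (intro allI impI)
        fix e :: real assume "e > 0"
        from uniform_continuity_grid[OF xc this]
        show "\<forall>\<^sub>F N in sequentially. \<forall>k<steps T N. \<bar>x (real (Suc k) / real N) - x (real k / real N)\<bar> \<le> e"
        proof eventually_elim
          case (elim N)
          show ?case
          proof (intro allI impI)
            fix k assume k: "k < steps T N"
            have "real (Suc k) / real N \<in> {0..T}" "real k / real N \<in> {0..T}"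
              using elim k index_le_steps[OF T, of N "Suc k"] index_le_steps[OF T, of N k] by auto
            moreover have "\<bar>real (Suc k) / real N - real k / real N\<bar> \<le> 1 / real N" by (simp add: add_divide_distrib)
            ultimately show "\<bar>x (real (Suc k) / real N) - x (real k / real N)\<bar> \<le> e" using elim by blast
          qed
        qed
      qed
    qed
    show "close_arrays (steps T) (\<lambda>N k. v N (Suc (N + k)) * (v N (N + k) - v N k)) (\<lambda>N k. x (real k / real N) * (x (real k / real N) - x (real k / real N - 1)))"
    proof (rule close_arrays_mult[OF c3 close_arrays_diff[OF c1 c2], where B = "2 * B"])
      show "\<forall>\<^sub>F N in sequentially. \<forall>k<steps T N. \<bar>x (real k / real N)\<bar> \<le> 2 * B \<and> \<bar>x (real k / real N) - x (real k / real N - 1)\<bar> \<le> 2 * B"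
        using eventually_gt_at_top[of 0]
      proof eventually_elim
        case (elim N)
        show ?case
        proof (intro allI impI)
          fix k assume k: "k < steps T N"
          have "real k / real N \<le> T" using index_le_steps[OF T elim, of k] k by auto
          moreover have "-1 \<le> real k / real N" by (rule order_trans[of _ 0]) auto
          ultimately have "\<bar>x (real k / real N)\<bar> \<le> B" "\<bar>x (real k / real N - 1)\<bar> \<le> B" using B by auto
          then show "\<bar>x (real k / real N)\<bar> \<le> 2 * B \<and> \<bar>x (real k / real N) - x (real k / real N - 1)\<bar> \<le> 2 * B" by linarith
        qed
      qed
    qed
  qed
qed

lemma step_path_close:
  assumes e: "e > 0"
  shows "\<forall>\<^sub>F N in sequentially. \<forall>t\<in>{-1..T}. \<bar>step_path N (v N) t - x t\<bar> \<le> e"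
proof -
  have "\<forall>\<^sub>F N in sequentially. \<forall>k<Suc (N + steps T N). \<bar>v N k - grid x N k\<bar> \<le> e / 2"
    using close e unfolding close_arrays_def by (meson half_gt_zero)
  moreover have "\<forall>\<^sub>F N in sequentially. N > 0 \<and> (\<forall>u\<in>{-1..T}. \<forall>v\<in>{-1..T}. \<bar>u - v\<bar> \<le> 1 / real N \<longrightarrow> \<bar>x u - x v\<bar> \<le> e / 2)"
    by (rule uniform_continuity_grid) (use e in \<open>auto intro: continuous_on_subset[OF x]\<close>)
  ultimately show ?thesis
  proof eventually_elim
    case (elim N)
    then have N: "N > 0" by simp
    show ?case
    proof
      fix t assume t: "t \<in> {-1..T}"
      define k where "k = nat \<lfloor>(t + 1) * real N\<rfloor>"
      have p: "(t + 1) * real N \<ge> 0" using t by simp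
      have k1: "real k \<le> (t + 1) * real N" unfolding k_def using p by simp
      have k2: "(t + 1) * real N < real k + 1" unfolding k_def using p by simp
      have "(t + 1) * real N \<le> (T + 1) * real N" using t by (intro mult_right_mono) auto
      then have "\<lfloor>(t + 1) * real N\<rfloor> \<le> \<lfloor>real N * T + real N\<rfloor>" by (intro floor_mono) (simp add: algebra_simps)
      then have "k \<le> N + steps T N" unfolding k_def steps_def using T by (simp add: nat_le_iff)
      then have 1: "\<bar>v N k - grid x N k\<bar> \<le> e / 2" using elim by simp
      have "t + 1 \<le> (real k + 1) / real N" using k2 N by (simp add: pos_le_divide_eq)
      moreover have "real k / real N \<le> t + 1" using k1 N by (simp add: pos_divide_le_eq)
      ultimately have "real k / real N \<le> t + 1" "t + 1 - real k / real N \<le> 1 / real N" "0 \<le> real k / real N"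
        by (auto simp: add_divide_distrib)
      then have "\<bar>x (real k / real N - 1) - x t\<bar> \<le> e / 2"
        using elim t by auto
      then show "\<bar>step_path N (v N) t - x t\<bar> \<le> e"
        using 1 unfolding step_path_def k_def[symmetric] grid_def by linarith
    qed
  qed
qed

end

lemma close_arrays_refl: "close_arrays m u u"
  unfolding close_arrays_def by simp

section \<open>Increments of the Wiener process\<close>

lemma distr_increment_gauss:
  assumes W: "wiener_process M W" and st: "0 \<le> s" "s < t"
  shows "distr M borel (\<lambda>\<omega>. W t \<omega> - W s \<omega>) = gauss (t - s)"
proof -
  have "distributed M lborel (\<lambda>\<omega>. W t \<omega> - W s \<omega>) (normal_density 0 (sqrt (t - s)))"
    using W st unfolding wiener_process_def by blast
  then have "distr M lborel (\<lambda>\<omega>. W t \<omega> - W s \<omega>) = gauss (t - s)"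
    unfolding gauss_def by (rule distributed_distr_eq_density)
  moreover have "distr M lborel (\<lambda>\<omega>. W t \<omega> - W s \<omega>) = distr M borel (\<lambda>\<omega>. W t \<omega> - W s \<omega>)"
    by (rule distr_cong) auto
  ultimately show ?thesis by simp
qed

definition noise_of :: "(real \<Rightarrow> 'w \<Rightarrow> real) \<Rightarrow> nat \<Rightarrow> nat \<Rightarrow> 'w \<Rightarrow> nat \<Rightarrow> real" where
  "noise_of W N n \<omega> = (\<lambda>k\<in>{..<n}. increments (\<lambda>t. W t \<omega>) N k)"

definition history_of :: "(real \<Rightarrow> 'w \<Rightarrow> real) \<Rightarrow> nat \<Rightarrow> 'w \<Rightarrow> nat \<Rightarrow> real" where
  "history_of X0 N \<omega> = (\<lambda>i. if i \<le> N then X0 (real i / real N - 1) \<omega> else 0)"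

lemma distr_noise_of:
  assumes W: "wiener_process M W" and N: "N > 0" and n: "n > 0"
  shows "distr M (noise (1 / N) n) (noise_of W N n) = noise (1 / N) n"
proof -
  interpret prob_space M using W unfolding wiener_process_def by simp
  let ?I = "\<lambda>k \<omega>. W (real (Suc k) / real N) \<omega> - W (real k / real N) \<omega>"
  have lt: "real k / real N < real (Suc k) / real N" for k using N by (simp add: divide_strict_right_mono)
  have ind: "indep_vars (\<lambda>_. borel) ?I {..<n}"
  proof -
    have "\<forall>(n::nat) t. 0 \<le> t 0 \<and> (\<forall>i<n. t i < t (Suc i)) \<longrightarrow>
        indep_vars (\<lambda>_. borel) (\<lambda>i \<omega>. W (t (Suc i)) \<omega> - W (t i) \<omega>) {..<n}"
      using W unfolding wiener_process_def by blast
    from this[rule_format, of "\<lambda>k. real k / real N" n] lt show ?thesis by simp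
  qed
  have rv: "?I k \<in> borel_measurable M" for k
  proof -
    have "W (real (Suc k) / real N) \<in> borel_measurable M" "W (real k / real N) \<in> borel_measurable M"
      using W unfolding wiener_process_def by auto
    then show ?thesis by simp
  qed
  have g: "distr M borel (?I k) = gauss (1 / N)" for k
  proof -
    have "distr M borel (?I k) = gauss (real (Suc k) / real N - real k / real N)"
      by (rule distr_increment_gauss[OF W _ lt]) simp
    then show ?thesis by (simp add: diff_divide_distrib[symmetric])
  qed
  have "distr M (\<Pi>\<^sub>M i\<in>{..<n}. borel) (\<lambda>x. \<lambda>i\<in>{..<n}. ?I i x) = (\<Pi>\<^sub>M i\<in>{..<n}. distr M borel (?I i))"
    using indep_vars_iff_distr_eq_PiM'[of "{..<n}" ?I "\<lambda>_. borel"] ind rv n by auto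
  moreover have "distr M (\<Pi>\<^sub>M i\<in>{..<n}. borel) (\<lambda>x. \<lambda>i\<in>{..<n}. ?I i x) = distr M (noise (1 / N) n) (noise_of W N n)"
    unfolding noise_of_def increments_def
    by (rule distr_cong[OF refl _ refl]) (rule sets_PiM_cong; simp)
  ultimately show ?thesis by (simp only: g)
qed

text \<open>Independence of the two processes passes to the finitely many values used by the scheme, because
  these are measurable functions of the restrictions of the processes to their index sets.\<close>

lemma indep_history_noise:
  assumes W: "wiener_process M W" and X0: "continuous_process_on M {-1..0} X0"
    and ind: "indep_processes M {-1..0} X0 {0..} W" and N: "N > 0" and n: "n > 0"
  shows "history_of X0 N \<in> M \<rightarrow>\<^sub>M seqs" "noise_of W N n \<in> M \<rightarrow>\<^sub>M noise (1 / N) n"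
    and "distr M (seqs \<Otimes>\<^sub>M noise (1 / N) n) (\<lambda>\<omega>. (history_of X0 N \<omega>, noise_of W N n \<omega>)) =
      distr M seqs (history_of X0 N) \<Otimes>\<^sub>M noise (1 / N) n"
proof -
  interpret prob_space M using W unfolding wiener_process_def by simp
  define Y1 where "Y1 f = (\<lambda>i. if i \<le> N then f (real i / real N - 1) else 0)" for f :: "real \<Rightarrow> real"
  define Y2 where "Y2 f = (\<lambda>k\<in>{..<n}. f (real (Suc k) / real N) - f (real k / real N))" for f :: "real \<Rightarrow> real"
  have le: "real i / real N \<le> 1" if "i \<le> N" for i using that N by simp
  have m1: "Y1 \<in> Pi\<^sub>M {-1..0} (\<lambda>_. borel) \<rightarrow>\<^sub>M seqs"
  proof (rule measurable_seqsI)
    fix i show "(\<lambda>f. Y1 f i) \<in> borel_measurable (Pi\<^sub>M {-1..0} (\<lambda>_. borel))"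
    proof (cases "i \<le> N")
      case True
      then have "real i / real N - 1 \<in> {-1..0}" using le[of i] by simp
      then show ?thesis using True unfolding Y1_def by (simp add: measurable_component_singleton)
    qed (simp add: Y1_def)
  qed
  have m2: "Y2 \<in> Pi\<^sub>M {0..} (\<lambda>_. borel) \<rightarrow>\<^sub>M noise (1 / N) n"
  proof (rule measurable_PiM_single')
    fix k assume k: "k \<in> {..<n}"
    have "(\<lambda>f. f (real (Suc k) / real N)) \<in> borel_measurable (Pi\<^sub>M {0..} (\<lambda>_. borel :: real measure))"
      "(\<lambda>f. f (real k / real N)) \<in> borel_measurable (Pi\<^sub>M {0..} (\<lambda>_. borel :: real measure))"
      by (rule measurable_component_singleton; simp)+
    then have "(\<lambda>f. f (real (Suc k) / real N) - f (real k / real N)) \<in> borel_measurable (Pi\<^sub>M {0..} (\<lambda>_. borel :: real measure))"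
      by (rule borel_measurable_diff)
    then show "(\<lambda>f. Y2 f k) \<in> Pi\<^sub>M {0..} (\<lambda>_. borel) \<rightarrow>\<^sub>M gauss (1 / N)"
      using k unfolding Y2_def by (simp cong: measurable_cong_sets)
  next
    show "Y2 \<in> space (Pi\<^sub>M {0..} (\<lambda>_. borel)) \<rightarrow> (\<Pi>\<^sub>E k\<in>{..<n}. space (gauss (1 / N)))"
      by (rule Pi_I) (simp add: Y2_def)
  qed
  have "indep_var seqs (Y1 \<circ> (\<lambda>\<omega>. \<lambda>t\<in>{-1..0}. X0 t \<omega>)) (noise (1 / N) n) (Y2 \<circ> (\<lambda>\<omega>. \<lambda>t\<in>{0..}. W t \<omega>))"
    by (rule indep_var_compose[OF ind[unfolded indep_processes_def] m1 m2])
  moreover have "Y1 \<circ> (\<lambda>\<omega>. \<lambda>t\<in>{-1..0}. X0 t \<omega>) = history_of X0 N"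
    using le by (auto simp: fun_eq_iff Y1_def history_of_def)
  moreover have "Y2 \<circ> (\<lambda>\<omega>. \<lambda>t\<in>{0..}. W t \<omega>) = noise_of W N n"
    by (auto simp: fun_eq_iff Y2_def noise_of_def increments_def)
  ultimately have iv: "indep_var seqs (history_of X0 N) (noise (1 / N) n) (noise_of W N n)" by simp
  show "history_of X0 N \<in> M \<rightarrow>\<^sub>M seqs" "noise_of W N n \<in> M \<rightarrow>\<^sub>M noise (1 / N) n"
    using indep_var_rv1[OF iv] indep_var_rv2[OF iv] by auto
  show "distr M (seqs \<Otimes>\<^sub>M noise (1 / N) n) (\<lambda>\<omega>. (history_of X0 N \<omega>, noise_of W N n \<omega>)) =
      distr M seqs (history_of X0 N) \<Otimes>\<^sub>M noise (1 / N) n"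
    using iv unfolding indep_var_distribution_eq distr_noise_of[OF W N n] by simp
qed

lemma nn_integral_history_noise:
  assumes W: "wiener_process M W" and X0: "continuous_process_on M {-1..0} X0"
    and ind: "indep_processes M {-1..0} X0 {0..} W" and N: "N > 0" and n: "n > 0"
    and F: "case_prod F \<in> borel_measurable (seqs \<Otimes>\<^sub>M noise (1 / N) n)"
  shows "(\<integral>\<^sup>+\<omega>. F (history_of X0 N \<omega>) (noise_of W N n \<omega>) \<partial>M) =
    (\<integral>\<^sup>+\<omega>. (\<integral>\<^sup>+\<xi>. F (history_of X0 N \<omega>) \<xi> \<partial>noise (1 / N) n) \<partial>M)"
proof -
  note i = indep_history_noise[OF W X0 ind N n]
  note [measurable] = i(1,2)
  interpret N: prob_space "noise (1 / N) n" using N by (intro prob_space_noise) simp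
  have F': "case_prod F \<in> borel_measurable (distr M seqs (history_of X0 N) \<Otimes>\<^sub>M noise (1 / N) n)"
    using F measurable_cong_sets[OF sets_pair_measure_cong[OF sets_distr refl] refl] by blast
  have "(\<integral>\<^sup>+\<omega>. F (history_of X0 N \<omega>) (noise_of W N n \<omega>) \<partial>M) =
    (\<integral>\<^sup>+z. case_prod F z \<partial>distr M (seqs \<Otimes>\<^sub>M noise (1 / N) n) (\<lambda>\<omega>. (history_of X0 N \<omega>, noise_of W N n \<omega>)))"
    using F by (subst nn_integral_distr) auto
  also have "\<dots> = (\<integral>\<^sup>+p. (\<integral>\<^sup>+\<xi>. F p \<xi> \<partial>noise (1 / N) n) \<partial>distr M seqs (history_of X0 N))"
    unfolding i(3) using N.nn_integral_fst[OF F'] by simp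
  also have "\<dots> = (\<integral>\<^sup>+\<omega>. (\<integral>\<^sup>+\<xi>. F (history_of X0 N \<omega>) \<xi> \<partial>noise (1 / N) n) \<partial>M)"
    using F by (subst nn_integral_distr) (auto intro: N.borel_measurable_nn_integral)
  finally show ?thesis .
qed

lemma integral_history_noise:
  fixes F :: "_ \<Rightarrow> _ \<Rightarrow> complex"
  assumes W: "wiener_process M W" and X0: "continuous_process_on M {-1..0} X0"
    and ind: "indep_processes M {-1..0} X0 {0..} W" and N: "N > 0" and n: "n > 0"
    and F: "case_prod F \<in> borel_measurable (seqs \<Otimes>\<^sub>M noise (1 / N) n)"
    and bd: "\<And>p \<xi>. norm (F p \<xi>) \<le> B"
  shows "(\<integral>\<omega>. F (history_of X0 N \<omega>) (noise_of W N n \<omega>) \<partial>M) =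
    (\<integral>\<omega>. (\<integral>\<xi>. F (history_of X0 N \<omega>) \<xi> \<partial>noise (1 / N) n) \<partial>M)"
proof -
  note i = indep_history_noise[OF W X0 ind N n]
  note [measurable] = i(1,2)
  interpret prob_space M using W unfolding wiener_process_def by simp
  interpret N: prob_space "noise (1 / N) n" using N by (intro prob_space_noise) simp
  interpret D: prob_space "distr M seqs (history_of X0 N)" by (rule prob_space_distr) (rule i(1))
  interpret P: pair_prob_space "distr M seqs (history_of X0 N)" "noise (1 / N) n" ..
  have F': "case_prod F \<in> borel_measurable (distr M seqs (history_of X0 N) \<Otimes>\<^sub>M noise (1 / N) n)"
    using F measurable_cong_sets[OF sets_pair_measure_cong[OF sets_distr refl] refl] by blast
  have int: "integrable (distr M seqs (history_of X0 N) \<Otimes>\<^sub>M noise (1 / N) n) (case_prod F)"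
    by (rule P.P.integrable_const_bound[where B = B, OF _ F'])
      (rule AE_I2, simp add: bd case_prod_unfold)
  have "(\<integral>\<omega>. F (history_of X0 N \<omega>) (noise_of W N n \<omega>) \<partial>M) =
    (\<integral>z. case_prod F z \<partial>distr M (seqs \<Otimes>\<^sub>M noise (1 / N) n) (\<lambda>\<omega>. (history_of X0 N \<omega>, noise_of W N n \<omega>)))"
    using F by (subst integral_distr) auto
  also have "\<dots> = (\<integral>p. (\<integral>\<xi>. F p \<xi> \<partial>noise (1 / N) n) \<partial>distr M seqs (history_of X0 N))"
    unfolding i(3) using P.integral_fst'[OF int] by simp
  also have "\<dots> = (\<integral>\<omega>. (\<integral>\<xi>. F (history_of X0 N \<omega>) \<xi> \<partial>noise (1 / N) n) \<partial>M)"
    using F by (subst integral_distr) (auto intro: N.borel_measurable_lebesgue_integral)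
  finally show ?thesis .
qed

section \<open>The Euler scheme driven by the Wiener process\<close>

lemma solves_sdde_pathwise:
  assumes W: "wiener_process M W" and sol: "solves_sdde M W X0 a Y"
  shows "AE \<omega> in M. pathwise_solution a (\<lambda>t. W t \<omega>) (\<lambda>t. Y t \<omega>) \<and> (\<forall>t\<in>{-1..0}. Y t \<omega> = X0 t \<omega>)"
proof -
  have "AE \<omega> in M. W 0 \<omega> = 0" "AE \<omega> in M. continuous_on {0..} (\<lambda>t. W t \<omega>)"
    using W unfolding wiener_process_def by auto
  moreover have "AE \<omega> in M.
        (\<forall>t\<in>{-1..0}. Y t \<omega> = X0 t \<omega>) \<and>
        (\<forall>t\<ge>0. Y t \<omega> =
           X0 0 \<omega> + a * (LBINT s:{0..t}. (LBINT u:{-1..0}. Y (s + u) \<omega>)) + W t \<omega>)"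
    using sol unfolding solves_sdde_def by simp
  moreover have "AE \<omega> in M. \<omega> \<in> space M" by (rule AE_space)
  ultimately show ?thesis
  proof eventually_elim
    case (elim \<omega>)
    let ?x = "\<lambda>t. Y t \<omega>"
    have x: "continuous_on {-1..} ?x" using sol elim(4) unfolding solves_sdde_def by blast
    have "?x t = ?x 0 + a * integral {0..t} (moving ?x) + W t \<omega>" if t: "t \<ge> 0" for t
    proof -
      have "(LBINT s:{0..t}. (LBINT u:{-1..0}. Y (s + u) \<omega>)) = (LBINT s:{0..t}. moving ?x s)"
      proof (rule set_lebesgue_integral_cong)
        show "\<forall>s. s \<in> {0..t} \<longrightarrow> (LBINT u:{-1..0}. Y (s + u) \<omega>) = moving ?x s"
        proof (intro allI impI)
          fix s assume s: "s \<in> {0..t}"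
          have "continuous_on {s-1..s} ?x" by (rule continuous_on_subset[OF x]) (use s in auto)
          then show "(LBINT u:{-1..0}. Y (s + u) \<omega>) = moving ?x s"
            unfolding moving_def set_integral_shift[where f = ?x] by (rule set_integral_continuous(2))
        qed
      qed simp
      also have "\<dots> = integral {0..t} (moving ?x)"
        by (rule set_integral_continuous(2)) (rule moving_continuous[OF x])
      finally show ?thesis using elim(3) t by auto
    qed
    then show ?case using elim x unfolding pathwise_solution_def by blast
  qed
qed

definition euler_process ::
  "(real \<Rightarrow> 'w \<Rightarrow> real) \<Rightarrow> (real \<Rightarrow> 'w \<Rightarrow> real) \<Rightarrow> real \<Rightarrow> real \<Rightarrow> nat \<Rightarrow> 'w \<Rightarrow> nat \<Rightarrow> real" where
  "euler_process W X0 a T N \<omega> = euler_path N a (history_of X0 N \<omega>) (steps T N) (noise_of W N (steps T N) \<omega>)"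

lemma euler_process_converges:
  assumes W: "wiener_process M W" and sol: "solves_sdde M W X0 a Y" and T: "T \<ge> 0"
  shows "AE \<omega> in M. close_arrays (\<lambda>N. Suc (N + steps T N)) (\<lambda>N. euler_process W X0 a T N \<omega>) (grid (\<lambda>t. Y t \<omega>))"
  using solves_sdde_pathwise[OF W sol]
proof eventually_elim
  case (elim \<omega>)
  let ?x = "\<lambda>t. Y t \<omega>" and ?w = "\<lambda>t. W t \<omega>"
  have "euler_process W X0 a T N \<omega> i = euler N a (grid ?x N) (increments ?w N) i"
    if N: "N > 0" and i: "i < Suc (N + steps T N)" for N i
  proof -
    have "euler_process W X0 a T N \<omega> i = euler N a (history_of X0 N \<omega>) (noise_of W N (steps T N) \<omega>) i"
      using i by (simp add: euler_process_def euler_path_def)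
    also have "\<dots> = euler N a (grid ?x N) (increments ?w N) i"
    proof (rule euler_cong[where n = "steps T N"])
      fix j assume j: "j \<le> N"
      then have "real j / real N \<le> 1" using N by simp
      then show "history_of X0 N \<omega> j = grid ?x N j" using j elim by (simp add: history_of_def grid_def)
    qed (use i in \<open>auto simp: noise_of_def\<close>)
    finally show ?thesis .
  qed
  moreover have "close_arrays (\<lambda>N. Suc (N + steps T N)) (\<lambda>N. euler N a (grid ?x N) (increments ?w N)) (grid ?x)"
    by (rule euler_converges[OF _ T]) (use elim in simp)
  ultimately show ?case
    unfolding close_arrays_def
  proof (intro allI impI)
    fix e :: real
    assume eq: "\<And>N i. 0 < N \<Longrightarrow> i < Suc (N + steps T N) \<Longrightarrow> euler_process W X0 a T N \<omega> i = euler N a (grid ?x N) (increments ?w N) i"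
      and c: "\<forall>e>0. \<forall>\<^sub>F N in sequentially. \<forall>k<Suc (N + steps T N). \<bar>euler N a (grid ?x N) (increments ?w N) k - grid ?x N k\<bar> \<le> e"
      and "e > 0"
    then have "\<forall>\<^sub>F N in sequentially. \<forall>k<Suc (N + steps T N). \<bar>euler N a (grid ?x N) (increments ?w N) k - grid ?x N k\<bar> \<le> e" by blast
    then show "\<forall>\<^sub>F N in sequentially. \<forall>k<Suc (N + steps T N). \<bar>euler_process W X0 a T N \<omega> k - grid ?x N k\<bar> \<le> e"
      using eventually_gt_at_top[of 0] by eventually_elim (simp add: eq)
  qed
qed

lemma measurable_euler_process:
  assumes W: "wiener_process M W" and X0: "continuous_process_on M {-1..0} X0" and N: "N > 0"
  shows "euler_process W X0 a T N \<in> M \<rightarrow>\<^sub>M seqs"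
  unfolding euler_process_def
proof (rule measurable_euler_path)
  fix i assume i: "i \<le> N"
  then have "real i / real N \<le> 1" using N by simp
  then show "(\<lambda>\<omega>. history_of X0 N \<omega> i) \<in> borel_measurable M"
    using X0 i unfolding history_of_def continuous_process_on_def by simp
next
  fix k assume "k < steps T N"
  moreover have "W t \<in> borel_measurable M" if "t \<ge> 0" for t using W that unfolding wiener_process_def by blast
  ultimately show "(\<lambda>\<omega>. noise_of W N (steps T N) \<omega> k) \<in> borel_measurable M"
    unfolding noise_of_def increments_def by simp
qed

lemma eventually_steps_pos: "T > 0 \<Longrightarrow> \<forall>\<^sub>F N in sequentially. N > 0 \<and> steps T N > 0"
proof -
  assume T: "T > 0"
  obtain m :: nat where m: "1 / T \<le> real m" using real_arch_simple by blast
  have "N > 0 \<and> steps T N > 0" if "N \<ge> Suc m" for N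
  proof -
    have "1 / T \<le> real N" using m that by linarith
    then have "1 \<le> real N * T" using T by (simp add: field_simps)
    then show ?thesis using that unfolding steps_def by simp
  qed
  then show ?thesis unfolding eventually_sequentially by blast
qed

lemma euler_process_girsanov:
  assumes W: "wiener_process M W" and X0: "continuous_process_on M {-1..0} X0"
    and ind: "indep_processes M {-1..0} X0 {0..} W" and N: "N > 0" and n: "steps T N > 0"
    and f: "f \<in> borel_measurable seqs"
  shows "(\<integral>\<^sup>+\<omega>. f (euler_process W X0 b T N \<omega>) \<partial>M) =
    (\<integral>\<^sup>+\<omega>. f (euler_process W X0 a T N \<omega>) * ennreal (exp (loglik a b
       (sum_drift_inc N (steps T N) (euler_process W X0 a T N \<omega>))
       (sum_drift_sq N (steps T N) (euler_process W X0 a T N \<omega>)))) \<partial>M)"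
proof -
  let ?n = "steps T N"
  have e [measurable]: "(\<lambda>(p, \<xi>). euler_path N c p ?n \<xi>) \<in> seqs \<Otimes>\<^sub>M noise (1 / N) ?n \<rightarrow>\<^sub>M seqs" for c
    unfolding case_prod_unfold by (rule measurable_euler_path) measurable
  note [measurable] = f
  have L [measurable]: "(\<lambda>v. ennreal (exp (loglik a b (sum_drift_inc N ?n v) (sum_drift_sq N ?n v)))) \<in> borel_measurable seqs"
    unfolding loglik_def by measurable
  have "(\<integral>\<^sup>+\<omega>. f (euler_process W X0 b T N \<omega>) \<partial>M) =
    (\<integral>\<^sup>+\<omega>. (\<integral>\<^sup>+\<xi>. f (euler_path N b (history_of X0 N \<omega>) ?n \<xi>) \<partial>noise (1 / N) ?n) \<partial>M)"
    unfolding euler_process_def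
    by (rule nn_integral_history_noise[OF W X0 ind N n])
      (use measurable_compose[OF e f] in \<open>simp add: case_prod_unfold\<close>)
  also have "\<dots> = (\<integral>\<^sup>+\<omega>. (\<integral>\<^sup>+\<xi>. f (euler_path N a (history_of X0 N \<omega>) ?n \<xi>) *
      ennreal (exp (loglik a b (sum_drift_inc N ?n (euler_path N a (history_of X0 N \<omega>) ?n \<xi>)) (sum_drift_sq N ?n (euler_path N a (history_of X0 N \<omega>) ?n \<xi>))))
      \<partial>noise (1 / N) ?n) \<partial>M)"
    by (intro nn_integral_cong discrete_girsanov[OF N f])
  also have "\<dots> = (\<integral>\<^sup>+\<omega>. f (euler_process W X0 a T N \<omega>) * ennreal (exp (loglik a b
       (sum_drift_inc N (steps T N) (euler_process W X0 a T N \<omega>))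
       (sum_drift_sq N (steps T N) (euler_process W X0 a T N \<omega>)))) \<partial>M)"
    unfolding euler_process_def
    by (rule nn_integral_history_noise[OF W X0 ind N n, symmetric])
      (use measurable_compose[OF e borel_measurable_times_ennreal[OF f L]] in \<open>simp add: case_prod_unfold\<close>)
  finally show ?thesis .
qed

section \<open>Lipschitz functionals of paths\<close>

text \<open>Such a functional is continuous for the product topology, and the Borel sets of that topology on
  sequences are the product of the Borel sets of the factors.\<close>

lemma measurable_lipschitz_seqs:
  fixes \<phi> :: "(nat \<Rightarrow> real) \<Rightarrow> real"
  assumes "\<And>u v. \<bar>\<phi> u - \<phi> v\<bar> \<le> K * (\<Sum>i<m. \<bar>u i - v i\<bar>)"
  shows "\<phi> \<in> borel_measurable seqs"
proof -
  have "isCont \<phi> u" for u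
  proof -
    have c: "continuous_on UNIV (\<lambda>v. K * (\<Sum>i<m. \<bar>v i - u i\<bar>))"
      by (intro continuous_intros continuous_on_product_coordinates)
    have "isCont (\<lambda>v. K * (\<Sum>i<m. \<bar>v i - u i\<bar>)) u"
      using c by (simp add: continuous_on_eq_continuous_at)
    then have "((\<lambda>v. K * (\<Sum>i<m. \<bar>v i - u i\<bar>)) \<longlongrightarrow> K * (\<Sum>i<m. \<bar>u i - u i\<bar>)) (at u)"
      by (rule isContD)
    then have l: "((\<lambda>v. K * (\<Sum>i<m. \<bar>v i - u i\<bar>)) \<longlongrightarrow> 0) (at u)" by simp
    have "((\<lambda>v. \<phi> v - \<phi> u) \<longlongrightarrow> 0) (at u)"
      by (rule Lim_null_comparison[OF _ l]) (use assms in \<open>auto intro!: always_eventually\<close>)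
    then show ?thesis by (simp add: isCont_def LIM_zero_iff)
  qed
  then have "continuous_on UNIV \<phi>" by (simp add: continuous_on_eq_continuous_at)
  then have "\<phi> \<in> borel_measurable borel" by (rule borel_measurable_continuous_onI)
  then show ?thesis using measurable_cong_sets[OF sets_PiM_equal_borel refl] by blast
qed

text \<open>Lipschitz functionals for the supremum norm on \<open>[-1, T]\<close>. They are defined on all functions, so that
  they can be applied to step functions as well as to paths.\<close>

definition path_lipschitz :: "real \<Rightarrow> ((real \<Rightarrow> real) \<Rightarrow> real) \<Rightarrow> bool" where
  "path_lipschitz T G \<longleftrightarrow> (\<exists>K\<ge>0. \<forall>x y e. (\<forall>t\<in>{-1..T}. \<bar>x t - y t\<bar> \<le> e) \<longrightarrow> \<bar>G x - G y\<bar> \<le> K * e)"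

lemma step_path_index:
  assumes "T \<ge> 0" "t \<in> {-1..T}"
  shows "nat \<lfloor>(t + 1) * real N\<rfloor> < Suc (N + steps T N)"
proof -
  have "(t + 1) * real N \<le> (T + 1) * real N" using assms by (intro mult_right_mono) auto
  then have "\<lfloor>(t + 1) * real N\<rfloor> \<le> \<lfloor>real N * T + real N\<rfloor>" by (intro floor_mono) (simp add: algebra_simps)
  then have "nat \<lfloor>(t + 1) * real N\<rfloor> \<le> N + steps T N" unfolding steps_def using assms by (simp add: nat_le_iff)
  then show ?thesis by simp
qed

lemma measurable_step_path_functional:
  assumes G: "path_lipschitz T G" and T: "T \<ge> 0"
  shows "(\<lambda>v. G (step_path N v)) \<in> borel_measurable seqs"
proof -
  obtain K where K: "K \<ge> 0" "\<And>x y e. (\<forall>t\<in>{-1..T}. \<bar>x t - y t\<bar> \<le> e) \<Longrightarrow> \<bar>G x - G y\<bar> \<le> K * e"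
    using G unfolding path_lipschitz_def by blast
  show ?thesis
  proof (rule measurable_lipschitz_seqs)
    fix u v :: "nat \<Rightarrow> real"
    show "\<bar>G (step_path N u) - G (step_path N v)\<bar> \<le> K * (\<Sum>i<Suc (N + steps T N). \<bar>u i - v i\<bar>)"
    proof (rule K(2), rule ballI)
      fix t assume t: "t \<in> {-1..T}"
      show "\<bar>step_path N u t - step_path N v t\<bar> \<le> (\<Sum>i<Suc (N + steps T N). \<bar>u i - v i\<bar>)"
        unfolding step_path_def
        by (rule member_le_sum) (use step_path_index[OF T t] in auto)
    qed
  qed
qed

lemma step_path_functional_converges:
  assumes G: "path_lipschitz T G" and T: "T \<ge> 0" and x: "continuous_on {-1..} x"
    and close: "close_arrays (\<lambda>N. Suc (N + steps T N)) v (grid x)"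
  shows "(\<lambda>N. G (step_path N (v N))) \<longlonglongrightarrow> G x"
proof -
  obtain K where K: "K \<ge> 0" "\<And>x y e. (\<forall>t\<in>{-1..T}. \<bar>x t - y t\<bar> \<le> e) \<Longrightarrow> \<bar>G x - G y\<bar> \<le> K * e"
    using G unfolding path_lipschitz_def by blast
  show ?thesis
  proof (rule tendsto_if_close[OF K(1)])
    fix e :: real assume "e > 0"
    from step_path_close[OF x T close this]
    show "\<forall>\<^sub>F N in sequentially. \<bar>G (step_path N (v N)) - G x\<bar> \<le> K * e"
      by eventually_elim (rule K(2))
  qed
qed

definition continuous_paths :: "'w measure \<Rightarrow> (real \<Rightarrow> 'w \<Rightarrow> real) \<Rightarrow> bool" where
  "continuous_paths M Y \<longleftrightarrow> (\<forall>t\<ge>-1. Y t \<in> borel_measurable M) \<and> (\<forall>\<omega>\<in>space M. continuous_on {-1..} (\<lambda>t. Y t \<omega>))"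

lemma solves_sdde_continuous_paths: "solves_sdde M W X0 a Y \<Longrightarrow> continuous_paths M Y"
  unfolding solves_sdde_def continuous_paths_def by blast

lemma measurable_grid:
  assumes "continuous_paths M Y"
  shows "(\<lambda>\<omega>. grid (\<lambda>t. Y t \<omega>) N) \<in> M \<rightarrow>\<^sub>M seqs"
proof (rule measurable_seqsI)
  fix i
  have "-1 \<le> real i / real N - 1" by simp
  then show "(\<lambda>\<omega>. grid (\<lambda>t. Y t \<omega>) N i) \<in> borel_measurable M"
    using assms unfolding continuous_paths_def grid_def by blast
qed

lemma measurable_path_functionals:
  assumes Y: "continuous_paths M Y" and T: "T \<ge> 0"
  shows "path_lipschitz T G \<Longrightarrow> (\<lambda>\<omega>. G (\<lambda>t. Y t \<omega>)) \<in> borel_measurable M"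
    and "(\<lambda>\<omega>. drift_integral T (\<lambda>t. Y t \<omega>)) \<in> borel_measurable M"
    and "(\<lambda>\<omega>. energy T (\<lambda>t. Y t \<omega>)) \<in> borel_measurable M"
proof -
  note m = measurable_compose[OF measurable_grid[OF Y]]
  have c: "continuous_on {-1..} (\<lambda>t. Y t \<omega>)" if "\<omega> \<in> space M" for \<omega>
    using Y that unfolding continuous_paths_def by blast
  show "(\<lambda>\<omega>. G (\<lambda>t. Y t \<omega>)) \<in> borel_measurable M" if G: "path_lipschitz T G"
    by (rule borel_measurable_LIMSEQ_real[OF step_path_functional_converges[OF G T c close_arrays_refl]])
      (auto intro: m measurable_step_path_functional[OF G T])
  show "(\<lambda>\<omega>. drift_integral T (\<lambda>t. Y t \<omega>)) \<in> borel_measurable M"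
    by (rule borel_measurable_LIMSEQ_real[OF sum_drift_inc_converges[OF c T close_arrays_refl]])
      (auto intro: m measurable_sum_drift)
  show "(\<lambda>\<omega>. energy T (\<lambda>t. Y t \<omega>)) \<in> borel_measurable M"
    by (rule borel_measurable_LIMSEQ_real[OF sum_drift_sq_converges[OF c T close_arrays_refl]])
      (auto intro: m measurable_sum_drift)
qed

section \<open>The Girsanov formula for the delay equation\<close>

text \<open>The driving process and the history are shared by the solutions \<open>X b\<close> for all parameters \<open>b\<close>.\<close>

locale affine_delay_model =
  fixes M :: "'w measure" and W X0 :: "real \<Rightarrow> 'w \<Rightarrow> real" and X :: "real \<Rightarrow> real \<Rightarrow> 'w \<Rightarrow> real"
  assumes wiener: "wiener_process M W"
    and initial: "continuous_process_on M {-1..0} X0"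
    and indep: "indep_processes M {-1..0} X0 {0..} W"
    and solution: "\<And>b. solves_sdde M W X0 b (X b)"
begin

sublocale prob_space M using wiener unfolding wiener_process_def by simp

lemma paths: "continuous_paths M (X b)"
  by (rule solves_sdde_continuous_paths[OF solution])

lemma euler_close:
  assumes "T \<ge> 0"
  shows "AE \<omega> in M. continuous_on {-1..} (\<lambda>t. X b t \<omega>) \<and>
    close_arrays (\<lambda>N. Suc (N + steps T N)) (\<lambda>N. euler_process W X0 b T N \<omega>) (grid (\<lambda>t. X b t \<omega>))"
  using euler_process_converges[OF wiener solution assms, of b] AE_space
  by eventually_elim (use paths[of b] in \<open>auto simp: continuous_paths_def\<close>)

text \<open>The discrete formula is applied to \<open>G\<close> times a truncated density. The truncation makes the
  integrands on both sides bounded, so that dominated convergence applies as the step tends to zero;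
  it uses \<open>min u K * exp l = min 1 (K * exp l)\<close> for \<open>u = exp (- l)\<close>.\<close>

lemma girsanov_truncated:
  assumes T: "T > 0" and G: "path_lipschitz T G" "\<And>x. 0 \<le> G x" "\<And>x. G x \<le> 1" and K: "K \<ge> 0"
  shows "(\<integral>\<^sup>+\<omega>. ennreal (G (\<lambda>t. X b t \<omega>) * min (exp (- loglik a b (drift_integral T (\<lambda>t. X b t \<omega>)) (energy T (\<lambda>t. X b t \<omega>)))) K) \<partial>M)
    = (\<integral>\<^sup>+\<omega>. ennreal (G (\<lambda>t. X a t \<omega>) * min 1 (K * exp (loglik a b (drift_integral T (\<lambda>t. X a t \<omega>)) (energy T (\<lambda>t. X a t \<omega>))))) \<partial>M)"
    (is "?L = ?R")
proof -
  have T0: "T \<ge> 0" using T by simp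
  define l where "l N v = loglik a b (sum_drift_inc N (steps T N) v) (sum_drift_sq N (steps T N) v)" for N v
  define f where "f N v = G (step_path N v) * min (exp (- l N v)) K" for N v
  define g where "g N v = G (step_path N v) * min 1 (K * exp (l N v))" for N v
  have lm [measurable]: "l N \<in> borel_measurable seqs" for N
    unfolding l_def[abs_def] loglik_def by measurable
  note [measurable] = measurable_step_path_functional[OF G(1) T0]
  have fm [measurable]: "f N \<in> borel_measurable seqs" "g N \<in> borel_measurable seqs" for N
    unfolding f_def[abs_def] g_def[abs_def] by measurable
  have fg: "f N v * exp (l N v) = g N v" for N v
    unfolding f_def g_def by (auto simp: min_def exp_minus field_simps)
  have f0: "0 \<le> f N v" "f N v \<le> K" for N v
    unfolding f_def using G(2,3)[of "step_path N v"] K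
      mult_mono[of "G (step_path N v)" 1 "min (exp (- l N v)) K" K] by auto
  have g0: "0 \<le> g N v" "g N v \<le> 1" for N v
    unfolding g_def using G(2,3)[of "step_path N v"] K
      mult_mono[of "G (step_path N v)" 1 "min 1 (K * exp (l N v))" 1] by auto
  let ?E = "\<lambda>b N. euler_process W X0 b T N"
  have eq: "\<forall>\<^sub>F N in sequentially. (\<integral>\<^sup>+\<omega>. ennreal (f N (?E b N \<omega>)) \<partial>M) = (\<integral>\<^sup>+\<omega>. ennreal (g N (?E a N \<omega>)) \<partial>M)"
    using eventually_steps_pos[OF T]
  proof eventually_elim
    case (elim N)
    have "(\<integral>\<^sup>+\<omega>. ennreal (f N (?E b N \<omega>)) \<partial>M) =
      (\<integral>\<^sup>+\<omega>. ennreal (f N (?E a N \<omega>)) * ennreal (exp (l N (?E a N \<omega>))) \<partial>M)"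
      unfolding l_def
      by (rule euler_process_girsanov[OF wiener initial indep]) (use elim in auto)
    also have "\<dots> = (\<integral>\<^sup>+\<omega>. ennreal (g N (?E a N \<omega>)) \<partial>M)"
      by (intro nn_integral_cong) (simp add: fg[symmetric] ennreal_mult' f0)
    finally show ?case .
  qed
  have Em: "(\<lambda>\<omega>. h (?E c (Suc N) \<omega>)) \<in> borel_measurable M" if "h \<in> borel_measurable seqs" for h :: "_ \<Rightarrow> real" and c N
    by (rule measurable_compose[OF measurable_euler_process[OF wiener initial] that]) simp
  note Xm [measurable] = measurable_path_functionals(1)[OF paths T0 G(1)] measurable_path_functionals(2,3)[OF paths T0]
  have llim: "(\<lambda>N. l N (?E c N \<omega>)) \<longlonglongrightarrow> loglik a b (drift_integral T (\<lambda>t. X c t \<omega>)) (energy T (\<lambda>t. X c t \<omega>))"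
    "(\<lambda>N. G (step_path N (?E c N \<omega>))) \<longlonglongrightarrow> G (\<lambda>t. X c t \<omega>)"
    if "continuous_on {-1..} (\<lambda>t. X c t \<omega>)" "close_arrays (\<lambda>N. Suc (N + steps T N)) (\<lambda>N. ?E c N \<omega>) (grid (\<lambda>t. X c t \<omega>))" for c \<omega>
    unfolding l_def loglik_def
    by (intro tendsto_intros sum_drift_inc_converges[OF that(1) T0 that(2)] sum_drift_sq_converges[OF that(1) T0 that(2)])
      (rule step_path_functional_converges[OF G(1) T0 that])
  have lim1: "(\<lambda>N. \<integral>\<^sup>+\<omega>. ennreal (f (Suc N) (?E b (Suc N) \<omega>)) \<partial>M) \<longlonglongrightarrow> ?L"
  proof (rule nn_integral_dominated_convergence[where w = "\<lambda>_. ennreal K"])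
    show "AE \<omega> in M. (\<lambda>N. ennreal (f (Suc N) (?E b (Suc N) \<omega>))) \<longlonglongrightarrow>
      ennreal (G (\<lambda>t. X b t \<omega>) * min (exp (- loglik a b (drift_integral T (\<lambda>t. X b t \<omega>)) (energy T (\<lambda>t. X b t \<omega>)))) K)"
      using euler_close[OF T0, of b]
    proof eventually_elim
      case (elim \<omega>)
      show ?case
        unfolding f_def by (intro tendsto_intros LIMSEQ_Suc llim) (use elim in auto)
    qed
    show "(\<lambda>\<omega>. ennreal (f (Suc N) (?E b (Suc N) \<omega>))) \<in> borel_measurable M" for N
      using Em[OF fm(1)] by measurable
    show "(\<lambda>\<omega>. ennreal (G (\<lambda>t. X b t \<omega>) * min (exp (- loglik a b (drift_integral T (\<lambda>t. X b t \<omega>)) (energy T (\<lambda>t. X b t \<omega>)))) K)) \<in> borel_measurable M"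
      unfolding loglik_def by measurable
  qed (auto simp: f0 emeasure_space_1 ennreal_leI)
  have lim2: "(\<lambda>N. \<integral>\<^sup>+\<omega>. ennreal (g (Suc N) (?E a (Suc N) \<omega>)) \<partial>M) \<longlonglongrightarrow> ?R"
  proof (rule nn_integral_dominated_convergence[where w = "\<lambda>_. ennreal 1"])
    show "AE \<omega> in M. (\<lambda>N. ennreal (g (Suc N) (?E a (Suc N) \<omega>))) \<longlonglongrightarrow>
      ennreal (G (\<lambda>t. X a t \<omega>) * min 1 (K * exp (loglik a b (drift_integral T (\<lambda>t. X a t \<omega>)) (energy T (\<lambda>t. X a t \<omega>)))))"
      using euler_close[OF T0, of a]
    proof eventually_elim
      case (elim \<omega>)
      show ?case
        unfolding g_def by (intro tendsto_intros LIMSEQ_Suc llim) (use elim in auto)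
    qed
    show "(\<lambda>\<omega>. ennreal (g (Suc N) (?E a (Suc N) \<omega>))) \<in> borel_measurable M" for N
      using Em[OF fm(2)] by measurable
    show "(\<lambda>\<omega>. ennreal (G (\<lambda>t. X a t \<omega>) * min 1 (K * exp (loglik a b (drift_integral T (\<lambda>t. X a t \<omega>)) (energy T (\<lambda>t. X a t \<omega>)))))) \<in> borel_measurable M"
      unfolding loglik_def by measurable
  qed (auto simp: g0 emeasure_space_1 ennreal_leI simp del: ennreal_1)
  have "(\<lambda>N. \<integral>\<^sup>+\<omega>. ennreal (f (Suc N) (?E b (Suc N) \<omega>)) \<partial>M) \<longlonglongrightarrow> ?R"
    by (rule Lim_transform_eventually[OF lim2])
      (use eventually_sequentially_Suc[of "\<lambda>N. (\<integral>\<^sup>+\<omega>. ennreal (f N (?E b N \<omega>)) \<partial>M) = (\<integral>\<^sup>+\<omega>. ennreal (g N (?E a N \<omega>)) \<partial>M)"] eq in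
        \<open>auto elim!: eventually_mono\<close>)
  then show ?thesis using lim1 LIMSEQ_unique by blast
qed

text \<open>Letting \<open>K\<close> tend to infinity with the roles of \<open>a\<close> and \<open>b\<close> exchanged, so that the truncated density
  increases to the likelihood ratio on one side and the truncation disappears on the other.\<close>

theorem girsanov_functional:
  assumes T: "T > 0" and G: "path_lipschitz T G" "\<And>x. 0 \<le> G x" "\<And>x. G x \<le> 1"
  shows "(\<integral>\<^sup>+\<omega>. ennreal (G (\<lambda>t. X b t \<omega>)) \<partial>M)
    = (\<integral>\<^sup>+\<omega>. ennreal (G (\<lambda>t. X a t \<omega>)) * ennreal (exp (loglik a b (drift_integral T (\<lambda>t. X a t \<omega>)) (energy T (\<lambda>t. X a t \<omega>)))) \<partial>M)"
proof -
  have T0: "T \<ge> 0" using T by simp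
  note Xm [measurable] = measurable_path_functionals(1)[OF paths T0 G(1)] measurable_path_functionals(2,3)[OF paths T0]
  let ?l = "\<lambda>c \<omega>. loglik b a (drift_integral T (\<lambda>t. X c t \<omega>)) (energy T (\<lambda>t. X c t \<omega>))"
  have lm [measurable]: "?l c \<in> borel_measurable M" for c unfolding loglik_def by measurable
  have neg: "- ?l c \<omega> = loglik a b (drift_integral T (\<lambda>t. X c t \<omega>)) (energy T (\<lambda>t. X c t \<omega>))" for c \<omega>
    by (simp add: loglik_def algebra_simps diff_divide_distrib)
  have eq: "(\<integral>\<^sup>+\<omega>. ennreal (G (\<lambda>t. X a t \<omega>) * min (exp (- ?l a \<omega>)) (real k)) \<partial>M)
      = (\<integral>\<^sup>+\<omega>. ennreal (G (\<lambda>t. X b t \<omega>) * min 1 (real k * exp (?l b \<omega>))) \<partial>M)" for k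
    by (rule girsanov_truncated[OF T G]) auto
  have "(\<integral>\<^sup>+\<omega>. ennreal (G (\<lambda>t. X a t \<omega>)) * ennreal (exp (- ?l a \<omega>)) \<partial>M) = (\<integral>\<^sup>+\<omega>. (SUP k. ennreal (G (\<lambda>t. X a t \<omega>) * min (exp (- ?l a \<omega>)) (real k))) \<partial>M)"
  proof (rule nn_integral_cong)
    fix \<omega>
    obtain k0 :: nat where k0: "exp (- ?l a \<omega>) \<le> real k0" using real_arch_simple by blast
    show "ennreal (G (\<lambda>t. X a t \<omega>)) * ennreal (exp (- ?l a \<omega>)) = (SUP k. ennreal (G (\<lambda>t. X a t \<omega>) * min (exp (- ?l a \<omega>)) (real k)))"
      unfolding ennreal_mult'[OF G(2), symmetric] ennreal_mult''[OF exp_ge_zero, symmetric]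
    proof (rule antisym)
      show "ennreal (G (\<lambda>t. X a t \<omega>) * exp (- ?l a \<omega>)) \<le> (SUP k. ennreal (G (\<lambda>t. X a t \<omega>) * min (exp (- ?l a \<omega>)) (real k)))"
        by (rule SUP_upper2[of k0]) (use k0 in \<open>auto simp: min_absorb1\<close>)
      show "(SUP k. ennreal (G (\<lambda>t. X a t \<omega>) * min (exp (- ?l a \<omega>)) (real k))) \<le> ennreal (G (\<lambda>t. X a t \<omega>) * exp (- ?l a \<omega>))"
        by (rule SUP_least, rule ennreal_leI, rule mult_left_mono) (use G(2) in auto)
    qed
  qed
  also have "\<dots> = (SUP k. \<integral>\<^sup>+\<omega>. ennreal (G (\<lambda>t. X a t \<omega>) * min (exp (- ?l a \<omega>)) (real k)) \<partial>M)"
    by (rule nn_integral_monotone_convergence_SUP)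
      (auto simp: incseq_def le_fun_def intro!: ennreal_leI mult_left_mono G(2) min.mono)
  also have "\<dots> = (SUP k. \<integral>\<^sup>+\<omega>. ennreal (G (\<lambda>t. X b t \<omega>) * min 1 (real k * exp (?l b \<omega>))) \<partial>M)"
    unfolding eq ..
  also have "\<dots> = (\<integral>\<^sup>+\<omega>. (SUP k. ennreal (G (\<lambda>t. X b t \<omega>) * min 1 (real k * exp (?l b \<omega>)))) \<partial>M)"
    by (rule nn_integral_monotone_convergence_SUP[symmetric])
      (auto simp: incseq_def le_fun_def intro!: ennreal_leI mult_left_mono mult_right_mono G(2) min.mono)
  also have "\<dots> = (\<integral>\<^sup>+\<omega>. ennreal (G (\<lambda>t. X b t \<omega>)) \<partial>M)"
  proof (rule nn_integral_cong)
    fix \<omega>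
    obtain k0 :: nat where "exp (- ?l b \<omega>) \<le> real k0" using real_arch_simple by blast
    then have "exp (- ?l b \<omega>) * exp (?l b \<omega>) \<le> real k0 * exp (?l b \<omega>)" by (rule mult_right_mono) simp
    then have k0: "1 \<le> real k0 * exp (?l b \<omega>)" by (simp add: exp_minus)
    show "(SUP k. ennreal (G (\<lambda>t. X b t \<omega>) * min 1 (real k * exp (?l b \<omega>)))) = ennreal (G (\<lambda>t. X b t \<omega>))"
    proof (rule antisym)
      show "ennreal (G (\<lambda>t. X b t \<omega>)) \<le> (SUP k. ennreal (G (\<lambda>t. X b t \<omega>) * min 1 (real k * exp (?l b \<omega>))))"
        by (rule SUP_upper2[of k0]) (use k0 in \<open>auto simp: min_absorb1\<close>)
      have "G (\<lambda>t. X b t \<omega>) * min 1 (real k * exp (?l b \<omega>)) \<le> G (\<lambda>t. X b t \<omega>) * 1" for k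
        by (rule mult_left_mono) (use G(2) in auto)
      then show "(SUP k. ennreal (G (\<lambda>t. X b t \<omega>) * min 1 (real k * exp (?l b \<omega>)))) \<le> ennreal (G (\<lambda>t. X b t \<omega>))"
        by (intro SUP_least ennreal_leI) simp
    qed
  qed
  finally show ?thesis unfolding neg by simp
qed

end

section \<open>Open sets of the path space\<close>

lemma mem_path_space:
  assumes "T \<ge> 0"
  shows "x \<in> mspace (path_space T) \<longleftrightarrow> x \<in> extensional {-1..T} \<and> continuous_on {-1..T} x"
proof -
  have "bounded (x ` {-1..T})" if "continuous_on {-1..T} x"
    by (intro compact_imp_bounded compact_continuous_image that) auto
  then show ?thesis
    unfolding path_space_def by (auto simp: continuous_map_iff_continuous)
qed

lemma dist_path_space_le:
  assumes "T \<ge> 0" "x \<in> mspace (path_space T)" "y \<in> mspace (path_space T)"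
  shows "mdist (path_space T) x y \<le> r \<longleftrightarrow> (\<forall>t\<in>{-1..T}. \<bar>x t - y t\<bar> \<le> r)"
  using cfunspace_mdist_le[of x "top_of_set {-1..T}" euclidean_metric y r] assms
  unfolding path_space_def by (auto simp: dist_real_def)

lemma openin_path_space:
  "openin (mtopology_of (path_space T)) U \<longleftrightarrow> U \<subseteq> mspace (path_space T) \<and>
     (\<forall>x\<in>U. \<exists>r>0. \<forall>y\<in>mspace (path_space T). mdist (path_space T) x y < r \<longrightarrow> y \<in> U)"
proof -
  have "mball_of (path_space T) x r \<subseteq> U \<longleftrightarrow> (\<forall>y\<in>mspace (path_space T). mdist (path_space T) x y < r \<longrightarrow> y \<in> U)"
    if "x \<in> mspace (path_space T)" for x r
    using that by (auto simp: subset_iff)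
  then have b: "(\<exists>r>0. mball_of (path_space T) x r \<subseteq> U) \<longleftrightarrow>
      (\<exists>r>0. \<forall>y\<in>mspace (path_space T). mdist (path_space T) x y < r \<longrightarrow> y \<in> U)"
    if "x \<in> mspace (path_space T)" for x
    using that by simp
  have "openin (mtopology_of (path_space T)) U \<longleftrightarrow> U \<subseteq> mspace (path_space T) \<and>
     (\<forall>x\<in>U. \<exists>r>0. mball_of (path_space T) x r \<subseteq> U)"
    unfolding mtopology_of_def Metric_space.openin_mtopology[OF Metric_space_mspace_mdist] mball_of_def Ball_def ..
  also have "\<dots> \<longleftrightarrow> U \<subseteq> mspace (path_space T) \<and>
     (\<forall>x\<in>U. \<exists>r>0. \<forall>y\<in>mspace (path_space T). mdist (path_space T) x y < r \<longrightarrow> y \<in> U)"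
    by (intro conj_cong refl ball_cong b) (erule subsetD)
  finally show ?thesis .
qed

lemma space_borel_path_space [simp]: "space (borel_path_space T) = mspace (path_space T)"
  unfolding borel_path_space_def by (rule space_measure_of_conv)

lemma opens_path_space_Pow: "{U. openin (mtopology_of (path_space T)) U} \<subseteq> Pow (mspace (path_space T))"
  by (auto simp: openin_path_space)

lemma sets_borel_path_space: "sets (borel_path_space T) =
    sigma_sets (mspace (path_space T)) {U. openin (mtopology_of (path_space T)) U}"
  unfolding borel_path_space_def by (rule sets_measure_of[OF opens_path_space_Pow])

text \<open>The distance of \<open>x\<close> from the set \<open>A\<close> in the supremum norm, cut off at \<open>1\<close> so that all suprema exist
  for arbitrary functions.\<close>

definition gap :: "real \<Rightarrow> (real \<Rightarrow> real) set \<Rightarrow> (real \<Rightarrow> real) \<Rightarrow> real" where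
  "gap T A x = (INF c\<in>A. SUP t\<in>{-1..T}. min 1 \<bar>x t - c t\<bar>)"

context
  fixes T :: real and A :: "(real \<Rightarrow> real) set"
  assumes T: "T \<ge> 0" and A: "A \<noteq> {}"
begin

lemma gap_sup_bounds:
  fixes x c :: "real \<Rightarrow> real"
  shows "0 \<le> (SUP t\<in>{-1..T}. min 1 \<bar>x t - c t\<bar>)"
proof -
  have "min 1 \<bar>x 0 - c 0\<bar> \<le> (SUP t\<in>{-1..T}. min 1 \<bar>x t - c t\<bar>)"
    by (rule cSUP_upper) (use T in \<open>auto intro!: bdd_aboveI2[of _ _ 1]\<close>)
  moreover have "0 \<le> min 1 \<bar>x 0 - c 0\<bar>" by simp
  ultimately show ?thesis by linarith
qed

lemma gap_bdd: "bdd_below ((\<lambda>c. SUP t\<in>{-1..T}. min 1 \<bar>x t - c t\<bar>) ` A)"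
  by (rule bdd_belowI2[of _ 0]) (rule gap_sup_bounds)

lemma gap_nonneg: "0 \<le> gap T A x"
  unfolding gap_def by (rule cINF_greatest[OF A gap_sup_bounds])

lemma gap_triangle:
  assumes "\<And>t. t \<in> {-1..T} \<Longrightarrow> \<bar>x t - y t\<bar> \<le> e"
  shows "gap T A x \<le> gap T A y + e"
proof -
  have "gap T A x - e \<le> gap T A y"
    unfolding gap_def[of T A y]
  proof (rule cINF_greatest[OF A])
    fix c assume c: "c \<in> A"
    have "gap T A x \<le> (SUP t\<in>{-1..T}. min 1 \<bar>x t - c t\<bar>)"
      unfolding gap_def by (rule cINF_lower[OF gap_bdd c])
    also have "\<dots> \<le> (SUP t\<in>{-1..T}. min 1 \<bar>y t - c t\<bar>) + e"
    proof (rule cSUP_least)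
      fix t assume t: "t \<in> {-1..T}"
      have "min 1 \<bar>x t - c t\<bar> \<le> min 1 \<bar>y t - c t\<bar> + e" using assms[OF t] by linarith
      also have "min 1 \<bar>y t - c t\<bar> \<le> (SUP t\<in>{-1..T}. min 1 \<bar>y t - c t\<bar>)"
        by (rule cSUP_upper[OF t]) (auto intro!: bdd_aboveI2[of _ _ 1])
      finally show "min 1 \<bar>x t - c t\<bar> \<le> (SUP t\<in>{-1..T}. min 1 \<bar>y t - c t\<bar>) + e" by simp
    qed (use T in auto)
    finally show "gap T A x - e \<le> (SUP t\<in>{-1..T}. min 1 \<bar>y t - c t\<bar>)" by simp
  qed
  then show ?thesis by simp
qed

lemma gap_eq_zero: "x \<in> A \<Longrightarrow> gap T A x = 0"
proof -
  assume x: "x \<in> A"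
  have "gap T A x \<le> (SUP t\<in>{-1..T}. min 1 \<bar>x t - x t\<bar>)"
    unfolding gap_def by (rule cINF_lower[OF gap_bdd x])
  also have "\<dots> = 0" using T by simp
  finally show ?thesis using gap_nonneg[of x] by simp
qed

lemma gap_positive:
  assumes r: "r > 0" and far: "\<And>c. c \<in> A \<Longrightarrow> \<exists>t\<in>{-1..T}. \<bar>x t - c t\<bar> \<ge> r"
  shows "gap T A x > 0"
proof -
  have "min 1 r \<le> gap T A x"
    unfolding gap_def
  proof (rule cINF_greatest[OF A])
    fix c assume "c \<in> A"
    then obtain t where t: "t \<in> {-1..T}" "\<bar>x t - c t\<bar> \<ge> r" using far by blast
    show "min 1 r \<le> (SUP t\<in>{-1..T}. min 1 \<bar>x t - c t\<bar>)"
      by (rule cSUP_upper2[OF _ t(1)]) (use t in \<open>auto intro!: bdd_aboveI2[of _ _ 1]\<close>)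
  qed
  then show ?thesis using r by simp
qed

text \<open>For the complement \<open>A\<close> of an open set these functionals increase to the indicator of the set as \<open>m\<close>
  grows.\<close>

lemma gap_lipschitz: "path_lipschitz T (\<lambda>x. min 1 (real m * gap T A x))"
  unfolding path_lipschitz_def
proof (intro exI[of _ "real m"] conjI allI impI)
  fix x y :: "real \<Rightarrow> real" and e assume e: "\<forall>t\<in>{-1..T}. \<bar>x t - y t\<bar> \<le> e"
  have "gap T A x \<le> gap T A y + e" "gap T A y \<le> gap T A x + e"
    using gap_triangle[of x y e] gap_triangle[of y x e] e by (auto simp: abs_minus_commute)
  then have "real m * gap T A x \<le> real m * (gap T A y + e)" "real m * gap T A y \<le> real m * (gap T A x + e)"
    by (auto intro: mult_left_mono)
  then have "real m * gap T A x \<le> real m * gap T A y + real m * e" "real m * gap T A y \<le> real m * gap T A x + real m * e"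
    by (simp_all only: distrib_left)
  moreover have "0 \<le> real m * e" using e T by (intro mult_nonneg_nonneg) force+
  ultimately show "\<bar>min 1 (real m * gap T A x) - min 1 (real m * gap T A y)\<bar> \<le> real m * e"
    by linarith
qed simp

end

lemma gap_positive_iff:
  assumes T: "T \<ge> 0" and U: "openin (mtopology_of (path_space T)) U" and x: "x \<in> mspace (path_space T)"
    and ne: "mspace (path_space T) - U \<noteq> {}"
  shows "gap T (mspace (path_space T) - U) x > 0 \<longleftrightarrow> x \<in> U"
proof
  assume "x \<in> U"
  then obtain r where r: "r > 0" "\<And>y. y \<in> mspace (path_space T) \<Longrightarrow> mdist (path_space T) x y < r \<Longrightarrow> y \<in> U"
    using U unfolding openin_path_space by blast
  show "gap T (mspace (path_space T) - U) x > 0"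
  proof (rule gap_positive[OF T ne])
    show "r / 2 > 0" using r by simp
    fix c assume c: "c \<in> mspace (path_space T) - U"
    then have "\<not> mdist (path_space T) x c < r" using r by blast
    then have "\<not> mdist (path_space T) x c \<le> r / 2" using r(1) by linarith
    then show "\<exists>t\<in>{-1..T}. r / 2 \<le> \<bar>x t - c t\<bar>"
      using dist_path_space_le[OF T x, of c "r / 2"] c by force
  qed
next
  assume "gap T (mspace (path_space T) - U) x > 0"
  then have "x \<notin> mspace (path_space T) - U" using gap_eq_zero[OF T ne, of x] by auto
  then show "x \<in> U" using x by blast
qed

section \<open>The likelihood ratio on the path space\<close>

lemma restricted_path_mem:
  assumes "T \<ge> 0" "continuous_paths M Y" "\<omega> \<in> space M"
  shows "restricted_path Y T \<omega> \<in> mspace (path_space T)"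
proof -
  have "continuous_on {-1..} (\<lambda>t. Y t \<omega>)" using assms unfolding continuous_paths_def by blast
  then have "continuous_on {-1..T} (\<lambda>t. Y t \<omega>)" by (rule continuous_on_subset) auto
  then have "continuous_on {-1..T} (restricted_path Y T \<omega>)"
    by (rule continuous_on_eq) (simp add: restricted_path_def)
  then show ?thesis using assms(1) by (simp add: mem_path_space restricted_path_def)
qed

lemma path_lipschitz_cong:
  assumes "path_lipschitz T G" "\<And>t. t \<in> {-1..T} \<Longrightarrow> x t = y t"
  shows "G x = G y"
proof -
  obtain K where "\<And>x y e. (\<forall>t\<in>{-1..T}. \<bar>x t - y t\<bar> \<le> e) \<Longrightarrow> \<bar>G x - G y\<bar> \<le> K * e"
    using assms(1) unfolding path_lipschitz_def by blast
  from this[of x y 0] show ?thesis using assms(2) by simp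
qed

text \<open>Open sets are positivity sets of Lipschitz functionals, and those are measurable functions of the
  process.\<close>

lemma measurable_restricted_path:
  assumes Y: "continuous_paths M Y" and T: "T \<ge> 0"
  shows "restricted_path Y T \<in> M \<rightarrow>\<^sub>M borel_path_space T"
  unfolding borel_path_space_def
proof (rule measurable_measure_of[OF opens_path_space_Pow])
  show mem: "restricted_path Y T \<in> space M \<rightarrow> mspace (path_space T)"
    by (rule Pi_I, rule restricted_path_mem[OF T Y])
  fix U assume "U \<in> {U. openin (mtopology_of (path_space T)) U}"
  then have U: "openin (mtopology_of (path_space T)) U" by simp
  show "restricted_path Y T -` U \<inter> space M \<in> sets M"
  proof (cases "mspace (path_space T) - U = {}")
    case True
    then have "restricted_path Y T -` U \<inter> space M = space M" using mem by blast
    then show ?thesis by simp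
  next
    case False
    let ?G = "\<lambda>x. min 1 (real 1 * gap T (mspace (path_space T) - U) x)"
    note G = gap_lipschitz[OF T False, of 1]
    have m [measurable]: "(\<lambda>\<omega>. ?G (\<lambda>t. Y t \<omega>)) \<in> borel_measurable M"
      by (rule measurable_path_functionals(1)[OF Y T G])
    have "restricted_path Y T \<omega> \<in> U \<longleftrightarrow> ?G (\<lambda>t. Y t \<omega>) > 0" if \<omega>: "\<omega> \<in> space M" for \<omega>
    proof -
      have "restricted_path Y T \<omega> \<in> U \<longleftrightarrow> ?G (restricted_path Y T \<omega>) > 0"
        using gap_positive_iff[OF T U restricted_path_mem[OF T Y \<omega>] False] by simp
      also have "?G (restricted_path Y T \<omega>) = ?G (\<lambda>t. Y t \<omega>)"
        by (rule path_lipschitz_cong[OF G]) (simp add: restricted_path_def)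
      finally show ?thesis .
    qed
    then have "restricted_path Y T -` U \<inter> space M = {\<omega>\<in>space M. ?G (\<lambda>t. Y t \<omega>) > 0}" by blast
    also have "\<dots> \<in> sets M" by measurable
    finally show ?thesis .
  qed
qed

lemma moving_cong: "(\<And>t. t \<in> {-1..T} \<Longrightarrow> x t = y t) \<Longrightarrow> s \<in> {0..T} \<Longrightarrow> moving x s = moving y s"
  unfolding moving_def by (rule Henstock_Kurzweil_Integration.integral_cong) auto

lemma functionals_cong:
  assumes T: "T \<ge> 0" and eq: "\<And>t. t \<in> {-1..T} \<Longrightarrow> x t = y t"
  shows "drift_integral T x = drift_integral T y" "energy T x = energy T y"
proof -
  have m: "moving x s = moving y s" if "s \<in> {0..T}" for s by (rule moving_cong[OF eq that])
  show "energy T x = energy T y" unfolding energy_def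
    by (rule Henstock_Kurzweil_Integration.integral_cong) (simp add: m)
  have "integral {0..T} (\<lambda>s. x s * (x s - x (s - 1))) = integral {0..T} (\<lambda>s. y s * (y s - y (s - 1)))"
    by (rule Henstock_Kurzweil_Integration.integral_cong) (simp add: eq)
  then show "drift_integral T x = drift_integral T y" unfolding drift_integral_def using T by (simp add: m eq)
qed

lemma measurable_path_space_eval:
  assumes T: "T \<ge> 0" and t: "t \<in> {-1..T}"
  shows "(\<lambda>x. x t) \<in> borel_measurable (borel_path_space T)"
proof (rule borel_measurableI)
  fix S :: "real set" assume S: "open S"
  have "openin (mtopology_of (path_space T)) ((\<lambda>x. x t) -` S \<inter> mspace (path_space T))"
    unfolding openin_path_space
  proof (intro conjI ballI)
    fix x assume x: "x \<in> (\<lambda>x. x t) -` S \<inter> mspace (path_space T)"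
    then obtain r where r: "r > 0" "\<And>u. \<bar>u - x t\<bar> < r \<Longrightarrow> u \<in> S"
      using S unfolding open_dist dist_real_def by blast
    have "y t \<in> S" if y: "y \<in> mspace (path_space T)" "mdist (path_space T) x y < r" for y
    proof -
      have "\<bar>x t - y t\<bar> \<le> mdist (path_space T) x y"
        using dist_path_space_le[OF T _ y(1), of x] x t by blast
      then show ?thesis using y(2) by (intro r(2)) linarith
    qed
    then show "\<exists>r>0. \<forall>y\<in>mspace (path_space T). mdist (path_space T) x y < r \<longrightarrow> y \<in> (\<lambda>x. x t) -` S \<inter> mspace (path_space T)"
      using r(1) by blast
  qed auto
  then show "(\<lambda>x. x t) -` S \<inter> space (borel_path_space T) \<in> sets (borel_path_space T)"
    unfolding sets_borel_path_space space_borel_path_space by (intro sigma_sets.Basic) simp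
qed

text \<open>The coordinate process on the path space, continued beyond \<open>T\<close> by its value at \<open>T\<close>, is itself a
  process with continuous paths, so the result for processes applies to it.\<close>

lemma measurable_path_space_functionals:
  assumes T: "T \<ge> 0"
  shows "drift_integral T \<in> borel_measurable (borel_path_space T)" "energy T \<in> borel_measurable (borel_path_space T)"
proof -
  define Y where "Y t x = x (min t T)" for t and x :: "real \<Rightarrow> real"
  have Y: "continuous_paths (borel_path_space T) Y"
    unfolding continuous_paths_def
  proof (intro conjI ballI allI impI)
    fix t :: real assume "t \<ge> -1"
    then have "min t T \<in> {-1..T}" using T by auto
    then show "Y t \<in> borel_measurable (borel_path_space T)" unfolding Y_def
      by (rule measurable_path_space_eval[OF T])
  next
    fix x assume "x \<in> space (borel_path_space T)"
    then have "continuous_on {-1..T} x" using mem_path_space[OF T] by simp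
    then show "continuous_on {-1..} (\<lambda>t. Y t x)" unfolding Y_def
      by (rule continuous_on_compose2) (use T in \<open>auto intro!: continuous_intros\<close>)
  qed
  have "drift_integral T (\<lambda>t. Y t x) = drift_integral T x" "energy T (\<lambda>t. Y t x) = energy T x" for x
    by (rule functionals_cong[OF T]; simp add: Y_def)+
  then show "drift_integral T \<in> borel_measurable (borel_path_space T)" "energy T \<in> borel_measurable (borel_path_space T)"
    using measurable_path_functionals(2,3)[OF Y T] by simp_all
qed

context affine_delay_model
begin

lemma prob_space_path_law: "T \<ge> 0 \<Longrightarrow> prob_space (path_law M (X b) T)"
  unfolding path_law_def by (intro prob_space_distr measurable_restricted_path paths)

abbreviation density_functional :: "real \<Rightarrow> real \<Rightarrow> real \<Rightarrow> (real \<Rightarrow> real) \<Rightarrow> ennreal" where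
  "density_functional a b T x \<equiv> ennreal (exp (loglik a b (drift_integral T x) (energy T x)))"

lemma measurable_density_functional:
  "T \<ge> 0 \<Longrightarrow> density_functional a b T \<in> borel_measurable (borel_path_space T)"
  using measurable_path_space_functionals[of T] unfolding loglik_def by measurable

text \<open>Monotone convergence in the Girsanov formula, applied to the Lipschitz functionals that increase to
  the indicator of \<open>U\<close>. For \<open>U\<close> the whole space there is no complement to measure distances from,
  and the constant functional is used instead.\<close>

lemma path_law_open:
  assumes T: "T > 0" and U: "openin (mtopology_of (path_space T)) U"
  shows "emeasure (path_law M (X b) T) U = emeasure (density (path_law M (X a) T) (density_functional a b T)) U"
proof -
  have T0: "T \<ge> 0" using T by simp
  note rm [measurable] = measurable_restricted_path[OF paths T0]
  note [measurable] = measurable_density_functional[OF T0]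
  have Us [measurable]: "U \<in> sets (borel_path_space T)"
    unfolding sets_borel_path_space using U by (intro sigma_sets.Basic) simp
  have dens: "density_functional a b T (restricted_path (X a) T \<omega>) = density_functional a b T (\<lambda>t. X a t \<omega>)" for \<omega>
  proof -
    have "restricted_path (X a) T \<omega> t = X a t \<omega>" if "t \<in> {-1..T}" for t using that by (simp add: restricted_path_def)
    then show ?thesis using functionals_cong[OF T0, of "restricted_path (X a) T \<omega>" "\<lambda>t. X a t \<omega>"] by simp
  qed
  have main: "(\<integral>\<^sup>+\<omega>. indicator U (restricted_path (X b) T \<omega>) \<partial>M) =
    (\<integral>\<^sup>+\<omega>. indicator U (restricted_path (X a) T \<omega>) * density_functional a b T (\<lambda>t. X a t \<omega>) \<partial>M)"
  proof (cases "mspace (path_space T) - U = {}")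
    case True
    then have i: "indicator U (restricted_path (X c) T \<omega>) = (1 :: ennreal)" if "\<omega> \<in> space M" for c \<omega>
    proof -
      have "restricted_path (X c) T \<omega> \<in> U" using True restricted_path_mem[OF T0 paths that] by blast
      then show ?thesis by simp
    qed
    have "path_lipschitz T (\<lambda>_. 1)" unfolding path_lipschitz_def by (intro exI[of _ 0]) simp
    from girsanov_functional[OF T this, where b = b and a = a]
    show ?thesis using i by (simp cong: nn_integral_cong)
  next
    case False
    let ?A = "mspace (path_space T) - U"
    let ?G = "\<lambda>m x. min 1 (real m * gap T ?A x)"
    note G = gap_lipschitz[OF T0 False]
    have Gm [measurable]: "(\<lambda>\<omega>. ?G m (\<lambda>t. X c t \<omega>)) \<in> borel_measurable M" for m c
      by (rule measurable_path_functionals(1)[OF paths T0 G])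
    have dm [measurable]: "(\<lambda>\<omega>. density_functional a b T (\<lambda>t. X a t \<omega>)) \<in> borel_measurable M"
      using measurable_path_functionals(2,3)[OF paths T0] unfolding loglik_def by measurable
    have S: "(SUP m. ennreal (?G m (\<lambda>t. X c t \<omega>))) = indicator U (restricted_path (X c) T \<omega>)"
      if \<omega>: "\<omega> \<in> space M" for c \<omega>
    proof -
      let ?x = "restricted_path (X c) T \<omega>"
      have x: "?x \<in> mspace (path_space T)" by (rule restricted_path_mem[OF T0 paths \<omega>])
      have gx: "?G m ?x = ?G m (\<lambda>t. X c t \<omega>)" for m
        by (rule path_lipschitz_cong[OF G]) (simp add: restricted_path_def)
      show ?thesis
      proof (cases "?x \<in> U")
        case True
        then have "gap T ?A ?x > 0" using gap_positive_iff[OF T0 U x False] by simp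
        then obtain k :: nat where "1 / gap T ?A ?x \<le> real k" using real_arch_simple by blast
        then have k: "1 \<le> real k * gap T ?A ?x" using \<open>gap T ?A ?x > 0\<close> by (simp add: pos_divide_le_eq)
        have "(SUP m. ennreal (?G m ?x)) = 1"
        proof (rule antisym)
          show "(SUP m. ennreal (?G m ?x)) \<le> 1" by (rule SUP_least) (simp add: ennreal_le_1)
          show "1 \<le> (SUP m. ennreal (?G m ?x))" by (rule SUP_upper2[of k]) (use k in \<open>simp_all add: min_absorb1\<close>)
        qed
        then show ?thesis using True by (simp only: gx) simp
      next
        case f: False
        then have "gap T ?A ?x = 0" using gap_eq_zero[OF T0 False, of ?x] x by blast
        then have "?G m (\<lambda>t. X c t \<omega>) = 0" for m unfolding gx[symmetric] by simp
        then show ?thesis using f by simp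
      qed
    qed
    have inc: "incseq (\<lambda>m \<omega>. ennreal (?G m (\<lambda>t. X c t \<omega>)))" for c
      unfolding incseq_def le_fun_def
      by (auto intro!: ennreal_leI min.mono mult_right_mono gap_nonneg[OF T0 False])
    have "(\<integral>\<^sup>+\<omega>. indicator U (restricted_path (X b) T \<omega>) \<partial>M) = (\<integral>\<^sup>+\<omega>. (SUP m. ennreal (?G m (\<lambda>t. X b t \<omega>))) \<partial>M)"
      by (rule nn_integral_cong) (simp only: S)
    also have "\<dots> = (SUP m. \<integral>\<^sup>+\<omega>. ennreal (?G m (\<lambda>t. X b t \<omega>)) \<partial>M)"
      by (rule nn_integral_monotone_convergence_SUP[OF inc]) measurable
    also have "\<dots> = (SUP m. \<integral>\<^sup>+\<omega>. ennreal (?G m (\<lambda>t. X a t \<omega>)) * density_functional a b T (\<lambda>t. X a t \<omega>) \<partial>M)"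
      by (subst girsanov_functional[OF T G, where b = b and a = a]) (auto intro!: mult_nonneg_nonneg gap_nonneg[OF T0 False])
    also have "\<dots> = (\<integral>\<^sup>+\<omega>. (SUP m. ennreal (?G m (\<lambda>t. X a t \<omega>)) * density_functional a b T (\<lambda>t. X a t \<omega>)) \<partial>M)"
      by (rule nn_integral_monotone_convergence_SUP[symmetric])
        (use inc[of a] in \<open>auto simp: incseq_def le_fun_def intro!: mult_right_mono\<close>)
    also have "\<dots> = (\<integral>\<^sup>+\<omega>. indicator U (restricted_path (X a) T \<omega>) * density_functional a b T (\<lambda>t. X a t \<omega>) \<partial>M)"
      by (rule nn_integral_cong) (simp only: SUP_mult_right_ennreal[symmetric] S)
    finally show ?thesis .
  qed
  have "emeasure (path_law M (X b) T) U = (\<integral>\<^sup>+x. indicator U x \<partial>path_law M (X b) T)"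
    by (simp add: path_law_def)
  also have "\<dots> = (\<integral>\<^sup>+\<omega>. indicator U (restricted_path (X b) T \<omega>) \<partial>M)"
    unfolding path_law_def by (rule nn_integral_distr) measurable
  also have "\<dots> = (\<integral>\<^sup>+\<omega>. density_functional a b T (restricted_path (X a) T \<omega>) * indicator U (restricted_path (X a) T \<omega>) \<partial>M)"
    unfolding main dens by (simp only: mult.commute)
  also have "\<dots> = (\<integral>\<^sup>+x. density_functional a b T x * indicator U x \<partial>path_law M (X a) T)"
    unfolding path_law_def by (rule nn_integral_distr[symmetric]) measurable
  also have "\<dots> = emeasure (density (path_law M (X a) T) (density_functional a b T)) U"
    unfolding path_law_def
    by (rule emeasure_density[symmetric])
      (simp_all only: measurable_distr_eq1 sets_distr Us measurable_density_functional[OF T0])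
  finally show ?thesis .
qed

text \<open>The open sets are stable under intersection and generate the Borel sets.\<close>

theorem path_law_density:
  assumes T: "T > 0"
  shows "density (path_law M (X a) T) (density_functional a b T) = path_law M (X b) T"
proof (rule measure_eqI_generator_eq[where \<Omega> = "mspace (path_space T)" and E = "{U. openin (mtopology_of (path_space T)) U}" and A = "\<lambda>_. mspace (path_space T)"])
  interpret P: prob_space "path_law M (X b) T" by (rule prob_space_path_law) (use T in simp)
  show "Int_stable {U. openin (mtopology_of (path_space T)) U}"
    by (auto simp: Int_stable_def)
  show "{U. openin (mtopology_of (path_space T)) U} \<subseteq> Pow (mspace (path_space T))"
    by (rule opens_path_space_Pow)
  show "emeasure (density (path_law M (X a) T) (density_functional a b T)) U = emeasure (path_law M (X b) T) U"
    if "U \<in> {U. openin (mtopology_of (path_space T)) U}" for U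
    using path_law_open[OF T, of U, where b = b and a = a] that by simp
  have o: "openin (mtopology_of (path_space T)) (mspace (path_space T))"
    using openin_topspace[of "mtopology_of (path_space T)"] by simp
  then show "range (\<lambda>_. mspace (path_space T)) \<subseteq> {U. openin (mtopology_of (path_space T)) U}" by auto
  show "emeasure (density (path_law M (X a) T) (density_functional a b T)) (mspace (path_space T)) \<noteq> \<infinity>"
    unfolding path_law_open[OF T o, where b = b and a = a, symmetric] by simp
qed (simp_all add: path_law_def sets_borel_path_space)

theorem log_likelihood_ratio_eq:
  assumes T: "T > 0"
  shows "AE \<omega> in M. log_likelihood_ratio M X a b T \<omega> =
    loglik a b (drift_integral T (\<lambda>t. X a t \<omega>)) (energy T (\<lambda>t. X a t \<omega>))"
proof -
  have T0: "T \<ge> 0" using T by simp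
  interpret P: prob_space "path_law M (X a) T" by (rule prob_space_path_law[OF T0])
  have "AE x in path_law M (X a) T. density_functional a b T x = RN_deriv (path_law M (X a) T) (path_law M (X b) T) x"
    by (rule P.RN_deriv_unique[OF _ path_law_density[OF T]])
      (use measurable_density_functional[OF T0] in \<open>simp add: path_law_def\<close>)
  then have "AE \<omega> in M. density_functional a b T (restricted_path (X a) T \<omega>) =
      RN_deriv (path_law M (X a) T) (path_law M (X b) T) (restricted_path (X a) T \<omega>)"
    unfolding path_law_def[of M "X a"] by (rule AE_distrD[OF measurable_restricted_path[OF paths T0]])
  then show ?thesis
  proof eventually_elim
    case (elim \<omega>)
    have "drift_integral T (restricted_path (X a) T \<omega>) = drift_integral T (\<lambda>t. X a t \<omega>)"
      "energy T (restricted_path (X a) T \<omega>) = energy T (\<lambda>t. X a t \<omega>)"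
      by (rule functionals_cong[OF T0]; simp add: restricted_path_def)+
    with elim show ?case unfolding log_likelihood_ratio_def by (metis enn2real_ennreal exp_ge_zero ln_exp)
  qed
qed

lemma measurable_log_likelihood_ratio:
  assumes T: "T > 0"
  shows "log_likelihood_ratio M X a b T \<in> borel_measurable M"
proof -
  have "RN_deriv (path_law M (X a) T) (path_law M (X b) T) \<in> borel_measurable (path_law M (X a) T)"
    by (rule borel_measurable_RN_deriv)
  then have [measurable]: "RN_deriv (path_law M (X a) T) (path_law M (X b) T) \<in> borel_measurable (borel_path_space T)"
    by (simp add: path_law_def)
  have [measurable]: "restricted_path (X a) T \<in> M \<rightarrow>\<^sub>M borel_path_space T"
    by (rule measurable_restricted_path[OF paths]) (use T in simp)
  show ?thesis unfolding log_likelihood_ratio_def[abs_def] by measurable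
qed

end

section \<open>Variation of constants\<close>

text \<open>Integration over \<open>[0, t]\<close> makes this the convolution of the two functions continued by zero to the
  left.\<close>

definition convolve :: "(real \<Rightarrow> real) \<Rightarrow> (real \<Rightarrow> real) \<Rightarrow> real \<Rightarrow> real" where
  "convolve f g t = integral {0..t} (\<lambda>s. f (t - s) * g s)"

lemma convolve_nonpos [simp]: "t \<le> 0 \<Longrightarrow> convolve f g t = 0"
  unfolding convolve_def by (cases "t = 0") auto

text \<open>The integrand vanishes outside \<open>[0, t - 1]\<close>, so both integrals are over its full support.\<close>

lemma integral_shift_unit:
  fixes f :: "real \<Rightarrow> real"
  assumes f: "continuous_on UNIV f" and t: "t \<ge> 0" and z: "\<And>s. s \<le> 0 \<Longrightarrow> f s = 0" "\<And>s. s \<ge> t - 1 \<Longrightarrow> f s = 0"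
  shows "integral {0..t} (\<lambda>s. f (s - 1)) = integral {0..t} f"
proof -
  have i: "f integrable_on {p..q}" for p q
    by (rule integrable_continuous_real) (rule continuous_on_subset[OF f], simp)
  have "((\<lambda>s. f (s - 1)) has_integral integral {-1..t-1} f) {0..t}"
    using has_integral_affinity'[of f "integral {-1..t-1} f" "-1" "t - 1" 1 "-1"] integrable_integral[OF i]
    by simp
  then have "integral {0..t} (\<lambda>s. f (s - 1)) = integral {-1..t-1} f" by (rule integral_unique)
  also have "\<dots> = integral {-1..t} f"
  proof -
    have "integral {-1..t-1} f + integral {t-1..t} f = integral {-1..t} f"
      by (rule Henstock_Kurzweil_Integration.integral_combine) (use t i in auto)
    moreover have "integral {t-1..t} f = integral {t-1..t} (\<lambda>_. 0)"
      by (rule Henstock_Kurzweil_Integration.integral_cong) (use z in auto)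
    ultimately show ?thesis by simp
  qed
  also have "\<dots> = integral {0..t} f"
  proof -
    have "integral {-1..0} f + integral {0..t} f = integral {-1..t} f"
      by (rule Henstock_Kurzweil_Integration.integral_combine) (use t i in auto)
    moreover have "integral {-1..0} f = integral {-1..0::real} (\<lambda>_. 0)"
      by (rule Henstock_Kurzweil_Integration.integral_cong) (use z in auto)
    ultimately show ?thesis by simp
  qed
  finally show ?thesis .
qed

lemma DERIV_reflect:
  assumes "(f has_real_derivative D) (at (t - s))"
  shows "((\<lambda>s. f (t - s)) has_real_derivative - D) (at s)"
proof -
  have "((\<lambda>s. t - s) has_real_derivative -1) (at s)" by (auto intro!: derivative_eq_intros)
  from DERIV_chain2[where g = "\<lambda>s. t - s", OF assms this] show ?thesis by simp
qed

lemma primitive_reflected: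
  assumes "continuous_on {0..} x" "s < t"
  shows "((\<lambda>s. primitive x (t - s)) has_real_derivative - x (t - s)) (at s)"
  by (rule DERIV_reflect, rule primitive_has_derivative) (use assms in auto)

text \<open>Variation of constants in integrated form. On \<open>[0, t]\<close> one integrates the derivative of
  \<open>P s = x0 (t - s) * primitive x s + a * (primitive x0 (t - s) * primitive (window x) s)\<close>. The
  equations for \<open>x0\<close> and \<open>x\<close> leave \<open>x0 (t - s) * F s\<close> and two delayed products, whose integrals
  agree after a unit shift. Integrating first is essential, since \<open>F\<close> will contain the Wiener path
  and is only continuous.\<close>

theorem primitive_eq_convolution:
  assumes fs: "fundamental_solution a x0" and x: "continuous_on {0..} x" and F: "continuous_on {0..} F"
    and eq: "\<And>t. t \<ge> 0 \<Longrightarrow> x t = F t + a * primitive (window x) t" and t: "t \<ge> 0"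
  shows "primitive x t = convolve x0 F t"
proof -
  note c0 = fundamental_solution_continuous[OF fs]
  have x00: "x0 0 = 1" using fundamental_solution_eq[OF fs, of 0] by simp
  let ?U = "primitive x0" and ?V = "primitive x" and ?A = "primitive (window x)"
  have wc: "continuous_on S (window x)" "continuous_on S (window x0)" for S by (rule window_continuous; fact)+
  have refl_cont: "continuous_on {0..t} (\<lambda>s. g (t - s))" if "continuous_on {0..} g" for g :: "real \<Rightarrow> real"
    by (rule continuous_on_compose2[OF that]) (auto intro!: continuous_intros)
  have shiftU: "continuous_on UNIV (\<lambda>s. ?U (r - s))" and shiftV: "continuous_on UNIV (\<lambda>s. ?V (s - r))" for r
    by (rule continuous_on_compose2[OF primitive_continuous[OF c0, of UNIV]] continuous_on_compose2[OF primitive_continuous[OF x, of UNIV]];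
        auto intro!: continuous_intros)+
  have Fc: "continuous_on {0..t} F" by (rule continuous_on_subset[OF F]) auto
  \<comment> \<open>\<open>P\<close> interpolates between \<open>0\<close> at \<open>s = 0\<close> and the left hand side at \<open>s = t\<close>.\<close>
  define P where "P s = x0 (t - s) * ?V s + a * (?U (t - s) * ?A s)" for s
  define p where "p s = x0 (t - s) * F s + a * (?U (t - 1 - s) * ?V s - ?U (t - s) * ?V (s - 1))" for s
  have "(p has_integral P t - P 0) {0..t}"
  proof (rule fundamental_theorem_of_calculus_interior[OF t])
    show "continuous_on {0..t} P"
      unfolding P_def
      by (intro continuous_intros refl_cont c0 primitive_continuous x wc continuous_on_subset[OF shiftU]) auto
    fix s assume s: "s \<in> {0<..<t}"
    have d1: "((\<lambda>s. x0 (t - s)) has_real_derivative - (a * window x0 (t - s))) (at s)"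
      by (rule DERIV_reflect, rule fundamental_solution_derivative[OF fs]) (use s in auto)
    have d2: "(?V has_real_derivative x s) (at s)" by (rule primitive_has_derivative[OF x]) (use s in auto)
    have d3: "((\<lambda>s. ?U (t - s)) has_real_derivative - x0 (t - s)) (at s)"
      by (rule primitive_reflected[OF c0]) (use s in auto)
    have d4: "(?A has_real_derivative window x s) (at s)"
      by (rule primitive_has_derivative[OF wc(1)]) (use s in auto)
    have "(P has_real_derivative (- (a * window x0 (t - s)) * ?V s + x s * x0 (t - s)) +
        a * (- x0 (t - s) * ?A s + window x s * ?U (t - s))) (at s)"
      unfolding P_def by (intro DERIV_add DERIV_cmult DERIV_mult d1 d2 d3 d4)
    moreover have "(- (a * window x0 (t - s)) * ?V s + x s * x0 (t - s)) +
        a * (- x0 (t - s) * ?A s + window x s * ?U (t - s)) = p s"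
    proof -
      have "x s = F s + a * ?A s" using eq[of s] s by auto
      moreover have "t - s - 1 = t - 1 - s" by simp
      ultimately show ?thesis unfolding p_def window_def by (simp add: algebra_simps)
    qed
    ultimately show "(P has_vector_derivative p s) (at s)"
      by (simp add: has_real_derivative_iff_has_vector_derivative)
  qed
  then have "integral {0..t} p = ?V t"
    by (simp add: integral_unique P_def x00)
  moreover have "integral {0..t} p = convolve x0 F t"
  proof -
    have c1: "continuous_on UNIV (\<lambda>s. ?U (t - 1 - s) * ?V s)"
      by (intro continuous_intros shiftU primitive_continuous[OF x])
    have c2: "continuous_on UNIV (\<lambda>s. ?U (t - s) * ?V (s - 1))"
      by (intro continuous_intros shiftU shiftV)
    have "integral {0..t} (\<lambda>s. ?U (t - 1 - (s - 1)) * ?V (s - 1)) = integral {0..t} (\<lambda>s. ?U (t - 1 - s) * ?V s)"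
      by (rule integral_shift_unit[OF c1 t]) auto
    \<comment> \<open>The two delayed products in \<open>p\<close> are unit shifts of one another, so they cancel in the integral.\<close>
    then have e: "integral {0..t} (\<lambda>s. ?U (t - s) * ?V (s - 1)) = integral {0..t} (\<lambda>s. ?U (t - 1 - s) * ?V s)"
      by simp
    have i0: "(\<lambda>s. x0 (t - s) * F s) integrable_on {0..t}"
      by (intro integrable_continuous_real continuous_intros refl_cont c0 Fc)
    have i1: "(\<lambda>s. ?U (t - 1 - s) * ?V s) integrable_on {0..t}"
      by (rule integrable_continuous_real) (rule continuous_on_subset[OF c1], simp)
    have i2: "(\<lambda>s. ?U (t - s) * ?V (s - 1)) integrable_on {0..t}"
      by (rule integrable_continuous_real) (rule continuous_on_subset[OF c2], simp)
    have "integral {0..t} p = integral {0..t} (\<lambda>s. x0 (t - s) * F s) +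
      integral {0..t} (\<lambda>s. a * (?U (t - 1 - s) * ?V s - ?U (t - s) * ?V (s - 1)))"
      unfolding p_def
      by (rule Henstock_Kurzweil_Integration.integral_add[OF i0])
        (intro integrable_on_mult_right Henstock_Kurzweil_Integration.integrable_diff i1 i2)
    also have "integral {0..t} (\<lambda>s. a * (?U (t - 1 - s) * ?V s - ?U (t - s) * ?V (s - 1))) = 0"
      by (simp add: Henstock_Kurzweil_Integration.integral_diff[OF i1 i2] e)
    finally show ?thesis by (simp add: convolve_def)
  qed
  ultimately show ?thesis by simp
qed

text \<open>The part of the moving integral that lies before time \<open>0\<close>; it vanishes from time \<open>1\<close> on.\<close>

definition history :: "(real \<Rightarrow> real) \<Rightarrow> real \<Rightarrow> real" where
  "history x s = integral {s-1..0} x"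

lemma history_ge_1 [simp]: "s \<ge> 1 \<Longrightarrow> history x s = 0"
  unfolding history_def by (cases "s = 1") auto

lemma moving_eq:
  assumes x: "continuous_on {-1..} x" and s: "s \<ge> 0"
  shows "moving x s = history x s + window x s"
proof -
  have i: "x integrable_on {p..q}" if "p \<ge> -1" for p q
    by (rule integrable_continuous_real) (rule continuous_on_subset[OF x], use that in auto)
  show ?thesis
  proof (cases "s \<ge> 1")
    case True
    have "integral {0..s-1} x + integral {s-1..s} x = integral {0..s} x"
      by (rule Henstock_Kurzweil_Integration.integral_combine) (use True i in auto)
    then show ?thesis using True by (simp add: moving_def window_def primitive_def)
  next
    case False
    have "integral {s-1..0} x + integral {0..s} x = integral {s-1..s} x"
      by (rule Henstock_Kurzweil_Integration.integral_combine) (use False s i in auto)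
    then show ?thesis using False by (simp add: moving_def window_def history_def primitive_def)
  qed
qed

lemma history_continuous:
  assumes x: "continuous_on {-1..} x"
  shows "continuous_on {0..} (history x)"
proof -
  have x0: "continuous_on {0..} x" by (rule continuous_on_subset[OF x]) auto
  have "continuous (at t within {0..}) (history x)" if t: "t \<ge> 0" for t
  proof -
    have "continuous_on {0..t+1} (\<lambda>s. moving x s - window x s)"
      by (intro continuous_intros moving_continuous[OF x] window_continuous[OF x0])
    then have "continuous_on {0..t+1} (history x)"
      by (rule continuous_on_eq) (simp add: moving_eq[OF x])
    then have "continuous (at t within {0..t+1}) (history x)"
      using t by (simp add: continuous_on_eq_continuous_within)
    moreover have "at t within {0..t+1} = at t within {0..}"
      by (rule at_within_nhd[of t "{..<t+1}"]) auto
    ultimately show ?thesis by simp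
  qed
  then show ?thesis by (simp add: continuous_on_eq_continuous_within)
qed

lemma history_bound:
  assumes x: "continuous_on {-1..} x" and d: "d \<ge> 0"
  shows "\<exists>B\<ge>0. \<forall>s\<ge>0. \<bar>history x s\<bar> \<le> B * exp (- d * s)"
proof -
  have "bounded (history x ` {0..1})"
    by (intro compact_imp_bounded compact_continuous_image continuous_on_subset[OF history_continuous[OF x]]) auto
  then obtain B where "\<forall>y\<in>history x ` {0..1}. \<bar>y\<bar> \<le> B" unfolding bounded_real by blast
  then have B: "\<And>s. 0 \<le> s \<Longrightarrow> s \<le> 1 \<Longrightarrow> \<bar>history x s\<bar> \<le> B" by auto
  have B0: "B \<ge> 0" using B[of 0] by simp
  have "\<bar>history x s\<bar> \<le> (B * exp d) * exp (- d * s)" if s: "s \<ge> 0" for s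
  proof (cases "s \<le> 1")
    case True
    have "d * s \<le> d * 1" using True d by (intro mult_left_mono) auto
    then have "B * 1 \<le> B * exp (d - d * s)" using B0 by (intro mult_left_mono) auto
    then show ?thesis using B[OF s True] by (simp add: exp_diff exp_minus divide_inverse mult.assoc)
  qed (use B0 in simp)
  then show ?thesis using B0 by (intro exI[of _ "B * exp d"]) auto
qed

lemma convolve_add:
  assumes "continuous_on {0..} f" "continuous_on {0..} g" "continuous_on {0..} h"
  shows "convolve f (\<lambda>s. g s + h s) t = convolve f g t + convolve f h t"
proof -
  have r: "continuous_on {0..t} (\<lambda>s. f (t - s))"
    by (rule continuous_on_compose2[OF assms(1)]) (auto intro!: continuous_intros)
  have gh: "continuous_on {0..t} g" "continuous_on {0..t} h"
    by (rule continuous_on_subset[OF assms(2)], simp, rule continuous_on_subset[OF assms(3)], simp)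
  show ?thesis unfolding convolve_def
    by (subst Henstock_Kurzweil_Integration.integral_add[symmetric])
      (auto intro!: integrable_continuous_real continuous_intros r gh simp: algebra_simps)
qed

lemma convolve_by_parts:
  assumes x0: "continuous_on {0..} x0" and g: "continuous_on {0..} g"
    and F: "\<And>t. t \<ge> 0 \<Longrightarrow> F t = c + a * primitive g t"
  shows "convolve x0 F t = primitive x0 t * c + a * integral {0..t} (\<lambda>s. primitive x0 (t - s) * g s)"
proof (cases "t \<ge> 0")
  case True
  have rc: "continuous_on {0..t} (\<lambda>s. x0 (t - s))"
    by (rule continuous_on_compose2[OF x0]) (auto intro!: continuous_intros)
  have Uc: "continuous_on {0..t} (\<lambda>s. primitive x0 (t - s))"
    by (rule continuous_on_compose2[OF primitive_continuous[OF x0, of UNIV]]) (auto intro!: continuous_intros)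
  have gc: "continuous_on {0..t} g" by (rule continuous_on_subset[OF g]) auto
  have pc: "continuous_on {0..t} (primitive g)" by (rule primitive_continuous[OF g])
  have "((\<lambda>s. primitive x0 (t - s) * (a * g s) - x0 (t - s) * (c + a * primitive g s)) has_integral
     primitive x0 (t - t) * (c + a * primitive g t) - primitive x0 (t - 0) * (c + a * primitive g 0)) {0..t}"
  proof (rule fundamental_theorem_of_calculus_interior[OF True])
    show "continuous_on {0..t} (\<lambda>s. primitive x0 (t - s) * (c + a * primitive g s))"
      by (intro continuous_intros Uc pc)
    fix s assume s: "s \<in> {0<..<t}"
    have d1: "((\<lambda>s. primitive x0 (t - s)) has_real_derivative - x0 (t - s)) (at s)"
      by (rule primitive_reflected[OF x0]) (use s in auto)
    have d2: "(primitive g has_real_derivative g s) (at s)" by (rule primitive_has_derivative[OF g]) (use s in auto)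
    have "((\<lambda>s. primitive x0 (t - s) * (c + a * primitive g s)) has_real_derivative
        (- x0 (t - s)) * (c + a * primitive g s) + (0 + a * g s) * primitive x0 (t - s)) (at s)"
      by (intro DERIV_mult DERIV_add DERIV_cmult DERIV_const d1 d2)
    then show "((\<lambda>s. primitive x0 (t - s) * (c + a * primitive g s)) has_vector_derivative
        primitive x0 (t - s) * (a * g s) - x0 (t - s) * (c + a * primitive g s)) (at s)"
      by (simp add: has_real_derivative_iff_has_vector_derivative algebra_simps)
  qed
  then have "integral {0..t} (\<lambda>s. primitive x0 (t - s) * (a * g s) - x0 (t - s) * (c + a * primitive g s)) = - primitive x0 t * c"
    by (simp add: integral_unique)
  moreover have "integral {0..t} (\<lambda>s. primitive x0 (t - s) * (a * g s) - x0 (t - s) * (c + a * primitive g s)) =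
    integral {0..t} (\<lambda>s. a * (primitive x0 (t - s) * g s)) - integral {0..t} (\<lambda>s. x0 (t - s) * (c + a * primitive g s))"
    by (subst Henstock_Kurzweil_Integration.integral_diff[symmetric])
      (auto intro!: integrable_continuous_real continuous_intros Uc gc rc pc simp: mult.left_commute)
  moreover have "convolve x0 F t = integral {0..t} (\<lambda>s. x0 (t - s) * (c + a * primitive g s))"
    unfolding convolve_def by (rule Henstock_Kurzweil_Integration.integral_cong) (simp add: F)
  ultimately show ?thesis by simp
qed simp

text \<open>The equation for \<open>x\<close> has the form of the variation of constants formula with forcing
  \<open>x 0 + a * primitive (history x) + w\<close>. Taking differences of \<open>primitive x\<close> over a unit interval
  turns the kernel \<open>primitive x0\<close> into \<open>window x0\<close>; the contribution of \<open>w\<close> is kept as a difference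
  of convolutions.\<close>

theorem moving_decomposition:
  assumes fs: "fundamental_solution a x0" and sol: "pathwise_solution a w x" and t: "t \<ge> 0"
  shows "moving x t = (history x t + window x0 t * x 0 + a * integral {0..t} (\<lambda>s. window x0 (t - s) * history x s))
    + (convolve x0 w t - convolve x0 w (t - 1))"
proof -
  note c0 = fundamental_solution_continuous[OF fs]
  have x: "continuous_on {-1..} x" and w: "continuous_on {0..} w"
    and eq: "\<And>t. t \<ge> 0 \<Longrightarrow> x t = x 0 + a * integral {0..t} (moving x) + w t"
    using sol unfolding pathwise_solution_def by blast+
  have xp: "continuous_on {0..} x" by (rule continuous_on_subset[OF x]) auto
  have hc: "continuous_on {0..} (history x)" by (rule history_continuous[OF x])
  have hc': "continuous_on {0..r} (history x)" for r by (rule continuous_on_subset[OF hc]) auto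
  define F0 where "F0 s = x 0 + a * primitive (history x) s" for s
  have F0c: "continuous_on {0..} F0" unfolding F0_def by (intro continuous_intros primitive_continuous hc)
  have xF: "x r = (F0 r + w r) + a * primitive (window x) r" if r: "r \<ge> 0" for r
  proof -
    have "integral {0..r} (moving x) = integral {0..r} (\<lambda>s. history x s + window x s)"
      by (rule Henstock_Kurzweil_Integration.integral_cong) (simp add: moving_eq[OF x])
    also have "\<dots> = integral {0..r} (history x) + integral {0..r} (window x)"
      by (rule Henstock_Kurzweil_Integration.integral_add)
        (intro integrable_continuous_real hc' window_continuous xp)+
    finally have m: "integral {0..r} (moving x) = primitive (history x) r + primitive (window x) r" by (simp add: primitive_def)
    show ?thesis by (subst eq[OF r]) (simp add: m F0_def algebra_simps)
  qed
  have V: "primitive x r = convolve x0 F0 r + convolve x0 w r" for r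
  proof (cases "r \<ge> 0")
    case True
    have "primitive x r = convolve x0 (\<lambda>s. F0 s + w s) r"
      by (rule primitive_eq_convolution[OF fs xp _ xF True]) (intro continuous_intros F0c w)
    then show ?thesis by (simp add: convolve_add[OF c0 F0c w])
  qed simp
  have C: "convolve x0 F0 r = primitive x0 r * x 0 + a * integral {0..r} (\<lambda>s. primitive x0 (r - s) * history x s)" for r
    by (rule convolve_by_parts[OF c0 hc]) (simp add: F0_def)
  have Uc: "continuous_on {0..t} (\<lambda>s. primitive x0 (r - s))" for r
    by (rule continuous_on_compose2[OF primitive_continuous[OF c0, of UNIV]]) (auto intro!: continuous_intros)
  have ext: "integral {0..t-1} (\<lambda>s. primitive x0 (t - 1 - s) * history x s) = integral {0..t} (\<lambda>s. primitive x0 (t - 1 - s) * history x s)"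
  proof (cases "t \<ge> 1")
    case True
    have "integral {0..t-1} (\<lambda>s. primitive x0 (t - 1 - s) * history x s) + integral {t-1..t} (\<lambda>s. primitive x0 (t - 1 - s) * history x s)
      = integral {0..t} (\<lambda>s. primitive x0 (t - 1 - s) * history x s)"
      by (rule Henstock_Kurzweil_Integration.integral_combine)
        (use True in \<open>auto intro!: integrable_continuous_real continuous_intros Uc hc'\<close>)
    moreover have "integral {t-1..t} (\<lambda>s. primitive x0 (t - 1 - s) * history x s) = integral {t-1..t} (\<lambda>_. 0)"
      by (rule Henstock_Kurzweil_Integration.integral_cong) simp
    ultimately show ?thesis by simp
  next
    case False
    have "integral {0..t} (\<lambda>s. primitive x0 (t - 1 - s) * history x s) = integral {0..t} (\<lambda>_. 0)"
      by (rule Henstock_Kurzweil_Integration.integral_cong) (use False in simp)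
    then show ?thesis using False by simp
  qed
  have D: "integral {0..t} (\<lambda>s. window x0 (t - s) * history x s) =
    integral {0..t} (\<lambda>s. primitive x0 (t - s) * history x s) - integral {0..t} (\<lambda>s. primitive x0 (t - 1 - s) * history x s)"
  proof -
    have "integral {0..t} (\<lambda>s. primitive x0 (t - s) * history x s) - integral {0..t} (\<lambda>s. primitive x0 (t - 1 - s) * history x s)
      = integral {0..t} (\<lambda>s. primitive x0 (t - s) * history x s - primitive x0 (t - 1 - s) * history x s)"
      by (rule Henstock_Kurzweil_Integration.integral_diff[symmetric])
        (intro integrable_continuous_real continuous_intros Uc hc')+
    also have "\<dots> = integral {0..t} (\<lambda>s. window x0 (t - s) * history x s)"
      by (rule Henstock_Kurzweil_Integration.integral_cong)
        (simp add: window_def algebra_simps)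
    finally show ?thesis by simp
  qed
  have "window x t = (convolve x0 F0 t - convolve x0 F0 (t - 1)) + (convolve x0 w t - convolve x0 w (t - 1))"
    unfolding window_def[of x] V by simp
  also have "convolve x0 F0 t - convolve x0 F0 (t - 1) = window x0 t * x 0 + a * integral {0..t} (\<lambda>s. window x0 (t - s) * history x s)"
    unfolding C ext D by (simp add: window_def algebra_simps)
  finally show ?thesis unfolding moving_eq[OF x t] by simp
qed

text \<open>The initial segment only acts up to time \<open>1\<close>, so it can be bounded by a faster exponential, rate
  \<open>d + 1\<close>, and its convolution with a kernel of rate \<open>d\<close> still decays at rate \<open>d\<close>.\<close>

lemma deterministic_part_decay:
  assumes fs: "fundamental_solution a x0" and x: "continuous_on {-1..} x"
    and d: "d > 0" and C: "C \<ge> 0" "\<And>t. \<bar>window x0 t\<bar> \<le> C * exp (- d * t)"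
  shows "\<exists>K\<ge>0. \<forall>t\<ge>0. \<bar>history x t + window x0 t * x 0 + a * integral {0..t} (\<lambda>s. window x0 (t - s) * history x s)\<bar> \<le> K * exp (- d * t)"
proof -
  note c0 = fundamental_solution_continuous[OF fs]
  have hc': "continuous_on {0..r} (history x)" for r
    by (rule continuous_on_subset[OF history_continuous[OF x]]) auto
  obtain B where B: "B \<ge> 0" "\<And>s. s \<ge> 0 \<Longrightarrow> \<bar>history x s\<bar> \<le> B * exp (- (d + 1) * s)"
    using history_bound[OF x, of "d + 1"] d by auto
  have "\<bar>history x t + window x0 t * x 0 + a * integral {0..t} (\<lambda>s. window x0 (t - s) * history x s)\<bar>
    \<le> (B + C * \<bar>x 0\<bar> + \<bar>a\<bar> * (C * B)) * exp (- d * t)" if t: "t \<ge> 0" for t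
  proof -
    have 1: "\<bar>history x t\<bar> \<le> B * exp (- d * t)"
    proof -
      have "B * exp (- (d + 1) * t) \<le> B * exp (- d * t)"
        using B(1) t by (intro mult_left_mono) (auto simp: algebra_simps)
      then show ?thesis using B(2)[OF t] by linarith
    qed
    have 2: "\<bar>window x0 t * x 0\<bar> \<le> C * \<bar>x 0\<bar> * exp (- d * t)"
      using mult_right_mono[OF C(2)[of t], of "\<bar>x 0\<bar>"] by (simp add: abs_mult mult_ac)
    have Wc: "continuous_on {0..t} (\<lambda>s. window x0 (t - s))"
      by (rule continuous_on_compose2[OF window_continuous[OF c0, of UNIV]]) (auto intro!: continuous_intros)
    have "\<bar>integral {0..t} (\<lambda>s. window x0 (t - s) * history x s)\<bar> \<le> integral {0..t} (\<lambda>s. (C * B * exp (- d * t)) * exp (- 1 * s))"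
      unfolding real_norm_def[symmetric]
    proof (rule integral_norm_bound_integral)
      show "(\<lambda>s. window x0 (t - s) * history x s) integrable_on {0..t}"
        by (intro integrable_continuous_real continuous_intros Wc hc')
      show "(\<lambda>s. (C * B * exp (- d * t)) * exp (- 1 * s)) integrable_on {0..t}"
        by (intro integrable_continuous_real continuous_intros)
      fix s assume s: "s \<in> {0..t}"
      have "norm (window x0 (t - s) * history x s) \<le> (C * exp (- d * (t - s))) * (B * exp (- (d + 1) * s))"
        unfolding real_norm_def abs_mult using s C(1) by (intro mult_mono C(2) B(2)) auto
      also have "\<dots> = (C * B * exp (- d * t)) * exp (- 1 * s)"
      proof -
        have "- d * (t - s) + - (d + 1) * s = - d * t + - 1 * s" by (simp add: algebra_simps)
        then have "exp (- d * (t - s)) * exp (- (d + 1) * s) = exp (- d * t) * exp (- 1 * s)"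
          by (simp only: exp_add[symmetric])
        then show ?thesis by (metis mult.assoc mult.left_commute)
      qed
      finally show "norm (window x0 (t - s) * history x s) \<le> \<dots>" .
    qed
    also have "\<dots> = (C * B * exp (- d * t)) * integral {0..t} (\<lambda>s. exp (- 1 * s))" by simp
    also have "\<dots> \<le> (C * B * exp (- d * t)) * 1"
    proof (rule mult_left_mono)
      have "((\<lambda>s. exp (- 1 * s)) has_integral (- exp (- 1 * t)) - (- exp (- 1 * 0))) {0..t}"
        by (rule fundamental_theorem_of_calculus[OF t])
          (auto intro!: derivative_eq_intros simp: has_real_derivative_iff_has_vector_derivative[symmetric])
      then show "integral {0..t} (\<lambda>s. exp (- 1 * s)) \<le> 1" by (simp add: integral_unique)
    qed (use C B in simp)
    finally have "\<bar>integral {0..t} (\<lambda>s. window x0 (t - s) * history x s)\<bar> \<le> C * B * exp (- d * t)" by simp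
    then have 3: "\<bar>a * integral {0..t} (\<lambda>s. window x0 (t - s) * history x s)\<bar> \<le> \<bar>a\<bar> * (C * B * exp (- d * t))"
      unfolding abs_mult by (intro mult_left_mono) auto
    have "\<bar>history x t + window x0 t * x 0 + a * integral {0..t} (\<lambda>s. window x0 (t - s) * history x s)\<bar>
      \<le> B * exp (- d * t) + C * \<bar>x 0\<bar> * exp (- d * t) + \<bar>a\<bar> * (C * B * exp (- d * t))"
      using 1 2 3 by linarith
    also have "\<dots> = (B + C * \<bar>x 0\<bar> + \<bar>a\<bar> * (C * B)) * exp (- d * t)" by (simp add: algebra_simps)
    finally show ?thesis .
  qed
  then show ?thesis using B C by (intro exI[of _ "B + C * \<bar>x 0\<bar> + \<bar>a\<bar> * (C * B)"]) auto
qed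

section \<open>Wiener integrals with a smooth kernel\<close>

lemma integral_monotone_partition:
  fixes f :: "real \<Rightarrow> real"
  assumes p: "\<And>k. p k \<le> p (Suc k)" and f: "continuous_on {p 0..p n} f"
  shows "integral {p 0..p n} f = (\<Sum>k<n. integral {p k..p (Suc k)} f)"
  using f
proof (induction n)
  case 0 then show ?case by simp
next
  case (Suc n)
  have le: "p 0 \<le> p n" using lift_Suc_mono_le[of p, OF p] by simp
  have "integral {p 0..p n} f + integral {p n..p (Suc n)} f = integral {p 0..p (Suc n)} f"
    by (rule Henstock_Kurzweil_Integration.integral_combine[OF le p]) (rule integrable_continuous_real[OF Suc.prems])
  moreover have "integral {p 0..p n} f = (\<Sum>k<n. integral {p k..p (Suc k)} f)"
    by (rule Suc.IH) (rule continuous_on_subset[OF Suc.prems], use p[of n] in auto)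
  ultimately show ?case by simp
qed

lemma sum_by_parts:
  fixes u w :: "nat \<Rightarrow> real"
  shows "(\<Sum>k<n. u k * (w (Suc k) - w k)) = (\<Sum>k<n. w (Suc k) * (u k - u (Suc k))) + u n * w n - u 0 * w 0"
  by (induction n) (simp_all add: algebra_simps)

text \<open>The convolution with \<open>x0\<close> is rewritten by summation by parts: the sum becomes
  \<open>\<Sum>k. w ((k + 1) / N) * (integral of x0 (t - s) over the k-th cell)\<close>, which differs from the
  integral by the oscillation of \<open>w\<close>. The cells are cut at \<open>t\<close>, where the kernel vanishes.\<close>

lemma convolve_close_sum:
  assumes x0: "continuous_on {0..} x0" and w: "continuous_on {0..} w" "w 0 = 0" and T: "T \<ge> 0" and N: "N > 0"
    and Bx: "\<And>s. 0 \<le> s \<Longrightarrow> s \<le> T \<Longrightarrow> \<bar>x0 s\<bar> \<le> Bx" and e: "e \<ge> 0"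
    and osc: "\<And>u v. u \<in> {0..T+1} \<Longrightarrow> v \<in> {0..T+1} \<Longrightarrow> \<bar>u - v\<bar> \<le> 1 / real N \<Longrightarrow> \<bar>w u - w v\<bar> \<le> e"
    and t: "t \<le> T"
  shows "\<bar>convolve x0 w t - (\<Sum>k<Suc (steps T N). primitive x0 (t - real k / real N) * increments w N k)\<bar> \<le> Bx * e * T"
proof -
  have Bx0: "Bx \<ge> 0" using Bx[of 0] T by simp
  let ?n = "Suc (steps T N)" and ?U = "primitive x0"
  show ?thesis
  proof (cases "t > 0")
    case False
    then have t0: "t \<le> 0" by simp
    have "?U (t - real k / real N) = 0" for k
      by (rule primitive_nonpos) (use t0 divide_nonneg_nonneg[of "real k" "real N"] in linarith)
    then show ?thesis using t0 Bx0 e T by simp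
  next
    case True
    \<comment> \<open>Cutting the grid at \<open>t\<close> lets the cells fill \<open>[0, t]\<close> exactly; the cut cells carry no weight, since \<open>primitive x0 0 = 0\<close>.\<close>
    define p where "p k = min (real k / real N) t" for k
    have pS: "p k \<le> p (Suc k)" for k unfolding p_def by (intro min.mono) (auto simp: divide_right_mono)
    have p0: "p 0 = 0" using True by (simp add: p_def)
    have "T < real ?n / real N"
      using steps_ge[OF T, of N] N by (simp add: pos_less_divide_eq mult.commute)
    then have pn: "p ?n = t" and nt: "t - real ?n / real N \<le> 0" using t by (auto simp: p_def)
    have p_bounds: "0 \<le> p k" "p k \<le> t" for k using True by (auto simp: p_def)
    have rc: "continuous_on {q..r} (\<lambda>s. x0 (t - s))" if "r \<le> t" for q r
      by (rule continuous_on_compose2[OF x0]) (use that in \<open>auto intro!: continuous_intros\<close>)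
    have wc: "continuous_on {q..r} w" if "0 \<le> q" for q r
      by (rule continuous_on_subset[OF w(1)]) (use that in auto)
    have Up: "?U (t - real k / real N) = ?U (t - p k)" for k
      unfolding p_def by (cases "real k / real N \<le> t") (auto simp: min_def)
    have cell: "?U (t - p k) - ?U (t - p (Suc k)) = integral {p k..p (Suc k)} (\<lambda>s. x0 (t - s))" for k
    proof -
      have "((\<lambda>s. x0 (t - s)) has_integral (- ?U (t - p (Suc k))) - (- ?U (t - p k))) {p k..p (Suc k)}"
      proof (rule fundamental_theorem_of_calculus_interior[OF pS])
        show "continuous_on {p k..p (Suc k)} (\<lambda>s. - ?U (t - s))"
          by (intro continuous_intros continuous_on_compose2[OF primitive_continuous[OF x0, of UNIV]]) auto
        fix s assume s: "s \<in> {p k<..<p (Suc k)}"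
        have "((\<lambda>s. ?U (t - s)) has_real_derivative - x0 (t - s)) (at s)"
          by (rule primitive_reflected[OF x0]) (use s p_bounds(2)[of "Suc k"] in auto)
        then have "((\<lambda>s. - ?U (t - s)) has_real_derivative - (- x0 (t - s))) (at s)" by (rule DERIV_minus)
        then show "((\<lambda>s. - ?U (t - s)) has_vector_derivative x0 (t - s)) (at s)"
          by (simp add: has_real_derivative_iff_has_vector_derivative)
      qed
      then show ?thesis by (simp add: integral_unique)
    qed
    have S: "(\<Sum>k<?n. ?U (t - real k / real N) * increments w N k) =
      (\<Sum>k<?n. w (real (Suc k) / real N) * integral {p k..p (Suc k)} (\<lambda>s. x0 (t - s)))"
    proof -
      have eqk: "?U (t - real k / real N) - ?U (t - real (Suc k) / real N) = integral {p k..p (Suc k)} (\<lambda>s. x0 (t - s))" for k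
        unfolding Up cell ..
      have "?U (t - real ?n / real N) = 0" by (rule primitive_nonpos[OF nt])
      then show ?thesis
        unfolding increments_def sum_by_parts[of "\<lambda>k. ?U (t - real k / real N)" "\<lambda>k. w (real k / real N)" ?n] eqk
        using w(2) by simp
    qed
    have "convolve x0 w t = integral {p 0..p ?n} (\<lambda>s. x0 (t - s) * w s)"
      unfolding convolve_def p0 pn ..
    also have "\<dots> = (\<Sum>k<?n. integral {p k..p (Suc k)} (\<lambda>s. x0 (t - s) * w s))"
      by (rule integral_monotone_partition[where p = p, OF pS]) (auto simp: p0 pn intro!: continuous_intros rc wc)
    finally have c: "convolve x0 w t = (\<Sum>k<?n. integral {p k..p (Suc k)} (\<lambda>s. x0 (t - s) * w s))" .
    have "\<bar>convolve x0 w t - (\<Sum>k<?n. ?U (t - real k / real N) * increments w N k)\<bar>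
      \<le> (\<Sum>k<?n. Bx * e * (p (Suc k) - p k))"
      unfolding c S sum_subtractf[symmetric]
    proof (rule order_trans[OF sum_abs sum_mono])
      fix k assume "k \<in> {..<?n}"
      let ?w = "w (real (Suc k) / real N)"
      have pk: "p (Suc k) \<le> t" "0 \<le> p k" by (rule p_bounds)+
      have "integral {p k..p (Suc k)} (\<lambda>s. x0 (t - s) * w s) - ?w * integral {p k..p (Suc k)} (\<lambda>s. x0 (t - s))
        = integral {p k..p (Suc k)} (\<lambda>s. x0 (t - s) * w s) - integral {p k..p (Suc k)} (\<lambda>s. ?w * x0 (t - s))"
        by simp
      also have "\<dots> = integral {p k..p (Suc k)} (\<lambda>s. x0 (t - s) * w s - ?w * x0 (t - s))"
        by (rule Henstock_Kurzweil_Integration.integral_diff[symmetric])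
          (intro integrable_continuous_real continuous_intros rc wc pk)+
      also have "\<bar>\<dots>\<bar> \<le> Bx * e * (p (Suc k) - p k)"
      proof (cases "p k = p (Suc k)")
        case True then show ?thesis by simp
      next
        case False
        have kt: "real k / real N < t"
        proof (rule ccontr)
          assume "\<not> real k / real N < t"
          then have "p k = t" by (simp add: p_def)
          then show False using False pS[of k] pk(1) by simp
        qed
        then have pk': "p k = real k / real N" by (simp add: p_def)
        have pSk: "p (Suc k) \<le> real (Suc k) / real N" by (simp add: p_def)
        have N1: "real (Suc k) / real N - real k / real N = 1 / real N" by (simp add: add_divide_distrib)
        have N2: "1 / real N \<le> 1" using N by simp
        have N3: "0 \<le> 1 / real N" by simp
        have k0: "0 \<le> real k / real N" by simp
        show ?thesis
          unfolding real_norm_def[symmetric]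
        proof (rule integral_bound[OF pS])
          show "continuous_on {p k..p (Suc k)} (\<lambda>s. x0 (t - s) * w s - ?w * x0 (t - s))"
            by (intro continuous_intros rc wc pk)
          fix s assume s: "s \<in> {p k..p (Suc k)}"
          have s': "real k / real N \<le> s" "s \<le> real (Suc k) / real N" "s \<le> t" "0 \<le> s"
            using s pSk pk k0 unfolding pk' atLeastAtMost_iff by linarith+
          have "\<bar>w s - ?w\<bar> \<le> e"
          proof (rule osc)
            show "s \<in> {0..T+1}" using s' t by auto
            show "real (Suc k) / real N \<in> {0..T+1}" using k0 N1 N2 N3 kt t unfolding atLeastAtMost_iff by linarith
            show "\<bar>s - real (Suc k) / real N\<bar> \<le> 1 / real N" using s' N1 unfolding abs_le_iff by linarith
          qed
          moreover have "\<bar>x0 (t - s)\<bar> \<le> Bx" using s' t by (intro Bx) auto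
          ultimately have "\<bar>x0 (t - s)\<bar> * \<bar>w s - ?w\<bar> \<le> Bx * e" using Bx0 by (intro mult_mono) auto
          moreover have "x0 (t - s) * w s - ?w * x0 (t - s) = x0 (t - s) * (w s - ?w)" by (simp add: algebra_simps)
          ultimately show "norm (x0 (t - s) * w s - ?w * x0 (t - s)) \<le> Bx * e"
            unfolding real_norm_def by (simp only: abs_mult)
        qed
      qed
      finally show "\<bar>integral {p k..p (Suc k)} (\<lambda>s. x0 (t - s) * w s) - ?w * integral {p k..p (Suc k)} (\<lambda>s. x0 (t - s))\<bar>
        \<le> Bx * e * (p (Suc k) - p k)" .
    qed
    also have "\<dots> = Bx * e * (p ?n - p 0)"
      unfolding sum_distrib_left[symmetric] by (simp only: sum_lessThan_telescope)
    also have "\<dots> \<le> Bx * e * T" using t Bx0 e unfolding p0 pn by (intro mult_left_mono) auto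
    finally show ?thesis .
  qed
qed

text \<open>A Wiener integral with kernel \<open>y (t - s)\<close>, discretised at step \<open>1 / N\<close>; the sum may run past \<open>t\<close>
  because the kernels of interest vanish on the negative half line.\<close>

definition kernel_sum :: "(real \<Rightarrow> real) \<Rightarrow> nat \<Rightarrow> nat \<Rightarrow> (nat \<Rightarrow> real) \<Rightarrow> real \<Rightarrow> real" where
  "kernel_sum y N n \<xi> t = (\<Sum>k<n. y (t - real k / real N) * \<xi> k)"

text \<open>The Wiener integral of \<open>window x0 (t - s)\<close> against \<open>w\<close> over \<open>[0, t]\<close>, integrated by parts.\<close>

definition window_wiener_integral :: "(real \<Rightarrow> real) \<Rightarrow> (real \<Rightarrow> real) \<Rightarrow> real \<Rightarrow> real" where
  "window_wiener_integral x0 w t = convolve x0 w t - convolve x0 w (t - 1)"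

lemma kernel_sum_converges:
  assumes x0: "continuous_on {0..} x0" and w: "continuous_on {0..} w" "w 0 = 0" and T: "T \<ge> 0"
  shows "uniform_limit {0..T} (\<lambda>N. kernel_sum (window x0) N (Suc (steps T N)) (increments w N)) (window_wiener_integral x0 w) sequentially"
  unfolding uniform_limit_iff
proof (intro allI impI)
  fix e :: real assume e: "e > 0"
  have "bounded (x0 ` {0..T})"
    by (intro compact_imp_bounded compact_continuous_image continuous_on_subset[OF x0]) auto
  then obtain B where "\<forall>y\<in>x0 ` {0..T}. \<bar>y\<bar> \<le> B" unfolding bounded_real by blast
  then have B: "\<And>s. 0 \<le> s \<Longrightarrow> s \<le> T \<Longrightarrow> \<bar>x0 s\<bar> \<le> B" by auto
  have B0: "B \<ge> 0" using B[of 0] T by simp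
  define \<eta> where "\<eta> = e / (2 * B * T + 1) / 2"
  have p: "2 * B * T + 1 > 0" using B0 T by (simp add: add_nonneg_pos)
  have \<eta>: "\<eta> > 0" using e p by (simp add: \<eta>_def)
  have wc: "continuous_on {0..T+1} w" by (rule continuous_on_subset[OF w(1)]) auto
  show "\<forall>\<^sub>F N in sequentially. \<forall>t\<in>{0..T}. dist (kernel_sum (window x0) N (Suc (steps T N)) (increments w N) t) (window_wiener_integral x0 w t) < e"
    using uniform_continuity_grid[OF wc \<eta>]
  proof eventually_elim
    case (elim N)
    then have N: "N > 0" and osc: "\<And>u v. u \<in> {0..T+1} \<Longrightarrow> v \<in> {0..T+1} \<Longrightarrow> \<bar>u - v\<bar> \<le> 1 / real N \<Longrightarrow> \<bar>w u - w v\<bar> \<le> \<eta>"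
      by blast+
    show ?case
    proof
      fix t assume t: "t \<in> {0..T}"
      let ?S = "\<lambda>t. \<Sum>k<Suc (steps T N). primitive x0 (t - real k / real N) * increments w N k"
      have "\<bar>convolve x0 w t - ?S t\<bar> \<le> B * \<eta> * T"
        by (rule convolve_close_sum[OF x0 w T N B _ osc]) (use \<eta> t in auto)
      moreover have "\<bar>convolve x0 w (t - 1) - ?S (t - 1)\<bar> \<le> B * \<eta> * T"
        by (rule convolve_close_sum[OF x0 w T N B _ osc]) (use \<eta> t in auto)
      moreover have "kernel_sum (window x0) N (Suc (steps T N)) (increments w N) t = ?S t - ?S (t - 1)"
        unfolding kernel_sum_def sum_subtractf[symmetric]
        by (rule sum.cong) (simp_all add: window_def algebra_simps)
      ultimately have "\<bar>kernel_sum (window x0) N (Suc (steps T N)) (increments w N) t - window_wiener_integral x0 w t\<bar> \<le> 2 * B * T * \<eta>"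
        unfolding window_wiener_integral_def by (simp add: mult_ac)
      also have "\<dots> \<le> (2 * B * T + 1) * \<eta>" using \<eta> by (intro mult_right_mono) auto
      also have "\<dots> = e / 2"
      proof -
        have "q * (e / q / 2) = e / 2" if "q > 0" for q using that by simp
        from this[OF p] show ?thesis unfolding \<eta>_def .
      qed
      also have "\<dots> < e" using e by simp
      finally show "dist (kernel_sum (window x0) N (Suc (steps T N)) (increments w N) t) (window_wiener_integral x0 w t) < e"
        by (simp add: dist_real_def)
    qed
  qed
qed

lemma kernel_sum_continuous:
  assumes "continuous_on UNIV y" shows "continuous_on A (kernel_sum y N n \<xi>)"
  unfolding kernel_sum_def
  by (intro continuous_intros continuous_on_compose2[OF assms]) auto

lemma kernel_energy_converges:
  assumes x0: "continuous_on {0..} x0" and w: "continuous_on {0..} w" "w 0 = 0" and T: "T \<ge> 0"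
  shows "continuous_on {0..T} (window_wiener_integral x0 w)"
    and "(\<lambda>N. integral {0..T} (\<lambda>t. (kernel_sum (window x0) N (Suc (steps T N)) (increments w N) t)\<^sup>2))
      \<longlonglongrightarrow> integral {0..T} (\<lambda>t. (window_wiener_integral x0 w t)\<^sup>2)"
proof -
  let ?G = "\<lambda>N. kernel_sum (window x0) N (Suc (steps T N)) (increments w N)"
  note u = kernel_sum_converges[OF x0 w T]
  have kc: "continuous_on {0..T} (?G N)" for N
    by (rule kernel_sum_continuous[OF window_continuous[OF x0]])
  show c: "continuous_on {0..T} (window_wiener_integral x0 w)"
    by (rule uniform_limit_theorem[OF _ u]) (simp_all add: kc)
  have b: "bounded (window_wiener_integral x0 w ` {0..T})"
    by (intro compact_imp_bounded compact_continuous_image c) auto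
  have u2: "uniform_limit {0..T} (\<lambda>N t. ?G N t * ?G N t) (\<lambda>t. window_wiener_integral x0 w t * window_wiener_integral x0 w t) sequentially"
    by (rule uniform_lim_mult[OF u u b b])
  have u3: "uniform_limit (cbox 0 T) (\<lambda>N t. ?G N t * ?G N t) (\<lambda>t. window_wiener_integral x0 w t * window_wiener_integral x0 w t) sequentially"
    using u2 by (simp add: cbox_interval)
  obtain I J where IJ: "\<And>N. ((\<lambda>t. ?G N t * ?G N t) has_integral I N) (cbox 0 T)"
    "((\<lambda>t. window_wiener_integral x0 w t * window_wiener_integral x0 w t) has_integral J) (cbox 0 T)" "(I \<longlongrightarrow> J) sequentially"
    by (rule uniform_limit_integral_cbox[OF u3]) (auto intro!: continuous_intros kc simp: cbox_interval)
  have I: "I = (\<lambda>N. integral {0..T} (\<lambda>t. ?G N t * ?G N t))"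
    by (intro ext integral_unique[symmetric]) (use IJ(1) in \<open>simp add: cbox_interval\<close>)
  have J: "J = integral {0..T} (\<lambda>t. window_wiener_integral x0 w t * window_wiener_integral x0 w t)"
    using IJ(2) by (simp add: cbox_interval integral_unique)
  show "(\<lambda>N. integral {0..T} (\<lambda>t. (?G N t)\<^sup>2)) \<longlonglongrightarrow> integral {0..T} (\<lambda>t. (window_wiener_integral x0 w t)\<^sup>2)"
    using IJ(3) unfolding I J power2_eq_square .
qed

section \<open>Variance of the energy of a Wiener integral\<close>

lemma one_minus_exp_ge:
  assumes "x > (0::real)" shows "1 / (1 - exp (- x)) \<le> 1 + 1 / x"
proof -
  have "1 + x \<le> exp x" by (rule exp_ge_add_one_self)
  then have "exp (- x) \<le> 1 / (1 + x)" using assms by (simp add: exp_minus field_simps)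
  then have "1 - exp (- x) \<ge> x / (1 + x)" using assms by (simp add: field_simps)
  then have "1 / (1 - exp (- x)) \<le> 1 / (x / (1 + x))" using assms by (intro divide_left_mono) auto
  also have "\<dots> = 1 + 1 / x" using assms by (simp add: field_simps)
  finally show ?thesis .
qed

lemma sum_geometric_le:
  assumes "0 \<le> q" "q < (1::real)" shows "(\<Sum>m<n. q ^ m) \<le> 1 / (1 - q)"
  using assms sum_gp_strict[of q n] by (simp add: divide_right_mono)

text \<open>The two bounds on \<open>J\<close> say that it is the integral of \<open>y\<^sup>2\<close> over the half line, with the rate at
  which the integral converges.\<close>

locale decaying_kernel =
  fixes y :: "real \<Rightarrow> real" and C d J :: real
  assumes y_cont: "continuous_on UNIV y" and y_neg: "\<And>s. s \<le> 0 \<Longrightarrow> y s = 0"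
    and C: "C \<ge> 0" and d: "d > 0" and y_bound: "\<And>s. \<bar>y s\<bar> \<le> C * exp (- d * s)"
    and J: "\<And>r. r \<ge> 0 \<Longrightarrow> 0 \<le> J - integral {0..r} (\<lambda>s. (y s)\<^sup>2)"
      "\<And>r. r \<ge> 0 \<Longrightarrow> J - integral {0..r} (\<lambda>s. (y s)\<^sup>2) \<le> C\<^sup>2 / (2 * d) * exp (- 2 * d * r)"
begin

text \<open>The matrix of the quadratic form that expresses the energy of a discretised Wiener integral in terms
  of the noise variables.\<close>

definition gram :: "real \<Rightarrow> nat \<Rightarrow> nat \<Rightarrow> nat \<Rightarrow> real" where
  "gram T N j k = integral {0..T} (\<lambda>t. y (t - real j / real N) * y (t - real k / real N))"

lemma y_shift_cont: "continuous_on A (\<lambda>t. y (t - c))"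
  by (rule continuous_on_compose2[OF y_cont]) (auto intro!: continuous_intros)

lemma gram_sym: "gram T N j k = gram T N k j"
  unfolding gram_def by (simp add: mult.commute)

lemma kernel_energy_eq_quadratic_form:
  "integral {0..T} (\<lambda>t. (kernel_sum y N n \<xi> t)\<^sup>2) = (\<Sum>j<n. \<Sum>k<n. gram T N j k * \<xi> j * \<xi> k)"
proof -
  have i: "(\<lambda>t. y (t - real j / real N) * y (t - real k / real N) * (\<xi> j * \<xi> k)) integrable_on {0..T}" for j k
    by (intro integrable_continuous_real continuous_intros y_shift_cont)
  have "(kernel_sum y N n \<xi> t)\<^sup>2 = (\<Sum>j<n. \<Sum>k<n. y (t - real j / real N) * y (t - real k / real N) * (\<xi> j * \<xi> k))" for t
    unfolding kernel_sum_def power2_eq_square sum_product by (intro sum.cong refl) (simp add: mult_ac)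
  then have "integral {0..T} (\<lambda>t. (kernel_sum y N n \<xi> t)\<^sup>2) =
    integral {0..T} (\<lambda>t. \<Sum>j<n. \<Sum>k<n. y (t - real j / real N) * y (t - real k / real N) * (\<xi> j * \<xi> k))" by simp
  also have "\<dots> = (\<Sum>j<n. \<Sum>k<n. integral {0..T} (\<lambda>t. y (t - real j / real N) * y (t - real k / real N) * (\<xi> j * \<xi> k)))"
    using i by (simp add: integral_sum integrable_sum)
  also have "\<dots> = (\<Sum>j<n. \<Sum>k<n. gram T N j k * \<xi> j * \<xi> k)"
    unfolding gram_def integral_mult_left by (simp only: mult.assoc)
  finally show ?thesis .
qed

text \<open>The product of the two shifted kernels is at most
  \<open>C\<^sup>2 * exp (- d * (m - s)) * exp (- 2 * d * (t - m))\<close> for \<open>t \<ge> m = k / N\<close>, where \<open>s = j / N\<close>, and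
  vanishes for \<open>t \<le> m\<close>.\<close>

lemma gram_bound:
  assumes T: "T \<ge> 0" and jk: "j \<le> k"
  shows "\<bar>gram T N j k\<bar> \<le> C\<^sup>2 / (2 * d) * exp (- d * (real k / real N - real j / real N))"
proof -
  let ?s = "real j / real N" and ?m = "real k / real N"
  have sm: "?s \<le> ?m" using jk by (simp add: divide_right_mono)
  have m0: "0 \<le> ?m" by simp
  let ?f = "\<lambda>t. y (t - ?s) * y (t - ?m)"
  have fc: "continuous_on A ?f" for A by (intro continuous_intros y_shift_cont)
  define E where "E = C\<^sup>2 * exp (- d * (?m - ?s))"
  have E0: "E \<ge> 0" by (simp add: E_def)
  have zero: "integral {0..r} ?f = 0" if "r \<le> ?m" for r
  proof -
    have "integral {0..r} ?f = integral {0..r} (\<lambda>_. 0)"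
      by (rule Henstock_Kurzweil_Integration.integral_cong) (use that y_neg in auto)
    then show ?thesis by simp
  qed
  have R: "C\<^sup>2 / (2 * d) * exp (- d * (?m - ?s)) = E / (2 * d)" by (simp add: E_def)
  show ?thesis
  proof (cases "T \<le> ?m")
    case True
    then show ?thesis using zero[OF True] E0 d unfolding R gram_def by simp
  next
    case False
    then have mT: "?m \<le> T" by simp
    have "integral {0..?m} ?f + integral {?m..T} ?f = integral {0..T} ?f"
      by (rule Henstock_Kurzweil_Integration.integral_combine[OF m0 mT]) (rule integrable_continuous_real[OF fc])
    then have g: "gram T N j k = integral {?m..T} ?f" unfolding gram_def using zero[of ?m] by simp
    have h: "((\<lambda>t. E * exp (- 2 * d * (t - ?m))) has_integral
        (- E / (2 * d) * exp (- 2 * d * (T - ?m))) - (- E / (2 * d) * exp (- 2 * d * (?m - ?m)))) {?m..T}"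
      by (rule fundamental_theorem_of_calculus[OF mT])
        (use d in \<open>auto intro!: derivative_eq_intros simp: has_real_derivative_iff_has_vector_derivative[symmetric]\<close>)
    have "\<bar>integral {?m..T} ?f\<bar> \<le> integral {?m..T} (\<lambda>t. E * exp (- 2 * d * (t - ?m)))"
      unfolding real_norm_def[symmetric]
    proof (rule integral_norm_bound_integral)
      show "?f integrable_on {?m..T}" by (rule integrable_continuous_real[OF fc])
      show "(\<lambda>t. E * exp (- 2 * d * (t - ?m))) integrable_on {?m..T}" using h by blast
      fix t assume t: "t \<in> {?m..T}"
      have "norm (?f t) \<le> (C * exp (- d * (t - ?s))) * (C * exp (- d * (t - ?m)))"
        unfolding real_norm_def abs_mult using C by (intro mult_mono y_bound) auto
      also have "\<dots> = C\<^sup>2 * exp (- d * (t - ?s) + - d * (t - ?m))" by (simp only: exp_add power2_eq_square mult_ac)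
      also have "- d * (t - ?s) + - d * (t - ?m) = - d * (?m - ?s) + - 2 * d * (t - ?m)" by (simp add: algebra_simps)
      also have "C\<^sup>2 * exp (- d * (?m - ?s) + - 2 * d * (t - ?m)) = E * exp (- 2 * d * (t - ?m))"
        unfolding E_def exp_add by (simp only: mult.assoc)
      finally show "norm (?f t) \<le> E * exp (- 2 * d * (t - ?m))" .
    qed
    also have "\<dots> = E / (2 * d) * (1 - exp (- 2 * d * (T - ?m)))" using integral_unique[OF h] by (simp add: algebra_simps)
    also have "\<dots> \<le> E / (2 * d) * 1" using E0 d by (intro mult_left_mono) auto
    finally show ?thesis unfolding g R by simp
  qed
qed

lemma gram_diag:
  assumes T: "real k / real N \<le> T"
  shows "gram T N k k = integral {0..T - real k / real N} (\<lambda>s. (y s)\<^sup>2)"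
proof -
  let ?c = "real k / real N"
  have c0: "0 \<le> ?c" by simp
  have cont: "continuous_on A (\<lambda>s. (y s)\<^sup>2)" for A
    by (intro continuous_intros continuous_on_subset[OF y_cont]) auto
  have i: "(\<lambda>s. (y s)\<^sup>2) integrable_on {p..q}" for p q by (rule integrable_continuous_real[OF cont])
  have "((\<lambda>t. (y (t - ?c))\<^sup>2) has_integral integral {-?c..T-?c} (\<lambda>s. (y s)\<^sup>2)) {0..T}"
    using has_integral_affinity'[of "\<lambda>s. (y s)\<^sup>2" "integral {-?c..T-?c} (\<lambda>s. (y s)\<^sup>2)" "-?c" "T-?c" 1 "-?c"] integrable_integral[OF i]
    by simp
  then have "gram T N k k = integral {-?c..T-?c} (\<lambda>s. (y s)\<^sup>2)"
    unfolding gram_def by (simp add: integral_unique power2_eq_square)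
  also have "\<dots> = integral {-?c..0} (\<lambda>s. (y s)\<^sup>2) + integral {0..T-?c} (\<lambda>s. (y s)\<^sup>2)"
    by (rule Henstock_Kurzweil_Integration.integral_combine[symmetric]) (use c0 T i in auto)
  also have "integral {-?c..0} (\<lambda>s. (y s)\<^sup>2) = integral {-?c..0} (\<lambda>_. 0)"
    by (rule Henstock_Kurzweil_Integration.integral_cong) (use y_neg in auto)
  finally show ?thesis by simp
qed

text \<open>Exponential decay off the diagonal makes every row sum a geometric series with ratio
  \<open>exp (- 2 * d / N)\<close>, hence of order \<open>N\<close>.\<close>

lemma gram_square_sum:
  assumes T: "T \<ge> 0" and N: "N > 0"
  shows "(\<Sum>j<n. \<Sum>k<n. (gram T N j k)\<^sup>2) \<le> real n * ((C\<^sup>2 / (2 * d))\<^sup>2 * (2 * (1 + real N / (2 * d))))"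
proof -
  define q where "q = exp (- (2 * d / real N))"
  have x: "2 * d / real N > 0" using d N by simp
  have q: "0 \<le> q" "q < 1" using x by (auto simp: q_def)
  let ?K = "(C\<^sup>2 / (2 * d))\<^sup>2"
  have g: "(gram T N j k)\<^sup>2 \<le> ?K * q ^ (k - j)" if "j \<le> k" for j k
  proof -
    have "(gram T N j k)\<^sup>2 = \<bar>gram T N j k\<bar>\<^sup>2" by simp
    also have "\<dots> \<le> (C\<^sup>2 / (2 * d) * exp (- d * (real k / real N - real j / real N)))\<^sup>2"
      by (intro power_mono gram_bound[OF T that]) simp
    also have "\<dots> = ?K * (exp (- d * (real k / real N - real j / real N)))\<^sup>2" by (simp only: power_mult_distrib)
    also have "(exp (- d * (real k / real N - real j / real N)))\<^sup>2 = q ^ (k - j)"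
    proof -
      have "(exp (- d * (real k / real N - real j / real N)))\<^sup>2 = exp (real 2 * (- d * (real k / real N - real j / real N)))"
        by (simp only: exp_of_nat_mult)
      also have "real 2 * (- d * (real k / real N - real j / real N)) = real (k - j) * (- (2 * d / real N))"
        using that by (simp add: of_nat_diff diff_divide_distrib algebra_simps)
      also have "exp \<dots> = q ^ (k - j)" unfolding q_def by (rule exp_of_nat_mult)
      finally show ?thesis .
    qed
    finally show ?thesis .
  qed
  have row: "(\<Sum>k<n. (gram T N j k)\<^sup>2) \<le> ?K * (2 * (1 + real N / (2 * d)))" if j: "j < n" for j
  proof -
    have geo: "(\<Sum>m<r. q ^ m) \<le> 1 + real N / (2 * d)" for r
      using sum_geometric_le[OF q, of r] one_minus_exp_ge[OF x] unfolding q_def by simp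
    have "(\<Sum>k<n. (gram T N j k)\<^sup>2) = (\<Sum>k<j. (gram T N j k)\<^sup>2) + (\<Sum>k=j..<n. (gram T N j k)\<^sup>2)"
      using sum.atLeastLessThan_concat[of 0 j n "\<lambda>k. (gram T N j k)\<^sup>2"] j by (simp add: atLeast0LessThan)
    also have "\<dots> \<le> (\<Sum>k<j. ?K * q ^ (j - k)) + (\<Sum>k=j..<n. ?K * q ^ (k - j))"
    proof (intro add_mono sum_mono)
      fix k assume "k \<in> {..<j}"
      then show "(gram T N j k)\<^sup>2 \<le> ?K * q ^ (j - k)" using g[of k j] gram_sym[of T N j k] by simp
    next
      fix k assume "k \<in> {j..<n}"
      then show "(gram T N j k)\<^sup>2 \<le> ?K * q ^ (k - j)" using g[of j k] by simp
    qed
    also have "(\<Sum>k<j. ?K * q ^ (j - k)) \<le> ?K * (1 + real N / (2 * d))"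
    proof -
      have "(\<Sum>k<j. q ^ (j - k)) \<le> (\<Sum>k<Suc j. q ^ (j - k))" using q by simp
      also have "\<dots> = (\<Sum>m<Suc j. q ^ m)" using sum.nat_diff_reindex[of "\<lambda>m. q ^ m" "Suc j"] by simp
      also have "\<dots> \<le> 1 + real N / (2 * d)" by (rule geo)
      finally show ?thesis unfolding sum_distrib_left[symmetric] by (intro mult_left_mono) auto
    qed
    also have "(\<Sum>k=j..<n. ?K * q ^ (k - j)) \<le> ?K * (1 + real N / (2 * d))"
    proof -
      have "(\<Sum>k=j..<n. q ^ (k - j)) = (\<Sum>m<n - j. q ^ m)"
        using sum.shift_bounds_nat_ivl[of "\<lambda>k. q ^ (k - j)" 0 j "n - j"] j by (simp add: atLeast0LessThan)
      also have "\<dots> \<le> 1 + real N / (2 * d)" by (rule geo)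
      finally show ?thesis unfolding sum_distrib_left[symmetric] by (intro mult_left_mono) auto
    qed
    finally show ?thesis by (simp add: algebra_simps)
  qed
  have "(\<Sum>j<n. \<Sum>k<n. (gram T N j k)\<^sup>2) \<le> (\<Sum>j<n. ?K * (2 * (1 + real N / (2 * d))))"
    by (intro sum_mono row) simp
  then show ?thesis by simp
qed

text \<open>A diagonal entry differs from \<open>J\<close> only by the tail of the integral of \<open>y\<^sup>2\<close>, which is small unless
  \<open>k / N\<close> is near \<open>T\<close>; the errors again sum to a geometric series.\<close>

lemma gram_trace:
  assumes T: "T \<ge> 0" and N: "N > 0"
  shows "\<bar>(1 / real N) * (\<Sum>k<Suc (steps T N). gram T N k k) - T * J\<bar> \<le> C\<^sup>2 / (2 * d) * (1 + 1 / (2 * d)) + J"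
proof -
  define q where "q = exp (- (2 * d / real N))"
  have x: "2 * d / real N > 0" using d N by simp
  have q: "0 \<le> q" "q < 1" using x by (auto simp: q_def)
  have J0: "J \<ge> 0" using J(1)[of 0] by simp
  let ?n = "steps T N" and ?K = "C\<^sup>2 / (2 * d)"
  have K0: "?K \<ge> 0" using d by simp
  have N1: "real N \<ge> 1" using N by simp
  have cell: "\<bar>gram T N k k - J\<bar> \<le> ?K * q ^ (?n - k)" if k: "k \<le> ?n" for k
  proof -
    have kT: "real k / real N \<le> T" by (rule index_le_steps[OF T N k])
    have 1: "\<bar>gram T N k k - J\<bar> \<le> ?K * exp (- 2 * d * (T - real k / real N))"
      unfolding gram_diag[OF kT] using J[of "T - real k / real N"] kT by simp
    have "real ?n / real N \<le> T" by (rule index_le_steps[OF T N order_refl])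
    then have "real (?n - k) / real N \<le> T - real k / real N" using k by (simp add: of_nat_diff diff_divide_distrib)
    then have "2 * d * (real (?n - k) / real N) \<le> 2 * d * (T - real k / real N)" using d by (intro mult_left_mono) auto
    then have "exp (- 2 * d * (T - real k / real N)) \<le> exp (real (?n - k) * (- (2 * d / real N)))" by (simp add: mult_ac)
    also have "\<dots> = q ^ (?n - k)" unfolding q_def by (rule exp_of_nat_mult)
    finally show ?thesis using order_trans[OF 1 mult_left_mono[OF _ K0]] by blast
  qed
  have "\<bar>(\<Sum>k<Suc ?n. gram T N k k) - real (Suc ?n) * J\<bar> = \<bar>\<Sum>k<Suc ?n. (gram T N k k - J)\<bar>"
    by (simp add: sum_subtractf del: sum.lessThan_Suc)
  also have "\<dots> \<le> (\<Sum>k<Suc ?n. ?K * q ^ (?n - k))"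
    by (rule order_trans[OF sum_abs sum_mono]) (use cell in auto)
  also have "\<dots> = ?K * (\<Sum>m<Suc ?n. q ^ m)"
    unfolding sum_distrib_left[symmetric] using sum.nat_diff_reindex[of "\<lambda>m. q ^ m" "Suc ?n"] by simp
  also have "\<dots> \<le> ?K * (1 + real N / (2 * d))"
    using sum_geometric_le[OF q, of "Suc ?n"] one_minus_exp_ge[OF x] K0 unfolding q_def
    by (intro mult_left_mono) auto
  finally have "\<bar>(\<Sum>k<Suc ?n. gram T N k k) - real (Suc ?n) * J\<bar> / real N \<le> ?K * (1 + real N / (2 * d)) / real N"
    by (rule divide_right_mono) simp
  also have "\<dots> = ?K * (1 / real N + 1 / (2 * d))" using N d by (simp add: field_simps)
  also have "\<dots> \<le> ?K * (1 + 1 / (2 * d))" using N1 K0 by (intro mult_left_mono) auto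
  finally have 1: "\<bar>(1 / real N) * (\<Sum>k<Suc ?n. gram T N k k) - (real (Suc ?n) / real N) * J\<bar> \<le> ?K * (1 + 1 / (2 * d))"
    using N by (simp add: diff_divide_distrib[symmetric] abs_divide[symmetric] del: sum.lessThan_Suc)
  have "\<bar>real (Suc ?n) / real N - T\<bar> \<le> 1"
  proof -
    have "1 / real N \<le> 1" using N1 by simp
    moreover have "real (Suc ?n) / real N = 1 / real N + real ?n / real N" by (simp add: add_divide_distrib)
    ultimately show ?thesis
      using steps_over_N_ge[OF T N] index_le_steps[OF T N order_refl] divide_nonneg_nonneg[of 1 "real N"]
      unfolding abs_le_iff by linarith
  qed
  then have "\<bar>(real (Suc ?n) / real N) * J - T * J\<bar> \<le> 1 * J"
    unfolding left_diff_distrib[symmetric] abs_mult using J0 by (intro mult_mono) auto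
  then have 2: "\<bar>(real (Suc ?n) / real N) * J - T * J\<bar> \<le> J" by simp
  have "\<bar>p - r\<bar> \<le> u + v" if "\<bar>p - q\<bar> \<le> u" "\<bar>q - r\<bar> \<le> v" for p q r u v :: real
    using that by linarith
  from this[OF 1 2] show ?thesis .
qed

text \<open>The mean \<open>m\<close> of the energy is within a constant of \<open>T * J\<close> and its variance is at most a constant
  times \<open>T\<close>, both uniformly in the step size; dividing by \<open>T\<^sup>2\<close> leaves \<open>K / T\<close>.\<close>

theorem kernel_energy_variance:
  "\<exists>K. \<forall>T\<ge>1. \<forall>N>0. (\<integral>\<^sup>+\<xi>. ennreal ((integral {0..T} (\<lambda>t. (kernel_sum y N (Suc (steps T N)) \<xi> t)\<^sup>2) / T - J)\<^sup>2)
     \<partial>noise (1 / N) (Suc (steps T N))) \<le> ennreal (K / T)"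
proof -
  define K1 where "K1 = (C\<^sup>2 / (2 * d))\<^sup>2 * (2 * (1 + 1 / (2 * d)))"
  define K2 where "K2 = C\<^sup>2 / (2 * d) * (1 + 1 / (2 * d)) + J"
  have K1: "K1 \<ge> 0" unfolding K1_def using d by (intro mult_nonneg_nonneg) auto
  define K where "K = 2 * (2 * (2 * K1)) + 2 * K2\<^sup>2"
  show ?thesis
  proof (intro exI[of _ K] allI impI)
    fix T :: real and N :: nat assume T: "1 \<le> T" and N: "0 < N"
    have T0: "T \<ge> 0" using T by simp
    let ?n = "Suc (steps T N)" and ?\<delta> = "1 / real N"
    have \<delta>: "?\<delta> > 0" using N by simp
    define m where "m = ?\<delta> * (\<Sum>k<?n. gram T N k k)"
    let ?Q = "\<lambda>\<xi>. integral {0..T} (\<lambda>t. (kernel_sum y N ?n \<xi> t)\<^sup>2)"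
    interpret P: prob_space "noise ?\<delta> ?n" by (rule prob_space_noise[OF \<delta>])
    have Qm [measurable]: "?Q \<in> borel_measurable (noise ?\<delta> ?n)"
      unfolding kernel_energy_eq_quadratic_form by measurable
    have var: "(\<integral>\<^sup>+\<xi>. ennreal ((?Q \<xi> - m)\<^sup>2) \<partial>noise ?\<delta> ?n) = ennreal (2 * ?\<delta>\<^sup>2 * (\<Sum>j<?n. \<Sum>k<?n. (gram T N j k)\<^sup>2))"
      unfolding kernel_energy_eq_quadratic_form m_def
      by (rule nn_integral_noise_quadratic_form[OF \<delta> gram_sym])
    have nN: "real ?n / real N \<le> 2 * T"
    proof -
      have "real ?n / real N \<le> T + 1 / real N" using index_le_steps[OF T0 N order_refl] by (simp add: add_divide_distrib)
      moreover have "1 / real N \<le> 1" using N by simp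
      ultimately show ?thesis using T by linarith
    qed
    have "?\<delta>\<^sup>2 * (\<Sum>j<?n. \<Sum>k<?n. (gram T N j k)\<^sup>2) \<le> ?\<delta>\<^sup>2 * (real ?n * ((C\<^sup>2 / (2 * d))\<^sup>2 * (2 * (1 + real N / (2 * d)))))"
      by (intro mult_left_mono gram_square_sum[OF T0 N]) simp
    also have "\<dots> = (real ?n / real N) * ((C\<^sup>2 / (2 * d))\<^sup>2 * (2 * (1 / real N + 1 / (2 * d))))"
      using N d by (simp add: field_simps power2_eq_square del: of_nat_Suc)
    also have "\<dots> \<le> (2 * T) * K1"
      unfolding K1_def
      by (intro mult_mono nN mult_left_mono add_mono) (use N T d in \<open>auto intro!: mult_nonneg_nonneg add_nonneg_nonneg\<close>)
    finally have v0: "?\<delta>\<^sup>2 * (\<Sum>j<?n. \<Sum>k<?n. (gram T N j k)\<^sup>2) \<le> (2 * T) * K1" .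
    have v: "2 * ?\<delta>\<^sup>2 * (\<Sum>j<?n. \<Sum>k<?n. (gram T N j k)\<^sup>2) \<le> 2 * (2 * T * K1)"
      unfolding mult.assoc[of 2 "?\<delta>\<^sup>2"] by (rule mult_left_mono[OF v0]) simp
    have mb: "(m - T * J)\<^sup>2 \<le> K2\<^sup>2"
      using gram_trace[OF T0 N] unfolding m_def[symmetric] K2_def[symmetric] by (rule abs_le_square_iff[THEN iffD1, OF order_trans]) simp
    have pw: "(?Q \<xi> / T - J)\<^sup>2 \<le> (2 / T\<^sup>2) * (?Q \<xi> - m)\<^sup>2 + (2 / T\<^sup>2) * K2\<^sup>2" for \<xi>
    proof -
      have "(?Q \<xi> / T - J)\<^sup>2 = (1 / T\<^sup>2) * ((?Q \<xi> - m) + (m - T * J))\<^sup>2"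
        using T by (simp add: power2_eq_square field_simps)
      also have "\<dots> \<le> (1 / T\<^sup>2) * (2 * (?Q \<xi> - m)\<^sup>2 + 2 * (m - T * J)\<^sup>2)"
      proof (rule mult_left_mono)
        have "(u + v)\<^sup>2 \<le> 2 * u\<^sup>2 + 2 * v\<^sup>2" for u v :: real
          using zero_le_power2[of "u - v"] by (simp add: power2_eq_square algebra_simps)
        then show "((?Q \<xi> - m) + (m - T * J))\<^sup>2 \<le> 2 * (?Q \<xi> - m)\<^sup>2 + 2 * (m - T * J)\<^sup>2" .
      qed simp
      also have "\<dots> \<le> (1 / T\<^sup>2) * (2 * (?Q \<xi> - m)\<^sup>2 + 2 * K2\<^sup>2)" using mb by (intro mult_left_mono) auto
      also have "\<dots> = (2 / T\<^sup>2) * (?Q \<xi> - m)\<^sup>2 + (2 / T\<^sup>2) * K2\<^sup>2" by (simp add: algebra_simps add_divide_distrib)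
      finally show ?thesis .
    qed
    have split: "ennreal (u * v + z) = ennreal u * ennreal v + ennreal z" if "0 \<le> u" "0 \<le> v" "0 \<le> z" for u v z :: real
      using that by (simp add: ennreal_mult)
    have T2: "0 \<le> 2 / T\<^sup>2" and T2K: "0 \<le> (2 / T\<^sup>2) * K2\<^sup>2" by simp_all
    have "(\<integral>\<^sup>+\<xi>. ennreal ((?Q \<xi> / T - J)\<^sup>2) \<partial>noise ?\<delta> ?n) \<le>
      (\<integral>\<^sup>+\<xi>. ennreal (2 / T\<^sup>2) * ennreal ((?Q \<xi> - m)\<^sup>2) + ennreal ((2 / T\<^sup>2) * K2\<^sup>2) \<partial>noise ?\<delta> ?n)"
    proof (rule nn_integral_mono)
      fix \<xi>
      have "ennreal ((?Q \<xi> / T - J)\<^sup>2) \<le> ennreal ((2 / T\<^sup>2) * (?Q \<xi> - m)\<^sup>2 + (2 / T\<^sup>2) * K2\<^sup>2)"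
        by (rule ennreal_leI[OF pw])
      then show "ennreal ((?Q \<xi> / T - J)\<^sup>2) \<le> ennreal (2 / T\<^sup>2) * ennreal ((?Q \<xi> - m)\<^sup>2) + ennreal ((2 / T\<^sup>2) * K2\<^sup>2)"
        unfolding split[OF T2 zero_le_power2 T2K] .
    qed
    also have "\<dots> = ennreal (2 / T\<^sup>2) * ennreal (2 * ?\<delta>\<^sup>2 * (\<Sum>j<?n. \<Sum>k<?n. (gram T N j k)\<^sup>2)) + ennreal ((2 / T\<^sup>2) * K2\<^sup>2)"
      by (subst nn_integral_add, measurable, subst nn_integral_cmult, measurable)
        (simp only: var nn_integral_const P.emeasure_space_1 mult_1_right)
    also have "\<dots> \<le> ennreal (2 / T\<^sup>2) * ennreal (2 * (2 * T * K1)) + ennreal ((2 / T\<^sup>2) * K2\<^sup>2)"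
      by (intro add_mono mult_left_mono ennreal_leI v) auto
    also have "\<dots> = ennreal ((2 / T\<^sup>2) * (2 * (2 * T * K1)) + (2 / T\<^sup>2) * K2\<^sup>2)"
      by (rule split[OF T2 _ T2K, symmetric]) (use T K1 in simp)
    also have "\<dots> \<le> ennreal (K / T)"
    proof (rule ennreal_leI)
      have "(2 / T\<^sup>2) * (2 * (2 * T * K1)) = (2 * (2 * (2 * K1))) / T" using T by (simp add: power2_eq_square field_simps)
      moreover have "(2 / T\<^sup>2) * K2\<^sup>2 \<le> (2 / T) * K2\<^sup>2"
      proof (rule mult_right_mono)
        have "T * 1 \<le> T * T" using T by (intro mult_left_mono) auto
        then show "2 / T\<^sup>2 \<le> 2 / T" using T by (intro divide_left_mono) (auto simp: power2_eq_square)
      qed simp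
      ultimately show "(2 / T\<^sup>2) * (2 * (2 * T * K1)) + (2 / T\<^sup>2) * K2\<^sup>2 \<le> K / T"
        unfolding K_def by (simp add: add_divide_distrib)
    qed
    finally show "(\<integral>\<^sup>+\<xi>. ennreal ((?Q \<xi> / T - J)\<^sup>2) \<partial>noise ?\<delta> ?n) \<le> ennreal (K / T)" .
  qed
qed

end

section \<open>Ergodicity of the energy\<close>

lemma integral_exp_square_tail:
  assumes d: "d > 0" and rR: "r \<le> R" and f: "continuous_on {r..R} f" and b: "\<And>t. t \<in> {r..R} \<Longrightarrow> \<bar>f t\<bar> \<le> C * exp (- d * t)"
    and C: "C \<ge> (0::real)"
  shows "integral {r..R} (\<lambda>t. (f t)\<^sup>2) \<le> C\<^sup>2 / (2 * d) * exp (- 2 * d * r)"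
proof -
  have h: "((\<lambda>t. C\<^sup>2 * exp (- 2 * d * t)) has_integral
      (- C\<^sup>2 / (2 * d) * exp (- 2 * d * R)) - (- C\<^sup>2 / (2 * d) * exp (- 2 * d * r))) {r..R}"
    by (rule fundamental_theorem_of_calculus[OF rR])
      (use d in \<open>auto intro!: derivative_eq_intros simp: has_real_derivative_iff_has_vector_derivative[symmetric]\<close>)
  have "integral {r..R} (\<lambda>t. (f t)\<^sup>2) \<le> integral {r..R} (\<lambda>t. C\<^sup>2 * exp (- 2 * d * t))"
  proof (rule integral_le)
    show "(\<lambda>t. (f t)\<^sup>2) integrable_on {r..R}" by (intro integrable_continuous_real continuous_intros f)
    show "(\<lambda>t. C\<^sup>2 * exp (- 2 * d * t)) integrable_on {r..R}" using h by blast
    fix t assume t: "t \<in> {r..R}"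
    have "(f t)\<^sup>2 = \<bar>f t\<bar>\<^sup>2" by simp
    also have "\<dots> \<le> (C * exp (- d * t))\<^sup>2" by (intro power_mono b t) simp
    also have "\<dots> = C\<^sup>2 * exp (- d * t + - d * t)" by (simp only: exp_add power2_eq_square mult_ac)
    also have "- d * t + - d * t = - 2 * d * t" by simp
    finally show "(f t)\<^sup>2 \<le> C\<^sup>2 * exp (- 2 * d * t)" .
  qed
  also have "\<dots> = C\<^sup>2 / (2 * d) * exp (- 2 * d * r) - C\<^sup>2 / (2 * d) * exp (- 2 * d * R)"
    using integral_unique[OF h] by simp
  also have "\<dots> \<le> C\<^sup>2 / (2 * d) * exp (- 2 * d * r)" using d by simp
  finally show ?thesis .
qed

text \<open>The asymptotic Fisher information per unit of time.\<close>

definition information :: "(real \<Rightarrow> real) \<Rightarrow> real" where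
  "information x0 = (LBINT t:{0..}. (window x0 t)\<^sup>2)"

lemma window_decaying_kernel:
  assumes fs: "fundamental_solution a x0" and a: "a \<in> {- (pi\<^sup>2 / 2)<..<0}"
  shows "\<exists>C d. decaying_kernel (window x0) C d (information x0)"
proof -
  note c0 = fundamental_solution_continuous[OF fs]
  have yc: "continuous_on A (window x0)" for A by (rule window_continuous[OF c0])
  obtain C d where C: "C \<ge> 0" and d: "d > 0" and b: "\<And>t. \<bar>window x0 t\<bar> \<le> C * exp (- d * t)"
    using window_exponential_decay[OF fs a] by blast
  have y2c: "continuous_on A (\<lambda>s. (window x0 s)\<^sup>2)" for A by (intro continuous_intros yc)
  have i: "(\<lambda>s. (window x0 s)\<^sup>2) integrable_on {p..q}" for p q by (rule integrable_continuous_real[OF y2c])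
  have "set_integrable lborel {0..} (\<lambda>s. (window x0 s)\<^sup>2)"
  proof (rule set_integrable_exp_decay[OF y2c, where k = "2 * d" and C = "C\<^sup>2"])
    fix t :: real
    have "(window x0 t)\<^sup>2 = \<bar>window x0 t\<bar>\<^sup>2" by simp
    also have "\<dots> \<le> (C * exp (- d * t))\<^sup>2" by (intro power_mono b) simp
    also have "\<dots> = C\<^sup>2 * exp (- d * t + - d * t)" by (simp only: exp_add power2_eq_square mult_ac)
    finally show "norm ((window x0 t)\<^sup>2) \<le> C\<^sup>2 * exp (- (2 * d) * t)" by (simp add: algebra_simps)
  qed (use d in simp)
  then have "((\<lambda>R. LBINT s:{0..R}. (window x0 s)\<^sup>2) \<longlongrightarrow> information x0) at_top"
    unfolding information_def by (intro tendsto_set_lebesgue_integral_at_top) auto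
  then have lim: "((\<lambda>R. integral {0..R} (\<lambda>s. (window x0 s)\<^sup>2)) \<longlongrightarrow> information x0) at_top"
    by (simp add: set_integral_continuous(2)[OF y2c])
  have split: "integral {0..R} (\<lambda>s. (window x0 s)\<^sup>2) = integral {0..r} (\<lambda>s. (window x0 s)\<^sup>2) + integral {r..R} (\<lambda>s. (window x0 s)\<^sup>2)"
    if "0 \<le> r" "r \<le> R" for r R
    by (rule Henstock_Kurzweil_Integration.integral_combine[symmetric]) (use that i in auto)
  have "decaying_kernel (window x0) C d (information x0)"
  proof
    fix r :: real assume r: "r \<ge> 0"
    show "0 \<le> information x0 - integral {0..r} (\<lambda>s. (window x0 s)\<^sup>2)"
    proof -
      have "integral {0..r} (\<lambda>s. (window x0 s)\<^sup>2) \<le> information x0"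
      proof (rule tendsto_lowerbound[OF lim])
        show "\<forall>\<^sub>F R in at_top. integral {0..r} (\<lambda>s. (window x0 s)\<^sup>2) \<le> integral {0..R} (\<lambda>s. (window x0 s)\<^sup>2)"
          using eventually_ge_at_top[of r]
        proof eventually_elim
          case (elim R)
          have "0 \<le> integral {r..R} (\<lambda>s. (window x0 s)\<^sup>2)"
            by (rule Henstock_Kurzweil_Integration.integral_nonneg[OF i]) simp
          then show ?case using split[OF r elim] by linarith
        qed
      qed simp
      then show ?thesis by simp
    qed
    show "information x0 - integral {0..r} (\<lambda>s. (window x0 s)\<^sup>2) \<le> C\<^sup>2 / (2 * d) * exp (- 2 * d * r)"
    proof -
      have "information x0 \<le> integral {0..r} (\<lambda>s. (window x0 s)\<^sup>2) + C\<^sup>2 / (2 * d) * exp (- 2 * d * r)"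
      proof (rule tendsto_upperbound[OF lim])
        show "\<forall>\<^sub>F R in at_top. integral {0..R} (\<lambda>s. (window x0 s)\<^sup>2) \<le> integral {0..r} (\<lambda>s. (window x0 s)\<^sup>2) + C\<^sup>2 / (2 * d) * exp (- 2 * d * r)"
          using eventually_ge_at_top[of r]
        proof eventually_elim
          case (elim R)
          then show ?case using split[OF r elim] integral_exp_square_tail[OF d elim yc b C] by linarith
        qed
      qed simp
      then show ?thesis by simp
    qed
  qed (use yc C d b in auto)
  then show ?thesis by blast
qed

text \<open>If it vanished, \<open>window x0\<close> would vanish on \<open>[0, 1]\<close>; then \<open>x0 = 1\<close> there and \<open>window x0 1 = 1\<close>.\<close>

lemma information_pos:
  assumes fs: "fundamental_solution a x0" and a: "a \<in> {- (pi\<^sup>2 / 2)<..<0}"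
  shows "information x0 > 0"
proof -
  note c0 = fundamental_solution_continuous[OF fs]
  obtain C d where "decaying_kernel (window x0) C d (information x0)" using window_decaying_kernel[OF fs a] by blast
  then interpret decaying_kernel "window x0" C d "information x0" .
  have y2c: "continuous_on {0..1} (\<lambda>s. (window x0 s)\<^sup>2)" by (intro continuous_intros window_continuous[OF c0])
  have "integral {0..1} (\<lambda>s. (window x0 s)\<^sup>2) \<noteq> 0"
  proof
    assume "integral {0..1} (\<lambda>s. (window x0 s)\<^sup>2) = 0"
    then have "((\<lambda>s. (window x0 s)\<^sup>2) has_integral 0) (cbox 0 1)"
      using integrable_integral[OF integrable_continuous_real[OF y2c]] by (simp add: cbox_interval)
    then have z: "window x0 s = 0" if "s \<in> {0..1}" for s
      using has_integral_0_cbox_imp_0[of 0 1 "\<lambda>s. (window x0 s)\<^sup>2" s] y2c that by (auto simp: cbox_interval)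
    have "x0 t = 1" if t: "t \<in> {0..1}" for t
    proof -
      have "integral {0..t} (window x0) = integral {0..t} (\<lambda>_. 0)"
        by (rule Henstock_Kurzweil_Integration.integral_cong) (use z t in auto)
      then show ?thesis using fundamental_solution_eq[OF fs, of t] t by simp
    qed
    then have "integral {0..1} x0 = integral {0..1::real} (\<lambda>_. 1)"
      by (intro Henstock_Kurzweil_Integration.integral_cong) auto
    then have "window x0 1 = 1" by (simp add: window_def primitive_def[of _ 1])
    then show False using z[of 1] by simp
  qed
  moreover have "integral {0..1} (\<lambda>s. (window x0 s)\<^sup>2) \<ge> 0"
    by (rule Henstock_Kurzweil_Integration.integral_nonneg[OF integrable_continuous_real[OF y2c]]) simp
  ultimately show ?thesis using J(1)[of 1] by simp
qed

locale stable_delay_model = affine_delay_model +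
  fixes a :: real and x0 :: "real \<Rightarrow> real"
  assumes fundamental: "fundamental_solution a x0" and stable: "a \<in> {- (pi\<^sup>2 / 2)<..<0}"
begin

abbreviation J :: real where "J \<equiv> information x0"

lemmas x0_cont = fundamental_solution_continuous[OF fundamental]

lemma J_pos: "J > 0" by (rule information_pos[OF fundamental stable])

definition kernel_energy :: "real \<Rightarrow> nat \<Rightarrow> 'a \<Rightarrow> real" where
  "kernel_energy T N \<omega> = integral {0..T} (\<lambda>t. (kernel_sum (window x0) N (Suc (steps T N)) (noise_of W N (Suc (steps T N)) \<omega>) t)\<^sup>2) / T"

text \<open>Defined as a limit along the discretisations, which makes it measurable at once. Almost surely it is
  the mean square of \<open>window_wiener_integral\<close> over \<open>[0, T]\<close>.\<close>

definition wiener_energy :: "real \<Rightarrow> 'a \<Rightarrow> real" where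
  "wiener_energy T \<omega> = lim (\<lambda>N. kernel_energy T (Suc N) \<omega>)"

lemma measurable_kernel_energy: "N > 0 \<Longrightarrow> kernel_energy T N \<in> borel_measurable M"
proof -
  assume N: "N > 0"
  obtain C d where "decaying_kernel (window x0) C d J" using window_decaying_kernel[OF fundamental stable] by blast
  then interpret decaying_kernel "window x0" C d J .
  have "W t \<in> borel_measurable M" if "t \<ge> 0" for t using wiener that unfolding wiener_process_def by blast
  then have [measurable]: "(\<lambda>\<omega>. noise_of W N n \<omega> k) \<in> borel_measurable M" if "k < n" for n k
    using that unfolding noise_of_def increments_def by simp
  show ?thesis unfolding kernel_energy_def[abs_def] kernel_energy_eq_quadratic_form
    by (intro borel_measurable_divide borel_measurable_sum borel_measurable_times measurable_const) auto
qed

lemma measurable_wiener_energy [measurable]: "wiener_energy T \<in> borel_measurable M"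
  unfolding wiener_energy_def[abs_def] by (rule borel_measurable_lim_metric) (rule measurable_kernel_energy, simp)

lemma kernel_energy_limit:
  assumes w: "continuous_on {0..} (\<lambda>t. W t \<omega>)" "W 0 \<omega> = 0" and T: "T \<ge> 0"
  shows "(\<lambda>N. kernel_energy T (Suc N) \<omega>) \<longlonglongrightarrow> wiener_energy T \<omega>"
    and "wiener_energy T \<omega> = integral {0..T} (\<lambda>t. (window_wiener_integral x0 (\<lambda>t. W t \<omega>) t)\<^sup>2) / T"
proof -
  have "kernel_sum (window x0) N (Suc (steps T N)) (noise_of W N (Suc (steps T N)) \<omega>) t =
      kernel_sum (window x0) N (Suc (steps T N)) (increments (\<lambda>t. W t \<omega>) N) t" for N t
    unfolding kernel_sum_def noise_of_def by (intro sum.cong) auto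
  then have e: "kernel_energy T N \<omega> = integral {0..T} (\<lambda>t. (kernel_sum (window x0) N (Suc (steps T N)) (increments (\<lambda>t. W t \<omega>) N) t)\<^sup>2) / T" for N
    unfolding kernel_energy_def by simp
  have "(\<lambda>N. kernel_energy T N \<omega>) \<longlonglongrightarrow> integral {0..T} (\<lambda>t. (window_wiener_integral x0 (\<lambda>t. W t \<omega>) t)\<^sup>2) / T"
    unfolding e divide_inverse by (intro tendsto_mult tendsto_const kernel_energy_converges(2)[OF x0_cont w T])
  then have l: "(\<lambda>N. kernel_energy T (Suc N) \<omega>) \<longlonglongrightarrow> integral {0..T} (\<lambda>t. (window_wiener_integral x0 (\<lambda>t. W t \<omega>) t)\<^sup>2) / T"
    by (rule LIMSEQ_Suc)
  then show "wiener_energy T \<omega> = integral {0..T} (\<lambda>t. (window_wiener_integral x0 (\<lambda>t. W t \<omega>) t)\<^sup>2) / T"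
    unfolding wiener_energy_def by (rule limI)
  with l show "(\<lambda>N. kernel_energy T (Suc N) \<omega>) \<longlonglongrightarrow> wiener_energy T \<omega>" by simp
qed

lemma wiener_paths: "AE \<omega> in M. continuous_on {0..} (\<lambda>t. W t \<omega>) \<and> W 0 \<omega> = 0"
  using wiener unfolding wiener_process_def by simp

text \<open>Fatou's lemma transfers the uniform bound for the discretised integrals to the limit.\<close>

lemma wiener_energy_L2: "\<exists>K. \<forall>T\<ge>1. (\<integral>\<^sup>+\<omega>. ennreal ((wiener_energy T \<omega> - J)\<^sup>2) \<partial>M) \<le> ennreal (K / T)"
proof -
  obtain C d where "decaying_kernel (window x0) C d J" using window_decaying_kernel[OF fundamental stable] by blast
  then interpret decaying_kernel "window x0" C d J .
  obtain K where K: "\<And>T N. T \<ge> 1 \<Longrightarrow> N > 0 \<Longrightarrow>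
     (\<integral>\<^sup>+\<xi>. ennreal ((integral {0..T} (\<lambda>t. (kernel_sum (window x0) N (Suc (steps T N)) \<xi> t)\<^sup>2) / T - J)\<^sup>2)
     \<partial>noise (1 / N) (Suc (steps T N))) \<le> ennreal (K / T)"
    using kernel_energy_variance by blast
  show ?thesis
  proof (intro exI[of _ K] allI impI)
    fix T :: real assume T: "T \<ge> 1"
    have b: "(\<integral>\<^sup>+\<omega>. ennreal ((kernel_energy T N \<omega> - J)\<^sup>2) \<partial>M) \<le> ennreal (K / T)" if N: "N > 0" for N
    proof -
      let ?n = "Suc (steps T N)"
      let ?Q = "\<lambda>\<xi>. ennreal ((integral {0..T} (\<lambda>t. (kernel_sum (window x0) N ?n \<xi> t)\<^sup>2) / T - J)\<^sup>2)"
      have nm: "noise_of W N ?n \<in> M \<rightarrow>\<^sub>M noise (1 / N) ?n"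
        by (rule indep_history_noise(2)[OF wiener initial indep N]) simp
      have Qm: "?Q \<in> borel_measurable (noise (1 / N) ?n)"
        unfolding kernel_energy_eq_quadratic_form by measurable
      have "(\<integral>\<^sup>+\<omega>. ennreal ((kernel_energy T N \<omega> - J)\<^sup>2) \<partial>M) = (\<integral>\<^sup>+\<xi>. ?Q \<xi> \<partial>distr M (noise (1 / N) ?n) (noise_of W N ?n))"
        unfolding kernel_energy_def by (rule nn_integral_distr[symmetric]) (rule nm, subst measurable_distr_eq1, rule Qm)
      also have "\<dots> = (\<integral>\<^sup>+\<xi>. ?Q \<xi> \<partial>noise (1 / N) ?n)"
        by (simp only: distr_noise_of[OF wiener N, of ?n, OF zero_less_Suc])
      also have "\<dots> \<le> ennreal (K / T)" by (rule K[OF T N])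
      finally show ?thesis .
    qed
    have "(\<integral>\<^sup>+\<omega>. ennreal ((wiener_energy T \<omega> - J)\<^sup>2) \<partial>M) = (\<integral>\<^sup>+\<omega>. liminf (\<lambda>N. ennreal ((kernel_energy T (Suc N) \<omega> - J)\<^sup>2)) \<partial>M)"
    proof (rule nn_integral_cong_AE)
      show "AE \<omega> in M. ennreal ((wiener_energy T \<omega> - J)\<^sup>2) = liminf (\<lambda>N. ennreal ((kernel_energy T (Suc N) \<omega> - J)\<^sup>2))"
        using wiener_paths
      proof eventually_elim
        case (elim \<omega>)
        have "(\<lambda>N. kernel_energy T (Suc N) \<omega>) \<longlonglongrightarrow> wiener_energy T \<omega>"
          by (rule kernel_energy_limit) (use elim T in auto)
        then have "(\<lambda>N. ennreal ((kernel_energy T (Suc N) \<omega> - J)\<^sup>2)) \<longlonglongrightarrow> ennreal ((wiener_energy T \<omega> - J)\<^sup>2)"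
          by (intro tendsto_intros)
        then show ?case by (intro lim_imp_Liminf[symmetric]) auto
      qed
    qed
    also have "\<dots> \<le> liminf (\<lambda>N. \<integral>\<^sup>+\<omega>. ennreal ((kernel_energy T (Suc N) \<omega> - J)\<^sup>2) \<partial>M)"
    proof (rule nn_integral_liminf)
      fix N
      have [measurable]: "kernel_energy T (Suc N) \<in> borel_measurable M" by (rule measurable_kernel_energy) simp
      show "(\<lambda>\<omega>. ennreal ((kernel_energy T (Suc N) \<omega> - J)\<^sup>2)) \<in> borel_measurable M" by measurable
    qed
    also have "\<dots> \<le> ennreal (K / T)"
      by (rule Liminf_le) (use b in \<open>auto intro: always_eventually\<close>)
    finally show "(\<integral>\<^sup>+\<omega>. ennreal ((wiener_energy T \<omega> - J)\<^sup>2) \<partial>M) \<le> ennreal (K / T)" .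
  qed
qed

lemma wiener_energy_in_probability:
  assumes e: "e > 0"
  shows "((\<lambda>T. prob {\<omega>\<in>space M. \<bar>wiener_energy T \<omega> - J\<bar> > e}) \<longlongrightarrow> 0) at_top"
proof -
  obtain K where K: "\<And>T. T \<ge> 1 \<Longrightarrow> (\<integral>\<^sup>+\<omega>. ennreal ((wiener_energy T \<omega> - J)\<^sup>2) \<partial>M) \<le> ennreal (K / T)"
    using wiener_energy_L2 by blast
  have b: "prob {\<omega>\<in>space M. \<bar>wiener_energy T \<omega> - J\<bar> > e} \<le> \<bar>K\<bar> / e\<^sup>2 * (1 / T)" if T: "T \<ge> 1" for T
  proof -
    have "emeasure M {\<omega>\<in>space M. \<bar>wiener_energy T \<omega> - J\<bar> > e}
      \<le> emeasure M {\<omega>\<in>space M. 1 \<le> ennreal (1 / e\<^sup>2) * ennreal ((wiener_energy T \<omega> - J)\<^sup>2)}"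
    proof (rule emeasure_mono)
      show "{\<omega>\<in>space M. \<bar>wiener_energy T \<omega> - J\<bar> > e} \<subseteq> {\<omega>\<in>space M. 1 \<le> ennreal (1 / e\<^sup>2) * ennreal ((wiener_energy T \<omega> - J)\<^sup>2)}"
      proof safe
        fix \<omega> assume "e < \<bar>wiener_energy T \<omega> - J\<bar>"
        then have "e\<^sup>2 \<le> (wiener_energy T \<omega> - J)\<^sup>2" using e by (simp add: abs_le_square_iff[symmetric])
        then have "1 \<le> 1 / e\<^sup>2 * (wiener_energy T \<omega> - J)\<^sup>2" using e by simp
        then have "ennreal 1 \<le> ennreal (1 / e\<^sup>2 * (wiener_energy T \<omega> - J)\<^sup>2)" by (rule ennreal_leI)
        then show "1 \<le> ennreal (1 / e\<^sup>2) * ennreal ((wiener_energy T \<omega> - J)\<^sup>2)"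
          by (subst ennreal_mult[symmetric]) auto
      qed
    qed measurable
    also have "\<dots> \<le> ennreal (1 / e\<^sup>2) * (\<integral>\<^sup>+\<omega>. ennreal ((wiener_energy T \<omega> - J)\<^sup>2) * indicator (space M) \<omega> \<partial>M)"
      by (rule nn_integral_Markov_inequality) auto
    also have "(\<integral>\<^sup>+\<omega>. ennreal ((wiener_energy T \<omega> - J)\<^sup>2) * indicator (space M) \<omega> \<partial>M) = (\<integral>\<^sup>+\<omega>. ennreal ((wiener_energy T \<omega> - J)\<^sup>2) \<partial>M)"
      by (rule nn_integral_cong) simp
    also have "ennreal (1 / e\<^sup>2) * (\<integral>\<^sup>+\<omega>. ennreal ((wiener_energy T \<omega> - J)\<^sup>2) \<partial>M) \<le> ennreal (1 / e\<^sup>2) * ennreal (\<bar>K\<bar> / T)"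
      using K[OF T] T by (intro mult_left_mono) (auto elim!: order_trans intro!: ennreal_leI divide_right_mono)
    also have "\<dots> = ennreal (\<bar>K\<bar> / e\<^sup>2 * (1 / T))"
      using T by (subst ennreal_mult[symmetric]) auto
    finally show ?thesis using T unfolding emeasure_eq_measure by (subst (asm) ennreal_le_iff) auto
  qed
  have "((\<lambda>T. \<bar>K\<bar> / e\<^sup>2 * (1 / T)) \<longlongrightarrow> \<bar>K\<bar> / e\<^sup>2 * 0) at_top"
    by (intro tendsto_mult tendsto_const tendsto_divide_0[OF tendsto_const] filterlim_at_top_imp_at_infinity filterlim_ident)
  then have "((\<lambda>T. \<bar>K\<bar> / e\<^sup>2 * (1 / T)) \<longlongrightarrow> 0) at_top" by simp
  then show ?thesis
  proof (rule tendsto_sandwich[OF _ _ tendsto_const, rotated 2])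
    show "\<forall>\<^sub>F T in at_top. prob {\<omega>\<in>space M. \<bar>wiener_energy T \<omega> - J\<bar> > e} \<le> \<bar>K\<bar> / e\<^sup>2 * (1 / T)"
      using eventually_ge_at_top[of 1] by eventually_elim (rule b)
  qed simp
qed

text \<open>With \<open>Y = D + G\<close>, where \<open>D\<close> is the decaying deterministic part and \<open>G\<close> the Wiener integral,
  \<open>\<bar>Y\<^sup>2 - G\<^sup>2\<bar> \<le> \<eta> * G\<^sup>2 + (1 + 1 / \<eta>) * D\<^sup>2\<close>, and the integral of \<open>D\<^sup>2\<close> over the half line is
  finite.\<close>

lemma energy_close_wiener_energy:
  "AE \<omega> in M. \<exists>c\<ge>0. \<forall>T>0. \<forall>\<eta>>0.
     \<bar>energy T (\<lambda>t. X a t \<omega>) / T - wiener_energy T \<omega>\<bar> \<le> \<eta> * wiener_energy T \<omega> + (1 + 1 / \<eta>) * c / T"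
  using wiener_paths solves_sdde_pathwise[OF wiener solution, of a]
proof eventually_elim
  case (elim \<omega>)
  let ?x = "\<lambda>t. X a t \<omega>" and ?w = "\<lambda>t. W t \<omega>"
  let ?G = "window_wiener_integral x0 ?w"
  have sol: "pathwise_solution a ?w ?x" using elim by simp
  then have x: "continuous_on {-1..} ?x" unfolding pathwise_solution_def by simp
  obtain C d where "decaying_kernel (window x0) C d J" using window_decaying_kernel[OF fundamental stable] by blast
  then interpret decaying_kernel "window x0" C d J .
  define D where "D t = history ?x t + window x0 t * ?x 0 + a * integral {0..t} (\<lambda>s. window x0 (t - s) * history ?x s)" for t
  have mD: "moving ?x t = D t + ?G t" if "t \<ge> 0" for t
    using moving_decomposition[OF fundamental sol that] unfolding D_def window_wiener_integral_def .
  obtain K where K: "K \<ge> 0" "\<And>t. t \<ge> 0 \<Longrightarrow> \<bar>D t\<bar> \<le> K * exp (- d * t)"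
    using deterministic_part_decay[OF fundamental x d C y_bound] unfolding D_def by blast
  show ?case
  proof (intro exI[of _ "K\<^sup>2 / (2 * d)"] conjI allI impI)
    fix T \<eta> :: real assume T: "T > 0" and \<eta>: "\<eta> > 0"
    have Gc: "continuous_on {0..T} ?G" by (rule kernel_energy_converges(1)[OF x0_cont]) (use elim T in auto)
    have mc: "continuous_on {0..T} (moving ?x)" by (rule moving_continuous[OF x])
    have Dc: "continuous_on {0..T} D"
      by (rule continuous_on_eq[where f = "\<lambda>t. moving ?x t - ?G t"]) (auto simp: mD intro!: continuous_intros mc Gc)
    have S: "wiener_energy T \<omega> = integral {0..T} (\<lambda>t. (?G t)\<^sup>2) / T"
      by (rule kernel_energy_limit) (use elim T in auto)
    have iD: "integral {0..T} (\<lambda>t. (D t)\<^sup>2) \<le> K\<^sup>2 / (2 * d)"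
      using integral_exp_square_tail[OF d _ Dc _ K(1)] K(2) T by simp
    have "\<bar>integral {0..T} (\<lambda>t. (moving ?x t)\<^sup>2 - (?G t)\<^sup>2)\<bar> \<le> integral {0..T} (\<lambda>t. \<eta> * (?G t)\<^sup>2 + (1 + 1 / \<eta>) * (D t)\<^sup>2)"
      unfolding real_norm_def[symmetric]
    proof (rule integral_norm_bound_integral)
      show "(\<lambda>t. (moving ?x t)\<^sup>2 - (?G t)\<^sup>2) integrable_on {0..T}" "(\<lambda>t. \<eta> * (?G t)\<^sup>2 + (1 + 1 / \<eta>) * (D t)\<^sup>2) integrable_on {0..T}"
        by (intro integrable_continuous_real continuous_intros mc Gc Dc)+
      fix t assume "t \<in> {0..T}"
      then have m: "moving ?x t = D t + ?G t" by (intro mD) auto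
      have amgm: "\<bar>2 * u * v\<bar> \<le> \<eta> * v\<^sup>2 + (1 / \<eta>) * u\<^sup>2" for u v
      proof -
        have "0 \<le> (1 / \<eta>) * (\<eta> * \<bar>v\<bar> - \<bar>u\<bar>)\<^sup>2" using \<eta> by simp
        also have "\<dots> = \<eta> * v\<^sup>2 + (1 / \<eta>) * u\<^sup>2 - 2 * (\<bar>u\<bar> * \<bar>v\<bar>)"
          using \<eta> by (simp add: power2_eq_square field_simps)
        finally show ?thesis by (simp add: abs_mult)
      qed
      have e1: "(D t + ?G t)\<^sup>2 - (?G t)\<^sup>2 = 2 * D t * ?G t + (D t)\<^sup>2" by (simp add: power2_sum)
      have e2: "(1 + 1 / \<eta>) * (D t)\<^sup>2 = (D t)\<^sup>2 + (1 / \<eta>) * (D t)\<^sup>2" by (simp add: distrib_right)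
      show "norm ((moving ?x t)\<^sup>2 - (?G t)\<^sup>2) \<le> \<eta> * (?G t)\<^sup>2 + (1 + 1 / \<eta>) * (D t)\<^sup>2"
        unfolding m e1 e2 real_norm_def using amgm[of "D t" "?G t"] zero_le_power2[of "D t"] by linarith
    qed
    also have "\<dots> = \<eta> * integral {0..T} (\<lambda>t. (?G t)\<^sup>2) + (1 + 1 / \<eta>) * integral {0..T} (\<lambda>t. (D t)\<^sup>2)"
      by (subst Henstock_Kurzweil_Integration.integral_add)
        (auto intro!: integrable_continuous_real continuous_intros Gc Dc)
    also have "\<dots> \<le> \<eta> * integral {0..T} (\<lambda>t. (?G t)\<^sup>2) + (1 + 1 / \<eta>) * (K\<^sup>2 / (2 * d))"
      using iD \<eta> by (intro add_left_mono mult_left_mono) auto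
    also have "integral {0..T} (\<lambda>t. (moving ?x t)\<^sup>2 - (?G t)\<^sup>2) = energy T ?x - integral {0..T} (\<lambda>t. (?G t)\<^sup>2)"
      unfolding energy_def
      by (rule Henstock_Kurzweil_Integration.integral_diff) (intro integrable_continuous_real continuous_intros mc Gc)+
    finally have "\<bar>energy T ?x - integral {0..T} (\<lambda>t. (?G t)\<^sup>2)\<bar> / T \<le>
      (\<eta> * integral {0..T} (\<lambda>t. (?G t)\<^sup>2) + (1 + 1 / \<eta>) * (K\<^sup>2 / (2 * d))) / T"
      using T by (intro divide_right_mono) auto
    then show "\<bar>energy T ?x / T - wiener_energy T \<omega>\<bar> \<le> \<eta> * wiener_energy T \<omega> + (1 + 1 / \<eta>) * (K\<^sup>2 / (2 * d)) / T"
      unfolding S using T by (simp add: add_divide_distrib diff_divide_distrib[symmetric])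
  qed (use d in simp)
qed

text \<open>On the event that the Wiener energy is within \<open>\<delta>\<close> of \<open>J\<close>, its multiple by \<open>\<eta>\<close> is at most \<open>e / 3\<close>.
  The transient contributes an error of order \<open>1 / T\<close> with a random constant, which is below \<open>e / 4\<close>
  eventually on every path; dominated convergence turns this into a statement about probabilities.\<close>

theorem energy_ergodic:
  assumes e: "e > 0"
  shows "((\<lambda>T. prob {\<omega>\<in>space M. \<bar>energy T (\<lambda>t. X a t \<omega>) / T - J\<bar> > e}) \<longlongrightarrow> 0) at_top"
proof -
  \<comment> \<open>Chosen such that \<open>\<eta>\<close> times a Wiener energy of at most \<open>J + 1\<close> is at most \<open>e / 3\<close>.\<close>
  define \<eta> where "\<eta> = e / (3 * (J + 1))"
  define \<delta> where "\<delta> = min 1 (e / 3)"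
  have p: "J + 1 > 0" using J_pos by simp
  have \<eta>: "\<eta> > 0" "\<eta> * (J + 1) = e / 3" using e p by (auto simp: \<eta>_def field_simps)
  have \<delta>: "\<delta> > 0" "\<delta> \<le> 1" "\<delta> \<le> e / 3" using e by (auto simp: \<delta>_def)
  let ?I = "\<lambda>T \<omega>. energy T (\<lambda>t. X a t \<omega>) / T" and ?Q = wiener_energy
  have Im [measurable]: "(\<lambda>\<omega>. ?I T \<omega>) \<in> borel_measurable M" if "T \<ge> 0" for T
    using measurable_path_functionals(3)[OF paths that, of a] by measurable
  define A where "A T = {\<omega>\<in>space M. \<bar>?Q T \<omega> - J\<bar> > \<delta>}" for T
  define B where "B T = {\<omega>\<in>space M. \<bar>?I T \<omega> - ?Q T \<omega>\<bar> > \<eta> * ?Q T \<omega> + e / 4}" for T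
  have sA [measurable]: "A T \<in> sets M" for T unfolding A_def by measurable
  have sB [measurable]: "B T \<in> sets M" if "T \<ge> 0" for T unfolding B_def using Im[OF that] by measurable
  have limA: "((\<lambda>T. prob (A T)) \<longlongrightarrow> 0) at_top"
    unfolding A_def by (rule wiener_energy_in_probability[OF \<delta>(1)])
  have limB: "((\<lambda>T. prob (B (max 0 T))) \<longlongrightarrow> 0) at_top"
  proof (rule tendsto_at_topI_sequentially)
    fix S :: "nat \<Rightarrow> real" assume S: "filterlim S at_top sequentially"
    have "(\<lambda>n. \<integral>\<omega>. indicator (B (max 0 (S n))) \<omega> \<partial>M) \<longlonglongrightarrow> (\<integral>\<omega>. (0::real) \<partial>M)"
    proof (rule integral_dominated_convergence[where w = "\<lambda>_. 1"])
      show "AE \<omega> in M. (\<lambda>n. indicator (B (max 0 (S n))) \<omega> :: real) \<longlonglongrightarrow> 0"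
        using energy_close_wiener_energy
      proof eventually_elim
        case (elim \<omega>)
        then obtain c where c: "c \<ge> 0" "\<And>T. T > 0 \<Longrightarrow> \<bar>?I T \<omega> - ?Q T \<omega>\<bar> \<le> \<eta> * ?Q T \<omega> + (1 + 1 / \<eta>) * c / T"
          using \<eta>(1) by blast
        have "((\<lambda>n. ((1 + 1 / \<eta>) * c) / S n) \<longlongrightarrow> 0) sequentially"
          by (intro tendsto_divide_0[OF tendsto_const] filterlim_at_top_imp_at_infinity S)
        then have "\<forall>\<^sub>F n in sequentially. ((1 + 1 / \<eta>) * c) / S n < e / 4" by (rule order_tendstoD(2)) (use e in simp)
        moreover have "\<forall>\<^sub>F n in sequentially. S n > 0" using S by (simp add: filterlim_at_top_dense)
        ultimately have "\<forall>\<^sub>F n in sequentially. indicator (B (max 0 (S n))) \<omega> = (0::real)"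
        proof eventually_elim
          case (elim n)
          have "\<bar>?I (S n) \<omega> - ?Q (S n) \<omega>\<bar> \<le> \<eta> * ?Q (S n) \<omega> + e / 4" using c(2)[of "S n"] elim by linarith
          then have "\<omega> \<notin> B (S n)" unfolding B_def by simp
          then show ?case using elim by (simp add: max_def)
        qed
        then show ?case by (rule tendsto_eventually)
      qed
    qed (auto simp: indicator_def)
    then show "(\<lambda>n. prob (B (max 0 (S n)))) \<longlonglongrightarrow> 0" by simp
  qed
  have "((\<lambda>T. prob (A T) + prob (B (max 0 T))) \<longlongrightarrow> 0 + 0) at_top" by (intro tendsto_add limA limB)
  then have lim: "((\<lambda>T. prob (A T) + prob (B (max 0 T))) \<longlongrightarrow> 0) at_top" by simp
  show ?thesis
  proof (rule tendsto_sandwich[OF _ _ tendsto_const lim])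
    show "\<forall>\<^sub>F T in at_top. prob {\<omega>\<in>space M. \<bar>?I T \<omega> - J\<bar> > e} \<le> prob (A T) + prob (B (max 0 T))"
      using eventually_gt_at_top[of 0]
    proof eventually_elim
      case (elim T)
      have "{\<omega>\<in>space M. \<bar>?I T \<omega> - J\<bar> > e} \<subseteq> A T \<union> B T"
      proof safe
        fix \<omega> assume \<omega>: "\<omega> \<in> space M" "e < \<bar>?I T \<omega> - J\<bar>" "\<omega> \<notin> B T"
        have 1: "\<bar>?I T \<omega> - ?Q T \<omega>\<bar> \<le> \<eta> * ?Q T \<omega> + e / 4" using \<omega> unfolding B_def by auto
        show "\<omega> \<in> A T"
        proof (rule ccontr)
          assume "\<omega> \<notin> A T"
          then have 2: "\<bar>?Q T \<omega> - J\<bar> \<le> \<delta>" using \<omega> unfolding A_def by auto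
          then have "?Q T \<omega> \<le> J + 1" using \<delta> by linarith
          then have "\<eta> * ?Q T \<omega> \<le> e / 3" using mult_left_mono[of "?Q T \<omega>" "J + 1" \<eta>] \<eta> by simp
          then show False using 1 2 \<delta>(3) \<omega>(2) e by linarith
        qed
      qed
      then have "prob {\<omega>\<in>space M. \<bar>?I T \<omega> - J\<bar> > e} \<le> prob (A T \<union> B T)"
        by (rule finite_measure_mono) (use elim in \<open>simp add: sets.Un sA sB\<close>)
      also have "\<dots> \<le> prob (A T) + prob (B T)" by (rule measure_Un_le) (use elim in \<open>simp_all add: sA sB\<close>)
      finally show ?case using elim by (simp add: max_def)
    qed
  qed simp
qed

end

section \<open>The characteristic function of the score\<close>

text \<open>Summands are admitted as long as the full sum has not passed \<open>c\<close>; the decision for index \<open>k\<close>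
  includes the \<open>k\<close>-th summand, so the truncated sum never exceeds \<open>c\<close>.\<close>

lemma truncated_sum_bounds:
  fixes g :: "nat \<Rightarrow> real"
  assumes g: "\<And>k. 0 \<le> g k" and c: "0 \<le> c"
  shows "(\<Sum>k<m. if (\<Sum>j\<le>k. g j) \<le> c then g k else 0) \<le> c"
proof -
  have "(\<Sum>k<m. if (\<Sum>j\<le>k. g j) \<le> c then g k else 0) \<le> c \<and>
    (\<Sum>k<m. if (\<Sum>j\<le>k. g j) \<le> c then g k else 0) \<le> (\<Sum>k<m. g k)"
  proof (induction m)
    case (Suc m)
    then show ?case using g[of m] by (auto simp: lessThan_Suc_atMost[symmetric])
  qed (use c in simp)
  then show ?thesis ..
qed

lemma measurable_drift_euler:
  assumes "\<And>i. (\<lambda>\<omega>. p \<omega> i) \<in> borel_measurable M" "\<And>k. k < n \<Longrightarrow> (\<lambda>\<omega>. \<xi> \<omega> k) \<in> borel_measurable M" "k \<le> n"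
  shows "(\<lambda>\<omega>. drift N (euler N a (p \<omega>) (\<xi> \<omega>)) k) \<in> borel_measurable M"
  unfolding drift_def
  by (intro borel_measurable_divide borel_measurable_sum borel_measurable_const measurable_euler[OF assms(1,2)])
    (use assms(3) in auto)

lemma drift_euler_adapted: "k \<le> j \<Longrightarrow> drift N (euler N a p (\<xi>(j := y))) k = drift N (euler N a p \<xi>) k"
  unfolding drift_def
  by (intro arg_cong2[where f = "(/)"] sum.cong euler_cong[where n = k]) auto

text \<open>Subtracting \<open>a\<close> times the energy removes the drift of the increments and leaves the martingale
  transform of the noise.\<close>

lemma sum_drift_inc_euler_path:
  assumes N: "N > 0"
  shows "sum_drift_inc N n (euler_path N a p n \<xi>) - a * sum_drift_sq N n (euler_path N a p n \<xi>) =
    (\<Sum>k<n. drift N (euler N a p \<xi>) k * \<xi> k)"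
proof -
  have d: "drift N (euler_path N a p n \<xi>) k = drift N (euler N a p \<xi>) k" if "k < n" for k
    unfolding drift_def euler_path_def by (intro arg_cong2[where f = "(/)"] sum.cong) (use that in auto)
  have "sum_drift_inc N n (euler_path N a p n \<xi>) =
    (\<Sum>k<n. drift N (euler N a p \<xi>) k * (a / real N * drift N (euler N a p \<xi>) k + \<xi> k))"
    unfolding sum_drift_inc_def by (intro sum.cong refl) (simp add: d euler_path_def euler_Suc)
  also have "\<dots> = a * ((\<Sum>k<n. (drift N (euler N a p \<xi>) k)\<^sup>2) / real N) + (\<Sum>k<n. drift N (euler N a p \<xi>) k * \<xi> k)"
    by (simp add: distrib_left sum.distrib sum_distrib_left sum_divide_distrib power2_eq_square mult_ac)
  also have "(\<Sum>k<n. (drift N (euler N a p \<xi>) k)\<^sup>2) / real N = sum_drift_sq N n (euler_path N a p n \<xi>)"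
    unfolding sum_drift_sq_def by (simp add: d)
  finally show ?thesis by simp
qed

text \<open>For a continuous martingale \<open>d\<close> that starts at \<open>0\<close> and has bounded bracket \<open>q\<close> this is a complex
  martingale with mean \<open>1\<close>.\<close>

definition exp_martingale :: "real \<Rightarrow> real \<Rightarrow> real \<Rightarrow> complex" where
  "exp_martingale s d q = exp (\<i> * complex_of_real (s * d) + complex_of_real (s\<^sup>2 / 2 * q))"

lemma norm_exp_martingale: "norm (exp_martingale s d q) = exp (s\<^sup>2 / 2 * q)"
  unfolding exp_martingale_def by simp

lemma measurable_exp_martingale [measurable]:
  assumes [measurable]: "d \<in> borel_measurable M" "q \<in> borel_measurable M"
  shows "(\<lambda>\<omega>. exp_martingale s (d \<omega>) (q \<omega>)) \<in> borel_measurable M"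
  unfolding exp_martingale_def by measurable

text \<open>The drift is truncated when the energy passes \<open>c\<close>. This keeps it adapted and its bracket bounded, so
  the truncated exponential martingale \<open>A\<close> has mean exactly \<open>1\<close>. Where \<open>\<psi> (q \<omega>) \<noteq> 0\<close> the truncation
  has no effect, and \<open>A\<close> is bounded everywhere by \<open>exp (s\<^sup>2 / 2 * c)\<close>.\<close>

lemma euler_exp_martingale:
  fixes a s c :: real and \<psi> :: "real \<Rightarrow> real"
  assumes W: "wiener_process M W" and X0: "continuous_process_on M {-1..0} X0"
    and ind: "indep_processes M {-1..0} X0 {0..} W" and N: "N > 0" and n: "steps T N > 0"
    and \<psi>: "continuous_on UNIV \<psi>" "\<And>q. 0 \<le> \<psi> q" "\<And>q. \<psi> q \<le> 1" "\<And>q. q > c \<Longrightarrow> \<psi> q = 0" and c: "c \<ge> 0"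
  defines "q \<equiv> \<lambda>\<omega>. sum_drift_sq N (steps T N) (euler_process W X0 a T N \<omega>)"
    and "d \<equiv> \<lambda>\<omega>. sum_drift_inc N (steps T N) (euler_process W X0 a T N \<omega>)"
  shows "norm ((\<integral>\<omega>. complex_of_real (\<psi> (q \<omega>)) * exp_martingale s (d \<omega> - a * q \<omega>) (q \<omega>) \<partial>M) - 1)
    \<le> exp (s\<^sup>2 / 2 * c) * (\<integral>\<omega>. 1 - \<psi> (q \<omega>) \<partial>M)"
proof -
  let ?n = "steps T N"
  interpret prob_space M using W unfolding wiener_process_def by simp
  define D where "D p \<xi> k = drift N (euler N a p \<xi>) k" for p \<xi> k
  \<comment> \<open>The condition involves the drift up to and including time \<open>k\<close>, which depends on earlier noise only.\<close>
  define h where "h p k \<xi> = (if (\<Sum>j\<le>k. (D p \<xi> j)\<^sup>2 * (1 / N)) \<le> c then D p \<xi> k else 0)" for p k \<xi>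
  define F where "F p \<xi> = exp_martingale s (\<Sum>k<?n. h p k \<xi> * \<xi> k) ((\<Sum>k<?n. (h p k \<xi>)\<^sup>2) * (1 / N))" for p \<xi>
  have hb: "(\<Sum>k<m. (h p k \<xi>)\<^sup>2) * (1 / N) \<le> c" for m p \<xi>
  proof -
    have "(\<Sum>k<m. (h p k \<xi>)\<^sup>2) * (1 / N) = (\<Sum>k<m. if (\<Sum>j\<le>k. (D p \<xi> j)\<^sup>2 * (1 / N)) \<le> c then (D p \<xi> k)\<^sup>2 * (1 / N) else 0)"
      unfolding sum_distrib_right h_def by (intro sum.cong) auto
    also have "\<dots> \<le> c" by (rule truncated_sum_bounds[OF _ c]) simp
    finally show ?thesis .
  qed
  have one: "(\<integral>\<xi>. F p \<xi> \<partial>noise (1 / N) ?n) = 1" for p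
    unfolding F_def exp_martingale_def
  proof (rule integral_exp_martingale_transform(2)[where c = c])
    fix k m :: nat assume km: "k \<le> m"
    have Dm [measurable]: "(\<lambda>\<xi>. D p \<xi> j) \<in> borel_measurable (noise (1 / N) m)" if "j \<le> k" for j
      unfolding D_def by (rule measurable_drift_euler[where n = m]) (use that km in auto)
    show "h p k \<in> borel_measurable (noise (1 / N) m)"
      unfolding h_def by measurable
  next
    fix k j :: nat and x :: "nat \<Rightarrow> real" and y assume "k \<le> j"
    then show "h p k (x(j := y)) = h p k x"
      unfolding h_def D_def by (simp add: drift_euler_adapted)
  qed (use N hb in auto)
  have nF: "norm (F p \<xi>) \<le> exp (s\<^sup>2 / 2 * c)" for p \<xi>
    unfolding F_def norm_exp_martingale exp_le_cancel_iff by (rule mult_left_mono[OF hb]) simp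
  have Fm: "case_prod F \<in> borel_measurable (seqs \<Otimes>\<^sub>M noise (1 / N) ?n)"
  proof -
    have Dm: "(\<lambda>z. D (fst z) (snd z) k) \<in> borel_measurable (seqs \<Otimes>\<^sub>M noise (1 / N) ?n)" if "k \<le> ?n" for k
      unfolding D_def by (rule measurable_drift_euler[OF _ _ that]) measurable
    have [measurable]: "(\<lambda>z. h (fst z) k (snd z)) \<in> borel_measurable (seqs \<Otimes>\<^sub>M noise (1 / N) ?n)" if "k < ?n" for k
      unfolding h_def
      by (intro measurable_If Dm borel_measurable_const borel_measurable_le measurable_sets_Collect
          pred_intros_logic borel_measurable_sum borel_measurable_times borel_measurable_power) (use that in auto)
    show ?thesis unfolding F_def case_prod_unfold by measurable
  qed
  note [measurable] = indep_history_noise(1,2)[OF W X0 ind N n]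
  define A where "A \<omega> = F (history_of X0 N \<omega>) (noise_of W N ?n \<omega>)" for \<omega>
  have Am [measurable]: "A \<in> borel_measurable M"
    unfolding A_def using measurable_compose[OF measurable_Pair[OF indep_history_noise(1,2)[OF W X0 ind N n]] Fm] by simp
  have EA: "(\<integral>\<omega>. A \<omega> \<partial>M) = 1"
    unfolding A_def integral_history_noise[OF W X0 ind N n Fm nF] one by (simp add: prob_space)
  have nA: "norm (A \<omega>) \<le> exp (s\<^sup>2 / 2 * c)" for \<omega> unfolding A_def by (rule nF)
  have [measurable]: "\<psi> \<in> borel_measurable borel" using \<psi>(1) by (rule borel_measurable_continuous_onI)
  have [measurable]: "q \<in> borel_measurable M" "d \<in> borel_measurable M"
    unfolding q_def d_def using measurable_euler_process[OF W X0 N] by measurable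
  have iA: "integrable M A" by (rule integrable_const_bound[where B = "exp (s\<^sup>2 / 2 * c)"]) (use nA in auto)
  have b1: "norm (1 - \<psi> r) \<le> 1" for r using \<psi>(2)[of r] \<psi>(3)[of r] by auto
  have i1: "integrable M (\<lambda>\<omega>. 1 - \<psi> (q \<omega>))" by (rule integrable_const_bound[where B = 1]) (use b1 in auto)
  have iAc: "integrable M (\<lambda>\<omega>. complex_of_real (\<psi> (q \<omega>)) * A \<omega>)"
  proof (rule Bochner_Integration.integrable_bound[OF iA])
    show "AE \<omega> in M. norm (complex_of_real (\<psi> (q \<omega>)) * A \<omega>) \<le> norm (A \<omega>)"
      using \<psi>(2,3) by (intro AE_I2) (auto simp: norm_mult intro!: mult_left_le_one_le)
  qed measurable
  have eq: "complex_of_real (\<psi> (q \<omega>)) * exp_martingale s (d \<omega> - a * q \<omega>) (q \<omega>) = complex_of_real (\<psi> (q \<omega>)) * A \<omega>" for \<omega>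
  proof (cases "q \<omega> > c")
    case True then show ?thesis using \<psi>(4) by simp
  next
    case False
    let ?p = "history_of X0 N \<omega>" and ?x = "noise_of W N ?n \<omega>"
    have q: "q \<omega> = (\<Sum>k<?n. (D ?p ?x k)\<^sup>2) * (1 / N)"
      unfolding q_def euler_process_def sum_drift_sq_def D_def
      by (auto simp: drift_def euler_path_def intro!: arg_cong2[where f = "(/)"] sum.cong)
    have "h ?p k ?x = D ?p ?x k" if "k < ?n" for k
    proof -
      have "(\<Sum>j\<le>k. (D ?p ?x j)\<^sup>2 * (1 / N)) \<le> (\<Sum>j<?n. (D ?p ?x j)\<^sup>2 * (1 / N))"
        by (rule sum_mono2) (use that in auto)
      also have "\<dots> \<le> c" using False unfolding q sum_distrib_right not_less .
      finally show ?thesis unfolding h_def by simp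
    qed
    then have "A \<omega> = exp_martingale s (\<Sum>k<?n. D ?p ?x k * ?x k) (q \<omega>)"
      unfolding A_def F_def q by simp
    also have "(\<Sum>k<?n. D ?p ?x k * ?x k) = d \<omega> - a * q \<omega>"
      unfolding d_def q_def euler_process_def D_def by (rule sum_drift_inc_euler_path[OF N, symmetric])
    finally show ?thesis by simp
  qed
  have "(\<integral>\<omega>. complex_of_real (\<psi> (q \<omega>)) * exp_martingale s (d \<omega> - a * q \<omega>) (q \<omega>) \<partial>M) - 1
    = (\<integral>\<omega>. complex_of_real (\<psi> (q \<omega>)) * A \<omega> - A \<omega> \<partial>M)"
    unfolding eq EA[symmetric] using iAc iA by (rule Bochner_Integration.integral_diff[symmetric])
  also have "norm \<dots> \<le> (\<integral>\<omega>. norm (complex_of_real (\<psi> (q \<omega>)) * A \<omega> - A \<omega>) \<partial>M)"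
    by (rule integral_norm_bound)
  also have "\<dots> \<le> (\<integral>\<omega>. exp (s\<^sup>2 / 2 * c) * (1 - \<psi> (q \<omega>)) \<partial>M)"
  proof (rule integral_mono)
    show "integrable M (\<lambda>\<omega>. norm (complex_of_real (\<psi> (q \<omega>)) * A \<omega> - A \<omega>))" using iAc iA by auto
    show "integrable M (\<lambda>\<omega>. exp (s\<^sup>2 / 2 * c) * (1 - \<psi> (q \<omega>)))" using i1 by simp
    fix \<omega>
    have "complex_of_real (\<psi> (q \<omega>)) * A \<omega> - A \<omega> = - (complex_of_real (1 - \<psi> (q \<omega>)) * A \<omega>)" by (simp add: algebra_simps)
    then have "norm (complex_of_real (\<psi> (q \<omega>)) * A \<omega> - A \<omega>) = (1 - \<psi> (q \<omega>)) * norm (A \<omega>)"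
      using \<psi>(3)[of "q \<omega>"] by (simp add: norm_mult norm_of_real del: of_real_diff)
    also have "\<dots> \<le> (1 - \<psi> (q \<omega>)) * exp (s\<^sup>2 / 2 * c)" by (rule mult_left_mono[OF nA]) (use \<psi>(3) in simp)
    finally show "norm (complex_of_real (\<psi> (q \<omega>)) * A \<omega> - A \<omega>) \<le> exp (s\<^sup>2 / 2 * c) * (1 - \<psi> (q \<omega>))" by (simp add: mult.commute)
  qed
  also have "\<dots> = exp (s\<^sup>2 / 2 * c) * (\<integral>\<omega>. 1 - \<psi> (q \<omega>) \<partial>M)" by (rule integral_mult_right_zero)
  finally show ?thesis .
qed

text \<open>The cut-off \<open>\<psi>\<close> is continuous, so all quantities in the estimate for the Euler scheme pass to the
  limit by dominated convergence.\<close>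

lemma (in affine_delay_model) exp_martingale_bound:
  fixes s c a T :: real and \<psi> :: "real \<Rightarrow> real"
  assumes T: "T > 0"
    and \<psi>: "continuous_on UNIV \<psi>" "\<And>q. 0 \<le> \<psi> q" "\<And>q. \<psi> q \<le> 1" "\<And>q. q > c \<Longrightarrow> \<psi> q = 0" and c: "c \<ge> 0"
  defines "q \<equiv> \<lambda>\<omega>. energy T (\<lambda>t. X a t \<omega>)" and "d \<equiv> \<lambda>\<omega>. drift_integral T (\<lambda>t. X a t \<omega>)"
  shows "norm ((\<integral>\<omega>. complex_of_real (\<psi> (q \<omega>)) * exp_martingale s (d \<omega> - a * q \<omega>) (q \<omega>) \<partial>M) - 1)
    \<le> exp (s\<^sup>2 / 2 * c) * (\<integral>\<omega>. 1 - \<psi> (q \<omega>) \<partial>M)"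
proof -
  have T0: "T \<ge> 0" using T by simp
  define f where "f d q = complex_of_real (\<psi> q) * exp_martingale s (d - a * q) q" for d q
  let ?E = "\<lambda>N \<omega>. euler_process W X0 a T N \<omega>"
  define qN where "qN N \<omega> = sum_drift_sq N (steps T N) (?E N \<omega>)" for N \<omega>
  define dN where "dN N \<omega> = sum_drift_inc N (steps T N) (?E N \<omega>)" for N \<omega>
  have [measurable]: "qN (Suc N) \<in> borel_measurable M" "dN (Suc N) \<in> borel_measurable M" for N
    unfolding qN_def[abs_def] dN_def[abs_def] using measurable_euler_process[OF wiener initial, of "Suc N"] by measurable
  have [measurable]: "q \<in> borel_measurable M" "d \<in> borel_measurable M"
    unfolding q_def d_def by (rule measurable_path_functionals[OF paths T0])+
  have [measurable]: "\<psi> \<in> borel_measurable borel" using \<psi>(1) by (rule borel_measurable_continuous_onI)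
  have lim: "AE \<omega> in M. (\<lambda>N. qN (Suc N) \<omega>) \<longlonglongrightarrow> q \<omega> \<and> (\<lambda>N. dN (Suc N) \<omega>) \<longlonglongrightarrow> d \<omega>"
    using euler_close[OF T0, of a]
  proof eventually_elim
    case (elim \<omega>)
    then show ?case
      unfolding qN_def dN_def q_def d_def
      by (auto intro!: LIMSEQ_Suc[OF sum_drift_sq_converges] LIMSEQ_Suc[OF sum_drift_inc_converges] T0)
  qed
  have \<psi>lim: "(\<lambda>N. \<psi> (r N)) \<longlonglongrightarrow> \<psi> l" if "r \<longlonglongrightarrow> l" for r l
    using continuous_on_tendsto_compose[OF \<psi>(1) that] by simp
  have nf: "norm (f d q) \<le> exp (s\<^sup>2 / 2 * c)" for d q
  proof (cases "q > c")
    case True then show ?thesis unfolding f_def by (simp add: \<psi>(4))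
  next
    case False
    have "norm (f d q) \<le> norm (exp_martingale s (d - a * q) q)"
      unfolding f_def norm_mult by (rule mult_left_le_one_le) (use \<psi>(2,3) in auto)
    also have "\<dots> \<le> exp (s\<^sup>2 / 2 * c)"
      unfolding norm_exp_martingale exp_le_cancel_iff by (rule mult_left_mono) (use False in auto)
    finally show ?thesis .
  qed
  have l1: "(\<lambda>N. \<integral>\<omega>. f (dN (Suc N) \<omega>) (qN (Suc N) \<omega>) \<partial>M) \<longlonglongrightarrow> (\<integral>\<omega>. f (d \<omega>) (q \<omega>) \<partial>M)"
  proof (rule integral_dominated_convergence[where w = "\<lambda>_. exp (s\<^sup>2 / 2 * c)"])
    show "AE \<omega> in M. (\<lambda>N. f (dN (Suc N) \<omega>) (qN (Suc N) \<omega>)) \<longlonglongrightarrow> f (d \<omega>) (q \<omega>)"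
      using lim by eventually_elim (unfold f_def exp_martingale_def, intro tendsto_intros \<psi>lim, auto)
  qed (unfold f_def, measurable, use nf[unfolded f_def] in auto)
  have l2: "(\<lambda>N. \<integral>\<omega>. 1 - \<psi> (qN (Suc N) \<omega>) \<partial>M) \<longlonglongrightarrow> (\<integral>\<omega>. 1 - \<psi> (q \<omega>) \<partial>M)"
  proof (rule integral_dominated_convergence[where w = "\<lambda>_. 1"])
    show "AE \<omega> in M. (\<lambda>N. 1 - \<psi> (qN (Suc N) \<omega>)) \<longlonglongrightarrow> 1 - \<psi> (q \<omega>)"
      using lim by eventually_elim (intro tendsto_intros \<psi>lim, auto)
  qed (use \<psi>(2,3) in auto)
  show ?thesis
    unfolding f_def[symmetric]
  proof (rule tendsto_le[OF sequentially_bot])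
    show "(\<lambda>N. exp (s\<^sup>2 / 2 * c) * (\<integral>\<omega>. 1 - \<psi> (qN (Suc N) \<omega>) \<partial>M)) \<longlonglongrightarrow> exp (s\<^sup>2 / 2 * c) * (\<integral>\<omega>. 1 - \<psi> (q \<omega>) \<partial>M)"
      by (intro tendsto_intros l2)
    show "(\<lambda>N. norm ((\<integral>\<omega>. f (dN (Suc N) \<omega>) (qN (Suc N) \<omega>) \<partial>M) - 1)) \<longlonglongrightarrow> norm ((\<integral>\<omega>. f (d \<omega>) (q \<omega>) \<partial>M) - 1)"
      by (intro tendsto_intros l1)
    have "\<forall>\<^sub>F N in sequentially. Suc N > 0 \<and> steps T (Suc N) > 0"
      using eventually_steps_pos[OF T] eventually_sequentially_Suc[of "\<lambda>N. N > 0 \<and> steps T N > 0"] by simp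
    then show "\<forall>\<^sub>F N in sequentially. norm ((\<integral>\<omega>. f (dN (Suc N) \<omega>) (qN (Suc N) \<omega>) \<partial>M) - 1)
      \<le> exp (s\<^sup>2 / 2 * c) * (\<integral>\<omega>. 1 - \<psi> (qN (Suc N) \<omega>) \<partial>M)"
    proof eventually_elim
      case (elim N)
      then show ?case
        unfolding f_def qN_def dN_def
        by (intro euler_exp_martingale[OF wiener initial indep _ _ \<psi> c]) auto
    qed
  qed
qed

lemma (in prob_space) expectation_tendsto_in_probability:
  fixes Y :: "real \<Rightarrow> 'a \<Rightarrow> real" and g :: "real \<Rightarrow> real"
  assumes Y: "\<And>T. T > 0 \<Longrightarrow> Y T \<in> borel_measurable M"
    and conv: "\<And>e. e > 0 \<Longrightarrow> ((\<lambda>T. prob {\<omega>\<in>space M. \<bar>Y T \<omega> - l\<bar> > e}) \<longlongrightarrow> 0) at_top"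
    and g: "continuous_on UNIV g" "\<And>y. \<bar>g y\<bar> \<le> B"
  shows "((\<lambda>T. \<integral>\<omega>. \<bar>g (Y T \<omega>) - g l\<bar> \<partial>M) \<longlongrightarrow> 0) at_top"
proof (rule tendstoI)
  fix e :: real assume e: "e > 0"
  have [measurable]: "g \<in> borel_measurable borel" using g(1) by (rule borel_measurable_continuous_onI)
  have B: "B \<ge> 0" using g(2)[of 0] by simp
  obtain r where r: "r > 0" "\<And>y. dist y l < r \<Longrightarrow> dist (g y) (g l) < e / 2"
    using g(1) e unfolding continuous_on_iff by (metis UNIV_I half_gt_zero)
  have "((\<lambda>T. 2 * B * prob {\<omega>\<in>space M. \<bar>Y T \<omega> - l\<bar> > r / 2}) \<longlongrightarrow> 2 * B * 0) at_top"
    by (intro tendsto_intros conv) (use r in simp)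
  then have "\<forall>\<^sub>F T in at_top. 2 * B * prob {\<omega>\<in>space M. \<bar>Y T \<omega> - l\<bar> > r / 2} < e / 2"
    by (rule order_tendstoD(2)) (use e in simp)
  then show "\<forall>\<^sub>F T in at_top. dist (\<integral>\<omega>. \<bar>g (Y T \<omega>) - g l\<bar> \<partial>M) 0 < e"
    using eventually_gt_at_top[of 0]
  proof eventually_elim
    case (elim T)
    note [measurable] = Y[OF elim(2)]
    let ?A = "{\<omega>\<in>space M. \<bar>Y T \<omega> - l\<bar> > r / 2}"
    have b: "\<bar>g y - g l\<bar> \<le> 2 * B" for y using g(2)[of y] g(2)[of l] by linarith
    have "(\<integral>\<omega>. \<bar>g (Y T \<omega>) - g l\<bar> \<partial>M) \<le> (\<integral>\<omega>. e / 2 + 2 * B * indicator ?A \<omega> \<partial>M)"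
    proof (rule integral_mono)
      show "integrable M (\<lambda>\<omega>. \<bar>g (Y T \<omega>) - g l\<bar>)"
        by (rule integrable_const_bound[where B = "2 * B"]) (use b in auto)
      show "integrable M (\<lambda>\<omega>. e / 2 + 2 * B * indicator ?A \<omega>)"
        by (intro Bochner_Integration.integrable_add integrable_mult_right integrable_const integrable_real_indicator) (auto simp: less_top[symmetric])
      fix \<omega> assume \<omega>: "\<omega> \<in> space M"
      show "\<bar>g (Y T \<omega>) - g l\<bar> \<le> e / 2 + 2 * B * indicator ?A \<omega>"
      proof (cases "\<omega> \<in> ?A")
        case True then show ?thesis using b[of "Y T \<omega>"] e by simp
      next
        case False
        then have "dist (Y T \<omega>) l < r" using \<omega> r(1) by (simp add: dist_real_def)
        then show ?thesis using r(2)[of "Y T \<omega>"] False by (simp add: dist_real_def)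
      qed
    qed
    also have "\<dots> = e / 2 + 2 * B * prob ?A"
      by (subst Bochner_Integration.integral_add) (auto simp: prob_space less_top[symmetric])
    also have "\<dots> < e" using elim by linarith
    finally show ?case by (simp add: integral_nonneg_AE)
  qed
qed

context stable_delay_model
begin

definition score :: "real \<Rightarrow> 'a \<Rightarrow> real" where
  "score T \<omega> = (drift_integral T (\<lambda>t. X a t \<omega>) - a * energy T (\<lambda>t. X a t \<omega>)) / sqrt T"

definition observed_information :: "real \<Rightarrow> 'a \<Rightarrow> real" where
  "observed_information T \<omega> = energy T (\<lambda>t. X a t \<omega>) / T"

lemma measurable_score [measurable (raw)]:
  assumes "T \<ge> 0"
  shows "score T \<in> borel_measurable M" "observed_information T \<in> borel_measurable M"
  unfolding score_def[abs_def] observed_information_def[abs_def]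
  using measurable_path_functionals(2,3)[OF paths assms, of a] by measurable

lemma information_expectation_tendsto:
  fixes g :: "real \<Rightarrow> real"
  assumes "continuous_on UNIV g" "\<And>y. \<bar>g y\<bar> \<le> B"
  shows "((\<lambda>T. \<integral>\<omega>. \<bar>g (observed_information T \<omega>) - g J\<bar> \<partial>M) \<longlongrightarrow> 0) at_top"
proof (rule expectation_tendsto_in_probability[OF _ _ assms])
  show "((\<lambda>T. prob {\<omega>\<in>space M. \<bar>observed_information T \<omega> - J\<bar> > e}) \<longlongrightarrow> 0) at_top" if "e > 0" for e
    unfolding observed_information_def by (rule energy_ergodic[OF that])
qed (rule measurable_score(2), simp)

text \<open>The martingale central limit theorem. With \<open>s = u / sqrt T\<close> and a cut-off of the energy at
  \<open>(J + 2) * T\<close>, the exponential martingale has mean close to \<open>1\<close>, because the cut-off acts on an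
  event of vanishing probability. As the observed information is close to \<open>J\<close>, its factor
  \<open>exp (u\<^sup>2 / 2 * I)\<close> may be replaced by \<open>exp (u\<^sup>2 / 2 * J)\<close>.\<close>

lemma score_characteristic_function:
  "((\<lambda>T. \<integral>\<omega>. iexp (u * score T \<omega>) \<partial>M) \<longlongrightarrow> complex_of_real (exp (- (u\<^sup>2 * J / 2)))) at_top"
proof -
  \<comment> \<open>Equal to \<open>1\<close> up to \<open>J + 1\<close> and to \<open>0\<close> from \<open>J + 2\<close> on.\<close>
  define \<psi> where "\<psi> r = max 0 (min 1 (J + 2 - r))" for r :: real
  \<comment> \<open>The error factor made by replacing the observed information by \<open>J\<close>; it is bounded and equals \<open>1\<close> at \<open>J\<close>.\<close>
  define g where "g r = \<psi> r * exp (u\<^sup>2 / 2 * (r - J))" for r :: real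
  have J0: "J > 0" by (rule J_pos)
  have \<psi>: "continuous_on UNIV \<psi>" "\<And>q. 0 \<le> \<psi> q" "\<And>q. \<psi> q \<le> 1" "\<And>q. q > J + 2 \<Longrightarrow> \<psi> q = 0" "\<psi> J = 1"
    unfolding \<psi>_def by (auto intro!: continuous_intros)
  have [measurable]: "\<psi> \<in> borel_measurable borel" using \<psi>(1) by (rule borel_measurable_continuous_onI)
  have gc: "continuous_on UNIV g" unfolding g_def by (intro continuous_intros \<psi>)
  have [measurable]: "g \<in> borel_measurable borel" using gc by (rule borel_measurable_continuous_onI)
  have g0: "0 \<le> g r" "g r \<le> exp (u\<^sup>2 / 2 * 2)" for r
  proof -
    show "0 \<le> g r" unfolding g_def using \<psi>(2) by simp
    show "g r \<le> exp (u\<^sup>2 / 2 * 2)"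
    proof (cases "r > J + 2")
      case True then show ?thesis unfolding g_def by (simp add: \<psi>(4))
    next
      case False
      have "g r \<le> exp (u\<^sup>2 / 2 * (r - J))" unfolding g_def by (rule mult_left_le_one_le) (use \<psi>(2,3) in auto)
      also have "\<dots> \<le> exp (u\<^sup>2 / 2 * 2)" unfolding exp_le_cancel_iff by (rule mult_left_mono) (use False in auto)
      finally show ?thesis .
    qed
  qed
  have gb: "\<bar>g r\<bar> \<le> exp (u\<^sup>2 / 2 * 2)" for r using g0 by simp
  have gJ: "g J = 1" unfolding g_def \<psi>(5) by simp
  let ?I = observed_information and ?S = score and ?L = "exp (- (u\<^sup>2 * J / 2))"
  have lim\<psi>: "((\<lambda>T. \<integral>\<omega>. \<bar>\<psi> (?I T \<omega>) - \<psi> J\<bar> \<partial>M) \<longlongrightarrow> 0) at_top"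
    by (rule information_expectation_tendsto[where B = 1]) (use \<psi> in auto)
  have limg: "((\<lambda>T. \<integral>\<omega>. \<bar>g (?I T \<omega>) - g J\<bar> \<partial>M) \<longlongrightarrow> 0) at_top"
    by (rule information_expectation_tendsto[OF gc gb])
  define F where "F T \<omega> = complex_of_real (\<psi> (?I T \<omega>)) * exp_martingale u (?S T \<omega>) (?I T \<omega>)" for T \<omega>
  have F: "norm ((\<integral>\<omega>. F T \<omega> \<partial>M) - 1) \<le> exp (u\<^sup>2 / 2 * (J + 2)) * (\<integral>\<omega>. \<bar>\<psi> (?I T \<omega>) - \<psi> J\<bar> \<partial>M)" if T: "T > 0" for T
  proof -
    let ?q = "\<lambda>\<omega>. energy T (\<lambda>t. X a t \<omega>)" and ?d = "\<lambda>\<omega>. drift_integral T (\<lambda>t. X a t \<omega>)"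
    have e: "(u / sqrt T)\<^sup>2 / 2 * ((J + 2) * T) = u\<^sup>2 / 2 * (J + 2)" using T by (simp add: power_divide)
    have st: "exp_martingale (u / sqrt T) (?d \<omega> - a * ?q \<omega>) (?q \<omega>) = exp_martingale u (?S T \<omega>) (?I T \<omega>)" for \<omega>
      unfolding exp_martingale_def score_def observed_information_def using T by (simp add: power_divide mult.commute)
    have "norm ((\<integral>\<omega>. complex_of_real (\<psi> (?q \<omega> / T)) * exp_martingale (u / sqrt T) (?d \<omega> - a * ?q \<omega>) (?q \<omega>) \<partial>M) - 1)
      \<le> exp ((u / sqrt T)\<^sup>2 / 2 * ((J + 2) * T)) * (\<integral>\<omega>. 1 - \<psi> (?q \<omega> / T) \<partial>M)"
    proof (rule exp_martingale_bound[OF T])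
      show "continuous_on UNIV (\<lambda>q. \<psi> (q / T))"
        by (rule continuous_on_compose2[OF \<psi>(1)]) (use T in \<open>auto intro!: continuous_intros\<close>)
      show "\<psi> (q / T) = 0" if "(J + 2) * T < q" for q using that T by (intro \<psi>(4)) (simp add: field_simps)
    qed (use \<psi> T J0 in auto)
    moreover have "\<bar>\<psi> r - \<psi> J\<bar> = 1 - \<psi> r" for r using \<psi>(3)[of r] \<psi>(5) by simp
    ultimately show ?thesis unfolding e st F_def observed_information_def[symmetric] by simp
  qed
  have main: "norm ((\<integral>\<omega>. iexp (u * ?S T \<omega>) \<partial>M) - complex_of_real ?L) \<le>
      (\<integral>\<omega>. \<bar>g (?I T \<omega>) - g J\<bar> \<partial>M) + ?L * (exp (u\<^sup>2 / 2 * (J + 2)) * (\<integral>\<omega>. \<bar>\<psi> (?I T \<omega>) - \<psi> J\<bar> \<partial>M))" if T: "T > 0" for T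
  proof -
    note [measurable] = measurable_score[OF less_imp_le[OF T]]
    have i1: "integrable M (\<lambda>\<omega>. iexp (u * ?S T \<omega>))"
      by (rule integrable_const_bound[where B = 1]) auto
    \<comment> \<open>\<open>F\<close> has mean close to \<open>1\<close>, and \<open>?L * F\<close> differs from the wanted exponential only by the factor \<open>g\<close>.\<close>
    have split: "complex_of_real ?L * F T \<omega> = iexp (u * ?S T \<omega>) * complex_of_real (g (?I T \<omega>))" for \<omega>
    proof -
      have "exp (u\<^sup>2 / 2 * (?I T \<omega> - J)) = ?L * exp (u\<^sup>2 / 2 * ?I T \<omega>)"
        unfolding exp_add[symmetric] by (rule arg_cong[where f = exp]) (simp add: field_simps)
      moreover have "exp_martingale u d q = iexp (u * d) * complex_of_real (exp (u\<^sup>2 / 2 * q))" for d q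
        by (simp only: exp_martingale_def exp_add exp_of_real)
      ultimately show ?thesis unfolding F_def g_def by simp
    qed
    have i2: "integrable M (\<lambda>\<omega>. iexp (u * ?S T \<omega>) * complex_of_real (g (?I T \<omega>)))"
      by (rule integrable_const_bound[where B = "exp (u\<^sup>2 / 2 * 2)"]) (use g0 in \<open>auto simp: norm_mult\<close>)
    have n1: "norm ((\<integral>\<omega>. iexp (u * ?S T \<omega>) \<partial>M) - complex_of_real ?L * (\<integral>\<omega>. F T \<omega> \<partial>M)) \<le> (\<integral>\<omega>. \<bar>g (?I T \<omega>) - g J\<bar> \<partial>M)"
    proof -
      have EF: "complex_of_real ?L * (\<integral>\<omega>. F T \<omega> \<partial>M) = (\<integral>\<omega>. iexp (u * ?S T \<omega>) * complex_of_real (g (?I T \<omega>)) \<partial>M)"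
        unfolding split[symmetric] by (rule integral_mult_right_zero[symmetric])
      have e: "z - z * complex_of_real r = z * complex_of_real (1 - r)" for z r
        by (simp add: algebra_simps)
      have n: "norm (iexp r) = 1" for r by (rule norm_exp_i_times)
      have "norm (\<integral>\<omega>. iexp (u * ?S T \<omega>) - iexp (u * ?S T \<omega>) * complex_of_real (g (?I T \<omega>)) \<partial>M)
        \<le> (\<integral>\<omega>. norm (iexp (u * ?S T \<omega>) - iexp (u * ?S T \<omega>) * complex_of_real (g (?I T \<omega>))) \<partial>M)"
        by (rule integral_norm_bound)
      moreover have "norm (iexp (u * ?S T \<omega>) - iexp (u * ?S T \<omega>) * complex_of_real (g (?I T \<omega>))) = \<bar>g (?I T \<omega>) - g J\<bar>" for \<omega>
        unfolding e norm_mult n norm_of_real gJ by (simp add: abs_minus_commute)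
      ultimately show ?thesis
        unfolding EF by (simp only: Bochner_Integration.integral_diff[OF i1 i2])
    qed
    have n2: "norm (complex_of_real ?L * ((\<integral>\<omega>. F T \<omega> \<partial>M) - 1)) \<le> ?L * (exp (u\<^sup>2 / 2 * (J + 2)) * (\<integral>\<omega>. \<bar>\<psi> (?I T \<omega>) - \<psi> J\<bar> \<partial>M))"
      unfolding norm_mult norm_of_real abs_exp_cancel by (intro mult_left_mono F T) simp
    have eq: "(\<integral>\<omega>. iexp (u * ?S T \<omega>) \<partial>M) - complex_of_real ?L =
       ((\<integral>\<omega>. iexp (u * ?S T \<omega>) \<partial>M) - complex_of_real ?L * (\<integral>\<omega>. F T \<omega> \<partial>M)) + complex_of_real ?L * ((\<integral>\<omega>. F T \<omega> \<partial>M) - 1)"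
      by (simp add: algebra_simps)
    show ?thesis
      by (subst eq) (rule order_trans[OF norm_triangle_ineq add_mono[OF n1 n2]])
  qed
  have "((\<lambda>T. (\<integral>\<omega>. \<bar>g (?I T \<omega>) - g J\<bar> \<partial>M) + ?L * (exp (u\<^sup>2 / 2 * (J + 2)) * (\<integral>\<omega>. \<bar>\<psi> (?I T \<omega>) - \<psi> J\<bar> \<partial>M)))
      \<longlongrightarrow> 0 + ?L * (exp (u\<^sup>2 / 2 * (J + 2)) * 0)) at_top"
    by (intro tendsto_intros limg lim\<psi>)
  then have "((\<lambda>T. (\<integral>\<omega>. \<bar>g (?I T \<omega>) - g J\<bar> \<partial>M) + ?L * (exp (u\<^sup>2 / 2 * (J + 2)) * (\<integral>\<omega>. \<bar>\<psi> (?I T \<omega>) - \<psi> J\<bar> \<partial>M)))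
      \<longlongrightarrow> 0) at_top" by simp
  moreover have "\<forall>\<^sub>F T in at_top. norm ((\<integral>\<omega>. iexp (u * ?S T \<omega>) \<partial>M) - complex_of_real ?L) \<le>
      (\<integral>\<omega>. \<bar>g (?I T \<omega>) - g J\<bar> \<partial>M) + ?L * (exp (u\<^sup>2 / 2 * (J + 2)) * (\<integral>\<omega>. \<bar>\<psi> (?I T \<omega>) - \<psi> J\<bar> \<partial>M))"
    using eventually_gt_at_top[of 0] by eventually_elim (rule main)
  ultimately have "((\<lambda>T. (\<integral>\<omega>. iexp (u * ?S T \<omega>) \<partial>M) - complex_of_real ?L) \<longlongrightarrow> 0) at_top"
    by (rule Lim_null_comparison[rotated])
  then show ?thesis by (rule LIM_zero_cancel)
qed

section \<open>Convergence in distribution and asymptotic normality\<close>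

text \<open>Any normal variable with variance \<open>J\<close> will do; the driving process supplies one on the given
  probability space.\<close>

definition limit_score :: "'a \<Rightarrow> real" where
  "limit_score \<omega> = sqrt J * (W 1 \<omega> - W 0 \<omega>)"

lemma distributed_limit_score: "distributed M lborel limit_score (normal_density 0 (sqrt J))"
proof -
  have "distributed M lborel (\<lambda>\<omega>. W 1 \<omega> - W 0 \<omega>) (normal_density 0 (sqrt (1 - 0)))"
    using wiener unfolding wiener_process_def by (metis order.refl zero_less_one)
  then have "distributed M lborel (\<lambda>\<omega>. 0 + sqrt J * (W 1 \<omega> - W 0 \<omega>)) (normal_density (0 + sqrt J * 0) (\<bar>sqrt J\<bar> * sqrt (1 - 0)))"
    by (rule normal_density_affine) (use J_pos in auto)
  then show ?thesis using J_pos by (simp add: limit_score_def[abs_def])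
qed

lemma measurable_limit_score [measurable]: "limit_score \<in> borel_measurable M"
  using distributed_measurable[OF distributed_limit_score] by simp

lemma char_limit_score: "char (distr M borel limit_score) u = complex_of_real (exp (- (u\<^sup>2 * J / 2)))"
proof -
  have "distributed M lborel (\<lambda>\<omega>. W 1 \<omega> - W 0 \<omega>) (normal_density 0 (sqrt (1 - 0)))"
    using wiener unfolding wiener_process_def by (metis order.refl zero_less_one)
  from distributed_distr_eq_density[OF this] distributed_measurable[OF this] have Z: "distr M lborel (\<lambda>\<omega>. W 1 \<omega> - W 0 \<omega>) = std_normal_distribution" "(\<lambda>\<omega>. W 1 \<omega> - W 0 \<omega>) \<in> measurable M lborel"
    by simp_all
  have "char (distr M borel limit_score) u = (\<integral>\<omega>. iexp (u * limit_score \<omega>) \<partial>M)"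
    unfolding char_def by (rule integral_distr) auto
  also have "\<dots> = (\<integral>\<omega>. iexp ((u * sqrt J) * (W 1 \<omega> - W 0 \<omega>)) \<partial>M)"
    by (simp only: limit_score_def mult.assoc)
  also have "\<dots> = (\<integral>x. iexp ((u * sqrt J) * x) \<partial>distr M lborel (\<lambda>\<omega>. W 1 \<omega> - W 0 \<omega>))"
    by (rule integral_distr[symmetric]) (use Z(2) in auto)
  also have "\<dots> = char std_normal_distribution (u * sqrt J)"
    unfolding char_def Z(1) ..
  also have "\<dots> = complex_of_real (exp (- (u\<^sup>2 * J / 2)))"
    unfolding char_std_normal_distribution using J_pos by (simp add: power_mult_distrib)
  finally show ?thesis .
qed

text \<open>Levy's continuity theorem along every sequence of times tending to infinity. The maximum with \<open>0\<close>
  only ensures measurability for the finitely many negative times.\<close>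

lemma score_converges_weakly:
  fixes g :: "real \<Rightarrow> real"
  assumes g: "continuous_on UNIV g" "\<And>x. \<bar>g x\<bar> \<le> B"
  shows "((\<lambda>T. \<integral>\<omega>. g (score T \<omega>) \<partial>M) \<longlongrightarrow> (\<integral>\<omega>. g (limit_score \<omega>) \<partial>M)) at_top"
proof (rule tendsto_at_topI_sequentially)
  fix S :: "nat \<Rightarrow> real" assume S: "filterlim S at_top sequentially"
  have [measurable]: "g \<in> borel_measurable borel" using g(1) by (rule borel_measurable_continuous_onI)
  let ?\<mu> = "\<lambda>n. distr M borel (score (max 0 (S n)))" and ?\<nu> = "distr M borel limit_score"
  have S0: "\<forall>\<^sub>F n in sequentially. max 0 (S n) = S n"
    using S by (auto simp: filterlim_at_top_dense max_def elim!: allE[of _ 0] eventually_mono)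
  have m [measurable]: "score (max 0 (S n)) \<in> borel_measurable M" for n by (rule measurable_score) simp
  have d: "real_distribution (?\<mu> n)" "real_distribution ?\<nu>" for n
    by (intro real_distribution_distr m measurable_limit_score)+
  have "weak_conv_m ?\<mu> ?\<nu>"
  proof (rule levy_continuity[OF d])
    fix u
    have "(\<lambda>n. \<integral>\<omega>. iexp (u * score (S n) \<omega>) \<partial>M) \<longlonglongrightarrow> char ?\<nu> u"
      unfolding char_limit_score by (rule filterlim_compose[OF score_characteristic_function S])
    moreover have "\<forall>\<^sub>F n in sequentially. (\<integral>\<omega>. iexp (u * score (S n) \<omega>) \<partial>M) = char (?\<mu> n) u"
      using S0
    proof eventually_elim
      case (elim n)
      have "char (?\<mu> n) u = (\<integral>\<omega>. iexp (u * score (max 0 (S n)) \<omega>) \<partial>M)"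
        unfolding char_def by (rule integral_distr) auto
      then show ?case unfolding elim by (rule sym)
    qed
    ultimately show "(\<lambda>n. char (?\<mu> n) u) \<longlonglongrightarrow> char ?\<nu> u" by (rule Lim_transform_eventually)
  qed
  then have "(\<lambda>n. \<integral>x. g x \<partial>?\<mu> n) \<longlonglongrightarrow> (\<integral>x. g x \<partial>?\<nu>)"
    by (rule weak_conv_imp_integral_bdd_continuous_conv[OF d, where B = B])
      (use g continuous_on_eq_continuous_at[of UNIV g] in auto)
  moreover have "(\<integral>x. g x \<partial>?\<nu>) = (\<integral>\<omega>. g (limit_score \<omega>) \<partial>M)" by (rule integral_distr) auto
  moreover have "\<forall>\<^sub>F n in sequentially. (\<integral>x. g x \<partial>?\<mu> n) = (\<integral>\<omega>. g (score (S n) \<omega>) \<partial>M)"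
    using S0
  proof eventually_elim
    case (elim n)
    have "(\<integral>x. g x \<partial>?\<mu> n) = (\<integral>\<omega>. g (score (max 0 (S n)) \<omega>) \<partial>M)" by (rule integral_distr) auto
    then show ?case unfolding elim .
  qed
  ultimately show "(\<lambda>n. \<integral>\<omega>. g (score (S n) \<omega>) \<partial>M) \<longlonglongrightarrow> (\<integral>\<omega>. g (limit_score \<omega>) \<partial>M)"
    by (auto intro: Lim_transform_eventually)
qed

text \<open>Slutsky's theorem. The second component converges in probability to the constant \<open>J\<close>; outside the
  events \<open>\<bar>score\<bar> > K + 1\<close> and \<open>\<bar>information - J\<bar> > \<delta>\<close> the arguments lie in a compact set, on which
  the test function is uniformly continuous. The first event is controlled by the continuous
  function \<open>\<phi> K\<close>, to which weak convergence applies.\<close>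

lemma score_information_converge:
  "converges_in_distribution M (\<lambda>T \<omega>. (score T \<omega>, observed_information T \<omega>)) (\<lambda>\<omega>. (limit_score \<omega>, J))"
  unfolding converges_in_distribution_def
proof (intro allI impI, elim conjE)
  fix f :: "real \<times> real \<Rightarrow> real"
  assume fc: "continuous_on UNIV f" and fb: "bounded (range f)"
  obtain B where B: "\<And>z. \<bar>f z\<bar> \<le> B" using fb unfolding bounded_iff by auto
  have B0: "B \<ge> 0" using B[of undefined] by linarith
  have fm [measurable]: "f \<in> borel_measurable borel" using fc by (rule borel_measurable_continuous_onI)
  have f1: "continuous_on UNIV (\<lambda>x. f (x, J))"
    by (rule continuous_on_compose2[OF fc]) (auto intro!: continuous_intros)
  let ?I = observed_information and ?S = score
  have marginal: "((\<lambda>T. \<integral>\<omega>. f (?S T \<omega>, J) \<partial>M) \<longlongrightarrow> (\<integral>\<omega>. f (limit_score \<omega>, J) \<partial>M)) at_top"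
    by (rule score_converges_weakly[OF f1, where B = B]) (rule B)
  have close: "((\<lambda>T. (\<integral>\<omega>. f (?S T \<omega>, ?I T \<omega>) \<partial>M) - (\<integral>\<omega>. f (?S T \<omega>, J) \<partial>M)) \<longlongrightarrow> 0) at_top"
  proof (rule tendstoI)
    fix e :: real assume e: "e > 0"
    \<comment> \<open>A continuous upper bound for the indicator of \<open>\<bar>x\<bar> > K + 1\<close>.\<close>
    define \<phi> where "\<phi> K x = min 1 (max 0 (\<bar>x\<bar> - K))" for K x :: real
    have \<phi>: "continuous_on UNIV (\<phi> K)" "0 \<le> \<phi> K x" "\<bar>\<phi> K x\<bar> \<le> 1" for K x
      unfolding \<phi>_def by (auto intro!: continuous_intros)
    have \<phi>1: "\<phi> K x = 1" if "\<bar>x\<bar> > K + 1" for K x using that unfolding \<phi>_def by auto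
    have [measurable]: "\<phi> K \<in> borel_measurable borel" for K using \<phi>(1) by (rule borel_measurable_continuous_onI)
    have "(\<lambda>n. \<integral>\<omega>. \<phi> (real n) (limit_score \<omega>) \<partial>M) \<longlonglongrightarrow> (\<integral>\<omega>. 0 \<partial>M)"
    proof (rule integral_dominated_convergence[where w = "\<lambda>_. 1"])
      show "AE \<omega> in M. (\<lambda>n. \<phi> (real n) (limit_score \<omega>)) \<longlonglongrightarrow> 0"
      proof (rule AE_I2)
        fix \<omega>
        have "\<forall>\<^sub>F n in sequentially. \<phi> (real n) (limit_score \<omega>) = 0"
          using eventually_ge_at_top[of "nat \<lceil>\<bar>limit_score \<omega>\<bar>\<rceil>"]
        proof eventually_elim
          case (elim n)
          have "\<bar>limit_score \<omega>\<bar> \<le> real n" using elim by linarith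
          then show ?case unfolding \<phi>_def by simp
        qed
        then show "(\<lambda>n. \<phi> (real n) (limit_score \<omega>)) \<longlonglongrightarrow> 0" by (rule tendsto_eventually)
      qed
    qed (use \<phi> in auto)
    then have "(\<lambda>n. 2 * B * (\<integral>\<omega>. \<phi> (real n) (limit_score \<omega>) \<partial>M)) \<longlonglongrightarrow> 2 * B * (\<integral>\<omega>. 0 \<partial>M)" by (intro tendsto_intros)
    then have "\<forall>\<^sub>F n in sequentially. 2 * B * (\<integral>\<omega>. \<phi> (real n) (limit_score \<omega>) \<partial>M) < e / 3"
      by (rule order_tendstoD(2)) (use e in simp)
    then obtain n where n: "2 * B * (\<integral>\<omega>. \<phi> (real n) (limit_score \<omega>) \<partial>M) < e / 3"
      unfolding eventually_sequentially by blast
    define K where "K = real n"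
    have "uniformly_continuous_on ({-(K+1)..K+1} \<times> {J-1..J+1}) f"
      by (intro compact_uniformly_continuous continuous_on_subset[OF fc] compact_Times) auto
    then obtain r where r: "r > 0"
      "\<And>z z'. z \<in> {-(K+1)..K+1} \<times> {J-1..J+1} \<Longrightarrow> z' \<in> {-(K+1)..K+1} \<times> {J-1..J+1} \<Longrightarrow> dist z' z < r \<Longrightarrow> dist (f z') (f z) < e / 3"
      using e unfolding uniformly_continuous_on_def by (metis divide_pos_pos zero_less_numeral)
    define \<delta> where "\<delta> = min 1 (r / 2)"
    have \<delta>: "\<delta> > 0" "\<delta> \<le> 1" "\<delta> < r" using r(1) unfolding \<delta>_def by auto
    have "((\<lambda>T. 2 * B * (\<integral>\<omega>. \<phi> K (?S T \<omega>) \<partial>M)) \<longlongrightarrow> 2 * B * (\<integral>\<omega>. \<phi> K (limit_score \<omega>) \<partial>M)) at_top"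
      by (intro tendsto_intros score_converges_weakly[where B = 1] \<phi>)
    then have e1: "\<forall>\<^sub>F T in at_top. 2 * B * (\<integral>\<omega>. \<phi> K (?S T \<omega>) \<partial>M) < e / 3"
      by (rule order_tendstoD(2)) (use n in \<open>simp add: K_def\<close>)
    have "((\<lambda>T. 2 * B * prob {\<omega>\<in>space M. \<bar>?I T \<omega> - J\<bar> > \<delta>}) \<longlongrightarrow> 2 * B * 0) at_top"
      unfolding observed_information_def by (intro tendsto_intros energy_ergodic \<delta>)
    then have e2: "\<forall>\<^sub>F T in at_top. 2 * B * prob {\<omega>\<in>space M. \<bar>?I T \<omega> - J\<bar> > \<delta>} < e / 3"
      by (rule order_tendstoD(2)) (use e in simp)
    show "\<forall>\<^sub>F T in at_top. dist ((\<integral>\<omega>. f (?S T \<omega>, ?I T \<omega>) \<partial>M) - (\<integral>\<omega>. f (?S T \<omega>, J) \<partial>M)) 0 < e"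
      using eventually_gt_at_top[of 0] e1 e2
    proof eventually_elim
      case (elim T)
      note [measurable] = measurable_score[OF less_imp_le[OF elim(1)]]
      let ?A = "{\<omega>\<in>space M. \<bar>?I T \<omega> - J\<bar> > \<delta>}"
      have i1: "integrable M (\<lambda>\<omega>. f (?S T \<omega>, ?I T \<omega>))" and i2: "integrable M (\<lambda>\<omega>. f (?S T \<omega>, J))"
        by (rule integrable_const_bound[where B = B]; (simp add: B)?; measurable)+
      have i3: "integrable M (\<lambda>\<omega>. \<phi> K (?S T \<omega>))"
        by (rule integrable_const_bound[where B = 1]) (use \<phi> in auto)
      have i4: "integrable M (\<lambda>\<omega>. indicator ?A \<omega> :: real)"
        by (rule integrable_real_indicator) (auto simp: less_top[symmetric])
      have "\<bar>(\<integral>\<omega>. f (?S T \<omega>, ?I T \<omega>) \<partial>M) - (\<integral>\<omega>. f (?S T \<omega>, J) \<partial>M)\<bar> = \<bar>\<integral>\<omega>. f (?S T \<omega>, ?I T \<omega>) - f (?S T \<omega>, J) \<partial>M\<bar>"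
        by (simp only: Bochner_Integration.integral_diff[OF i1 i2])
      also have "\<dots> \<le> (\<integral>\<omega>. \<bar>f (?S T \<omega>, ?I T \<omega>) - f (?S T \<omega>, J)\<bar> \<partial>M)"
        using integral_norm_bound[of M "\<lambda>\<omega>. f (?S T \<omega>, ?I T \<omega>) - f (?S T \<omega>, J)"] by simp
      also have "\<dots> \<le> (\<integral>\<omega>. e / 3 + (2 * B * \<phi> K (?S T \<omega>) + 2 * B * indicator ?A \<omega>) \<partial>M)"
      proof (rule integral_mono)
        show "integrable M (\<lambda>\<omega>. \<bar>f (?S T \<omega>, ?I T \<omega>) - f (?S T \<omega>, J)\<bar>)" using i1 i2 by simp
        show "integrable M (\<lambda>\<omega>. e / 3 + (2 * B * \<phi> K (?S T \<omega>) + 2 * B * indicator ?A \<omega>))"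
          using i3 i4 by (intro Bochner_Integration.integrable_add integrable_mult_right integrable_const)
        fix \<omega> assume \<omega>: "\<omega> \<in> space M"
        have b: "\<bar>f (?S T \<omega>, ?I T \<omega>) - f (?S T \<omega>, J)\<bar> \<le> 2 * B"
          using B[of "(?S T \<omega>, ?I T \<omega>)"] B[of "(?S T \<omega>, J)"] by linarith
        have n1: "0 \<le> 2 * B * \<phi> K (?S T \<omega>)" and n2: "0 \<le> 2 * B * indicator ?A \<omega>" using B0 \<phi>(2) by auto
        show "\<bar>f (?S T \<omega>, ?I T \<omega>) - f (?S T \<omega>, J)\<bar> \<le> e / 3 + (2 * B * \<phi> K (?S T \<omega>) + 2 * B * indicator ?A \<omega>)"
        proof (cases "\<omega> \<in> ?A")
          case True
          then have "2 * B * indicator ?A \<omega> = 2 * B" by simp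
          then show ?thesis using b n1 e by linarith
        next
          case A: False
          show ?thesis
          proof (cases "\<bar>?S T \<omega>\<bar> > K + 1")
            case True
            then have "2 * B * \<phi> K (?S T \<omega>) = 2 * B" by (simp add: \<phi>1)
            then show ?thesis using b n2 e by linarith
          next
            case False
            have I: "\<bar>?I T \<omega> - J\<bar> \<le> \<delta>" using A \<omega> by simp
            have "dist (f (?S T \<omega>, ?I T \<omega>)) (f (?S T \<omega>, J)) < e / 3"
            proof (rule r(2))
              show "dist (?S T \<omega>, ?I T \<omega>) (?S T \<omega>, J) < r"
                using I \<delta>(3) by (simp add: dist_Pair_Pair dist_real_def)
            qed (use False I \<delta>(2) in auto)
            then show ?thesis using n1 n2 unfolding dist_real_def by linarith
          qed
        qed
      qed
      also have "\<dots> = e / 3 + (2 * B * (\<integral>\<omega>. \<phi> K (?S T \<omega>) \<partial>M) + 2 * B * prob ?A)"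
        using i3 i4 by (simp add: prob_space)
      also have "\<dots> < e" using elim by linarith
      finally show ?case by (simp add: dist_real_def)
    qed
  qed
  show "((\<lambda>T. \<integral>\<omega>. f (?S T \<omega>, ?I T \<omega>) \<partial>M) \<longlongrightarrow> (\<integral>\<omega>. f (limit_score \<omega>, J) \<partial>M)) at_top"
    using tendsto_add[OF close marginal] by simp
qed

text \<open>Completing the square: the integrand is the normal density with mean \<open>h * J\<close>.\<close>

lemma limit_score_exponential_moment: "(\<integral>\<omega>. exp (h * limit_score \<omega> - h\<^sup>2 * J / 2) \<partial>M) = 1"
proof -
  have "(\<integral>\<omega>. exp (h * limit_score \<omega> - h\<^sup>2 * J / 2) \<partial>M)
    = (\<integral>x. normal_density 0 (sqrt J) x * exp (h * x - h\<^sup>2 * J / 2) \<partial>lborel)"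
    by (rule distributed_integral[OF distributed_limit_score, symmetric]) auto
  also have "\<dots> = (\<integral>x. normal_density (h * J) (sqrt J) x \<partial>lborel)"
  proof (rule Bochner_Integration.integral_cong[OF refl])
    fix x :: real
    have "- (x\<^sup>2 / (2 * J)) + (h * x - h\<^sup>2 * J / 2) = - ((x - h * J)\<^sup>2 / (2 * J))"
      using J_pos by (simp add: power2_eq_square field_simps)
    then have "exp (- (x\<^sup>2 / (2 * J))) * exp (h * x - h\<^sup>2 * J / 2) = exp (- ((x - h * J)\<^sup>2 / (2 * J)))"
      unfolding exp_add[symmetric] by simp
    then show "normal_density 0 (sqrt J) x * exp (h * x - h\<^sup>2 * J / 2) = normal_density (h * J) (sqrt J) x"
      unfolding normal_density_def using J_pos by simp
  qed
  also have "\<dots> = 1" using J_pos by (intro integral_normal_density) simp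
  finally show ?thesis .
qed

text \<open>For \<open>b = a + k\<close> the Girsanov exponent is \<open>k * (D - a * E) - k\<^sup>2 * E / 2\<close>, so the quadratic expansion
  is exact.\<close>

lemma likelihood_remainder_zero:
  assumes T: "T > 0"
  shows "AE \<omega> in M. log_likelihood_ratio M X a (a + 1 / sqrt T * h) T \<omega>
    - (h * score T \<omega> - h\<^sup>2 * observed_information T \<omega> / 2) = 0"
  using log_likelihood_ratio_eq[OF T, of a "a + 1 / sqrt T * h"]
proof eventually_elim
  case (elim \<omega>)
  have q: "(1 / sqrt T * h)\<^sup>2 = h\<^sup>2 / T" using T by (simp add: power_divide)
  have "loglik a (a + k) D E = k * (D - a * E) - k\<^sup>2 * E / 2" for k D E
    unfolding loglik_def by (simp add: power2_eq_square field_simps)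
  from this[of "1 / sqrt T * h"] show ?case
    unfolding elim score_def observed_information_def q by simp
qed

lemma likelihood_remainder_vanishes:
  "vanishes_in_probability M (\<lambda>T \<omega>. log_likelihood_ratio M X a (a + 1 / sqrt T * h T) T \<omega>
     - (h T * score T \<omega> - (h T)\<^sup>2 * observed_information T \<omega> / 2))"
  (is "vanishes_in_probability M ?R")
  unfolding vanishes_in_probability_def
proof (intro conjI allI impI)
  fix T :: real assume T: "T > 0"
  note [measurable] = measurable_score[OF less_imp_le[OF T]] measurable_log_likelihood_ratio[OF T]
  show "?R T \<in> borel_measurable M" by measurable
next
  fix \<epsilon> :: real assume \<epsilon>: "\<epsilon> > 0"
  have "\<forall>\<^sub>F T in at_top. prob {\<omega>\<in>space M. \<bar>?R T \<omega>\<bar> > \<epsilon>} = 0"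
    using eventually_gt_at_top[of 0]
  proof eventually_elim
    case (elim T)
    have "prob {\<omega>\<in>space M. \<bar>?R T \<omega>\<bar> > \<epsilon>} = prob {}"
    proof (rule finite_measure_eq_AE)
      show "AE \<omega> in M. (\<omega> \<in> {\<omega>\<in>space M. \<bar>?R T \<omega>\<bar> > \<epsilon>}) = (\<omega> \<in> {})"
        using likelihood_remainder_zero[OF elim, of "h T"] by eventually_elim (use \<epsilon> in simp)
      note [measurable] = measurable_score[OF less_imp_le[OF elim]] measurable_log_likelihood_ratio[OF elim]
      show "{\<omega>\<in>space M. \<bar>?R T \<omega>\<bar> > \<epsilon>} \<in> sets M" by measurable
    qed simp
    then show ?case by simp
  qed
  then show "((\<lambda>T. prob {\<omega>\<in>space M. \<bar>?R T \<omega>\<bar> > \<epsilon>}) \<longlongrightarrow> 0) at_top" by (rule tendsto_eventually)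
qed

lemma locally_asymptotically_quadratic: "LAQ M X a (\<lambda>T. 1 / sqrt T) limit_score (\<lambda>_. J)"
proof -
  have "\<exists>\<Delta>\<^sub>T J\<^sub>T. (\<forall>T>0. \<Delta>\<^sub>T T \<in> borel_measurable M \<and> J\<^sub>T T \<in> borel_measurable M) \<and>
      (\<forall>h. bounded (h ` {0<..}) \<longrightarrow> vanishes_in_probability M (\<lambda>T \<omega>.
         log_likelihood_ratio M X a (a + 1 / sqrt T * h T) T \<omega> - (h T * \<Delta>\<^sub>T T \<omega> - (h T)\<^sup>2 * J\<^sub>T T \<omega> / 2))) \<and>
      converges_in_distribution M (\<lambda>T \<omega>. (\<Delta>\<^sub>T T \<omega>, J\<^sub>T T \<omega>)) (\<lambda>\<omega>. (limit_score \<omega>, J))"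
    by (rule exI[of _ score], rule exI[of _ observed_information])
      (intro conjI allI impI likelihood_remainder_vanishes score_information_converge, simp_all add: measurable_score)
  then show ?thesis
    unfolding LAQ_def using J_pos by (simp add: limit_score_exponential_moment)
qed

text \<open>The sigma algebra generated by a constant is trivial, so conditioning amounts to taking
  expectations.\<close>

lemma limit_score_cond_normal: "cond_centred_normal M limit_score (\<lambda>_. J)"
  unfolding cond_centred_normal_def
proof
  fix B :: "real set" assume [measurable]: "B \<in> sets borel"
  let ?F = "vimage_algebra (space M) (\<lambda>_. J) (borel :: real measure)"
  let ?f = "\<lambda>\<omega>. indicator B (limit_score \<omega>) :: real"
  let ?c = "measure (density lborel (normal_density 0 (sqrt J))) B"
  have sets_F: "sets ?F = {(\<lambda>_. J) -` A \<inter> space M | A. A \<in> sets borel}"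
    by (rule sets_vimage_algebra2) simp
  interpret finite_measure_subalgebra M ?F
    by unfold_locales (auto simp: subalgebra_def sets_F)
  have c: "(\<integral>\<omega>. ?f \<omega> \<partial>M) = ?c"
  proof -
    have "(\<integral>\<omega>. ?f \<omega> \<partial>M) = (\<integral>x. indicator B x \<partial>distr M lborel limit_score)"
      by (rule integral_distr[symmetric]) auto
    also have "\<dots> = ?c" unfolding distributed_distr_eq_density[OF distributed_limit_score] by simp
    finally show ?thesis .
  qed
  show "AE \<omega> in M. real_cond_exp M ?F ?f \<omega> = ?c"
  proof (rule real_cond_exp_charact)
    fix A assume "A \<in> sets ?F"
    then have "A = {} \<or> A = space M" unfolding sets_F by (auto split: if_splits)
    then show "(\<integral>\<omega>\<in>A. ?f \<omega> \<partial>M) = (\<integral>\<omega>\<in>A. ?c \<partial>M)"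
    proof
      assume A: "A = space M"
      have "(\<integral>\<omega>\<in>space M. f \<omega> \<partial>M) = (\<integral>\<omega>. f \<omega> \<partial>M)" for f :: "'a \<Rightarrow> real"
        unfolding set_lebesgue_integral_def by (rule Bochner_Integration.integral_cong) auto
      then show ?thesis unfolding A by (simp only: c) (simp add: prob_space)
    qed (simp add: set_lebesgue_integral_def)
  next
    show "integrable M ?f" by (rule integrable_const_bound[where B = 1]) auto
  qed auto
qed

lemma locally_asymptotically_normal: "LAN M X a (\<lambda>T. 1 / sqrt T) limit_score (\<lambda>_. J)"
  unfolding LAN_def LAMN_def
  by (intro conjI locally_asymptotically_quadratic limit_score_cond_normal exI[of _ J]) simp

end

lemma information_eq:
  assumes "fundamental_solution a x0"
  shows "(LBINT t:{0..}. (LBINT u:{-1..0}. x0 (t + u))\<^sup>2) = information x0"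
  unfolding information_def
  by (rule set_lebesgue_integral_cong) (auto simp: fundamental_solution_window[OF assms])

theorem proposition4p1:
  fixes M :: "'w measure"
    and W X0 :: "real \<Rightarrow> 'w \<Rightarrow> real"
    and X :: "real \<Rightarrow> real \<Rightarrow> 'w \<Rightarrow> real"
    and x0 :: "real \<Rightarrow> real"
    and a :: real
  assumes "wiener_process M W"
    and "continuous_process_on M {-1..0} X0"
    and "indep_processes M {-1..0} X0 {0..} W"
    and "\<And>b. solves_sdde M W X0 b (X b)"
    and "fundamental_solution a x0"
    and "a \<in> {- (pi\<^sup>2 / 2)<..<0}"
  shows "\<exists>\<Delta>. LAN M X a (\<lambda>T. 1 / sqrt T) \<Delta>
           (\<lambda>_. LBINT t:{0..}. (LBINT u:{-1..0}. x0 (t + u))\<^sup>2)"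
proof -
  interpret stable_delay_model M W X0 X a x0
    by unfold_locales (use assms in auto)
  show ?thesis
    unfolding information_eq[OF assms(5)] using locally_asymptotically_normal by blast
qed

end
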